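(* Let $0<\alpha<1$, let $\Omega$ be a bounded and simply-connected domain in $\mathbb R^3$ without holes and with a $C^{r+\alpha}$ boundary, $r\ge3$. Let $\mathcal H^e\in C^{2+\alpha}_{\rm loc}(\Omega^c,\mathbb R^3)\cap C^{1+\alpha}_{\rm loc}(\overline{\Omega^c},\mathbb R^3)$ with $\operatorname{curl}\mathcal H^e=\mathbf 0$, $\operatorname{div}\mathcal H^e=0$ in $\Omega^c$ and $\mathcal H^e_T\in C^{2+\alpha}(\partial\Omega,\mathbb R^3)$, and let $\mathcal F^e\in C^{2+\alpha}_{\rm loc}(\overline{\Omega^c},\mathbb R^3)$ with $\operatorname{div}\mathcal F^e=0$ and $\operatorname{curl}\mathcal F^e=\mathcal H^e$ in $\Omega^c$. Let $\mathbf A\in\mathbb C_t^{2+\alpha,0}(\overline\Omega,\overline{\Omega^c},\mathbb R^3)$ be a solution of problem (L), and assume $\mathbf H=\lambda\operatorname{curl}\mathbf A\in\mathbb C_t^{1+\alpha,0}(\overline\Omega,\overline{\Omega^c},\mathbb R^3)$. Denote $$\mathbf A_\Omega=\mathbf A|_{\overline\Omega},\qquad\mathcal A=\mathbf A|_{\overline{\Omega^c}},\qquad\mathbf H_\Omega=(\lambda\operatorname{curl}\mathbf A)|_\Omega .$$ Then: (i) $\mathbf A_\Omega\in C^{2+\alpha}(\overline\Omega,\mathbb R^3)$ and it is a solution of $-\lambda^2\operatorname{curl}^2\mathbf A_\Omega=(1-|\mathbf A_\Omega|^2)\mathbf A_\Omega$ in $\Omega$. (ii) $\mathcal A\in C^{2+\alpha}_{\rm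 loc}(\overline{\Omega^c},\mathbb R^3)$ and it can be represented in $\Omega^c$ by $\mathcal A=\lambda^{-1}(\mathcal F^e+\mathbf u)$, where $\mathbf u\in C^{1+\alpha}_{\rm loc}(\overline{\Omega^c},\mathbb R^3)$ is determined by $$\operatorname{curl}\mathbf u=\nabla\phi^0\ \text{in }\Omega^c,\qquad\mathbf u_T^+=\lambda(\mathbf A_\Omega)_T^--(\mathcal F^e)_T^+\ \text{on }\partial\Omega,$$ and $\phi^0$ is the unique solution of $$\Delta\phi^0=0\ \text{in }\Omega^c,\quad(\nabla\phi^0)_T^+=(\mathbf H_\Omega)_T^--(\mathcal H^e)_T^+\ \text{on }\partial\Omega,\quad\int_{\partial\Omega}\frac{\partial\phi^0}{\partial\nu}dS=0,$$ $$\phi^0(x)=O(|x|^{-2}),\quad|\nabla\phi^0(x)|=O(|x|^{-3})\ \text{as }|x|\to\infty .$$ (iii) $\mathbf A_\Omega$, $\mathbf H_\Omega$ and $\phi^0$ satisfy $$\nu\cdot\operatorname{curl}((\mathbf H_\Omega)_T^-)=0,\qquad\lambda(\nu\cdot\operatorname{curl}\mathbf A_\Omega)^-=\nu\cdot(\mathcal H^e)^++\frac{\partial\phi^0}{\partial\nu}\quad\text{on }\partial\Omega .$$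
   Context: $\Omega^c=\mathbb R^3\setminus\overline\Omega$; "without holes" means $\Omega^c$ is connected. $\nu$ is the unit normal of $\partial\Omega$ pointing into $\Omega^c$; subscript $T$: tangential component on $\partial\Omega$; superscripts $-,+$: traces from $\Omega$, $\Omega^c$; $[\cdot]$ is the jump. For a tangential field $\mathbf w$ on $\partial\Omega$, $\nu\cdot\operatorname{curl}\mathbf w$ is computed from any extension with tangential trace $\mathbf w$. $C^{k+\alpha}_{\rm loc}(\overline{\Omega^c})$ means $C^{k+\alpha}(\overline{B\cap\Omega^c})$ for every ball $B$. $\mathbb C_t^{k+\alpha,0}(\overline\Omega,\overline{\Omega^c},\mathbb R^3)$ is the set of $\mathbf A\in C^{k+\alpha}(\overline\Omega,\mathbb R^3)\cap C^{k+\alpha}_{\rm loc}(\overline{\Omega^c},\mathbb R^3)$ with $\mathbf A_T^-=\mathbf A_T^+$ on $\partial\Omega$. Problem (L), for $\lambda>0$: $$-\lambda^2\operatorname{curl}^2\mathbf A=(1-|\mathbf A|^2)\mathbf A\ \text{in }\Omega,\quad\operatorname{curl}^2\mathbf A=\mathbf 0\ \text{in }\Omega^c,\quad[\mathbf A_T]=\mathbf 0,\ [(\operatorname{curl}\mathbf A)_T]=\mathbf 0\ \text{on }\partial\Omega,$$ $$\lambda\operatorname{curl}\mathbf A-\mathcal H^e\to\mathbf 0\ \text{as }|x|\to\infty,\qquad\|\mathbf A\|_{L^\infty(\Omega)}<\tfrac1{\sqrt3}.$$ *)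

theory Defs
  imports "HOL-Analysis.Analysis" "HOL-Library.Landau_Symbols"
    "HOL-Probability.Essential_Supremum"
begin

text \<open>
  Fields are total functions, but only their values on the open sets \<open>\<Omega>\<close> and \<open>exterior \<Omega>\<close>
  matter. In particular the restrictions \<open>A|\<Omega>\<close> and \<open>A|\<Omega>\<^sup>c\<close> of a field with a jump
  are both represented by \<open>A\<close> itself; the open set is an explicit argument of every regularity
  notion, and boundary values are always one-sided limits (\<open>bdry_trace\<close>).
\<close>

abbreviation exterior :: "'a::topological_space set \<Rightarrow> 'a set"
  where "exterior \<Omega> \<equiv> - closure \<Omega>"


subsection \<open>Differential operators\<close>

definition partial :: "'a::euclidean_space \<Rightarrow> ('a \<Rightarrow> 'b::real_normed_vector) \<Rightarrow> 'a \<Rightarrow> 'b"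
  where "partial b f x = frechet_derivative f (at x) b"

definition curl :: "(real^3 \<Rightarrow> real^3) \<Rightarrow> real^3 \<Rightarrow> real^3"
  where "curl F x =
    vector [partial (axis 2 1) F x $ 3 - partial (axis 3 1) F x $ 2,
            partial (axis 3 1) F x $ 1 - partial (axis 1 1) F x $ 3,
            partial (axis 1 1) F x $ 2 - partial (axis 2 1) F x $ 1]"

definition divergence :: "(real^3 \<Rightarrow> real^3) \<Rightarrow> real^3 \<Rightarrow> real"
  where "divergence F x = (\<Sum>i\<in>UNIV. partial (axis i 1) F x $ i)"

definition grad :: "(real^3 \<Rightarrow> real) \<Rightarrow> real^3 \<Rightarrow> real^3"
  where "grad f x = (\<chi> i. partial (axis i 1) f x)"

definition laplacian :: "(real^3 \<Rightarrow> real) \<Rightarrow> real^3 \<Rightarrow> real"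
  where "laplacian f x = (\<Sum>i\<in>UNIV. partial (axis i 1) (partial (axis i 1) f) x)"


subsection \<open>Hoelder spaces\<close>

definition iter_partial ::
  "'a::euclidean_space list \<Rightarrow> ('a \<Rightarrow> 'b::real_normed_vector) \<Rightarrow> 'a \<Rightarrow> 'b"
  where "iter_partial bs f = foldr partial bs f"

definition C_on :: "nat \<Rightarrow> 'a::euclidean_space set \<Rightarrow> ('a \<Rightarrow> 'b::real_normed_vector) \<Rightarrow> bool"
  where "C_on k U f \<longleftrightarrow>
    (\<forall>bs. set bs \<subseteq> Basis \<and> length bs < k \<longrightarrow> (\<forall>x\<in>U. iter_partial bs f differentiable (at x))) \<and>
    (\<forall>bs. set bs \<subseteq> Basis \<and> length bs \<le> k \<longrightarrow> continuous_on U (iter_partial bs f))"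

text \<open>\<open>C_closure k U\<close> is \<open>C\<^sup>k\<close> of the closure of the open set \<open>U\<close>, and \<open>C_holder k \<alpha> U\<close> is
  \<open>C\<close> of order \<open>k + \<alpha>\<close> of the closure of the bounded open set \<open>U\<close>.\<close>

definition C_closure :: "nat \<Rightarrow> 'a::euclidean_space set \<Rightarrow> ('a \<Rightarrow> 'b::real_normed_vector) \<Rightarrow> bool"
  where "C_closure k U f \<longleftrightarrow> C_on k U f \<and>
    (\<forall>bs. set bs \<subseteq> Basis \<and> length bs \<le> k \<longrightarrow>
      (\<exists>g. continuous_on (closure U) g \<and> (\<forall>x\<in>U. g x = iter_partial bs f x)))"

definition C_holder ::
  "nat \<Rightarrow> real \<Rightarrow> 'a::euclidean_space set \<Rightarrow> ('a \<Rightarrow> 'b::real_normed_vector) \<Rightarrow> bool"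
  where "C_holder k \<alpha> U f \<longleftrightarrow> C_closure k U f \<and>
    (\<forall>bs. set bs \<subseteq> Basis \<and> length bs = k \<longrightarrow>
      (\<exists>K. \<forall>x\<in>U. \<forall>y\<in>U. norm (iter_partial bs f x - iter_partial bs f y) \<le> K * dist x y powr \<alpha>))"

text \<open>Local spaces on the closure of \<open>U\<close> (regularity up to the boundary), and on \<open>U\<close> itself.\<close>

definition C_closure_loc ::
  "nat \<Rightarrow> 'a::euclidean_space set \<Rightarrow> ('a \<Rightarrow> 'b::real_normed_vector) \<Rightarrow> bool"
  where "C_closure_loc k U f \<longleftrightarrow> (\<forall>c R. C_closure k (ball c R \<inter> U) f)"

definition C_holder_loc ::
  "nat \<Rightarrow> real \<Rightarrow> 'a::euclidean_space set \<Rightarrow> ('a \<Rightarrow> 'b::real_normed_vector) \<Rightarrow> bool"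
  where "C_holder_loc k \<alpha> U f \<longleftrightarrow> (\<forall>c R. C_holder k \<alpha> (ball c R \<inter> U) f)"

definition C_holder_interior ::
  "nat \<Rightarrow> real \<Rightarrow> 'a::euclidean_space set \<Rightarrow> ('a \<Rightarrow> 'b::real_normed_vector) \<Rightarrow> bool"
  where "C_holder_interior k \<alpha> U f \<longleftrightarrow>
    (\<forall>V. open V \<and> compact (closure V) \<and> closure V \<subseteq> U \<longrightarrow> C_holder k \<alpha> V f)"


subsection \<open>The boundary surface\<close>

text \<open>\<open>\<sigma>\<close> parametrises, over the disc of radius \<open>\<delta>\<close>, a piece of the boundary of \<open>\<Omega>\<close> as the graph of
  a \<open>C\<^sup>1\<close> function \<open>g\<close> in the orthonormal frame given by the isometric embedding \<open>p\<close> of the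
  plane and the unit vector \<open>n\<close>; inside the cylinder of half-height \<open>h\<close> centred at \<open>\<sigma> 0\<close>, \<open>\<Omega>\<close> is
  exactly the part strictly below the graph.\<close>

definition graph_patch :: "(real^3) set \<Rightarrow> (real^2 \<Rightarrow> real^3) \<Rightarrow> real \<Rightarrow> bool"
  where "graph_patch \<Omega> \<sigma> \<delta> \<longleftrightarrow> 0 < \<delta> \<and>
    (\<exists>x p n h g. linear p \<and> (\<forall>y. norm (p y) = norm y) \<and> norm n = 1 \<and> (\<forall>y. p y \<bullet> n = 0) \<and>
      0 < h \<and> C_on 1 (ball 0 \<delta>) g \<and> g 0 = 0 \<and> (\<forall>y\<in>ball 0 \<delta>. \<bar>g y\<bar> < h) \<and>
      \<sigma> = (\<lambda>y. x + p y + g y *\<^sub>R n) \<and>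
      (\<forall>y\<in>ball 0 \<delta>. \<forall>t. \<bar>t\<bar> < h \<longrightarrow> (x + p y + t *\<^sub>R n \<in> \<Omega> \<longleftrightarrow> t < g y)))"

definition holder_boundary :: "nat \<Rightarrow> real \<Rightarrow> (real^3) set \<Rightarrow> bool"
  where "holder_boundary k \<alpha> \<Omega> \<longleftrightarrow>
    (\<forall>x\<in>frontier \<Omega>. \<exists>\<sigma> \<delta>. graph_patch \<Omega> \<sigma> \<delta> \<and> \<sigma> 0 = x \<and> C_holder k \<alpha> (ball 0 \<delta>) \<sigma>)"

definition C_holder_on_boundary ::
  "nat \<Rightarrow> real \<Rightarrow> (real^3) set \<Rightarrow> (real^3 \<Rightarrow> 'b::real_normed_vector) \<Rightarrow> bool"
  where "C_holder_on_boundary k \<alpha> \<Omega> f \<longleftrightarrow>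
    (\<forall>x\<in>frontier \<Omega>. \<exists>\<sigma> \<delta>. graph_patch \<Omega> \<sigma> \<delta> \<and> \<sigma> 0 = x \<and>
      C_holder k \<alpha> (ball 0 \<delta>) \<sigma> \<and> C_holder k \<alpha> (ball 0 \<delta>) (f \<circ> \<sigma>))"

text \<open>The unit normal pointing into the exterior.\<close>

definition nu :: "(real^3) set \<Rightarrow> real^3 \<Rightarrow> real^3"
  where "nu \<Omega> x = (THE v. norm v = 1 \<and>
    (\<exists>\<sigma> \<delta>. graph_patch \<Omega> \<sigma> \<delta> \<and> \<sigma> 0 = x \<and> (\<forall>b\<in>Basis. v \<bullet> partial b \<sigma> 0 = 0)) \<and>
    (\<forall>\<^sub>F t in at_right 0. x + t *\<^sub>R v \<in> exterior \<Omega>))"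

text \<open>The surface integral with respect to \<open>dS\<close>: the boundary is cut into finitely many Borel
  pieces \<open>P i\<close>, each inside one patch, and \<open>dS = |\<partial>\<^sub>1\<sigma> \<times> \<partial>\<^sub>2\<sigma>| dy\<close> on a patch.
  The value does not depend on the decomposition.\<close>

definition has_surface_integral :: "(real^3) set \<Rightarrow> (real^3 \<Rightarrow> real) \<Rightarrow> real \<Rightarrow> bool"
  where "has_surface_integral \<Omega> f I \<longleftrightarrow>
    (\<exists>(m::nat) \<sigma> \<delta> P.
      (\<forall>i<m. graph_patch \<Omega> (\<sigma> i) (\<delta> i) \<and> P i \<in> sets borel \<and> P i \<subseteq> \<sigma> i ` ball 0 (\<delta> i)) \<and>
      disjoint_family_on P {..<m} \<and> (\<Union>i<m. P i) = frontier \<Omega> \<and>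
      (let Q = (\<lambda>i. {y \<in> ball 0 (\<delta> i). \<sigma> i y \<in> P i});
           F = (\<lambda>i y. f (\<sigma> i y) *
             norm (cross3 (partial (axis 1 1) (\<sigma> i) y) (partial (axis 2 1) (\<sigma> i) y)))
       in (\<forall>i<m. set_integrable lborel (Q i) (F i)) \<and>
          I = (\<Sum>i<m. set_lebesgue_integral lborel (Q i) (F i))))"


subsection \<open>Traces\<close>

definition bdry_trace :: "(real^3) set \<Rightarrow> (real^3 \<Rightarrow> 'b::t2_space) \<Rightarrow> real^3 \<Rightarrow> 'b"
  where "bdry_trace U f x = Lim (at x within U) f"

abbreviation (input) trace_minus :: "(real^3) set \<Rightarrow> (real^3 \<Rightarrow> 'b::t2_space) \<Rightarrow> real^3 \<Rightarrow> 'b"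
  where "trace_minus \<Omega> \<equiv> bdry_trace \<Omega>"

abbreviation (input) trace_plus :: "(real^3) set \<Rightarrow> (real^3 \<Rightarrow> 'b::t2_space) \<Rightarrow> real^3 \<Rightarrow> 'b"
  where "trace_plus \<Omega> \<equiv> bdry_trace (exterior \<Omega>)"

definition tangential :: "(real^3) set \<Rightarrow> (real^3 \<Rightarrow> real^3) \<Rightarrow> real^3 \<Rightarrow> real^3"
  where "tangential \<Omega> w x = w x - (w x \<bullet> nu \<Omega> x) *\<^sub>R nu \<Omega> x"

abbreviation (input) tan_minus :: "(real^3) set \<Rightarrow> (real^3 \<Rightarrow> real^3) \<Rightarrow> real^3 \<Rightarrow> real^3"
  where "tan_minus \<Omega> f \<equiv> tangential \<Omega> (trace_minus \<Omega> f)"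

abbreviation (input) tan_plus :: "(real^3) set \<Rightarrow> (real^3 \<Rightarrow> real^3) \<Rightarrow> real^3 \<Rightarrow> real^3"
  where "tan_plus \<Omega> f \<equiv> tangential \<Omega> (trace_plus \<Omega> f)"

definition normal_deriv_plus :: "(real^3) set \<Rightarrow> (real^3 \<Rightarrow> real) \<Rightarrow> real^3 \<Rightarrow> real"
  where "normal_deriv_plus \<Omega> f x = nu \<Omega> x \<bullet> trace_plus \<Omega> (grad f) x"

text \<open>\<open>\<nu> \<cdot> curl w\<close> for a tangential field \<open>w\<close> on the boundary: the common value obtained from all
  \<open>C\<^sup>1\<close> extensions \<open>W\<close> of \<open>w\<close> into \<open>\<Omega>\<close>, where only the tangential trace of \<open>W\<close> is prescribed.\<close>

definition nu_curl_tangential :: "(real^3) set \<Rightarrow> (real^3 \<Rightarrow> real^3) \<Rightarrow> real^3 \<Rightarrow> real"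
  where "nu_curl_tangential \<Omega> w x =
    (THE c. \<exists>W. C_closure 1 \<Omega> W \<and> (\<forall>y\<in>frontier \<Omega>. tan_minus \<Omega> W y = w y) \<and>
      c = nu \<Omega> x \<bullet> trace_minus \<Omega> (curl W) x)"

definition Ct_holder :: "nat \<Rightarrow> real \<Rightarrow> (real^3) set \<Rightarrow> (real^3 \<Rightarrow> real^3) \<Rightarrow> bool"
  where "Ct_holder k \<alpha> \<Omega> A \<longleftrightarrow>
    C_holder k \<alpha> \<Omega> A \<and> C_holder_loc k \<alpha> (exterior \<Omega>) A \<and>
    (\<forall>x\<in>frontier \<Omega>. tan_minus \<Omega> A x = tan_plus \<Omega> A x)"


subsection \<open>The boundary value problems\<close>

definition solves_L ::
  "(real^3) set \<Rightarrow> real \<Rightarrow> (real^3 \<Rightarrow> real^3) \<Rightarrow> (real^3 \<Rightarrow> real^3) \<Rightarrow> bool"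
  where "solves_L \<Omega> lam He A \<longleftrightarrow>
    (\<forall>x\<in>\<Omega>. - (lam\<^sup>2 *\<^sub>R curl (curl A) x) = (1 - (norm (A x))\<^sup>2) *\<^sub>R A x) \<and>
    (\<forall>x\<in>exterior \<Omega>. curl (curl A) x = 0) \<and>
    (\<forall>x\<in>frontier \<Omega>. tan_plus \<Omega> A x - tan_minus \<Omega> A x = 0) \<and>
    (\<forall>x\<in>frontier \<Omega>. tan_plus \<Omega> (curl A) x - tan_minus \<Omega> (curl A) x = 0) \<and>
    ((\<lambda>x. lam *\<^sub>R curl A x - He x) \<longlongrightarrow> 0) at_infinity \<and>
    esssup (lebesgue_on \<Omega>) (\<lambda>x. ereal (norm (A x))) < ereal (1 / sqrt 3)"

text \<open>The exterior problem for a harmonic function with tangential gradient \<open>w\<close> on the boundary,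
  in the class \<open>C\<^sup>2\<close> of the exterior with \<open>C\<^sup>1\<close> regularity up to the boundary.\<close>

definition solves_exterior_harmonic ::
  "(real^3) set \<Rightarrow> (real^3 \<Rightarrow> real^3) \<Rightarrow> (real^3 \<Rightarrow> real) \<Rightarrow> bool"
  where "solves_exterior_harmonic \<Omega> w \<phi> \<longleftrightarrow>
    C_on 2 (exterior \<Omega>) \<phi> \<and> C_closure_loc 1 (exterior \<Omega>) \<phi> \<and>
    (\<forall>x\<in>exterior \<Omega>. laplacian \<phi> x = 0) \<and>
    (\<forall>x\<in>frontier \<Omega>. tan_plus \<Omega> (grad \<phi>) x = w x) \<and>
    has_surface_integral \<Omega> (normal_deriv_plus \<Omega> \<phi>) 0 \<and>
    \<phi> \<in> O[at_infinity](\<lambda>x. 1 / norm x ^ 2) \<and>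
    (\<lambda>x. norm (grad \<phi> x)) \<in> O[at_infinity](\<lambda>x. 1 / norm x ^ 3)"

end

theory Submission
  imports Defs
begin

text \<open>
  On the exterior of \<open>\<Omega>\<close> put \<open>u = \<lambda> A - F\<^sup>e\<close> and \<open>v = H - H\<^sup>e = curl u\<close>; then \<open>v\<close> is curl-free,
  divergence-free and tends to \<open>0\<close> at infinity.

  \<open>v\<close> is a gradient. For a cutoff \<open>\<chi>\<close> vanishing near the closure of \<open>\<Omega>\<close>, the Helmholtz identity with
  a regularised Newton kernel turns the circulation of \<open>v\<close> along a closed polygon into the integral
  of the compactly supported solenoidal field \<open>curl (\<chi> v)\<close> against the Biot--Savart field of the
  polygon. Off the polygon that field is curl-free, and near the closure of the simply connected set
  \<open>\<Omega>\<close> it is therefore a gradient, so the integral is \<open>0\<close>. The identity applied to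
  \<open>\<nabla>(\<chi> \<phi>)\<close>, whose divergence has mean \<open>0\<close> because \<open>v\<close> is a curl, gives \<open>v = O(|x|\<^sup>-\<^sup>3)\<close>, and
  \<open>\<phi>\<close>, suitably normalised, is \<open>O(|x|\<^sup>-\<^sup>2)\<close>.

  On a graph patch, Stokes' theorem in weak form shows that the normal component of a curl depends only
  on the tangential trace; with a partition of unity it also shows that a curl has no flux through the
  boundary. Regularity up to the boundary uses that the exterior is locally quasi-convex, so that
  functions with bounded gradient are Lipschitz on its bounded parts.

  The difference of two solutions \<open>\<phi>\<close> is a constant \<open>c\<close> on the connected boundary. If \<open>c > 0\<close>,
  comparison with \<open>\<epsilon> / |x - x\<^sub>0|\<close>, \<open>x\<^sub>0 \<in> \<Omega>\<close>, contradicts the decay \<open>O(|x|\<^sup>-\<^sup>2)\<close>; hence \<open>c = 0\<close>, and the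
  maximum principle applies.
\<close>


text \<open>The exterior is not assumed simply connected, so periods of a curl-free field have to be
  excluded globally, and the simple connectivity of \<open>\<Omega>\<close> is the only source for
  that: this is a duality between loops outside and potentials inside, made explicit by pairing two
  fields. Regularising the kernel avoids every singular integral and keeps all fields C^1 on the
  whole space; the price is that \<open>v\<close> is seen only through averages over balls of radius
  \<open>e\<close>, with a mass that is bounded below but never computed, and the polygon must be
  compared with its averages as \<open>e\<close> shrinks. The mean value zero of the divergence
  removes the monopole term of the representation, which is why the rate is |x|^-3 and not |x|^-2.
  At the boundary the fields are differentiable on one side only and merely extend continuously, so
  surface identities are proved on shifted copies of a patch and passed to the limit. Traces,
  normals and surface integrals are defined through arbitrary patches; a description of the normal
  by its half-space and a change of variables make them independent of the patch.\<close>

section \<open>Directional derivatives and functions of class C^1\<close>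

lemma partial_eq: "(f has_derivative f') (at x) \<Longrightarrow> partial h f x = f' h"
  by (metis frechet_derivative_at partial_def)

lemma has_derivative_partial:
  "f differentiable (at x) \<Longrightarrow> (f has_derivative (\<lambda>h. partial h f x)) (at x)"
  unfolding partial_def by (metis frechet_derivative_works)

lemma linear_partial: "f differentiable (at x) \<Longrightarrow> linear (\<lambda>h. partial h f x)"
  using has_derivative_partial has_derivative_linear by blast

lemma partial_sum_Basis:
  "f differentiable (at x) \<Longrightarrow> partial h f x = (\<Sum>b\<in>Basis. (h \<bullet> b) *\<^sub>R partial b f x)"
  by (subst euclidean_representation[of h, symmetric])
    (simp add: linear_sum[OF linear_partial] linear_cmul[OF linear_partial])

lemma has_derivative_cong_open:
  assumes "open U" "x \<in> U" "\<And>y. y \<in> U \<Longrightarrow> f y = g y"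
  shows "(f has_derivative D) (at x) \<longleftrightarrow> (g has_derivative D) (at x)"
  using assms by (metis has_derivative_transform_within_open)

lemma partial_cong_open:
  assumes "open U" "x \<in> U" "\<And>y. y \<in> U \<Longrightarrow> f y = g y"
  shows "partial h f x = partial h g x"
  unfolding partial_def frechet_derivative_def using has_derivative_cong_open[OF assms] by simp

lemma differentiable_cong_open:
  assumes "open U" "x \<in> U" "\<And>y. y \<in> U \<Longrightarrow> f y = g y"
  shows "f differentiable (at x) \<longleftrightarrow> g differentiable (at x)"
  unfolding differentiable_def using has_derivative_cong_open[OF assms] by simp

text \<open>Continuity is asked for every direction \<open>h\<close>, not only for basis vectors, so
  that chain and product rules can be stated without coordinates; \<open>C1_on_iff_Basis\<close>
  gives the coordinate form used by \<open>C_on\<close>.\<close>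

definition C1_on :: "'a::euclidean_space set \<Rightarrow> ('a \<Rightarrow> 'b::real_normed_vector) \<Rightarrow> bool"
  where "C1_on U f \<longleftrightarrow> (\<forall>x\<in>U. f differentiable (at x)) \<and> (\<forall>h. continuous_on U (partial h f))"

lemma C1_on_differentiable: "C1_on U f \<Longrightarrow> x \<in> U \<Longrightarrow> f differentiable (at x)"
  by (simp add: C1_on_def)

lemma C1_on_has_derivative: 
  "C1_on U f \<Longrightarrow> x \<in> U \<Longrightarrow> (f has_derivative (\<lambda>h. partial h f x)) (at x)"
  by (simp add: C1_on_differentiable has_derivative_partial)

lemma C1_on_continuous_partial: "C1_on U f \<Longrightarrow> continuous_on U (partial h f)"
  by (simp add: C1_on_def)

lemma C1_on_continuous: "C1_on U f \<Longrightarrow> continuous_on U f"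
  by (meson C1_on_def continuous_at_imp_continuous_on differentiable_imp_continuous_within)

lemma C1_on_subset: "C1_on U f \<Longrightarrow> V \<subseteq> U \<Longrightarrow> C1_on V f"
  unfolding C1_on_def by (meson continuous_on_subset subsetD)

lemma C1_onI:
  assumes "\<And>x. x \<in> U \<Longrightarrow> (f has_derivative f' x) (at x)" "\<And>h. continuous_on U (\<lambda>x. f' x h)"
  shows "C1_on U f"
proof -
  have "continuous_on U (partial h f)" for h
    by (rule continuous_on_cong[THEN iffD1, OF refl _ assms(2)[of h]]) (simp add: partial_eq[OF assms(1)])
  then show ?thesis unfolding C1_on_def differentiable_def using assms(1) by blast
qed

lemma C1_on_cong:
  assumes "open U" "\<And>y. y \<in> U \<Longrightarrow> f y = g y"
  shows "C1_on U f \<longleftrightarrow> C1_on U g"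
  unfolding C1_on_def 
  using differentiable_cong_open[OF assms(1) _ assms(2)] partial_cong_open[OF assms(1) _ assms(2)]
  by (simp cong: continuous_on_cong)

lemma C1_on_iff_Basis:
  "C1_on U f \<longleftrightarrow> (\<forall>x\<in>U. f differentiable (at x)) \<and> (\<forall>b\<in>Basis. continuous_on U (partial b f))"
proof -
  have "continuous_on U (partial h f)" 
    if "\<forall>x\<in>U. f differentiable (at x)" "\<forall>b\<in>Basis. continuous_on U (partial b f)" for h
  proof -
    have "continuous_on U (\<lambda>x. \<Sum>b\<in>Basis. (h \<bullet> b) *\<^sub>R partial b f x)"
      using that by (intro continuous_intros) auto
    then show ?thesis
      using that by (simp add: partial_sum_Basis[of f _ h] cong: continuous_on_cong)
  qed
  then show ?thesis unfolding C1_on_def by blast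
qed

text \<open>\<open>iter_partial\<close> folds from the right, so the last entry of the list is the
  derivative applied first. Splitting lists at their end therefore turns \<open>C_on\<close> of
  \<open>f\<close> into \<open>C_on\<close> of the functions \<open>partial b f\<close>.\<close>

lemma C_on_Suc:
  fixes f :: "'a::euclidean_space \<Rightarrow> 'b::real_normed_vector"
  shows "C_on (Suc k) U f \<longleftrightarrow> continuous_on U f \<and> (\<forall>x\<in>U. f differentiable (at x)) \<and> (\<forall>b\<in>Basis. C_on k U (partial b f))"
  (is "?L = ?R")
proof -
  have snoc: "iter_partial (bs @ [b]) f = iter_partial bs (partial b f)" for bs b
    by (simp add: iter_partial_def)
  have A: "(\<forall>bs::'a list. set bs \<subseteq> Basis \<and> length bs < Suc k \<longrightarrow> P bs) \<longleftrightarrow> 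
      P [] \<and> (\<forall>b\<in>Basis. \<forall>bs::'a list. set bs \<subseteq> Basis \<and> length bs < k \<longrightarrow> P (bs @ [b]))" for P :: "'a list \<Rightarrow> bool"
  proof (intro iffI conjI allI ballI impI)
    fix bs :: "'a list" assume *: "P [] \<and> (\<forall>b\<in>Basis. \<forall>bs::'a list. set bs \<subseteq> Basis \<and> length bs < k \<longrightarrow> P (bs @ [b]))"
      "set bs \<subseteq> Basis \<and> length bs < Suc k"
    then show "P bs" by (cases bs rule: rev_cases) auto
  qed auto
  have B: "(\<forall>bs::'a list. set bs \<subseteq> Basis \<and> length bs \<le> Suc k \<longrightarrow> P bs) \<longleftrightarrow> 
      P [] \<and> (\<forall>b\<in>Basis. \<forall>bs::'a list. set bs \<subseteq> Basis \<and> length bs \<le> k \<longrightarrow> P (bs @ [b]))" for P :: "'a list \<Rightarrow> bool"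
  proof (intro iffI conjI allI ballI impI)
    fix bs :: "'a list" assume *: "P [] \<and> (\<forall>b\<in>Basis. \<forall>bs::'a list. set bs \<subseteq> Basis \<and> length bs \<le> k \<longrightarrow> P (bs @ [b]))"
      "set bs \<subseteq> Basis \<and> length bs \<le> Suc k"
    then show "P bs" by (cases bs rule: rev_cases) auto
  qed auto
  show ?thesis unfolding C_on_def A B snoc by (auto simp: iter_partial_def)
qed

lemma C_on_0: "C_on 0 U f \<longleftrightarrow> continuous_on U f"
  by (simp add: C_on_def iter_partial_def)

lemma C_on_1: "C_on 1 U f \<longleftrightarrow> C1_on U f"
  by (auto simp: One_nat_def C_on_Suc C_on_0 C1_on_iff_Basis intro: continuous_at_imp_continuous_on 
      differentiable_imp_continuous_within)

lemma C_on_2: "C_on 2 U f \<longleftrightarrow> C1_on U f \<and> (\<forall>b\<in>Basis. C1_on U (partial b f))"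
  unfolding numeral_2_eq_2 C_on_Suc[of "Suc 0"] C_on_1[unfolded One_nat_def]
  by (metis C1_on_continuous C1_on_iff_Basis)

lemma C_on_mono: "C_on k U f \<Longrightarrow> j \<le> k \<Longrightarrow> C_on j U f"
  unfolding C_on_def by auto

subsection \<open>Algebra of partial derivatives\<close>

lemma C1_on_const [intro,simp]: "C1_on U (\<lambda>x. c)"
  by (rule C1_onI[where f'="\<lambda>_ _. 0"]) auto

lemma C1_on_id [intro,simp]: "C1_on U (\<lambda>x. x)"
  by (rule C1_onI[where f'="\<lambda>_ h. h"]) auto

lemma partial_const [simp]: "partial h (\<lambda>x. c) x = 0"
  by (rule partial_eq) auto

lemma partial_bounded_linear:
  assumes "bounded_linear L" "f differentiable (at x)"
  shows "partial h (\<lambda>x. L (f x)) x = L (partial h f x)"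
  by (rule partial_eq) (intro bounded_linear.has_derivative[OF assms(1)] has_derivative_partial assms)

lemma C1_on_bounded_linear:
  assumes "bounded_linear L" "C1_on U f"
  shows "C1_on U (\<lambda>x. L (f x))"
  by (rule C1_onI[OF bounded_linear.has_derivative[OF assms(1) C1_on_has_derivative[OF assms(2)]]])
    (auto intro!: bounded_linear.continuous_on[OF assms(1)] C1_on_continuous_partial assms)

lemma partial_add:
  assumes "f differentiable (at x)" "g differentiable (at x)"
  shows "partial h (\<lambda>x. f x + g x) x = partial h f x + partial h g x"
  by (rule partial_eq) (intro has_derivative_add has_derivative_partial assms)

lemma partial_diff:
  assumes "f differentiable (at x)" "g differentiable (at x)"
  shows "partial h (\<lambda>x. f x - g x) x = partial h f x - partial h g x"
  by (rule partial_eq) (intro has_derivative_diff has_derivative_partial assms)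

lemma C1_on_add:
  assumes "C1_on U f" "C1_on U g"
  shows "C1_on U (\<lambda>x. f x + g x)"
  by (rule C1_onI[OF has_derivative_add[OF C1_on_has_derivative[OF assms(1)] C1_on_has_derivative[OF assms(2)]]])
    (auto intro!: continuous_intros C1_on_continuous_partial assms)

lemma C1_on_diff:
  assumes "C1_on U f" "C1_on U g"
  shows "C1_on U (\<lambda>x. f x - g x)"
  by (rule C1_onI[OF has_derivative_diff[OF C1_on_has_derivative[OF assms(1)] C1_on_has_derivative[OF assms(2)]]])
    (auto intro!: continuous_intros C1_on_continuous_partial assms)

lemma partial_bilinear:
  assumes "bounded_bilinear B" "f differentiable (at x)" "g differentiable (at x)"
  shows "partial h (\<lambda>x. B (f x) (g x)) x = B (f x) (partial h g x) + B (partial h f x) (g x)"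
  by (rule partial_eq) (intro bounded_bilinear.FDERIV[OF assms(1)] has_derivative_partial assms)

lemma C1_on_bilinear:
  assumes "bounded_bilinear B" "C1_on U f" "C1_on U g"
  shows "C1_on U (\<lambda>x. B (f x) (g x))"
proof (rule C1_onI)
  show "((\<lambda>x. B (f x) (g x)) has_derivative (\<lambda>h. B (f x) (partial h g x) + B (partial h f x) (g x))) (at x)" if "x \<in> U" for x
    using bounded_bilinear.FDERIV[OF assms(1) C1_on_has_derivative[OF assms(2) that] C1_on_has_derivative[OF assms(3) that]] .
  show "continuous_on U (\<lambda>x. B (f x) (partial h g x) + B (partial h f x) (g x))" for h
    by (rule continuous_on_add[OF bounded_bilinear.continuous_on[OF assms(1) C1_on_continuous[OF assms(2)] C1_on_continuous_partial[OF assms(3)]]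
       bounded_bilinear.continuous_on[OF assms(1) C1_on_continuous_partial[OF assms(2)] C1_on_continuous[OF assms(3)]]])
qed

lemmas C1_on_scaleR = C1_on_bilinear[OF bounded_bilinear_scaleR]
lemmas C1_on_mult = C1_on_bilinear[OF bounded_bilinear_mult]
lemmas C1_on_inner = C1_on_bilinear[OF bounded_bilinear_inner]
lemmas partial_scaleR = partial_bilinear[OF bounded_bilinear_scaleR]
lemmas partial_mult = partial_bilinear[OF bounded_bilinear_mult]
lemmas partial_inner = partial_bilinear[OF bounded_bilinear_inner]

lemma bounded_bilinear_cross3: "bounded_bilinear cross3"
  using bilinear_conv_bounded_bilinear bilinear_cross by blast

lemmas C1_on_cross = C1_on_bilinear[OF bounded_bilinear_cross3]
lemmas partial_cross = partial_bilinear[OF bounded_bilinear_cross3]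

lemma C1_on_nth: "C1_on U f \<Longrightarrow> C1_on U (\<lambda>x. f x $ i)"
  by (rule C1_on_bounded_linear[OF bounded_linear_vec_nth])

lemma partial_nth: "f differentiable (at x) \<Longrightarrow> partial h (\<lambda>x. f x $ i) x = partial h f x $ i"
  by (rule partial_bounded_linear[OF bounded_linear_vec_nth])

lemma partial_compose:
  assumes "g differentiable (at x)" "f differentiable (at (g x))"
  shows "partial h (\<lambda>x. f (g x)) x = partial (partial h g x) f (g x)"
  by (rule partial_eq)
    (use has_derivative_compose[OF has_derivative_partial[OF assms(1)] has_derivative_partial[OF assms(2)]] in auto)

lemma C1_on_compose:
  assumes g: "C1_on U g" and f: "C1_on V f" and sub: "g ` U \<subseteq> V"
  shows "C1_on U (\<lambda>x. f (g x))"
proof (rule C1_onI)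
  show "((\<lambda>x. f (g x)) has_derivative (\<lambda>h. partial (partial h g x) f (g x))) (at x)" if "x \<in> U" for x
    using has_derivative_compose[OF C1_on_has_derivative[OF g that] C1_on_has_derivative[OF f]] that sub by auto
  fix h
  \<comment> \<open>The direction \<open>partial h g x\<close> varies with \<open>x\<close>;
    expanding it in the basis leaves only derivatives of \<open>f\<close> in fixed
    directions.\<close>
  have "partial (partial h g x) f (g x) = (\<Sum>b\<in>Basis. (partial h g x \<bullet> b) *\<^sub>R partial b f (g x))" if "x \<in> U" for x
    using partial_sum_Basis[of f "g x"] f that sub by (auto simp: C1_on_def)
  moreover have "continuous_on U (\<lambda>x. partial b f (g x))" for b
    using continuous_on_compose2[OF C1_on_continuous_partial[OF f] C1_on_continuous[OF g] sub] .
  ultimately show "continuous_on U (\<lambda>x. partial (partial h g x) f (g x))"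
    by (simp cong: continuous_on_cong) (intro continuous_intros C1_on_continuous_partial g)
qed

text \<open>The open sets \<open>U\<close> and \<open>- K\<close> cover the space, and on
  \<open>- K\<close> the extended function is identically zero, so regularity is checked on each of
  them.\<close>

lemma C1_on_extend_zero:
  assumes U: "open U" and f: "C1_on U f" and K: "closed K" "K \<subseteq> U" and z: "\<And>x. x \<in> U - K \<Longrightarrow> f x = 0"
  shows "C1_on UNIV (\<lambda>x. if x \<in> U then f x else 0)"
proof -
  let ?g = "\<lambda>x. if x \<in> U then f x else 0"
  have 1: "C1_on U ?g" using C1_on_cong[OF U, of ?g f] f by simp
  have oK: "open (- K)" using K by auto
  have 2: "C1_on (- K) ?g" using C1_on_cong[OF oK, of ?g "\<lambda>x. 0"] z by auto
  have UN: "U \<union> (- K) = UNIV" using K by auto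
  have "continuous_on (U \<union> (- K)) (partial h ?g)" for h
    using 1 2 continuous_on_open_Un[OF U oK] C1_on_def by blast
  then show ?thesis using 1 2 UN unfolding C1_on_def by (metis Un_iff UNIV_I)
qed

subsection \<open>Symmetry of second derivatives\<close>

lemma partial_line:
  assumes "f differentiable (at (x + t *\<^sub>R h))"
  shows "((\<lambda>t. f (x + t *\<^sub>R h)) has_vector_derivative partial h f (x + t *\<^sub>R h)) (at t)"
proof -
  have "((\<lambda>t. x + t *\<^sub>R h) has_derivative (\<lambda>s. s *\<^sub>R h)) (at t)"
    by (auto intro!: derivative_eq_intros)
  from has_derivative_compose[OF this has_derivative_partial[OF assms]]
  show ?thesis unfolding has_vector_derivative_def
    by (simp add: linear_cmul[OF linear_partial[OF assms]])
qed

text \<open>The second difference \<open>D\<close> over a small parallelogram is evaluated by the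
  mean value theorem in both orders. Each order gives \<open>s * s\<close> times a mixed derivative
  at some point of the parallelogram, and continuity at \<open>x\<close> compares the two.\<close>

lemma partial_commute_real:
  fixes f :: "'a::euclidean_space \<Rightarrow> real"
  assumes U: "open U" "x \<in> U" and f: "C1_on U f" and a: "C1_on U (partial a f)" and b: "C1_on U (partial b f)"
  shows "partial a (partial b f) x = partial b (partial a f) x"
proof (rule ccontr)
  assume ne: "\<not> ?thesis"
  define e where "e = \<bar>partial a (partial b f) x - partial b (partial a f) x\<bar> / 2"
  have e: "e > 0" using ne by (simp add: e_def)
  have c: "isCont (partial a (partial b f)) x" "isCont (partial b (partial a f)) x"
    using C1_on_continuous_partial[OF a] C1_on_continuous_partial[OF b] U 
    by (auto simp: continuous_on_eq_continuous_at)
  from c(1) obtain d1 where d1: "d1 > 0" "\<And>y. dist y x < d1 \<Longrightarrow> \<bar>partial a (partial b f) y - partial a (partial b f) x\<bar> < e"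
    using e unfolding continuous_at_eps_delta dist_real_def by blast
  from c(2) obtain d2 where d2: "d2 > 0" "\<And>y. dist y x < d2 \<Longrightarrow> \<bar>partial b (partial a f) y - partial b (partial a f) x\<bar> < e"
    using e unfolding continuous_at_eps_delta dist_real_def by blast
  from U obtain d3 where d3: "d3 > 0" "ball x d3 \<subseteq> U" using open_contains_ball by blast
  define d where "d = min d1 (min d2 d3)"
  \<comment> \<open>The side factor keeps the whole parallelogram within distance \<open>d\<close>
    of \<open>x\<close>; the summand 1 covers the case that \<open>a\<close> and \<open>b\<close>
    are both zero.\<close>
  define s where "s = d / (2 * (norm a + norm b + 1))"
  have pos: "d > 0" using d1 d2 d3 by (simp add: d_def)
  have s: "s > 0" unfolding s_def using pos by (intro divide_pos_pos) (auto intro: add_nonneg_pos)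
  have sab: "s * (norm a + norm b) < d"
  proof -
    have "s * (norm a + norm b) < s * (2 * (norm a + norm b + 1))" using s by (intro mult_strict_left_mono) (simp_all add: add_nonneg_pos)
    also have "s * (2 * (norm a + norm b + 1)) = d" unfolding s_def by (simp add: add_nonneg_eq_0_iff)
    finally show ?thesis .
  qed
  have near: "dist (x + u *\<^sub>R a + v *\<^sub>R b) x < d" if "0 \<le> u" "u \<le> s" "0 \<le> v" "v \<le> s" for u v
  proof -
    have "norm (u *\<^sub>R a + v *\<^sub>R b) \<le> u * norm a + v * norm b" using norm_triangle_ineq[of "u *\<^sub>R a" "v *\<^sub>R b"] that by simp
    also have "\<dots> \<le> s * norm a + s * norm b" using that by (intro add_mono mult_right_mono) auto
    also have "\<dots> < d" using sab by (simp add: algebra_simps)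
    finally show ?thesis by (simp add: dist_norm add.assoc)
  qed
  have inU: "x + u *\<^sub>R a + v *\<^sub>R b \<in> U" if "0 \<le> u" "u \<le> s" "0 \<le> v" "v \<le> s" for u v
    using near[OF that] d3 by (auto simp: d_def dist_commute)
  define D where "D = f (x + s *\<^sub>R a + s *\<^sub>R b) - f (x + s *\<^sub>R a) - f (x + s *\<^sub>R b) + f x"
  have da: "((\<lambda>u. g (x + u *\<^sub>R a + w)) has_real_derivative partial a g (x + u *\<^sub>R a + w)) (at u)"
    if "g differentiable (at (x + u *\<^sub>R a + w))" for g :: "'a \<Rightarrow> real" and u w
    using partial_line[of g "x + w" u a] that by (simp add: has_real_derivative_iff_has_vector_derivative algebra_simps)
  have db: "((\<lambda>u. g (w + u *\<^sub>R b)) has_real_derivative partial b g (w + u *\<^sub>R b)) (at u)"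
    if "g differentiable (at (w + u *\<^sub>R b))" for g :: "'a \<Rightarrow> real" and u w
    using partial_line[of g w u b] that by (simp add: has_real_derivative_iff_has_vector_derivative)
  have "\<exists>z>0. z < s \<and> (f (x + s *\<^sub>R a + s *\<^sub>R b) - f (x + s *\<^sub>R a + 0 *\<^sub>R b)) - (f (x + 0 *\<^sub>R a + s *\<^sub>R b) - f (x + 0 *\<^sub>R a + 0 *\<^sub>R b)) = 
    (s - 0) * (partial a f (x + z *\<^sub>R a + s *\<^sub>R b) - partial a f (x + z *\<^sub>R a + 0 *\<^sub>R b))"
    using inU s f by (intro MVT2[of 0 s "\<lambda>u. f (x + u *\<^sub>R a + s *\<^sub>R b) - f (x + u *\<^sub>R a + 0 *\<^sub>R b)"]) 
       (auto intro!: DERIV_diff da da[where w=0, simplified] C1_on_differentiable[OF f] inU[where v=0, simplified])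
  then obtain z where z: "0 < z" "z < s" "D = s * (partial a f (x + z *\<^sub>R a + s *\<^sub>R b) - partial a f (x + z *\<^sub>R a + 0 *\<^sub>R b))"
    by (auto simp: D_def)
  have "\<exists>w>0. w < s \<and> partial a f (x + z *\<^sub>R a + s *\<^sub>R b) - partial a f (x + z *\<^sub>R a + 0 *\<^sub>R b) = 
    (s - 0) * partial b (partial a f) (x + z *\<^sub>R a + w *\<^sub>R b)"
    using inU s z by (intro MVT2[of 0 s "\<lambda>u. partial a f (x + z *\<^sub>R a + u *\<^sub>R b)"]) 
       (auto intro!: db C1_on_differentiable[OF a])
  then obtain w where w: "0 < w" "w < s" "D = s * (s * partial b (partial a f) (x + z *\<^sub>R a + w *\<^sub>R b))"
    using z by auto
  have "\<exists>z>0. z < s \<and> (f (x + s *\<^sub>R a + s *\<^sub>R b) - f (x + 0 *\<^sub>R a + s *\<^sub>R b)) - (f (x + s *\<^sub>R a + 0 *\<^sub>R b) - f (x + 0 *\<^sub>R a + 0 *\<^sub>R b)) = 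
    (s - 0) * (partial b f (x + s *\<^sub>R a + z *\<^sub>R b) - partial b f (x + 0 *\<^sub>R a + z *\<^sub>R b))"
    using inU s f by (intro MVT2[of 0 s "\<lambda>u. f (x + s *\<^sub>R a + u *\<^sub>R b) - f (x + 0 *\<^sub>R a + u *\<^sub>R b)"]) 
       (auto intro!: DERIV_diff db C1_on_differentiable[OF f] inU[where u=0, simplified])
  then obtain z' where z': "0 < z'" "z' < s" "D = s * (partial b f (x + s *\<^sub>R a + z' *\<^sub>R b) - partial b f (x + 0 *\<^sub>R a + z' *\<^sub>R b))"
    by (auto simp: D_def algebra_simps)
  have "\<exists>w>0. w < s \<and> partial b f (x + s *\<^sub>R a + z' *\<^sub>R b) - partial b f (x + 0 *\<^sub>R a + z' *\<^sub>R b) = 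
    (s - 0) * partial a (partial b f) (x + w *\<^sub>R a + z' *\<^sub>R b)"
    using inU s z' by (intro MVT2[of 0 s "\<lambda>u. partial b f (x + u *\<^sub>R a + z' *\<^sub>R b)"]) 
       (auto intro!: da C1_on_differentiable[OF b])
  then obtain w' where w': "0 < w'" "w' < s" "D = s * (s * partial a (partial b f) (x + w' *\<^sub>R a + z' *\<^sub>R b))"
    using z' by auto
  have "partial b (partial a f) (x + z *\<^sub>R a + w *\<^sub>R b) = partial a (partial b f) (x + w' *\<^sub>R a + z' *\<^sub>R b)"
    using w(3) w'(3) s by simp
  moreover have "\<bar>partial b (partial a f) (x + z *\<^sub>R a + w *\<^sub>R b) - partial b (partial a f) x\<bar> < e"
    using near[of z w] w z by (intro d2) (auto simp: d_def)
  moreover have "\<bar>partial a (partial b f) (x + w' *\<^sub>R a + z' *\<^sub>R b) - partial a (partial b f) x\<bar> < e"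
    using near[of w' z'] w' z' by (intro d1) (auto simp: d_def)
  ultimately have "\<bar>partial a (partial b f) x - partial b (partial a f) x\<bar> < 2 * e" by linarith
  then show False by (simp add: e_def)
qed

lemma partial_commute:
  fixes f :: "'a::euclidean_space \<Rightarrow> 'b::euclidean_space"
  assumes U: "open U" "x \<in> U" and f: "C1_on U f" and a: "C1_on U (partial a f)" and b: "C1_on U (partial b f)"
  shows "partial a (partial b f) x = partial b (partial a f) x"
proof (rule euclidean_eqI)
  fix i :: 'b assume "i \<in> Basis"
  let ?f = "\<lambda>x. f x \<bullet> i"
  note bl = bounded_linear_inner_left[of i]
  have eq: "partial h ?f y = partial h f y \<bullet> i" if "y \<in> U" for h y
    by (rule partial_bounded_linear[OF bl]) (use that f in \<open>auto simp: C1_on_def\<close>)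
  have C: "C1_on U (partial h ?f) = C1_on U (\<lambda>y. partial h f y \<bullet> i)" for h
    by (rule C1_on_cong[OF U(1)]) (simp add: eq)
  have "partial a (partial b ?f) x = partial b (partial a ?f) x"
    by (rule partial_commute_real[OF U]) (simp_all add: C C1_on_bounded_linear[OF bl] f a b)
  moreover have "partial c (partial d ?f) x = partial c (partial d f) x \<bullet> i" if "C1_on U (partial d f)" for c d
    using partial_cong_open[OF U, of "partial d ?f" "\<lambda>y. partial d f y \<bullet> i" c]
      partial_bounded_linear[OF bl, of "partial d f" x] that U eq by (auto simp: C1_on_def)
  ultimately show "partial a (partial b f) x \<bullet> i = partial b (partial a f) x \<bullet> i"
    using a b by simp
qed


subsection \<open>Integration by parts\<close>

lemma integrable_compact_support:
  fixes f :: "'a::euclidean_space \<Rightarrow> 'b::euclidean_space"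
  assumes "continuous_on UNIV f" "\<And>x. R \<le> norm x \<Longrightarrow> f x = 0"
  shows "integrable lborel f"
proof -
  have "integrable lborel (\<lambda>x. indicator (cball 0 R) x *\<^sub>R f x)"
    by (intro borel_integrable_compact continuous_on_subset[OF assms(1)]) auto
  also have "(\<lambda>x. indicator (cball 0 R) x *\<^sub>R f x) = f"
    using assms(2) by (auto simp: indicator_def fun_eq_iff)
  finally show ?thesis .
qed

lemma partial_zero_outside:
  assumes "\<And>x. R \<le> norm x \<Longrightarrow> f x = 0" "R < norm x"
  shows "partial h f x = 0"
proof -
  have "partial h f x = partial h (\<lambda>x. 0) x"
    by (rule partial_cong_open[where U="- cball 0 R"]) (use assms in auto)
  then show ?thesis by simp
qed

text \<open>By translation invariance every difference quotient of \<open>f\<close> has integral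
  zero. The quotients converge to the derivative and are dominated by a bound of the derivative on a
  fixed ball, so the integral of the limit vanishes.\<close>

lemma
  fixes f :: "'a::euclidean_space \<Rightarrow> real"
  assumes f: "C1_on UNIV f" and z: "\<And>x. R \<le> norm x \<Longrightarrow> f x = 0"
  shows integrable_partial: "integrable lborel (partial h f)"
    and integral_partial_zero: "(\<integral>x. partial h f x \<partial>lborel) = 0"
proof -
  have z': "partial h f x = 0" if "R + 1 \<le> norm x" for x
    by (rule partial_zero_outside[of R]) (use z that in auto)
  have c: "continuous_on UNIV (partial h f)" by (rule C1_on_continuous_partial[OF f])
  show int: "integrable lborel (partial h f)"
    by (rule integrable_compact_support[OF c z'])
  have fi: "integrable lborel f" by (rule integrable_compact_support[OF C1_on_continuous[OF f] z])
  obtain M where M: "\<And>x. \<bar>partial h f x\<bar> \<le> M"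
  proof -
    have "compact (partial h f ` cball 0 (R + 1))"
      by (intro compact_continuous_image continuous_on_subset[OF c]) auto
    then obtain M where M: "\<And>x. x \<in> cball 0 (R+1) \<Longrightarrow> norm (partial h f x) \<le> M"
      using compact_imp_bounded bounded_iff by (metis image_eqI)
    have "\<bar>partial h f x\<bar> \<le> max M 0" for x
      using M[of x] z'[of x] by (cases "norm x \<le> R + 1") auto
    then show ?thesis using that by blast
  qed
  define D where "D n x = (f (x + (1 / real (Suc n)) *\<^sub>R h) - f x) * real (Suc n)" for n x
  have Dint: "integrable lborel (D n)" "(\<integral>x. D n x \<partial>lborel) = 0" for n
  proof -
    let ?h = "(1 / real (Suc n)) *\<^sub>R h"
    have i: "integrable lborel (\<lambda>x. f (x + ?h))" "(\<integral>x. f (x + ?h) \<partial>lborel) = (\<integral>x. f x \<partial>lborel)"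
    proof -
      have mf: "f \<in> borel_measurable borel" using C1_on_continuous[OF f] borel_measurable_continuous_onI by blast
      have "integrable (distr lborel borel ((+) ?h)) f" using fi lborel_distr_plus[of ?h] by simp
      then have "integrable lborel (\<lambda>x. f (?h + x))"
        using integrable_distr_eq[of "(+) ?h" lborel borel f] mf by simp
      then show "integrable lborel (\<lambda>x. f (x + ?h))" by (simp add: add.commute)
      have "(\<integral>x. f x \<partial>lborel) = (\<integral>x. f x \<partial>distr lborel borel ((+) ?h))" using lborel_distr_plus[of ?h] by simp
      also have "\<dots> = (\<integral>x. f (?h + x) \<partial>lborel)" by (rule integral_distr) (use mf in auto)
      finally show "(\<integral>x. f (x + ?h) \<partial>lborel) = (\<integral>x. f x \<partial>lborel)" by (simp add: add.commute)
    qed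
    show "integrable lborel (D n)" unfolding D_def using i(1) fi by (intro integrable_mult_left Bochner_Integration.integrable_diff)
    have "(\<integral>x. D n x \<partial>lborel) = ((\<integral>x. f (x + ?h) \<partial>lborel) - (\<integral>x. f x \<partial>lborel)) * real (Suc n)"
      unfolding D_def using i fi by (simp del: of_nat_Suc)
    then show "(\<integral>x. D n x \<partial>lborel) = 0" using i by simp
  qed
  have lim: "(\<lambda>n. D n x) \<longlonglongrightarrow> partial h f x" for x
  proof -
    have "((\<lambda>t. f (x + t *\<^sub>R h)) has_real_derivative partial h f x) (at 0)"
      using partial_line[of f x 0 h] C1_on_differentiable[OF f] by (simp add: has_real_derivative_iff_has_vector_derivative)
    then have "((\<lambda>t. (f (x + t *\<^sub>R h) - f x) / t) \<longlongrightarrow> partial h f x) (at 0)"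
      by (simp add: has_field_derivative_iff)
    moreover have "filterlim (\<lambda>n. 1 / real (Suc n)) (at 0) sequentially"
      using LIMSEQ_Suc[OF lim_1_over_n] by (auto simp: filterlim_at simp del: of_nat_Suc)
    ultimately have "(\<lambda>n. (f (x + (1 / real (Suc n)) *\<^sub>R h) - f x) / (1 / real (Suc n))) \<longlonglongrightarrow> partial h f x"
      by (rule filterlim_compose)
    then show ?thesis by (simp add: D_def)
  qed
  \<comment> \<open>All steps are at most 1 in size, so enlarging the support ball by
    \<open>norm h\<close> catches every shifted argument.\<close>
  have bound: "norm (D n x) \<le> M * indicator (cball 0 (R + norm h)) x" for n x
  proof (cases "x \<in> cball 0 (R + norm h)")
    case True
    let ?s = "1 / real (Suc n)"
    have "\<exists>z>0. z < ?s \<and> f (x + ?s *\<^sub>R h) - f (x + 0 *\<^sub>R h) = (?s - 0) * partial h f (x + z *\<^sub>R h)"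
      by (rule MVT2) (auto simp: has_real_derivative_iff_has_vector_derivative intro!: partial_line C1_on_differentiable[OF f])
    then obtain z where "f (x + ?s *\<^sub>R h) - f x = ?s * partial h f (x + z *\<^sub>R h)" by auto
    then have "D n x = partial h f (x + z *\<^sub>R h)" by (simp add: D_def del: of_nat_Suc)
    then show ?thesis using M True by simp
  next
    case False
    have "norm ((1 / real (Suc n)) *\<^sub>R h) \<le> norm h" 
      by (simp add: field_simps mult_le_cancel_left1 del: of_nat_Suc) 
    then have "norm x - norm h \<le> norm (x + (1 / real (Suc n)) *\<^sub>R h)" 
      using norm_diff_ineq[of x "(1 / real (Suc n)) *\<^sub>R h"] by linarith
    then have "R \<le> norm (x + (1 / real (Suc n)) *\<^sub>R h)" using False by simp
    moreover have "R \<le> norm x"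
    proof -
      have "R + norm h < norm x" using False by simp
      then show ?thesis using norm_ge_zero[of h] by linarith
    qed
    ultimately show ?thesis using False z by (simp add: D_def)
  qed
  have "(\<lambda>n. \<integral>x. D n x \<partial>lborel) \<longlonglongrightarrow> (\<integral>x. partial h f x \<partial>lborel)"
  proof (rule integral_dominated_convergence)
    show "partial h f \<in> borel_measurable lborel" "\<And>n. D n \<in> borel_measurable lborel"
      using int Dint by auto
    show "integrable lborel (\<lambda>x. M * indicator (cball 0 (R + norm h)) x)"
      by (rule integrable_mult_right[OF integrable_real_indicator[OF _ emeasure_bounded_finite[OF bounded_cball]]]) simp
  qed (use lim bound in auto)
  then show "(\<integral>x. partial h f x \<partial>lborel) = 0"
    using Dint(2) LIMSEQ_unique[OF _ tendsto_const] by simp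
qed

subsection \<open>Divergence and curl\<close>

lemma UNIV_3_axis: "(Basis :: (real^3) set) = {axis 1 1, axis 2 1, axis 3 1}"
  by (auto simp: Basis_vec_def UNIV_3)

lemma divergence_3: "divergence F x = partial (axis 1 1) F x $ 1 + partial (axis 2 1) F x $ 2 + partial (axis 3 1) F x $ 3"
  by (simp add: divergence_def sum_3)

lemma curl_nth:
  "curl F x $ 1 = partial (axis 2 1) F x $ 3 - partial (axis 3 1) F x $ 2"
  "curl F x $ 2 = partial (axis 3 1) F x $ 1 - partial (axis 1 1) F x $ 3"
  "curl F x $ 3 = partial (axis 1 1) F x $ 2 - partial (axis 2 1) F x $ 1"
  by (simp_all add: curl_def)

lemma partial_eq_sum_3:
  fixes f :: "real^3 \<Rightarrow> 'b::real_normed_vector"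
  assumes "f differentiable (at x)"
  shows "partial h f x = h $ 1 *\<^sub>R partial (axis 1 1) f x + h $ 2 *\<^sub>R partial (axis 2 1) f x + h $ 3 *\<^sub>R partial (axis 3 1) f x"
proof -
  have "h = h $ 1 *\<^sub>R axis 1 1 + h $ 2 *\<^sub>R axis 2 1 + h $ 3 *\<^sub>R axis 3 1"
    by (simp add: vec_eq_iff forall_3 axis_def)
  then have "partial h f x = partial (h $ 1 *\<^sub>R axis 1 1 + h $ 2 *\<^sub>R axis 2 1 + h $ 3 *\<^sub>R axis 3 1) f x" by simp
  also have "\<dots> = h $ 1 *\<^sub>R partial (axis 1 1) f x + h $ 2 *\<^sub>R partial (axis 2 1) f x + h $ 3 *\<^sub>R partial (axis 3 1) f x"
    by (simp only: linear_add[OF linear_partial[OF assms]] linear_cmul[OF linear_partial[OF assms]])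
  finally show ?thesis .
qed

text \<open>The antisymmetric part of the derivative is a cross product with the curl. This
  coordinate-free form serves twice: it makes the derivative of a curl-free field symmetric, and it
  produces the surface normal in Stokes' theorem.\<close>

lemma partial_curl_cross:
  assumes "F differentiable (at x)"
  shows "partial a F x \<bullet> b - partial b F x \<bullet> a = curl F x \<bullet> cross3 a b"
  unfolding partial_eq_sum_3[OF assms, of a] partial_eq_sum_3[OF assms, of b]
  by (simp add: cross3_def inner_vec_def sum_3 curl_nth algebra_simps)

lemma grad_inner:
  assumes "f differentiable (at x)"
  shows "grad f x \<bullet> h = partial h f x"
  unfolding partial_eq_sum_3[OF assms, of h] by (simp add: grad_def inner_vec_def sum_3)

lemma grad_eqI: "(f has_derivative (\<lambda>h. v \<bullet> h)) (at x) \<Longrightarrow> grad f x = v"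
  by (simp add: grad_def partial_eq inner_axis vec_eq_iff)

lemma grad_has_derivative:
  "f differentiable (at x) \<Longrightarrow> (f has_derivative (\<lambda>h. grad f x \<bullet> h)) (at x)"
  by (simp add: grad_inner has_derivative_partial)

lemma C1_on_continuous_divergence: "C1_on U F \<Longrightarrow> continuous_on U (divergence F)"
  unfolding divergence_def[abs_def] by (intro continuous_intros C1_on_continuous_partial)

text \<open>As a combination of fixed axis vectors the curl is accessible to the termwise continuity
  and C^1 rules.\<close>

lemma curl_sum_axis: "curl F = (\<lambda>x. (partial (axis 2 1) F x $ 3 - partial (axis 3 1) F x $ 2) *\<^sub>R axis 1 1 
    + (partial (axis 3 1) F x $ 1 - partial (axis 1 1) F x $ 3) *\<^sub>R axis 2 1
    + (partial (axis 1 1) F x $ 2 - partial (axis 2 1) F x $ 1) *\<^sub>R axis 3 1)"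
  by (simp add: vec_eq_iff forall_3 curl_nth axis_def fun_eq_iff)

lemma C1_on_continuous_curl: "C1_on U F \<Longrightarrow> continuous_on U (curl F)"
  unfolding curl_sum_axis by (intro continuous_intros C1_on_continuous_partial)

lemma divergence_cong_open: "open U \<Longrightarrow> x \<in> U \<Longrightarrow> (\<And>y. y \<in> U \<Longrightarrow> F y = G y) \<Longrightarrow> divergence F x = divergence G x"
  unfolding divergence_def using partial_cong_open[of U x F G] by simp

lemma curl_cong_open: "open U \<Longrightarrow> x \<in> U \<Longrightarrow> (\<And>y. y \<in> U \<Longrightarrow> F y = G y) \<Longrightarrow> curl F x = curl G x"
  unfolding curl_def using partial_cong_open[of U x F G] by simp

lemma grad_cong_open: "open U \<Longrightarrow> x \<in> U \<Longrightarrow> (\<And>y. y \<in> U \<Longrightarrow> f y = g y) \<Longrightarrow> grad f x = grad g x"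
  unfolding grad_def using partial_cong_open[of U x f g] by simp

lemma divergence_diff:
  assumes "F differentiable (at x)" "G differentiable (at x)"
  shows "divergence (\<lambda>x. F x - G x) x = divergence F x - divergence G x"
  by (simp add: divergence_def partial_diff assms sum_subtractf)

lemma curl_diff:
  assumes "F differentiable (at x)" "G differentiable (at x)"
  shows "curl (\<lambda>x. F x - G x) x = curl F x - curl G x"
  by (simp add: vec_eq_iff forall_3 curl_nth partial_diff assms)

lemma partial_cmul:
  "F differentiable (at x) \<Longrightarrow> partial h (\<lambda>x. c *\<^sub>R F x) x = c *\<^sub>R partial h F x"
  by (rule partial_bounded_linear[OF bounded_linear_scaleR_right])

lemma curl_cmul: "F differentiable (at x) \<Longrightarrow> curl (\<lambda>x. c *\<^sub>R F x) x = c *\<^sub>R curl F x"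
  by (simp add: vec_eq_iff forall_3 curl_nth partial_cmul algebra_simps)

lemma divergence_scaleR:
  assumes "s differentiable (at x)" "F differentiable (at x)"
  shows "divergence (\<lambda>x. s x *\<^sub>R F x) x = s x * divergence F x + grad s x \<bullet> F x"
  by (simp add: divergence_3 partial_scaleR assms grad_def inner_vec_def sum_3 algebra_simps)

lemma curl_scaleR:
  assumes "s differentiable (at x)" "F differentiable (at x)"
  shows "curl (\<lambda>x. s x *\<^sub>R F x) x = s x *\<^sub>R curl F x + cross3 (grad s x) (F x)"
  by (simp add: vec_eq_iff forall_3 curl_nth partial_scaleR assms grad_def cross3_def algebra_simps)

lemma divergence_cross:
  assumes "F differentiable (at x)" "G differentiable (at x)"
  shows "divergence (\<lambda>x. cross3 (F x) (G x)) x = curl F x \<bullet> G x - F x \<bullet> curl G x"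
  unfolding divergence_3 partial_cross[OF assms] by (simp add: curl_nth inner_vec_def sum_3 cross3_def algebra_simps)

lemma C1_on_curl:
  assumes "\<And>h. h \<in> Basis \<Longrightarrow> C1_on U (partial h F)"
  shows "C1_on U (curl F)"
proof -
  show ?thesis unfolding curl_sum_axis
    by (intro C1_on_add C1_on_scaleR C1_on_diff C1_on_nth C1_on_const assms) (auto simp: UNIV_3_axis)
qed

lemma divergence_curl:
  assumes U: "open U" "x \<in> U" and F: "C_on 2 U F"
  shows "divergence (curl F) x = 0"
proof -
  have F1: "C1_on U F" and F2: "C1_on U (partial (axis i 1) F)" for i :: 3
    using F by (auto simp: C_on_2)
  have d: "(\<lambda>x. partial (axis i 1) F x $ j) differentiable (at x)" for i j :: 3
    using C1_on_nth[OF F2] U by (auto simp: C1_on_def)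
  have n: "partial h (\<lambda>x. partial (axis i 1) F x $ j) x = partial h (partial (axis i 1) F) x $ j" for h and i j :: 3
    by (rule partial_nth) (use F2 U in \<open>auto simp: C1_on_def\<close>)
  have c: "partial (axis i 1) (partial (axis j 1) F) x = partial (axis j 1) (partial (axis i 1) F) x" for i j :: 3
    by (rule partial_commute[OF U F1 F2 F2])
  have dc: "curl F differentiable (at x)" 
    using C1_on_curl[of U F] F U by (auto simp: C_on_2 C1_on_def)
  have "divergence (curl F) x = partial (axis 1 1) (\<lambda>x. curl F x $ 1) x + partial (axis 2 1) (\<lambda>x. curl F x $ 2) x + partial (axis 3 1) (\<lambda>x. curl F x $ 3) x"
    by (simp add: divergence_3 partial_nth[OF dc])
  also have "\<dots> = 0"
    unfolding curl_nth by (simp add: partial_diff[OF d d] n c[of 1 2] c[of 1 3] c[of 2 3])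
  finally show ?thesis .
qed

lemma curl_grad:
  assumes U: "open U" "x \<in> U" and f: "C_on 2 U f"
  shows "curl (grad f) x = 0"
proof -
  have f1: "C1_on U f" and f2: "C1_on U (partial (axis i 1) f)" for i :: 3
    using f by (auto simp: C_on_2)
  have eq: "grad f = (\<lambda>x. partial (axis 1 1) f x *\<^sub>R axis 1 1 + partial (axis 2 1) f x *\<^sub>R axis 2 1 + partial (axis 3 1) f x *\<^sub>R axis 3 1)"
    by (simp add: vec_eq_iff forall_3 grad_def axis_def fun_eq_iff)
  have C: "C1_on U (grad f)" unfolding eq by (intro C1_on_add C1_on_scaleR C1_on_const f2)
  have n: "partial h (grad f) x $ i = partial h (partial (axis i 1) f) x" for h i
    using partial_nth[of "grad f" x h i] C U by (auto simp: C1_on_def grad_def)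
  show ?thesis
    using partial_commute[OF U f1 f2 f2] by (simp add: vec_eq_iff forall_3 curl_nth n)
qed

lemma C1_on_grad:
  assumes "\<And>h. h \<in> Basis \<Longrightarrow> C1_on U (partial h f)"
  shows "C1_on U (grad f)"
proof -
  have eq: "grad f = (\<lambda>x. partial (axis 1 1) f x *\<^sub>R axis 1 1 + partial (axis 2 1) f x *\<^sub>R axis 2 1 + partial (axis 3 1) f x *\<^sub>R axis 3 1)"
    by (simp add: vec_eq_iff forall_3 grad_def axis_def fun_eq_iff)
  show ?thesis unfolding eq by (intro C1_on_add C1_on_scaleR C1_on_const assms) (auto simp: UNIV_3_axis)
qed

lemma
  assumes F: "C1_on UNIV F" and z: "\<And>x. R \<le> norm x \<Longrightarrow> F x = 0"
  shows integrable_divergence: "integrable lborel (divergence F)"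
    and integral_divergence_zero: "(\<integral>x. divergence F x \<partial>lborel) = 0"
proof -
  have d: "partial h F x $ i = partial h (\<lambda>x. F x $ i) x" for h x i
    using F by (simp add: partial_nth C1_on_def)
  have C: "C1_on UNIV (\<lambda>x. F x $ i)" for i by (rule C1_on_nth[OF F])
  have i: "integrable lborel (partial h (\<lambda>x. F x $ i))" "(\<integral>x. partial h (\<lambda>x. F x $ i) x \<partial>lborel) = 0" for h i
    using integrable_partial[OF C, of R] integral_partial_zero[OF C, of R] z by auto
  show "integrable lborel (divergence F)" unfolding divergence_def[abs_def] d by (intro Bochner_Integration.integrable_sum i)
  show "(\<integral>x. divergence F x \<partial>lborel) = 0" unfolding divergence_def d by (subst Bochner_Integration.integral_sum) (auto simp: i)
qed


subsection \<open>Cutoff functions\<close>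

text \<open>At the seam the two one-sided difference quotients have the same limit, because both the
  values and the derivatives agree there.\<close>

lemma DERIV_if_le:
  fixes f g :: "real \<Rightarrow> real"
  assumes f: "\<And>t. t \<le> a \<Longrightarrow> (f has_real_derivative f' t) (at t)"
    and g: "\<And>t. a \<le> t \<Longrightarrow> (g has_real_derivative g' t) (at t)"
    and eq: "f a = g a" "f' a = g' a"
  shows "((\<lambda>t. if t \<le> a then f t else g t) has_real_derivative (if t \<le> a then f' t else g' t)) (at t)"
proof -
  let ?h = "\<lambda>t. if t \<le> a then f t else g t"
  consider "t < a" | "t = a" | "a < t" by linarith
  then show ?thesis
  proof cases
    case 1
    have "(?h has_real_derivative f' t) (at t)"
      by (rule has_field_derivative_transform_within_open[OF f, where S="{..<a}"]) (use 1 in auto)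
    then show ?thesis using 1 by simp
  next
    case 3
    have "(?h has_real_derivative g' t) (at t)"
      by (rule has_field_derivative_transform_within_open[OF g, where S="{a<..}"]) (use 3 in auto)
    then show ?thesis using 3 by simp
  next
    case 2
    have F: "((\<lambda>y. (f y - f a) / (y - a)) \<longlongrightarrow> f' a) (at_left a)"
      using f[of a] by (simp add: has_field_derivative_iff filterlim_at_split)
    have G: "((\<lambda>y. (g y - g a) / (y - a)) \<longlongrightarrow> f' a) (at_right a)"
      using g[of a] eq by (simp add: has_field_derivative_iff filterlim_at_split)
    have "((\<lambda>y. (?h y - ?h a) / (y - a)) \<longlongrightarrow> f' a) (at a)"
    proof (rule filterlim_split_at)
      show "((\<lambda>y. (?h y - ?h a) / (y - a)) \<longlongrightarrow> f' a) (at_left a)"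
        by (rule Lim_transform_eventually[OF F]) (auto simp: eventually_at_filter)
      show "((\<lambda>y. (?h y - ?h a) / (y - a)) \<longlongrightarrow> f' a) (at_right a)"
        by (rule Lim_transform_eventually[OF G]) (auto simp: eventually_at_filter eq)
    qed
    then show ?thesis using 2 by (simp add: has_field_derivative_iff)
  qed
qed

text \<open>The quintic 10 s^3 - 15 s^4 + 6 s^5: its first derivative 30 s^2 (1 - s)^2 and its
  second derivative vanish at 0 and 1, so it glues to the constants 0 and 1 in class C^2.\<close>

definition sstep :: "real \<Rightarrow> real"
  where "sstep s = (if s \<le> 0 then 0 else if s \<le> 1 then s^3 * (10 - 15 * s + 6 * s^2) else 1)"

definition sstep' :: "real \<Rightarrow> real"
  where "sstep' s = (if s \<le> 0 then 0 else if s \<le> 1 then 30 * s^2 * (1 - s)^2 else 0)"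

definition sstep'' :: "real \<Rightarrow> real"
  where "sstep'' s = (if s \<le> 0 then 0 else if s \<le> 1 then 60 * s * (1 - s) * (1 - 2 * s) else 0)"

lemma sstep_deriv: "(sstep has_real_derivative sstep' s) (at s)"
proof -
  have p: "((\<lambda>s. s^3 * (10 - 15 * s + 6 * s^2)) has_real_derivative 30 * t^2 * (1 - t)^2) (at t)" for t :: real
    by (auto intro!: derivative_eq_intros simp: algebra_simps power2_eq_square power3_eq_cube)
  have 1: "((\<lambda>s. if s \<le> 1 then s^3 * (10 - 15 * s + 6 * s^2) else 1) has_real_derivative 
     (if t \<le> 1 then 30 * t^2 * (1 - t)^2 else 0)) (at t)" for t :: real
    by (rule DERIV_if_le[OF p]) auto
  show ?thesis unfolding sstep_def[abs_def] sstep'_def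
    by (rule DERIV_if_le[OF _ 1]) auto
qed

lemma sstep'_deriv: "(sstep' has_real_derivative sstep'' s) (at s)"
proof -
  have p: "((\<lambda>s. 30 * s^2 * (1 - s)^2) has_real_derivative 60 * t * (1 - t) * (1 - 2 * t)) (at t)" for t :: real
    by (auto intro!: derivative_eq_intros simp: algebra_simps power2_eq_square power3_eq_cube)
  have 1: "((\<lambda>s. if s \<le> 1 then 30 * s^2 * (1 - s)^2 else 0) has_real_derivative 
     (if t \<le> 1 then 60 * t * (1 - t) * (1 - 2 * t) else 0)) (at t)" for t :: real
    by (rule DERIV_if_le[OF p]) auto
  show ?thesis unfolding sstep'_def[abs_def] sstep''_def
    by (rule DERIV_if_le[OF _ 1]) auto
qed

lemma continuous_sstep'': "continuous_on UNIV sstep''"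
proof -
  have eq: "sstep'' = (\<lambda>s. 60 * max 0 (min 1 s) * (1 - max 0 (min 1 s)) * (1 - 2 * max 0 (min 1 s)))"
    by (auto simp: sstep''_def fun_eq_iff)
  show ?thesis unfolding eq by (intro continuous_intros)
qed

lemma sstep'_bound: "\<bar>sstep' s\<bar> \<le> 30"
proof -
  have "30 * s^2 * (1 - s)^2 \<le> 30 * 1 * 1" if "0 \<le> s" "s \<le> 1"
    by (intro mult_mono) (use that in \<open>auto simp: power_le_one\<close>)
  then show ?thesis by (auto simp: sstep'_def)
qed

lemma sstep_simps: "s \<le> 0 \<Longrightarrow> sstep s = 0" "1 \<le> s \<Longrightarrow> sstep s = 1"
  by (auto simp: sstep_def)

lemma C1_on_real:
  fixes F :: "real \<Rightarrow> real"
  assumes "\<And>s. s \<in> U \<Longrightarrow> (F has_real_derivative F' s) (at s)" "continuous_on U F'"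
  shows "C1_on U F"
  by (rule C1_onI[where f'="\<lambda>s h. F' s * h"]) 
    (use assms in \<open>auto simp: has_field_derivative_def intro!: continuous_intros\<close>)

text \<open>Radial functions are composed with an affine function of the squared distance instead of
  the distance, which keeps them smooth at the centre.\<close>

definition quad :: "'a::euclidean_space \<Rightarrow> real \<Rightarrow> real \<Rightarrow> 'a \<Rightarrow> real"
  where "quad a k l y = k * ((y - a) \<bullet> (y - a)) + l"

lemma quad_has_derivative: "(quad a k l has_derivative (\<lambda>h. (2 * k) *\<^sub>R (y - a) \<bullet> h)) (at y)"
  unfolding quad_def[abs_def] by (auto intro!: derivative_eq_intros simp: inner_commute algebra_simps)

lemma C1_on_diff_const: "C1_on U (\<lambda>y. y - a)"
  by (intro C1_on_diff C1_on_id C1_on_const)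

lemma C1_on_quad: "C1_on U (quad a k l)"
  by (rule C1_onI[OF quad_has_derivative]) (intro continuous_intros)

lemma radial_has_derivative:
  assumes "(F has_real_derivative D) (at (quad a k l y))"
  shows "((\<lambda>y. F (quad a k l y)) has_derivative (\<lambda>h. ((2 * k * D) *\<^sub>R (y - a)) \<bullet> h)) (at y)"
proof -
  have "((\<lambda>y. F (quad a k l y)) has_derivative (\<lambda>h. D * ((2 * k) *\<^sub>R (y - a) \<bullet> h))) (at y)"
    using has_derivative_compose[OF quad_has_derivative[of a k l y] assms[unfolded has_field_derivative_def]] .
  then show ?thesis by (simp add: algebra_simps)
qed

lemma C_on_2_radial:
  assumes F: "\<And>s. (F has_real_derivative F' s) (at s)" and F': "\<And>s. (F' has_real_derivative F'' s) (at s)"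
    and c: "continuous_on UNIV F''"
  shows "C_on 2 U (\<lambda>y. F (quad a k l y))"
proof -
  have F1: "C1_on UNIV F'" by (rule C1_on_real[OF F' c])
  have F0: "C1_on UNIV F" by (rule C1_on_real[OF F C1_on_continuous[OF F1]])
  have 0: "C1_on U (\<lambda>y. F (quad a k l y))" by (rule C1_on_compose[OF C1_on_quad F0]) simp
  have 1: "partial h (\<lambda>y. F (quad a k l y)) = (\<lambda>y. F' (quad a k l y) * ((2 * k) *\<^sub>R (y - a) \<bullet> h))" for h
    by (rule ext, rule partial_eq[OF radial_has_derivative[OF F], THEN trans]) (simp add: algebra_simps)
  have "C1_on U (\<lambda>y. F' (quad a k l y) * ((2 * k) *\<^sub>R (y - a) \<bullet> h))" for h
    by (rule C1_on_mult[OF C1_on_compose[OF C1_on_quad F1 subset_UNIV]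
        C1_on_inner[OF C1_on_scaleR[OF C1_on_const C1_on_diff_const] C1_on_const]])
  then show ?thesis using 0 unfolding C_on_2 1 by blast
qed

text \<open>The argument of \<open>sstep\<close> is affine in the squared distance from
  \<open>a\<close>, equal to 0 on the sphere of radius \<open>r\<close> and to 1 on the sphere of
  radius \<open>s\<close>.\<close>

definition bump :: "'a::euclidean_space \<Rightarrow> real \<Rightarrow> real \<Rightarrow> 'a \<Rightarrow> real"
  where "bump a r s y = 1 - sstep (quad a (1 / (s^2 - r^2)) (-(r^2) / (s^2 - r^2)) y)"

context
  fixes a :: "'a::euclidean_space" and r s :: real
  assumes rs: "0 \<le> r" "r < s"
begin

lemma bump_arg: "quad a (1 / (s^2 - r^2)) (-(r^2) / (s^2 - r^2)) y = ((norm (y - a))\<^sup>2 - r^2) / (s^2 - r^2)"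
  by (simp add: quad_def power2_norm_eq_inner diff_divide_distrib)

lemma bump_pos: "0 < s^2 - r^2"
  using rs by (simp add: power_strict_mono)

lemma bump_1: "norm (y - a) \<le> r \<Longrightarrow> bump a r s y = 1"
  unfolding bump_def bump_arg using bump_pos rs
  by (subst sstep_simps) (auto intro!: divide_nonpos_pos power_mono)

lemma bump_0: "s \<le> norm (y - a) \<Longrightarrow> bump a r s y = 0"
  unfolding bump_def bump_arg using bump_pos rs
  by (subst sstep_simps) (auto simp: le_divide_eq_1 intro!: power_mono)

lemma C2_bump: "C_on 2 U (bump a r s)"
proof -
  have 1: "((\<lambda>x. 1 - sstep x) has_real_derivative - sstep' t) (at t)" for t
    by (auto intro!: derivative_eq_intros sstep_deriv)
  have 2: "((\<lambda>x. - sstep' x) has_real_derivative - sstep'' t) (at t)" for t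
    by (auto intro!: derivative_eq_intros sstep'_deriv)
  show ?thesis unfolding bump_def[abs_def]
    by (rule C_on_2_radial[OF 1 2]) (intro continuous_intros continuous_sstep'')
qed

lemma bump_range: "0 \<le> bump a r s y" "bump a r s y \<le> 1"
proof -
  have "0 \<le> sstep t \<and> sstep t \<le> 1" for t
  proof -
    have nn: "0 \<le> sstep' x" for x by (auto simp: sstep'_def)
    have "sstep t \<le> sstep (max t 1)" by (rule DERIV_nonneg_imp_nondecreasing) (use sstep_deriv nn in auto)
    moreover have "sstep (min t 0) \<le> sstep t" by (rule DERIV_nonneg_imp_nondecreasing) (use sstep_deriv nn in auto)
    ultimately show ?thesis by (simp add: sstep_simps)
  qed
  then show "0 \<le> bump a r s y" "bump a r s y \<le> 1" by (auto simp: bump_def)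
qed

end

lemma grad_bump:
  fixes a :: "real^3"
  assumes "0 \<le> r" "r < s"
  shows "grad (bump a r s) y = (- 2 / (s^2 - r^2) * sstep' (quad a (1 / (s^2 - r^2)) (-(r^2) / (s^2 - r^2)) y)) *\<^sub>R (y - a)"
proof -
  have 1: "((\<lambda>x. 1 - sstep x) has_real_derivative - sstep' t) (at t)" for t
    by (auto intro!: derivative_eq_intros sstep_deriv)
  show ?thesis unfolding bump_def[abs_def]
    by (rule grad_eqI, rule has_derivative_eq_rhs[OF radial_has_derivative[OF 1]]) (simp add: algebra_simps)
qed

text \<open>The factors 2 / (3 R^2) from the rescaling, 30 from \<open>sstep'_bound\<close> and 2 R
  for the radius multiply to 40 / R. The order 1 / R is the point: with a kernel of order R^-2 and a
  shell of volume of order R^3, the truncation error stays controlled by the supremum of the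
  field.\<close>

lemma grad_bump_bound:
  assumes "0 < R"
  shows "norm (grad (bump (0::real^3) R (2 * R)) y) \<le> 40 / R"
proof (cases "norm y \<le> 2 * R")
  case True
  have "norm (grad (bump (0::real^3) R (2 * R)) y) = 2 / (3 * R^2) * \<bar>sstep' (quad 0 (1 / ((2*R)^2 - R^2)) (-(R^2) / ((2*R)^2 - R^2)) y)\<bar> * norm y"
    using assms by (subst grad_bump) (auto simp: abs_mult power2_eq_square)
  also have "\<dots> \<le> 2 / (3 * R^2) * 30 * (2 * R)"
    using True assms by (intro mult_mono sstep'_bound) auto
  also have "\<dots> = 40 / R" using assms by (simp add: power2_eq_square field_simps)
  finally show ?thesis .
next
  case False
  have "grad (bump (0::real^3) R (2 * R)) y = grad (\<lambda>x. 0) y"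
    by (rule grad_cong_open[where U="- cball 0 (2 * R)"]) (use False assms bump_0[of R "2 * R" _ "0::real^3"] in auto)
  then show ?thesis using assms by (simp add: grad_def zero_vec_def[symmetric])
qed


subsection \<open>The regularised Newton kernel\<close>

text \<open>\<open>newt e\<close> is the gradient of a \<open>C\<^sup>2\<close> function that agrees with \<open>1 / norm z\<close> for
  \<open>norm z \<ge> e\<close>; the coefficients on \<open>norm z \<le> e\<close> are those of the Taylor polynomial of
  \<open>s powr (- 3 / 2)\<close> at \<open>s = e\<^sup>2\<close>.\<close>

definition newt_coeff :: "real \<Rightarrow> real \<Rightarrow> real"
  where "newt_coeff e s = (if s \<le> e^2 then (3 / 2 * s / e^2 - 5 / 2) / e^3 else - 1 / (sqrt s)^3)"

definition newt_coeff' :: "real \<Rightarrow> real \<Rightarrow> real"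
  where "newt_coeff' e s = (if s \<le> e^2 then 3 / 2 / e^5 else 3 / 2 / (sqrt s)^5)"

definition newt :: "real \<Rightarrow> real^3 \<Rightarrow> real^3"
  where "newt e z = newt_coeff e (z \<bullet> z) *\<^sub>R z"

text \<open>Up to its total mass an approximate identity: minus the Laplacian of the regularised
  \<open>1 / norm z\<close>, nonnegative and carried by the ball of radius \<open>e\<close>.\<close>

definition kap :: "real \<Rightarrow> real^3 \<Rightarrow> real"
  where "kap e z = - divergence (newt e) z"

context
  fixes e :: real
  assumes e: "0 < e"
begin

lemma newt_coeff_deriv: "(newt_coeff e has_real_derivative newt_coeff' e s) (at s)"
  unfolding newt_coeff_def[abs_def] newt_coeff'_def
proof (rule DERIV_if_le)
  show "((\<lambda>s. (3 / 2 * s / e^2 - 5 / 2) / e^3) has_real_derivative 3 / 2 / e^5) (at t)" for t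
    using e by (auto intro!: derivative_eq_intros simp: field_simps power_numeral_reduce)
  show "((\<lambda>s. - 1 / (sqrt s)^3) has_real_derivative 3 / 2 / (sqrt t)^5) (at t)" if "e^2 \<le> t" for t
  proof -
    have t: "0 < t" using that e by (metis less_le_trans zero_less_power)
    define q where "q = sqrt t"
    have q: "q > 0" using t by (simp add: q_def)
    have s: "(sqrt has_real_derivative inverse q / 2) (at t)" unfolding q_def by (rule DERIV_real_sqrt[OF t])
    have "((\<lambda>s. - 1 / (sqrt s)^3) has_real_derivative 
        (0 * (sqrt t)^3 - - 1 * (of_nat 3 * (inverse q / 2 * (sqrt t)^(3 - Suc 0)))) / ((sqrt t)^3 * (sqrt t)^3)) (at t)"
      by (intro DERIV_divide DERIV_const DERIV_power s) (use t in simp)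
    moreover have "(0 * q^3 - - 1 * (of_nat 3 * (inverse q / 2 * q^(3 - Suc 0)))) / (q^3 * q^3) = 3 / 2 / q^5"
      using q by (simp add: field_simps power_numeral_reduce)
    ultimately show ?thesis unfolding q_def by simp
  qed
qed (use e in \<open>auto simp: field_simps power_numeral_reduce\<close>)

lemma C1_on_newt_coeff: "C1_on UNIV (newt_coeff e)"
proof (rule C1_on_real[OF newt_coeff_deriv])
  have "newt_coeff' e = (\<lambda>s. 3 / 2 / (sqrt (max s (e^2)))^5)"
    using e by (auto simp: newt_coeff'_def fun_eq_iff max_def)
  moreover have "continuous_on UNIV (\<lambda>s. 3 / 2 / (sqrt (max s (e^2)))^5)"
    using e by (intro continuous_intros) (auto simp: max_def)
  ultimately show "continuous_on UNIV (newt_coeff' e)" by simp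
qed

lemma newt_has_derivative:
  "(newt e has_derivative (\<lambda>h. newt_coeff e (z \<bullet> z) *\<^sub>R h + (2 * newt_coeff' e (z \<bullet> z) * (z \<bullet> h)) *\<^sub>R z)) (at z)"
proof -
  have "((\<lambda>z. newt_coeff e (quad 0 1 0 z) *\<^sub>R z) has_derivative 
     (\<lambda>h. newt_coeff e (quad 0 1 0 z) *\<^sub>R h + (((2 * 1 * newt_coeff' e (quad 0 1 0 z)) *\<^sub>R (z - 0)) \<bullet> h) *\<^sub>R z)) (at z)"
    by (rule has_derivative_scaleR[OF radial_has_derivative[OF newt_coeff_deriv] has_derivative_ident])
  then show ?thesis by (simp add: newt_def[abs_def] quad_def)
qed

lemma partial_newt: "partial h (newt e) z = newt_coeff e (z \<bullet> z) *\<^sub>R h + (2 * newt_coeff' e (z \<bullet> z) * (z \<bullet> h)) *\<^sub>R z"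
  by (rule partial_eq[OF newt_has_derivative])

lemma C1_on_newt: "C1_on UNIV (newt e)"
proof -
  have "C1_on UNIV (\<lambda>z::real^3. newt_coeff e (quad 0 1 0 z) *\<^sub>R z)"
    by (rule C1_on_scaleR[OF C1_on_compose[OF C1_on_quad C1_on_newt_coeff] C1_on_id]) simp
  then show ?thesis by (simp add: newt_def[abs_def] quad_def)
qed

lemma curl_newt: "curl (newt e) z = 0"
  by (simp add: vec_eq_iff forall_3 curl_nth partial_newt axis_def inner_vec_def sum_3)

lemma kap_eq: "kap e z = - 3 * newt_coeff e (z \<bullet> z) - 2 * newt_coeff' e (z \<bullet> z) * (z \<bullet> z)"
  unfolding kap_def divergence_3 partial_newt
  by (simp add: axis_def inner_vec_def sum_3 algebra_simps)

lemma kap_inside: "norm z \<le> e \<Longrightarrow> kap e z = 15 / 2 * (1 - (norm z)\<^sup>2 / e^2) / e^3"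
  using e power_mono[of "norm z" e 2]
  by (auto simp: kap_eq newt_coeff_def newt_coeff'_def power2_norm_eq_inner[symmetric] field_simps power_numeral_reduce)

lemma kap_outside: "e \<le> norm z \<Longrightarrow> kap e z = 0"
proof (cases "norm z = e")
  case True
  then show ?thesis using kap_inside[of z] e by simp
next
  case False
  assume "e \<le> norm z"
  then have "e^2 < (norm z)^2" "norm z > 0" using False e by (auto intro!: power_strict_mono)
  then show ?thesis unfolding kap_eq newt_coeff_def newt_coeff'_def power2_norm_eq_inner[symmetric]
    by (simp add: field_simps power_numeral_reduce)
qed

lemma kap_nonneg: "0 \<le> kap e z"
proof (cases "norm z \<le> e")
  case True
  then have "(norm z)\<^sup>2 / e^2 \<le> 1" using e power_mono[of "norm z" e 2] by simp
  then show ?thesis unfolding kap_inside[OF True] using e by (intro divide_nonneg_pos mult_nonneg_nonneg) auto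
next
  case False then show ?thesis using kap_outside[of z] by simp
qed

lemma continuous_kap: "continuous_on UNIV (kap e)"
  unfolding kap_def[abs_def] by (intro continuous_intros C1_on_continuous_divergence C1_on_newt)

lemma integrable_kap: "integrable lborel (kap e)"
  by (rule integrable_compact_support[OF continuous_kap kap_outside])

lemma newt_outside: "e \<le> norm z \<Longrightarrow> newt e z = (- 1 / (norm z)^3) *\<^sub>R z"
proof -
  assume a: "e \<le> norm z"
  show ?thesis
  proof (cases "norm z = e")
    case True
    then have "z \<bullet> z = e^2" by (simp add: power2_norm_eq_inner[symmetric])
    then show ?thesis using True e by (simp add: newt_def newt_coeff_def)
  next
    case False
    then have "e^2 < (norm z)^2" using a e by (auto intro!: power_strict_mono)
    then show ?thesis by (simp add: newt_def newt_coeff_def power2_norm_eq_inner[symmetric])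
  qed
qed

lemma norm_newt: "e \<le> norm z \<Longrightarrow> norm (newt e z) = 1 / (norm z)^2"
  using e by (simp add: newt_outside field_simps power_numeral_reduce)

text \<open>The constant is 1 from differentiating the factor \<open>z\<close> plus 3 from
  differentiating the coefficient. The rate \<open>1 / norm x ^ 3\<close> of the final decay
  estimate originates here.\<close>

lemma norm_partial_newt:
  assumes "e \<le> norm z" shows "norm (partial h (newt e) z) \<le> 4 * norm h / (norm z)^3"
proof -
  have z: "norm z > 0" using assms e by linarith
  have c: "newt_coeff e (z \<bullet> z) = - 1 / (norm z)^3" "newt_coeff' e (z \<bullet> z) = 3 / 2 / (norm z)^5"
    using power_mono[OF assms, of 2] e assms 
    by (auto simp: newt_coeff_def newt_coeff'_def power2_norm_eq_inner[symmetric])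
  have "norm (partial h (newt e) z) \<le> norm h / (norm z)^3 + 3 / (norm z)^5 * \<bar>z \<bullet> h\<bar> * norm z"
    unfolding partial_newt c by (rule order.trans[OF norm_triangle_ineq]) (simp add: abs_mult)
  also have "\<dots> \<le> norm h / (norm z)^3 + 3 / (norm z)^5 * (norm z * norm h) * norm z"
    using z by (intro add_left_mono mult_right_mono mult_left_mono Cauchy_Schwarz_ineq2) auto
  also have "\<dots> = 4 * norm h / (norm z)^3" using z by (simp add: field_simps power_numeral_reduce)
  finally show ?thesis .
qed

text \<open>A positive bound independent of \<open>e\<close> is enough, so the mass is estimated on
  the cube of side \<open>e / 2\<close>. It lies in the ball of radius \<open>e / 2\<close>, where
  \<open>kap e\<close> is at least 45 / (8 e^3); the volume e^3 / 8 then gives 45 / 64.\<close>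

lemma integral_kap_lower: "45 / 64 \<le> (\<integral>z. kap e z \<partial>lborel)"
proof -
  define Q :: "(real^3) set" where "Q = cbox (\<chi> i. - e / 4) (\<chi> i. e / 4)"
  have "norm z \<le> e / 2" if "z \<in> Q" for z
  proof (rule power2_le_imp_le)
    have b: "(z $ i)\<^sup>2 \<le> (e / 4)\<^sup>2" for i 
    proof -
      have "- e / 4 \<le> z $ i \<and> z $ i \<le> e / 4" using that by (simp add: Q_def mem_box_cart)
      then show ?thesis using e by (intro iffD1[OF abs_le_square_iff]) (auto simp: abs_le_iff)
    qed
    then have "(norm z)\<^sup>2 \<le> 3 * (e / 4)\<^sup>2"
    proof -
      have "(norm z)\<^sup>2 = (z $ 1)\<^sup>2 + (z $ 2)\<^sup>2 + (z $ 3)\<^sup>2"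
        unfolding power2_norm_eq_inner by (simp add: inner_vec_def sum_3 power2_eq_square)
      then show ?thesis using b[of 1] b[of 2] b[of 3] by linarith
    qed
    also have "\<dots> \<le> (e / 2)\<^sup>2" by (simp add: power2_eq_square)
    finally show "(norm z)\<^sup>2 \<le> (e / 2)\<^sup>2" .
  qed (use e in simp)
  note nQ = this
  have "45 / 8 / e^3 \<le> kap e z" if "z \<in> Q" for z
  proof -
    have n: "norm z \<le> e / 2" by (rule nQ[OF that])
    have "(norm z)\<^sup>2 \<le> (e / 2)\<^sup>2" using n by (intro power_mono) auto
    then have "(norm z)\<^sup>2 / e^2 \<le> 1 / 4" using e by (simp add: field_simps)
    then have "15 / 2 * (3 / 4) \<le> 15 / 2 * (1 - (norm z)\<^sup>2 / e^2)" by simp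
    then have "15 / 2 * (3 / 4) / e^3 \<le> 15 / 2 * (1 - (norm z)\<^sup>2 / e^2) / e^3" using e by (intro divide_right_mono) auto
    then show ?thesis using kap_inside[of z] n e by simp
  qed
  then have "(\<integral>z. 45 / 8 / e^3 * indicator Q z \<partial>lborel) \<le> (\<integral>z. kap e z \<partial>lborel)"
    by (intro integral_mono integrable_kap integrable_mult_right[OF integrable_real_indicator[OF _ emeasure_bounded_finite]]) 
      (auto simp: Q_def indicator_def kap_nonneg)
  moreover have "measure lborel Q = (e / 2)^3"
  proof -
    have ne: "cbox (\<chi> i. - e / 4) (\<chi> i. e / 4) \<noteq> ({} :: (real^3) set)"
      using e by (auto simp: interval_ne_empty_cart)
    show ?thesis using content_cbox_cart[OF ne] by (simp add: Q_def power3_eq_cube)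
  qed
  moreover have "(\<integral>z. 45 / 8 / e^3 * indicator Q z \<partial>lborel) = 45 / 8 / e^3 * measure lborel Q" 
    by (simp add: Q_def)
  moreover have "45 / 8 / e^3 * (e / 2)^3 = 45 / 64" using e by (simp add: field_simps)
  ultimately show ?thesis by simp
qed

end

subsection \<open>The Helmholtz identity\<close>

lemma differentiable_nth: "f differentiable F \<Longrightarrow> (\<lambda>x. f x $ i) differentiable F"
  unfolding differentiable_def using bounded_linear.has_derivative[OF bounded_linear_vec_nth] by blast

text \<open>The field on the left is, up to sign, the i-th row of the polarised Maxwell stress
  tensor of \<open>g\<close> and \<open>\<Gamma>\<close>. Its divergence pairs the divergence and
  the curl of either field with the other one, and the term with \<open>curl \<Gamma>\<close> is
  zero.\<close>

lemma helmholtz_pointwise: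
  fixes g \<Gamma> :: "real^3 \<Rightarrow> real^3"
  assumes g: "g differentiable (at x)" and \<Gamma>: "\<Gamma> differentiable (at x)" and c: "curl \<Gamma> x = 0"
  shows "divergence (\<lambda>y. (\<Gamma> y \<bullet> g y) *\<^sub>R axis i 1 - g y $ i *\<^sub>R \<Gamma> y - \<Gamma> y $ i *\<^sub>R g y) x
    = - (divergence g x *\<^sub>R \<Gamma> x + divergence \<Gamma> x *\<^sub>R g x + cross3 (curl g x) (\<Gamma> x)) $ i"
proof -
  have d: "(\<lambda>y. \<Gamma> y \<bullet> g y) differentiable (at x)" "(\<lambda>y. g y $ i) differentiable (at x)" "(\<lambda>y. \<Gamma> y $ i) differentiable (at x)"
    using g \<Gamma> by (auto intro: differentiable_nth)
  have c': "partial (axis 2 1) \<Gamma> x $ 3 = partial (axis 3 1) \<Gamma> x $ 2" "partial (axis 3 1) \<Gamma> x $ 1 = partial (axis 1 1) \<Gamma> x $ 3"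
    "partial (axis 1 1) \<Gamma> x $ 2 = partial (axis 2 1) \<Gamma> x $ 1"
    using c by (auto simp: vec_eq_iff forall_3 curl_nth)
  have "divergence (\<lambda>y. (\<Gamma> y \<bullet> g y) *\<^sub>R axis i 1 - g y $ i *\<^sub>R \<Gamma> y - \<Gamma> y $ i *\<^sub>R g y) x
    = grad (\<lambda>y. \<Gamma> y \<bullet> g y) x $ i - (g x $ i * divergence \<Gamma> x + grad (\<lambda>y. g y $ i) x \<bullet> \<Gamma> x)
      - (\<Gamma> x $ i * divergence g x + grad (\<lambda>y. \<Gamma> y $ i) x \<bullet> g x)"
  proof -
    have "divergence (\<lambda>y. (\<Gamma> y \<bullet> g y) *\<^sub>R axis i 1) x = grad (\<lambda>y. \<Gamma> y \<bullet> g y) x $ i"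
      by (subst divergence_scaleR[OF d(1)]) (auto simp: divergence_def inner_axis)
    moreover have "(\<lambda>y. (\<Gamma> y \<bullet> g y) *\<^sub>R axis i 1 - g y $ i *\<^sub>R \<Gamma> y) differentiable (at x)"
      "(\<lambda>y. (\<Gamma> y \<bullet> g y) *\<^sub>R (axis i 1 :: real^3)) differentiable (at x)" 
      using d g \<Gamma> by (auto intro!: differentiable_diff differentiable_scaleR)
    ultimately show ?thesis
      using d g \<Gamma> by (simp add: divergence_diff divergence_scaleR differentiable_scaleR)
  qed
  also have "\<dots> = - (divergence g x *\<^sub>R \<Gamma> x + divergence \<Gamma> x *\<^sub>R g x + cross3 (curl g x) (\<Gamma> x)) $ i"
  proof -
    have gr: "grad (\<lambda>y. \<Gamma> y \<bullet> g y) x $ i = \<Gamma> x \<bullet> partial (axis i 1) g x + partial (axis i 1) \<Gamma> x \<bullet> g x"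
      by (simp add: grad_def partial_inner[OF \<Gamma> g])
    show ?thesis unfolding gr using exhaust_3[of i] c'
      by (auto simp: grad_def inner_vec_def sum_3 divergence_3 cross3_def curl_nth partial_nth[OF g] partial_nth[OF \<Gamma>] algebra_simps)
  qed
  finally show ?thesis .
qed

lemma helmholtz_compact:
  fixes g \<Gamma> :: "real^3 \<Rightarrow> real^3"
  assumes g: "C1_on UNIV g" and z: "\<And>x. R \<le> norm x \<Longrightarrow> g x = 0" and \<Gamma>: "C1_on UNIV \<Gamma>" and c: "\<And>x. curl \<Gamma> x = 0"
  shows "(\<integral>y. divergence g y *\<^sub>R \<Gamma> y + divergence \<Gamma> y *\<^sub>R g y + cross3 (curl g y) (\<Gamma> y) \<partial>lborel) = 0"
proof -
  let ?T = "\<lambda>i y. (\<Gamma> y \<bullet> g y) *\<^sub>R axis i 1 - g y $ i *\<^sub>R \<Gamma> y - \<Gamma> y $ i *\<^sub>R g y"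
  let ?I = "\<lambda>y. divergence g y *\<^sub>R \<Gamma> y + divergence \<Gamma> y *\<^sub>R g y + cross3 (curl g y) (\<Gamma> y)"
  have T: "C1_on UNIV (?T i)" for i :: 3
    by (intro C1_on_diff C1_on_scaleR C1_on_inner C1_on_nth g \<Gamma> C1_on_const)
  have eq: "divergence (?T i) y = - (?I y $ i)" for i y
    using helmholtz_pointwise[of g y \<Gamma> i] g \<Gamma> c by (auto simp: C1_on_def)
  have cont: "continuous_on UNIV ?I"
    by (intro continuous_intros continuous_on_cross C1_on_continuous C1_on_continuous_divergence C1_on_continuous_curl g \<Gamma>)
  have dz: "divergence g y = 0" "curl g y = 0" if "R + 1 \<le> norm y" for y
  proof -
    have "partial h g y = 0" for h by (rule partial_zero_outside[of R g y, OF z]) (use that in auto)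
    then show "divergence g y = 0" "curl g y = 0" by (simp_all add: divergence_3 vec_eq_iff forall_3 curl_nth)
  qed
  have int: "integrable lborel ?I"
    by (rule integrable_compact_support[where R="R+1", OF cont]) (simp add: dz z)
  have "(\<integral>y. ?I y \<partial>lborel) $ i = 0" for i
  proof -
    have "(\<integral>y. ?I y \<partial>lborel) $ i = (\<integral>y. ?I y $ i \<partial>lborel)"
      using integral_bounded_linear[OF bounded_linear_vec_nth[of i] int] by simp
    also have "\<dots> = - (\<integral>y. divergence (?T i) y \<partial>lborel)"
      by (simp only: eq Bochner_Integration.integral_minus minus_minus)
    also have "\<dots> = 0" using integral_divergence_zero[OF T, of R] z by simp
    finally show ?thesis .
  qed
  then show ?thesis by (simp add: vec_eq_iff)
qed

lemma grad_bump_0: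
  fixes a :: "real^3"
  assumes rs: "0 \<le> r" "r < s" and "norm (y - a) \<le> r \<or> s \<le> norm (y - a)"
  shows "grad (bump a r s) y = 0"
proof -
  have "((norm (y - a))\<^sup>2 - r^2) / (s^2 - r^2) \<le> 0 \<or> 1 \<le> ((norm (y - a))\<^sup>2 - r^2) / (s^2 - r^2)"
    using assms(3)
  proof
    assume "norm (y - a) \<le> r"
    then show ?thesis using bump_pos[OF rs] by (intro disjI1 divide_nonpos_pos) (auto intro!: power_mono)
  next
    assume "s \<le> norm (y - a)"
    then show ?thesis using bump_pos[OF rs] rs by (intro disjI2) (auto simp: le_divide_eq_1 intro!: power_mono)
  qed
  then have "sstep' (quad a (1 / (s^2 - r^2)) (-(r^2) / (s^2 - r^2)) y) = 0"
    unfolding bump_arg[OF rs] by (auto simp: sstep'_def)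
  then show ?thesis by (simp add: grad_bump[OF rs])
qed

text \<open>Taking the translated kernel for \<open>\<Gamma>\<close> makes
  \<open>divergence \<Gamma>\<close> the weight \<open>kap e (x - y)\<close>. Since \<open>g\<close>
  merely tends to zero, it is multiplied by a cutoff between radii \<open>R\<close> and
  \<open>2 * R\<close>; the error lives on that shell and is at most a fixed constant times the
  supremum of \<open>g\<close> there.\<close>

theorem helmholtz:
  fixes g :: "real^3 \<Rightarrow> real^3"
  assumes e: "0 < e" and g: "C1_on UNIV g" and lim: "(g \<longlongrightarrow> 0) at_infinity"
    and dz: "\<And>x. R0 \<le> norm x \<Longrightarrow> divergence g x = 0 \<and> curl g x = 0"
  shows "(\<integral>y. kap e (x - y) *\<^sub>R g y \<partial>lborel) 
     = - (\<integral>y. divergence g y *\<^sub>R newt e (x - y) + cross3 (curl g y) (newt e (x - y)) \<partial>lborel)"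
proof -
  define \<Gamma> where "\<Gamma> y = newt e (x - y)" for y
  have nd: "newt e differentiable (at z)" for z using C1_on_newt[OF e] by (simp add: C1_on_def)
  have xd: "((\<lambda>y. x - y) has_derivative (\<lambda>h. - h)) (at y)" for y by (auto intro!: derivative_eq_intros)
  have \<Gamma>: "C1_on UNIV \<Gamma>" unfolding \<Gamma>_def[abs_def]
    by (rule C1_on_compose[OF C1_on_diff[OF C1_on_const C1_on_id] C1_on_newt[OF e] subset_UNIV])
  have p\<Gamma>: "partial h \<Gamma> y = - partial h (newt e) (x - y)" for h y
    unfolding \<Gamma>_def[abs_def] 
    by (rule partial_eq[OF has_derivative_compose[OF xd has_derivative_partial[OF nd]], THEN trans]) 
      (simp add: linear_neg[OF linear_partial[OF nd]])
  have d\<Gamma>: "divergence \<Gamma> y = kap e (x - y)" for y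
    by (simp add: kap_def divergence_3 p\<Gamma>)
  have c\<Gamma>: "curl \<Gamma> y = 0" for y
    using curl_newt[OF e, of "x - y"] by (simp add: vec_eq_iff forall_3 curl_nth p\<Gamma>)
  have cont: "continuous_on UNIV \<Gamma>" "continuous_on UNIV (divergence \<Gamma>)" "continuous_on UNIV g" 
    "continuous_on UNIV (divergence g)" "continuous_on UNIV (curl g)"
    by (auto intro!: C1_on_continuous C1_on_continuous_divergence C1_on_continuous_curl g \<Gamma>)
  let ?I1 = "\<lambda>y. divergence \<Gamma> y *\<^sub>R g y"
  let ?I2 = "\<lambda>y. divergence g y *\<^sub>R \<Gamma> y + cross3 (curl g y) (\<Gamma> y)"
  have i1: "integrable lborel ?I1"
  proof (rule integrable_compact_support[where R="norm x + e"])
    show "continuous_on UNIV ?I1" by (intro continuous_intros cont)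
    show "?I1 y = 0" if "norm x + e \<le> norm y" for y
      using kap_outside[OF e, of "x - y"] norm_triangle_ineq2[of y x] that by (simp add: d\<Gamma> norm_minus_commute)
  qed
  have i2: "integrable lborel ?I2"
  proof (rule integrable_compact_support[where R="R0"])
    show "continuous_on UNIV ?I2" by (intro continuous_intros continuous_on_cross cont)
  qed (use dz in auto)
  define S where "S = (\<integral>y. ?I1 y \<partial>lborel) + (\<integral>y. ?I2 y \<partial>lborel)"
  have bound: "norm S \<le> 20480 * \<eta>" if \<eta>: "\<eta> > 0" for \<eta>
  proof -
    obtain B where B: "\<And>y. B \<le> norm y \<Longrightarrow> norm (g y) \<le> \<eta>"
      using lim \<eta> unfolding Lim_at_infinity dist_norm by (auto) (meson less_imp_le)
    \<comment> \<open>The bound by \<open>2 * norm x + 2 * e\<close> gives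
      \<open>norm (x - y) \<ge> R / 2 \<ge> e\<close> for \<open>y\<close> on the shell, so the
      exact Newton kernel applies there; \<open>B\<close> makes \<open>g\<close> small and
      \<open>R0\<close> makes it free of divergence and curl.\<close>
    define R where "R = max (max B R0) (max 1 (2 * norm x + 2 * e))"
    have R: "B \<le> R" "R0 \<le> R" "0 < R" "2 * norm x + 2 * e \<le> R" by (auto simp: R_def)
    let ?\<zeta> = "bump (0::real^3) R (2 * R)"
    have \<zeta>: "C1_on UNIV ?\<zeta>" by (rule conjunct1[OF C_on_2[THEN iffD1, OF C2_bump]]) (use R in auto)
    have dif: "?\<zeta> differentiable (at y)" "g differentiable (at y)" for y using \<zeta> g by (auto simp: C1_on_def)
    have z0: "?\<zeta> y = 0" if "2 * R \<le> norm y" for y using bump_0[of R "2*R" y "0::real^3"] R that by simp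
    have z1: "?\<zeta> y = 1" if "norm y \<le> R" for y using bump_1[of R "2*R" y "0::real^3"] R that by simp
    have gz: "grad ?\<zeta> y = 0" if "norm y \<le> R \<or> 2 * R \<le> norm y" for y
      using grad_bump_0[of R "2*R" y 0] R that by simp
    let ?h = "\<lambda>y. ?\<zeta> y *\<^sub>R g y"
    have h: "C1_on UNIV ?h" by (rule C1_on_scaleR[OF \<zeta> g])
    let ?E = "\<lambda>y. (grad ?\<zeta> y \<bullet> g y) *\<^sub>R \<Gamma> y + cross3 (cross3 (grad ?\<zeta> y) (g y)) (\<Gamma> y)"
    have dh: "divergence ?h y = divergence g y + grad ?\<zeta> y \<bullet> g y" for y
      using divergence_scaleR[OF dif] dz[of y] z1[of y] R(2) by (cases "norm y \<le> R") auto
    have ch: "curl ?h y = curl g y + cross3 (grad ?\<zeta> y) (g y)" for y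
      using curl_scaleR[OF dif] dz[of y] z1[of y] R(2) by (cases "norm y \<le> R") auto
    have kh: "divergence \<Gamma> y *\<^sub>R ?h y = divergence \<Gamma> y *\<^sub>R g y" for y
    proof (cases "norm y \<le> R")
      case False
      then have "e \<le> norm (x - y)" using R e norm_triangle_ineq2[of y x] by (simp add: norm_minus_commute)
      then show ?thesis by (simp add: d\<Gamma> kap_outside[OF e])
    qed (simp add: z1)
    have gc: "continuous_on UNIV (grad ?\<zeta>)"
      by (rule C1_on_continuous[OF C1_on_grad[OF conjunct2[OF C_on_2[THEN iffD1, OF C2_bump], rule_format]]]) (use R in auto)
    have ei: "integrable lborel ?E"
      by (rule integrable_compact_support[where R="2 * R"]) (auto intro!: continuous_intros continuous_on_cross gc cont simp: gz)
    have "0 = (\<integral>y. divergence ?h y *\<^sub>R \<Gamma> y + divergence \<Gamma> y *\<^sub>R ?h y + cross3 (curl ?h y) (\<Gamma> y) \<partial>lborel)"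
      by (rule helmholtz_compact[where R="2 * R", OF h _ \<Gamma> c\<Gamma>, symmetric]) (simp add: z0)
    also have "\<dots> = (\<integral>y. (?I1 y + ?I2 y) + ?E y \<partial>lborel)"
      unfolding dh ch kh by (intro Bochner_Integration.integral_cong refl) (simp add: algebra_simps cross_add_left)
    also have "\<dots> = S + (\<integral>y. ?E y \<partial>lborel)"
      using i1 i2 ei by (simp add: S_def)
    finally have "S = - (\<integral>y. ?E y \<partial>lborel)" by (simp add: eq_neg_iff_add_eq_0)
    then have S: "norm S = norm (\<integral>y. ?E y \<partial>lborel)" by simp
    let ?Q = "cbox (\<chi> i. - 2 * R) (\<chi> i. 2 * R) :: (real^3) set"
    have eb: "norm (?E y) \<le> 320 * \<eta> / R^3 * indicator ?Q y" for y
    proof (cases "norm y \<le> R \<or> 2 * R \<le> norm y")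
      case True
      then show ?thesis using \<eta> R by (simp add: gz)
    next
      case False
      have "\<bar>y $ i\<bar> \<le> 2 * R" for i using component_le_norm_cart[of y i] False by linarith
      then have "y \<in> ?Q" by (auto simp: mem_box_cart abs_le_iff minus_le_iff)
      have R2: "R / 2 \<le> norm (x - y)" using False R e norm_triangle_ineq2[of y x] by (simp add: norm_minus_commute)
      have "e \<le> norm (x - y)" using R R2 norm_ge_zero[of x] by linarith
      then have "norm (\<Gamma> y) = 1 / (norm (x - y))^2" unfolding \<Gamma>_def by (rule norm_newt[OF e])
      also have "\<dots> \<le> 1 / (R / 2)^2"
        by (rule divide_left_mono[OF power_mono[OF R2]]) (use R R2 e in \<open>auto intro!: mult_pos_pos\<close>)
      finally have "norm (\<Gamma> y) \<le> 1 / (R / 2)^2" .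
      then have n\<Gamma>: "norm (\<Gamma> y) \<le> 4 / R^2" by (simp add: power_divide)
      have ng: "norm (g y) \<le> \<eta>" using B[of y] False R by simp
      have nz: "norm (grad ?\<zeta> y) \<le> 40 / R" by (rule grad_bump_bound[OF R(3)])
      have nc: "norm (cross3 a b) \<le> norm a * norm b" for a b
      proof (rule power2_le_imp_le)
        show "(norm (cross3 a b))\<^sup>2 \<le> (norm a * norm b)\<^sup>2"
          using norm_cross_dot[of a b] zero_le_power2[of "a \<bullet> b"] by linarith
      qed simp
      have "norm (?E y) \<le> \<bar>grad ?\<zeta> y \<bullet> g y\<bar> * norm (\<Gamma> y) + norm (cross3 (grad ?\<zeta> y) (g y)) * norm (\<Gamma> y)"
        by (rule order.trans[OF norm_triangle_ineq]) (intro add_mono nc, simp)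
      also have "\<dots> \<le> (norm (grad ?\<zeta> y) * norm (g y)) * norm (\<Gamma> y) + (norm (grad ?\<zeta> y) * norm (g y)) * norm (\<Gamma> y)"
        by (intro add_mono mult_right_mono nc Cauchy_Schwarz_ineq2) auto
      also have "\<dots> \<le> (40 / R * \<eta>) * (4 / R^2) + (40 / R * \<eta>) * (4 / R^2)"
        using R \<eta> by (intro add_mono mult_mono n\<Gamma> ng nz) auto
      also have "\<dots> = 320 * \<eta> / R^3" by (simp add: field_simps power_numeral_reduce)
      finally show ?thesis using \<open>y \<in> ?Q\<close> by simp
    qed
    have mQ: "measure lborel ?Q = (4 * R)^3"
    proof -
      have ne: "?Q \<noteq> {}" using R by (auto simp: interval_ne_empty_cart)
      show ?thesis using content_cbox_cart[OF ne] by (simp add: power3_eq_cube)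
    qed
    \<comment> \<open>The shell is enclosed in a cube of volume 64 R^3, and 320 times 64 is 20480:
      the powers of \<open>R\<close> cancel.\<close>
    have "norm (\<integral>y. ?E y \<partial>lborel) \<le> (\<integral>y. 320 * \<eta> / R^3 * indicator ?Q y \<partial>lborel)"
      by (rule Bochner_Integration.integral_norm_bound_integral[OF ei integrable_mult_right[OF integrable_real_indicator[OF _ emeasure_bounded_finite]]])
        (rule eb | simp)+
    also have "\<dots> = 320 * \<eta> / R^3 * (4 * R)^3" unfolding mQ[symmetric] by simp
    also have "\<dots> = 20480 * \<eta>" using R by (simp add: field_simps)
    finally show ?thesis using S by simp
  qed
  have "S = 0"
  proof (rule ccontr)
    assume "S \<noteq> 0"
    then show False using bound[of "norm S / 40960"] by simp
  qed
  then show ?thesis by (simp add: S_def d\<Gamma> \<Gamma>_def eq_neg_iff_add_eq_0)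
qed


subsection \<open>Potentials of curl-free fields\<close>

text \<open>Continuity of the derivative is assumed for each fixed direction only; in finite
  dimension this already gives continuity as a map into bounded linear functions, as differentiation
  under the integral requires.\<close>

lemma leibniz_interval:
  fixes f :: "'a::euclidean_space \<Rightarrow> real \<Rightarrow> 'c::euclidean_space"
  assumes U: "open U" "convex U" "x0 \<in> U"
    and d: "\<And>x t. x \<in> U \<Longrightarrow> t \<in> {0..1} \<Longrightarrow> ((\<lambda>x. f x t) has_derivative f' x t) (at x)"
    and c: "\<And>h. continuous_on (U \<times> {0..1}) (\<lambda>(x,t). f' x t h)"
    and i: "\<And>x. x \<in> U \<Longrightarrow> continuous_on {0..1} (f x)"
  shows "((\<lambda>x. integral {0..1} (f x)) has_derivative (\<lambda>h. integral {0..1} (\<lambda>t. f' x0 t h))) (at x0)"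
proof -
  define F where "F x t = Blinfun (f' x t)" for x t
  have F: "blinfun_apply (F x t) = f' x t" if "x \<in> U" "t \<in> {0..1}" for x t
    unfolding F_def by (rule bounded_linear_Blinfun_apply[OF has_derivative_bounded_linear[OF d[OF that]]])
  have cF: "continuous_on (U \<times> {0..1}) (\<lambda>(x,t). F x t)"
  proof (rule continuous_on_blinfun_componentwise)
    fix h :: 'a
    show "continuous_on (U \<times> {0..1}) (\<lambda>z. blinfun_apply (case z of (x, t) \<Rightarrow> F x t) h)"
      by (rule continuous_on_cong[THEN iffD1, OF refl _ c[of h]]) (auto simp: F)
  qed
  have *: "((\<lambda>x. integral (cbox 0 1) (f x)) has_derivative integral (cbox 0 1) (F x0)) (at x0 within U)"
  proof (rule leibniz_rule)
    show "((\<lambda>x. f x t) has_derivative blinfun_apply (F x t)) (at x within U)" if "x \<in> U" "t \<in> cbox 0 1" for x t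
      using d[of x t] F[of x t] that by (auto intro: has_derivative_at_withinI)
    show "f x integrable_on cbox 0 1" if "x \<in> U" for x
      using i[OF that] by (simp add: integrable_continuous_real)
  qed (use cF U in \<open>auto simp: case_prod_beta\<close>)
  have ci: "continuous_on {0..1} (F x0)"
    using continuous_on_compose2[OF cF, of "{0..1}" "\<lambda>t. (x0, t)"] U(3)
    by (force intro: continuous_intros)
  have "blinfun_apply (integral (cbox 0 1) (F x0)) h = integral {0..1} (\<lambda>t. f' x0 t h)" for h
  proof -
    have "blinfun_apply (integral (cbox 0 1) (F x0)) h = integral (cbox 0 1) (\<lambda>t. blinfun_apply (F x0 t) h)"
      using integral_linear[of "F x0" "cbox 0 1" "\<lambda>b. blinfun_apply b h"] ci
      by (simp add: integrable_continuous_real blinfun.bounded_linear_left o_def)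
    also have "\<dots> = integral {0..1} (\<lambda>t. f' x0 t h)"
      unfolding cbox_interval by (rule Henstock_Kurzweil_Integration.integral_cong) (use F U in auto)
    finally show ?thesis .
  qed
  then have "blinfun_apply (integral (cbox 0 1) (F x0)) = (\<lambda>h. integral {0..1} (\<lambda>t. f' x0 t h))" by blast
  then show ?thesis using * at_within_open[OF U(3,1)] by simp
qed

text \<open>The derivative is a full one at every point of \<open>U\<close> even if \<open>U\<close>
  is not open, so the notion passes to arbitrary subsets, in particular to the closed exterior of a
  ball.\<close>

definition is_pot :: "'a::euclidean_space set \<Rightarrow> ('a \<Rightarrow> 'a) \<Rightarrow> ('a \<Rightarrow> real) \<Rightarrow> bool"
  where "is_pot U V \<psi> \<longleftrightarrow> (\<forall>x\<in>U. (\<psi> has_derivative (\<lambda>h. V x \<bullet> h)) (at x))"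

definition seg :: "('a::euclidean_space \<Rightarrow> 'a) \<Rightarrow> 'a \<Rightarrow> 'a \<Rightarrow> real"
  where "seg V a b = integral {0..1} (\<lambda>t. V (a + t *\<^sub>R (b - a)) \<bullet> (b - a))"

lemma is_pot_subset: "is_pot U V \<psi> \<Longrightarrow> U' \<subseteq> U \<Longrightarrow> is_pot U' V \<psi>"
  by (auto simp: is_pot_def)

lemma is_pot_C1: "is_pot U V \<psi> \<Longrightarrow> continuous_on U V \<Longrightarrow> C1_on U \<psi>"
  by (rule C1_onI[where f'="\<lambda>x h. V x \<bullet> h"]) (auto simp: is_pot_def intro: continuous_intros)

lemma is_pot_partial: "is_pot U V \<psi> \<Longrightarrow> x \<in> U \<Longrightarrow> partial h \<psi> x = V x \<bullet> h"
  by (rule partial_eq) (auto simp: is_pot_def)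

lemma is_pot_diff_const:
  assumes "is_pot U V \<psi>" "is_pot U V \<psi>'" "open U" "connected U" "x \<in> U" "y \<in> U"
  shows "\<psi> x - \<psi>' x = \<psi> y - \<psi>' y"
proof (rule has_derivative_zero_unique_connected[where f="\<lambda>x. \<psi> x - \<psi>' x" and s=U])
  show "((\<lambda>x. \<psi> x - \<psi>' x) has_derivative (\<lambda>h. 0)) (at z)" if "z \<in> U" for z
    using has_derivative_diff[of \<psi> "\<lambda>h. V z \<bullet> h" "at z" \<psi>' "\<lambda>h. V z \<bullet> h"] assms(1,2) that by (simp add: is_pot_def)
qed (use assms in auto)

lemma seg_point: "t \<in> {0..1} \<Longrightarrow> a + t *\<^sub>R (b - a) \<in> closed_segment a b"
  unfolding in_segment by (rule exI[of _ t]) (auto simp: algebra_simps)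

lemma seg_pot:
  assumes "is_pot U V \<psi>" "closed_segment a b \<subseteq> U"
  shows "seg V a b = \<psi> b - \<psi> a"
proof -
  have "((\<lambda>t. V (a + t *\<^sub>R (b - a)) \<bullet> (b - a)) has_integral \<psi> (a + 1 *\<^sub>R (b - a)) - \<psi> (a + 0 *\<^sub>R (b - a))) {0..1}"
  proof (rule fundamental_theorem_of_calculus)
    fix t :: real assume t: "t \<in> {0..1}"
    have inU: "a + t *\<^sub>R (b - a) \<in> U" using seg_point[OF t] assms(2) by blast
    then have "\<psi> differentiable (at (a + t *\<^sub>R (b - a)))" using assms(1) by (auto simp: is_pot_def differentiable_def)
    from partial_line[OF this] is_pot_partial[OF assms(1) inU]
    show "((\<lambda>t. \<psi> (a + t *\<^sub>R (b - a))) has_vector_derivative V (a + t *\<^sub>R (b - a)) \<bullet> (b - a)) (at t within {0..1})"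
      by (simp add: has_vector_derivative_at_within)
  qed simp
  then show ?thesis unfolding seg_def by (simp add: integral_unique)
qed

lemma seg_self [simp]: "seg V a a = 0"
  by (simp add: seg_def)

lemma seg_triangle:
  assumes "is_pot U V \<psi>" "convex U" "a \<in> U" "b \<in> U" "c \<in> U"
  shows "seg V a c = seg V a b + seg V b c"
  using seg_pot[OF assms(1)] closed_segment_subset[OF _ _ assms(2)] assms(3-5) by simp

text \<open>Curl-freeness enters the topological arguments only in this form, which mentions no
  derivative of \<open>V\<close> and makes the line integral around a small closed polygon
  vanish.\<close>

definition locally_pot :: "'a::euclidean_space set \<Rightarrow> ('a \<Rightarrow> 'a) \<Rightarrow> bool"
  where "locally_pot S V \<longleftrightarrow> (\<forall>x\<in>S. \<exists>r>0. ball x r \<subseteq> S \<and> (\<exists>\<psi>. is_pot (ball x r) V \<psi>))"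

text \<open>The Poincare lemma: the potential is the line integral from a fixed point
  \<open>a\<close>, differentiated under the integral sign.\<close>

lemma pot_convex:
  fixes V :: "real^3 \<Rightarrow> real^3"
  assumes U: "open U" "convex U" and V: "C1_on U V" and c: "\<And>x. x \<in> U \<Longrightarrow> curl V x = 0"
  shows "\<exists>\<psi>. is_pot U V \<psi>"
proof (cases "U = {}")
  case False
  then obtain a where a: "a \<in> U" by blast
  have inU: "a + t *\<^sub>R (x - a) \<in> U" if "x \<in> U" "t \<in> {0..1}" for x t
    using convexD_alt[OF U(2) a that(1), of t] that(2) by (simp add: algebra_simps)
  have "is_pot U V (seg V a)" unfolding is_pot_def
  proof
    fix x assume x: "x \<in> U"
    let ?f' = "\<lambda>x t h. partial (t *\<^sub>R h) V (a + t *\<^sub>R (x - a)) \<bullet> (x - a) + V (a + t *\<^sub>R (x - a)) \<bullet> h"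
    have "((\<lambda>x. integral {0..1} (\<lambda>t. V (a + t *\<^sub>R (x - a)) \<bullet> (x - a))) has_derivative
       (\<lambda>h. integral {0..1} (\<lambda>t. ?f' x t h))) (at x)"
    proof (rule leibniz_interval[OF U x])
      fix y and t :: real assume y: "y \<in> U" and t: "t \<in> {0..1}"
      have "((\<lambda>y. a + t *\<^sub>R (y - a)) has_derivative (\<lambda>h. t *\<^sub>R h)) (at y)" by (auto intro!: derivative_eq_intros)
      from has_derivative_compose[OF this C1_on_has_derivative[OF V inU[OF y t]]]
      have "((\<lambda>y. V (a + t *\<^sub>R (y - a))) has_derivative (\<lambda>h. partial (t *\<^sub>R h) V (a + t *\<^sub>R (y - a)))) (at y)" .
      from has_derivative_inner[OF this has_derivative_diff[OF has_derivative_ident has_derivative_const]]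
      show "((\<lambda>x. V (a + t *\<^sub>R (x - a)) \<bullet> (x - a)) has_derivative ?f' y t) (at y)"
        by (simp add: add.commute)
    next
      fix h
      have s: "partial (t *\<^sub>R h) V (a + t *\<^sub>R (x - a)) = t *\<^sub>R partial h V (a + t *\<^sub>R (x - a))" if "x \<in> U" "t \<in> {0..1}" for x t
        by (rule linear_cmul[OF linear_partial[OF C1_on_differentiable[OF V inU[OF that]]]])
      have m: "continuous_on (U \<times> {0..1}) (\<lambda>z. a + snd z *\<^sub>R (fst z - a))" by (intro continuous_intros)
      have "continuous_on (U \<times> {0..1}) (\<lambda>z. (snd z *\<^sub>R partial h V (a + snd z *\<^sub>R (fst z - a))) \<bullet> (fst z - a) + V (a + snd z *\<^sub>R (fst z - a)) \<bullet> h)"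
        by (intro continuous_intros continuous_on_compose2[OF C1_on_continuous_partial[OF V] m] continuous_on_compose2[OF C1_on_continuous[OF V] m])
          (auto intro!: inU)
      then show "continuous_on (U \<times> {0..1}) (\<lambda>(x,t). ?f' x t h)"
        by (rule continuous_on_cong[THEN iffD1, OF refl, rotated]) (auto simp: s)
    next
      fix y assume y: "y \<in> U"
      show "continuous_on {0..1} (\<lambda>t. V (a + t *\<^sub>R (y - a)) \<bullet> (y - a))"
        by (intro continuous_intros continuous_on_compose2[OF C1_on_continuous[OF V]]) (auto intro!: inU y)
    qed
    moreover have "integral {0..1} (\<lambda>t. ?f' x t h) = V x \<bullet> h" for h
    proof -
      \<comment> \<open>Symmetry of the derivative of \<open>V\<close> makes the integrand the
        \<open>t\<close>-derivative of \<open>t\<close> times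
        \<open>V (a + t *\<^sub>R (x - a)) \<bullet> h\<close>, so only the endpoint
        \<open>t = 1\<close> survives.\<close>
      have "((\<lambda>t. ?f' x t h) has_integral 1 *\<^sub>R (V (a + 1 *\<^sub>R (x - a)) \<bullet> h) - 0 *\<^sub>R (V (a + 0 *\<^sub>R (x - a)) \<bullet> h)) {0..1}"
      proof (rule fundamental_theorem_of_calculus)
        fix t :: real assume t: "t \<in> {0..1}"
        let ?p = "a + t *\<^sub>R (x - a)"
        have d: "V differentiable (at ?p)" by (rule C1_on_differentiable[OF V inU[OF x t]])
        have sym: "partial (x - a) V ?p \<bullet> h = partial h V ?p \<bullet> (x - a)"
          using partial_curl_cross[OF d, of "x - a" h] c[OF inU[OF x t]] by simp
        have "((\<lambda>t. t *\<^sub>R (V (a + t *\<^sub>R (x - a)) \<bullet> h)) has_vector_derivative 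
           t *\<^sub>R (partial (x - a) V ?p \<bullet> h) + 1 *\<^sub>R (V ?p \<bullet> h)) (at t)"
        proof (rule has_vector_derivative_scaleR)
          show "((\<lambda>t. V (a + t *\<^sub>R (x - a)) \<bullet> h) has_vector_derivative partial (x - a) V ?p \<bullet> h) (at t)"
            using bounded_linear.has_vector_derivative[OF bounded_linear_inner_left partial_line[OF d]] .
        qed (auto intro!: derivative_eq_intros)
        then show "((\<lambda>t. t *\<^sub>R (V (a + t *\<^sub>R (x - a)) \<bullet> h)) has_vector_derivative ?f' x t h) (at t within {0..1})"
          by (simp add: sym linear_cmul[OF linear_partial[OF d]] has_vector_derivative_at_within)
      qed simp
      then show ?thesis by (simp add: integral_unique)
    qed
    ultimately show "(seg V a has_derivative (\<lambda>h. V x \<bullet> h)) (at x)"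
      by (simp add: seg_def[abs_def])
  qed
  then show ?thesis by blast
qed (auto simp: is_pot_def)

lemma locally_pot_curl_free:
  fixes V :: "real^3 \<Rightarrow> real^3"
  assumes "open S" "C1_on S V" "\<And>x. x \<in> S \<Longrightarrow> curl V x = 0"
  shows "locally_pot S V"
  unfolding locally_pot_def
proof
  fix x assume "x \<in> S"
  then obtain r where "r > 0" "ball x r \<subseteq> S" using assms(1) open_contains_ball by blast
  moreover from this have "\<exists>\<psi>. is_pot (ball x r) V \<psi>"
    by (intro pot_convex C1_on_subset[OF assms(2)]) (use assms in auto)
  ultimately show "\<exists>r>0. ball x r \<subseteq> S \<and> (\<exists>\<psi>. is_pot (ball x r) V \<psi>)" by blast
qed

lemma locally_pot_Lebesgue:
  assumes "locally_pot S V" "compact K" "K \<subseteq> S"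
  obtains \<rho> where "\<rho> > 0" "\<And>x. x \<in> K \<Longrightarrow> ball x \<rho> \<subseteq> S \<and> (\<exists>\<psi>. is_pot (ball x \<rho>) V \<psi>)"
proof -
  define G where "G = {ball x r | x r. ball x r \<subseteq> S \<and> (\<exists>\<psi>. is_pot (ball x r) V \<psi>)}"
  have "K \<subseteq> \<Union>G"
  proof
    fix x assume "x \<in> K"
    then obtain r where "r > 0" "ball x r \<in> G" using assms(1,3) unfolding locally_pot_def G_def by blast
    then show "x \<in> \<Union>G" by (meson UnionI centre_in_ball)
  qed
  moreover have "\<And>B. B \<in> G \<Longrightarrow> open B" by (auto simp: G_def)
  ultimately obtain e where e: "e > 0" "\<And>x. x \<in> K \<Longrightarrow> \<exists>B\<in>G. ball x e \<subseteq> B"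
    using Heine_Borel_lemma[OF assms(2), of G] by metis
  show ?thesis
  proof (rule that[OF e(1)])
    fix x assume "x \<in> K"
    then obtain B where "B \<in> G" "ball x e \<subseteq> B" using e by blast
    then show "ball x e \<subseteq> S \<and> (\<exists>\<psi>. is_pot (ball x e) V \<psi>)"
      unfolding G_def by (blast intro: is_pot_subset)
  qed
qed


subsection \<open>Simply connected sets\<close>

text \<open>The multivalued potential of \<open>V\<close> lifted along \<open>h\<close>; the uniform \<open>\<delta>\<close> stands in for path lifting in
  a covering space.\<close>

definition lift_pot :: "('a::euclidean_space \<Rightarrow> 'a) \<Rightarrow> ('q::metric_space \<Rightarrow> 'a) \<Rightarrow> 'q set \<Rightarrow> ('q \<Rightarrow> real) \<Rightarrow> bool"
  where "lift_pot V h Q \<theta> \<longleftrightarrow> (\<exists>\<delta>>0. \<forall>q\<in>Q. \<forall>q'\<in>Q. dist q q' < \<delta> \<longrightarrow> \<theta> q' - \<theta> q = seg V (h q) (h q'))"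

text \<open>\<open>Q\<close> is starlike about the origin, so \<open>q\<close> is joined to 0 by a
  ray; the image of the ray under \<open>h\<close> is cut into \<open>N\<close> short pieces, and
  \<open>\<theta> q\<close> sums the line integrals over the chords. Comparing the rays to
  \<open>q\<close> and \<open>q'\<close>, every small quadrilateral between them contributes zero
  and the sum telescopes to its outermost side.\<close>

lemma lift_pot_exists:
  fixes h :: "'q::euclidean_space \<Rightarrow> 'a::euclidean_space"
  assumes S: "locally_pot S V"
    and Q: "compact Q" "\<And>q t. q \<in> Q \<Longrightarrow> 0 \<le> t \<Longrightarrow> t \<le> 1 \<Longrightarrow> t *\<^sub>R q \<in> Q"
    and h: "continuous_on Q h" "h ` Q \<subseteq> S"
  shows "\<exists>\<theta>. lift_pot V h Q \<theta>"
proof -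
  obtain \<rho> where \<rho>: "\<rho> > 0" "\<And>x. x \<in> h ` Q \<Longrightarrow> ball x \<rho> \<subseteq> S \<and> (\<exists>\<psi>. is_pot (ball x \<rho>) V \<psi>)"
    using locally_pot_Lebesgue[OF S compact_continuous_image[OF h(1) Q(1)] h(2)] by blast
  have "uniformly_continuous_on Q h" using h(1) Q(1) compact_uniformly_continuous by blast
  then obtain \<delta> where \<delta>: "\<delta> > 0" "\<And>p q. p \<in> Q \<Longrightarrow> q \<in> Q \<Longrightarrow> dist p q < \<delta> \<Longrightarrow> dist (h p) (h q) < \<rho>"
    unfolding uniformly_continuous_on_def using \<rho>(1) by (metis dist_commute)
  obtain M where M: "\<And>q. q \<in> Q \<Longrightarrow> norm q \<le> M" using compact_imp_bounded[OF Q(1)] bounded_iff by blast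
  \<comment> \<open>With \<open>N\<close> above \<open>2 * M / \<delta>\<close> neighbouring points
    on a ray are less than \<open>\<delta> / 2\<close> apart, so the diagonals of the quadrilaterals
    below stay under \<open>\<delta>\<close>.\<close>
  obtain N :: nat where N: "2 * M / \<delta> < real N" "0 < N"
    using reals_Archimedean2[of "max 0 (2 * M / \<delta>)"] by auto
  have step: "norm q / real N < \<delta> / 2" if "q \<in> Q" for q
  proof -
    have "2 * M < real N * \<delta>" using N \<delta> by (simp add: field_simps)
    then show ?thesis using M[OF that] N by (simp add: field_simps)
  qed
  let ?p = "\<lambda>i q. (real i / real N) *\<^sub>R q"
  have pQ: "?p i q \<in> Q" if "q \<in> Q" "i \<le> N" for i q
    using that N by (intro Q(2)) auto
  define \<theta> where "\<theta> q = (\<Sum>i<N. seg V (h (?p i q)) (h (?p (Suc i) q)))" for q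
  have "\<theta> q' - \<theta> q = seg V (h q) (h q')" if q: "q \<in> Q" "q' \<in> Q" and d: "dist q q' < \<delta> / 2" for q q'
  proof -
    have d1: "dist (?p i q) (?p i q') < \<delta> / 2" if "i \<le> N" for i
    proof -
      have "dist (?p i q) (?p i q') = real i / real N * dist q q'"
        by (simp add: dist_norm scaleR_diff_right[symmetric] del: scaleR_diff_right)
      also have "\<dots> \<le> 1 * dist q q'" using that N by (intro mult_right_mono) auto
      finally show ?thesis using d by simp
    qed
    have d2: "dist (?p i q) (?p (Suc i) q) < \<delta> / 2" if "q \<in> Q" for i q
    proof -
      have "?p i q - ?p (Suc i) q = (- (1 / real N)) *\<^sub>R q"
        unfolding scaleR_diff_left[symmetric] by (simp add: diff_divide_distrib[symmetric])
      then show ?thesis using step[OF that] by (simp add: dist_norm)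
    qed
    have quad: "seg V (h (?p i q')) (h (?p (Suc i) q')) - seg V (h (?p i q)) (h (?p (Suc i) q))
        = seg V (h (?p (Suc i) q)) (h (?p (Suc i) q')) - seg V (h (?p i q)) (h (?p i q'))" if i: "i < N" for i
    proof -
      let ?a = "h (?p i q)" and ?b = "h (?p (Suc i) q)" and ?a' = "h (?p i q')" and ?b' = "h (?p (Suc i) q')"
      have mem: "?p i q \<in> Q" "?p (Suc i) q \<in> Q" "?p i q' \<in> Q" "?p (Suc i) q' \<in> Q"
        by (intro pQ q; use i in simp)+
      have "?a \<in> h ` Q" using mem by blast
      then obtain \<psi> where \<psi>: "is_pot (ball ?a \<rho>) V \<psi>" using \<rho>(2) by blast
      have "dist (?p i q) (?p (Suc i) q') < \<delta>"
        using dist_triangle[of "?p i q" "?p (Suc i) q'" "?p i q'"] d1[of i] d2[OF q(2), of i] i by simp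
      then have in1: "?a \<in> ball ?a \<rho>" "?b \<in> ball ?a \<rho>" "?a' \<in> ball ?a \<rho>" "?b' \<in> ball ?a \<rho>"
        using \<rho>(1) d1[of i] d2[OF q(1), of i] i \<delta> mem by auto
      show ?thesis
        using seg_triangle[OF \<psi> convex_ball in1(1,3,4)] seg_triangle[OF \<psi> convex_ball in1(1,2,4)] by simp
    qed
    have "\<theta> q' - \<theta> q = (\<Sum>i<N. seg V (h (?p (Suc i) q)) (h (?p (Suc i) q')) - seg V (h (?p i q)) (h (?p i q')))"
      unfolding \<theta>_def sum_subtractf[symmetric] by (rule sum.cong) (use quad in auto)
    also have "\<dots> = seg V (h (?p N q)) (h (?p N q')) - seg V (h (?p 0 q)) (h (?p 0 q'))"
      by (rule sum_lessThan_telescope)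
    also have "\<dots> = seg V (h q) (h q')" using N by simp
    finally show ?thesis .
  qed
  then show ?thesis unfolding lift_pot_def using \<delta>(1) by (intro exI[of _ \<theta>] exI[of _ "\<delta> / 2"]) auto
qed

text \<open>Both lifts have the same increments over short distances, so their difference is locally
  constant on the connected set \<open>Q\<close>.\<close>

lemma lift_pot_unique:
  assumes "lift_pot V h Q \<theta>" "lift_pot V h Q \<theta>'" "connected Q" "p \<in> Q" "q \<in> Q"
  shows "\<theta> q - \<theta> p = \<theta>' q - \<theta>' p"
proof -
  obtain d1 where d1: "d1 > 0" "\<And>p q. p \<in> Q \<Longrightarrow> q \<in> Q \<Longrightarrow> dist p q < d1 \<Longrightarrow> \<theta> q - \<theta> p = seg V (h p) (h q)"
    using assms(1) unfolding lift_pot_def by blast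
  obtain d2 where d2: "d2 > 0" "\<And>p q. p \<in> Q \<Longrightarrow> q \<in> Q \<Longrightarrow> dist p q < d2 \<Longrightarrow> \<theta>' q - \<theta>' p = seg V (h p) (h q)"
    using assms(2) unfolding lift_pot_def by blast
  have "\<theta> p - \<theta>' p = \<theta> q - \<theta>' q"
  proof (rule connected_local_const[OF assms(3,4,5), where f="\<lambda>p. \<theta> p - \<theta>' p"], rule ballI)
    fix a assume a: "a \<in> Q"
    have "\<theta> a - \<theta>' a = \<theta> b - \<theta>' b" if "b \<in> Q" "dist b a < min d1 d2" for b
      using d1(2)[OF a that(1)] d2(2)[OF a that(1)] that(2) by (simp add: dist_commute)
    then show "\<forall>\<^sub>F b in at a within Q. \<theta> a - \<theta>' a = \<theta> b - \<theta>' b"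
      unfolding eventually_at using d1(1) d2(1) by (intro exI[of _ "min d1 d2"]) auto
  qed
  then show ?thesis by simp
qed

text \<open>A map that does not increase distances keeps the same \<open>\<delta>\<close>. The uses
  are the sides of a parameter square and the two halves of a joined path.\<close>

lemma lift_pot_compose:
  assumes "lift_pot V h Q \<theta>" "\<And>p q. p \<in> P \<Longrightarrow> q \<in> P \<Longrightarrow> dist (f p) (f q) \<le> dist p q" "f ` P \<subseteq> Q"
    "\<And>p. p \<in> P \<Longrightarrow> k p = h (f p)"
  shows "lift_pot V k P (\<lambda>p. \<theta> (f p))"
proof -
  obtain d where d: "d > 0" "\<And>p q. p \<in> Q \<Longrightarrow> q \<in> Q \<Longrightarrow> dist p q < d \<Longrightarrow> \<theta> q - \<theta> p = seg V (h p) (h q)"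
    using assms(1) unfolding lift_pot_def by blast
  have "\<theta> (f q) - \<theta> (f p) = seg V (k p) (k q)" if "p \<in> P" "q \<in> P" "dist p q < d" for p q
    using d(2)[of "f p" "f q"] assms(2)[OF that(1,2)] that assms(3) assms(4) by auto
  then show ?thesis unfolding lift_pot_def using d(1) by blast
qed

lemma lift_pot_is_pot:
  assumes "is_pot U V \<psi>" "convex U" "h ` Q \<subseteq> U"
  shows "lift_pot V h Q (\<lambda>q. \<psi> (h q))"
  unfolding lift_pot_def 
  using seg_pot[OF assms(1)] closed_segment_subset[OF _ _ assms(2)] assms(3)
  by (intro exI[of _ 1]) (simp add: image_subset_iff)

text \<open>The potential at \<open>x\<close> is the increment of a lift along a chosen path from
  \<open>a\<close> to \<open>x\<close>. For \<open>y\<close> near \<open>x\<close>, the path to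
  \<open>x\<close> continued by a segment is homotopic to the path chosen for \<open>y\<close>, and
  lifting the homotopy over the square equates the two increments.\<close>

lemma simply_connected_pot:
  fixes V :: "'a::euclidean_space \<Rightarrow> 'a"
  assumes S: "open S" "simply_connected S" "locally_pot S V"
  shows "\<exists>\<psi>. is_pot S V \<psi>"
proof (cases "S = {}")
  case False
  then obtain a where a: "a \<in> S" by blast
  have "path_connected S" using S simply_connected_imp_path_connected by blast
  then have "\<forall>x\<in>S. \<exists>g. path g \<and> path_image g \<subseteq> S \<and> pathstart g = a \<and> pathfinish g = x"
    using a unfolding path_connected_def by blast
  then obtain g where g: "\<And>x. x \<in> S \<Longrightarrow> path (g x) \<and> path_image (g x) \<subseteq> S \<and> pathstart (g x) = a \<and> pathfinish (g x) = x"
    by metis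
  have "\<exists>\<theta>. lift_pot V k {0..1::real} \<theta>" if "path k" "path_image k \<subseteq> S" for k
    by (rule lift_pot_exists[OF S(3)]) (use that in \<open>auto simp: path_def path_image_def mult_le_one\<close>)
  then have "\<forall>x\<in>S. \<exists>\<theta>. lift_pot V (g x) {0..1::real} \<theta>" using g by blast
  then obtain \<theta> where \<theta>: "\<And>x. x \<in> S \<Longrightarrow> lift_pot V (g x) {0..1::real} (\<theta> x)" by metis
  define \<phi> where "\<phi> x = \<theta> x 1 - \<theta> x 0" for x
  have key: "\<phi> y = \<phi> x + (\<psi> y - \<psi> x)" 
    if x: "x \<in> S" and r: "ball x r \<subseteq> S" "is_pot (ball x r) V \<psi>" and y: "y \<in> ball x r" for x r \<psi> y
  proof -
    have yS: "y \<in> S" using r y by blast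
    have xr: "x \<in> ball x r" using y by (metis centre_in_ball dist_not_less_zero mem_ball not_less_iff_gr_or_eq order_less_trans)
    have segsub: "closed_segment x y \<subseteq> ball x r" by (rule closed_segment_subset[OF xr y convex_ball])
    let ?p = "g x +++ linepath x y"
    have p: "path ?p" "path_image ?p \<subseteq> S" "pathstart ?p = a" "pathfinish ?p = y"
      using g[OF x] segsub r by (auto simp: path_image_join)
    have "homotopic_paths S ?p (g y)"
      using S(2) p g[OF yS] unfolding simply_connected_eq_homotopic_paths by auto
    then obtain h where h: "continuous_on ({0..1} \<times> {0..1}) h" "h \<in> ({0..1} \<times> {0..1}) \<rightarrow> S"
      "\<And>t. t \<in> {0..1} \<Longrightarrow> h (0, t) = ?p t" "\<And>t. t \<in> {0..1} \<Longrightarrow> h (1, t) = g y t"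
      "\<And>s. s \<in> {0..1} \<Longrightarrow> h (s, 0) = a" "\<And>s. s \<in> {0..1::real} \<Longrightarrow> h (s, 1::real) = y"
      unfolding homotopic_paths pathstart_def pathfinish_def using p[unfolded pathstart_def pathfinish_def] by auto
    have "\<exists>\<Theta>. lift_pot V h ({0..1} \<times> {0..1}) \<Theta>"
      by (rule lift_pot_exists[OF S(3) _ _ h(1)]) (use h(2) in \<open>auto simp: compact_Times mult_le_one\<close>)
    then obtain \<Theta> where \<Theta>: "lift_pot V h ({0..1} \<times> {0..1}) \<Theta>" by blast
    \<comment> \<open>On these two sides the homotopy stays at an endpoint, so the zero function is
      a lift as well and uniqueness forces \<open>\<Theta>\<close> to be constant there.\<close>
    have const: "\<Theta> (1, t) = \<Theta> (0, t)" if t: "t = 0 \<or> t = 1" for t :: real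
    proof -
      have "lift_pot V (\<lambda>s. h (s, t)) {0..1} (\<lambda>s. \<Theta> (s, t))"
        by (rule lift_pot_compose[OF \<Theta>]) (use t in \<open>auto simp: dist_Pair_Pair\<close>)
      moreover have "lift_pot V (\<lambda>s. h (s, t)) {0..1} (\<lambda>s. 0)"
        unfolding lift_pot_def using h(5,6) t by (intro exI[of _ 1]) auto
      ultimately show ?thesis
        using lift_pot_unique[of V "\<lambda>s. h (s,t)" "{0..1}" "\<lambda>s. \<Theta> (s, t)" "\<lambda>s. 0" 0 1] by simp
    qed
    have "lift_pot V (g y) {0..1} (\<lambda>t. \<Theta> (1, t))"
      by (rule lift_pot_compose[OF \<Theta>]) (use h(4) in \<open>auto simp: dist_Pair_Pair\<close>)
    then have 1: "\<phi> y = \<Theta> (1, 1) - \<Theta> (1, 0)"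
      using lift_pot_unique[OF \<theta>[OF yS], of "\<lambda>t. \<Theta> (1, t)" 0 1] by (simp add: \<phi>_def)
    have "lift_pot V ?p {0..1} (\<lambda>t. \<Theta> (0, t))"
      by (rule lift_pot_compose[OF \<Theta>]) (use h(3) in \<open>auto simp: dist_Pair_Pair\<close>)
    note lp = this
    \<comment> \<open>A joined path runs through its parts at double speed: the first part occupies
      the parameters \<open>t / 2\<close> and the second \<open>(t + 1) / 2\<close>.\<close>
    have "lift_pot V (g x) {0..1} (\<lambda>t. \<Theta> (0, t / 2))"
      by (rule lift_pot_compose[OF lp, where f="\<lambda>t. t / 2"]) (auto simp: dist_real_def joinpaths_def)
    then have 2: "\<phi> x = \<Theta> (0, 1 / 2) - \<Theta> (0, 0)"
      using lift_pot_unique[OF \<theta>[OF x], of "\<lambda>t. \<Theta> (0, t / 2)" 0 1] by (simp add: \<phi>_def)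
    have "lift_pot V (linepath x y) {0..1} (\<lambda>t. \<Theta> (0, (t + 1) / 2))"
    proof (rule lift_pot_compose[OF lp, where f="\<lambda>t. (t + 1) / 2"])
      show "linepath x y t = ?p ((t + 1) / 2)" if "t \<in> {0..1}" for t
      proof -
        have "2 * ((t + 1) / 2) - 1 = t" by (simp add: field_simps)
        then show ?thesis using that g[OF x] by (cases "t = 0") (auto simp: joinpaths_def pathfinish_def linepath_def)
      qed
      show "dist ((p + 1) / 2) ((q + 1) / 2) \<le> dist p q" for p q :: real
      proof -
        have eq: "(p + 1) / 2 - (q + 1) / 2 = (p - q) / 2" by (simp only: diff_divide_distrib[symmetric]) simp
        show ?thesis unfolding dist_real_def eq by simp
      qed
    qed auto
    moreover have "lift_pot V (linepath x y) {0..1} (\<lambda>t. \<psi> (linepath x y t))"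
      by (rule lift_pot_is_pot[OF r(2) convex_ball]) (use segsub in \<open>auto simp: linepath_in_path subset_iff\<close>)
    ultimately have "\<Theta> (0, 1) - \<Theta> (0, 1 / 2) = \<psi> y - \<psi> x"
      using lift_pot_unique[of V "linepath x y" "{0..1}" "\<lambda>t. \<Theta> (0, (t + 1) / 2)" "\<lambda>t. \<psi> (linepath x y t)" 0 1]
      by (simp add: linepath_def)
    then show ?thesis using 1 2 const[of 0] const[of 1] by simp
  qed
  have "is_pot S V \<phi>" unfolding is_pot_def
  proof
    fix x assume x: "x \<in> S"
    then obtain r \<psi> where r: "r > 0" "ball x r \<subseteq> S" "is_pot (ball x r) V \<psi>"
      using S(3) unfolding locally_pot_def by blast
    have "((\<lambda>y. \<phi> x + (\<psi> y - \<psi> x)) has_derivative (\<lambda>h. V x \<bullet> h)) (at x)"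
      using r by (auto intro!: derivative_eq_intros simp: is_pot_def)
    then show "(\<phi> has_derivative (\<lambda>h. V x \<bullet> h)) (at x)"
    proof (rule has_derivative_transform_within_open[OF _ open_ball[of x r]])
      show "x \<in> ball x r" using r by simp
      show "\<phi> x + (\<psi> y - \<psi> x) = \<phi> y" if "y \<in> ball x r" for y
        by (rule key[OF x r(2,3) that, symmetric])
    qed
  qed
  then show ?thesis by blast
qed (auto simp: is_pot_def)


subsection \<open>Polygonal chains\<close>

text \<open>A polygonal walk is encoded by the list of its vertices, so that joining and reversing
  walks become operations on lists, with edges oriented by the order of the list.\<close>

fun wsum :: "('a \<Rightarrow> 'a \<Rightarrow> 'b::comm_monoid_add) \<Rightarrow> 'a list \<Rightarrow> 'b"
  where "wsum f (a # b # ps) = f a b + wsum f (b # ps)"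
  | "wsum f _ = 0"

fun wset :: "'a::real_vector list \<Rightarrow> 'a set"
  where "wset (a # b # ps) = closed_segment a b \<union> wset (b # ps)"
  | "wset [a] = {a}"
  | "wset [] = {}"

lemma wsum_append: "wsum f (ps @ a # qs) = wsum f (ps @ [a]) + wsum f (a # qs)"
  by (induction f ps rule: wsum.induct) (auto simp: add.assoc)

lemma wset_append: "wset (ps @ a # qs) = wset (ps @ [a]) \<union> wset (a # qs)"
proof (induction ps rule: wset.induct)
  case (2 b) then show ?case by (cases qs) auto
next
  case 3 then show ?case by (cases qs) auto
qed auto

lemma compact_wset: "compact (wset ps)" for ps :: "'a::euclidean_space list"
  by (induction ps rule: wset.induct) auto

lemma wset_rev: "wset (rev ps) = wset ps"
proof (induction ps rule: wset.induct)
  case (1 a b ps)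
  have "wset (rev (a # b # ps)) = wset (rev ps @ b # [a])" by simp
  also have "\<dots> = wset (rev (b # ps)) \<union> wset [b, a]" by (subst wset_append) simp
  finally show ?case using 1 by (auto simp: closed_segment_commute)
qed auto

lemma wsum_telescope: 
  fixes k :: "'a \<Rightarrow> 'b::ab_group_add"
  shows "ps \<noteq> [] \<Longrightarrow> wsum (\<lambda>a b. k b - k a) ps = k (last ps) - k (hd ps)"
  by (induction "\<lambda>a b. k b - k a" ps rule: wsum.induct) auto

lemma wsum_norm_le:
  fixes f :: "'a::real_vector \<Rightarrow> 'a \<Rightarrow> 'b::real_normed_vector"
  assumes "wset ps \<subseteq> S" "\<And>a b. closed_segment a b \<subseteq> S \<Longrightarrow> norm (f a b) \<le> g a b"
  shows "norm (wsum f ps) \<le> wsum g ps"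
  using assms(1)
proof (induction ps rule: wset.induct)
  case (1 a b ps)
  then have "norm (f a b) \<le> g a b" "norm (wsum f (b # ps)) \<le> wsum g (b # ps)" using assms(2) by auto
  then show ?case using norm_triangle_ineq[of "f a b" "wsum f (b # ps)"] by simp
qed auto

lemma wsum_rev:
  fixes f :: "'a::real_vector \<Rightarrow> 'a \<Rightarrow> 'b::ab_group_add"
  assumes "wset ps \<subseteq> S" "\<And>a b. closed_segment a b \<subseteq> S \<Longrightarrow> f b a = - f a b"
  shows "wsum f (rev ps) = - wsum f ps"
  using assms(1)
proof (induction ps rule: wset.induct)
  case (1 a b ps)
  have "wsum f (rev (a # b # ps)) = wsum f (rev ps @ b # [a])" by simp
  also have "\<dots> = wsum f (rev (b # ps)) + wsum f [b, a]" by (subst wsum_append) simp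
  finally show ?case using 1 assms(2)[of a b] by simp
qed auto

lemma wsum_diff: 
  fixes f :: "'a \<Rightarrow> 'a \<Rightarrow> 'b::ab_group_add"
  shows "wsum (\<lambda>a b. f a b - g a b) ps = wsum f ps - wsum g ps" 
  by (induction f ps rule: wsum.induct) auto

lemma wsum_linear: "linear L \<Longrightarrow> wsum (\<lambda>a b. L (f a b)) ps = L (wsum f ps)"
  by (induction f ps rule: wsum.induct) (auto simp: linear_add linear_0)

lemma seg_swap:
  fixes V :: "'a::euclidean_space \<Rightarrow> 'a"
  assumes "continuous_on (closed_segment a b) V"
  shows "seg V b a = - seg V a b"
proof -
  let ?f = "\<lambda>t. V (a + t *\<^sub>R (b - a)) \<bullet> (b - a)"
  have "continuous_on {0..1} ?f"
    by (intro continuous_intros continuous_on_compose2[OF assms]) (auto intro!: seg_point)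
  then have "(?f has_integral seg V a b) (cbox 0 1)"
    unfolding seg_def by (simp add: integrable_integral integrable_continuous_real)
  from has_integral_affinity[OF this, of "-1" 1]
  have "((\<lambda>t. ?f (1 - t)) has_integral seg V a b) ((\<lambda>t. 1 - t) ` {0..1})"
    by (simp add: image_def algebra_simps)
  moreover have "(\<lambda>t. 1 - t) ` {0..1} = {0..1::real}"
    by (auto simp: image_iff intro!: bexI[of _ "1 - _"])
  moreover have "?f (1 - t) = - (V (b + t *\<^sub>R (a - b)) \<bullet> (a - b))" for t
    by (simp add: algebra_simps inner_diff_right)
  ultimately have "((\<lambda>t. - (V (b + t *\<^sub>R (a - b)) \<bullet> (a - b))) has_integral seg V a b) {0..1}" by simp
  from has_integral_neg[OF this] show ?thesis by (simp add: seg_def integral_unique)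
qed

text \<open>Any two points are joined by a polygonal walk, because being so joined is an equivalence
  relation with open classes. The potential is the line integral along a chosen walk, and vanishing
  on closed walks makes its increment along a segment independent of the choices.\<close>

lemma walk_pot:
  fixes V :: "'a::euclidean_space \<Rightarrow> 'a"
  assumes S: "open S" "connected S" "locally_pot S V" and V: "continuous_on S V"
    and closed_walk: "\<And>ps. ps \<noteq> [] \<Longrightarrow> wset ps \<subseteq> S \<Longrightarrow> hd ps = last ps \<Longrightarrow> wsum (seg V) ps = 0"
  shows "\<exists>\<psi>. is_pot S V \<psi>"
proof (cases "S = {}")
  case False
  then obtain a where a: "a \<in> S" by blast
  have loc: "\<exists>r>0. ball x r \<subseteq> S \<and> (\<exists>\<psi>. is_pot (ball x r) V \<psi>)" if "x \<in> S" for x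
    using S(3) that unfolding locally_pot_def by blast
  define R where "R x y \<longleftrightarrow> (\<exists>ps. ps \<noteq> [] \<and> wset ps \<subseteq> S \<and> hd ps = x \<and> last ps = y)" for x y
  have R: "R x y" if "x \<in> S" "y \<in> S" for x y
  proof (rule connected_equivalence_relation[OF S(2) that])
    show "R y x" if "R x y" for x y 
    proof -
      obtain ps where "ps \<noteq> []" "wset ps \<subseteq> S" "hd ps = x" "last ps = y" using \<open>R x y\<close> R_def by auto
      then show ?thesis unfolding R_def by (intro exI[of _ "rev ps"]) (auto simp: wset_rev hd_rev last_rev)
    qed
    show "R x z" if xy: "R x y" and yz: "R y z" for x y z
    proof -
      obtain ps where p: "ps \<noteq> []" "wset ps \<subseteq> S" "hd ps = x" "last ps = y" using xy R_def by auto
      obtain qs where q: "qs \<noteq> []" "wset qs \<subseteq> S" "hd qs = y" "last qs = z" using yz R_def by auto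
      obtain ps' where ps': "ps = ps' @ [y]" using p by (metis append_butlast_last_id)
      obtain qs' where qs': "qs = y # qs'" using q by (cases qs) auto
      show ?thesis unfolding R_def
        by (rule exI[of _ "ps' @ y # qs'"], subst wset_append) (use p q ps' qs' in \<open>auto simp: hd_append\<close>)
    qed
    show "\<exists>T. openin (top_of_set S) T \<and> b \<in> T \<and> (\<forall>x\<in>T. R b x)" if b: "b \<in> S" for b
    proof -
      obtain r where r: "r > 0" "ball b r \<subseteq> S" using loc[OF b] by blast
      have "R b x" if x: "x \<in> ball b r" for x
      proof -
        have "closed_segment b x \<subseteq> S" using closed_segment_subset[of b "ball b r" x] x r by auto
        then show ?thesis unfolding R_def using x r by (intro exI[of _ "[b, x]"]) auto
      qed
      then show ?thesis using r S(1) by (intro exI[of _ "ball b r"]) (auto simp: openin_open_eq)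
    qed
  qed
  have "\<forall>x\<in>S. \<exists>ps. ps \<noteq> [] \<and> wset ps \<subseteq> S \<and> hd ps = a \<and> last ps = x" using R[OF a] unfolding R_def by blast
  then obtain p where p: "\<And>x. x \<in> S \<Longrightarrow> p x \<noteq> [] \<and> wset (p x) \<subseteq> S \<and> hd (p x) = a \<and> last (p x) = x" by metis
  define \<phi> where "\<phi> x = wsum (seg V) (p x)" for x
  have sw: "seg V b a = - seg V a b" if "closed_segment a b \<subseteq> S" for a b
    by (rule seg_swap[OF continuous_on_subset[OF V that]])
  have key: "\<phi> y - \<phi> x = seg V x y" if xy: "closed_segment x y \<subseteq> S" for x y
  proof -
    have x: "x \<in> S" and y: "y \<in> S" using xy by auto
    obtain us where us: "p x = us @ [x]" using p[OF x] by (metis append_butlast_last_id)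
    obtain vs where vs: "rev (p y) = y # vs" using p[OF y] by (metis hd_rev list.collapse rev_is_Nil_conv)
    \<comment> \<open>The closed walk from \<open>a\<close> to \<open>x\<close>, over the segment to
      \<open>y\<close>, and back to \<open>a\<close> along the reversed walk of
      \<open>y\<close>.\<close>
    let ?w = "us @ x # y # vs"
    have "last (rev (p y)) = a" using p[OF y] by (simp add: last_rev)
    then have "last ?w = a" using vs by simp
    moreover have "hd ?w = a" using p[OF x] us by (cases us) auto
    moreover have "wset ?w \<subseteq> S"
    proof -
      have "wset ?w = wset (p x) \<union> (closed_segment x y \<union> wset (p y))"
        using vs us wset_rev[of "p y"] by (subst wset_append) simp
      then show ?thesis using p[OF x] p[OF y] xy by simp
    qed
    ultimately have "wsum (seg V) ?w = 0" by (intro closed_walk) auto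
    moreover have "wsum (seg V) ?w = \<phi> x + (seg V x y + wsum (seg V) (rev (p y)))"
      using us vs by (subst wsum_append) (simp add: \<phi>_def)
    moreover have "wsum (seg V) (rev (p y)) = - \<phi> y"
      unfolding \<phi>_def by (rule wsum_rev[where S=S]) (use p[OF y] sw in auto)
    ultimately show ?thesis by simp
  qed
  have "is_pot S V \<phi>" unfolding is_pot_def
  proof
    fix x assume x: "x \<in> S"
    then obtain r \<psi> where r: "r > 0" "ball x r \<subseteq> S" "is_pot (ball x r) V \<psi>"
      using loc by blast
    have "((\<lambda>y. \<phi> x + (\<psi> y - \<psi> x)) has_derivative (\<lambda>h. V x \<bullet> h)) (at x)"
      using r by (auto intro!: derivative_eq_intros simp: is_pot_def)
    then show "(\<phi> has_derivative (\<lambda>h. V x \<bullet> h)) (at x)"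
    proof (rule has_derivative_transform_within_open[OF _ open_ball[of x r]])
      show "x \<in> ball x r" using r by simp
      fix y assume "y \<in> ball x r"
      then have s: "closed_segment x y \<subseteq> ball x r" using r by (intro closed_segment_subset) auto
      show "\<phi> x + (\<psi> y - \<psi> x) = \<phi> y"
        using key[OF order.trans[OF s r(2)]] seg_pot[OF r(3) s] by simp
    qed
  qed
  then show ?thesis by blast
qed (auto simp: is_pot_def)

subsection \<open>Extending potentials to a neighbourhood\<close>

text \<open>Near a boundary point the potential on \<open>\<Omega>\<close> and a local potential of
  \<open>B\<close> have the same gradient, but they could differ by another constant on each
  component of the intersection with \<open>\<Omega>\<close>. The hypothesis \<open>lc\<close>
  supplies neighbourhoods with connected intersection, hence a single constant, which makes the
  local extensions consistent.\<close>

lemma pot_neighbourhood: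
  fixes B :: "'a::euclidean_space \<Rightarrow> 'a"
  assumes \<Omega>: "compact (closure \<Omega>)"
    and lc: "\<And>x r. x \<in> closure \<Omega> \<Longrightarrow> 0 < r \<Longrightarrow> \<exists>N. open N \<and> x \<in> N \<and> N \<subseteq> ball x r \<and> connected (N \<inter> \<Omega>)"
    and oO: "open \<Omega>" and W: "closure \<Omega> \<subseteq> W" and B: "locally_pot W B" and pot: "is_pot \<Omega> B \<psi>0"
  shows "\<exists>U \<psi>. open U \<and> closure \<Omega> \<subseteq> U \<and> U \<subseteq> W \<and> is_pot U B \<psi>"
proof -
  define good where "good N \<psi> \<longleftrightarrow> open N \<and> N \<subseteq> W \<and> (\<exists>D. convex D \<and> N \<subseteq> D \<and> is_pot D B \<psi>) \<and> (\<exists>c. \<forall>w\<in>N \<inter> \<Omega>. \<psi>0 w = \<psi> w + c)" for N \<psi>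
  have "\<exists>N \<psi>. x \<in> N \<and> good N \<psi>" if x: "x \<in> closure \<Omega>" for x
  proof -
    obtain r \<psi> where r: "r > 0" "ball x r \<subseteq> W" "is_pot (ball x r) B \<psi>"
      using B W x unfolding locally_pot_def by blast
    obtain N where N: "open N" "x \<in> N" "N \<subseteq> ball x r" "connected (N \<inter> \<Omega>)" using lc[OF x r(1)] by blast
    have "\<exists>c. \<forall>w\<in>N \<inter> \<Omega>. \<psi>0 w = \<psi> w + c"
    proof (cases "N \<inter> \<Omega> = {}")
      case False
      then obtain w0 where w0: "w0 \<in> N \<inter> \<Omega>" by blast
      have "\<psi>0 w = \<psi> w + (\<psi>0 w0 - \<psi> w0)" if "w \<in> N \<inter> \<Omega>" for w
      proof -
        have "N \<inter> \<Omega> \<subseteq> ball x r" "open (N \<inter> \<Omega>)" using N oO by auto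
        from is_pot_diff_const[OF is_pot_subset[OF pot] is_pot_subset[OF r(3) this(1)] this(2) N(4) that w0]
        show ?thesis by simp
      qed
      then show ?thesis by blast
    qed auto
    then show ?thesis unfolding good_def using N r by (intro exI[of _ N] exI[of _ \<psi>]) auto
  qed
  then have "closure \<Omega> \<subseteq> \<Union>{N. \<exists>\<psi>. good N \<psi>}" by blast
  moreover have "\<And>N. N \<in> {N. \<exists>\<psi>. good N \<psi>} \<Longrightarrow> open N" by (auto simp: good_def)
  ultimately obtain \<rho> where \<rho>: "\<rho> > 0" "\<And>x. x \<in> closure \<Omega> \<Longrightarrow> \<exists>N\<in>{N. \<exists>\<psi>. good N \<psi>}. ball x \<rho> \<subseteq> N"
    using Heine_Borel_lemma[OF \<Omega>, of "{N. \<exists>\<psi>. good N \<psi>}"] by metis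
  \<comment> \<open>\<open>\<rho>\<close> is a Lebesgue number of the cover by good sets. A point
    within \<open>\<rho> / 4\<close> of \<open>x\<close> and its companion in
    \<open>\<Omega>\<close> at distance below \<open>\<rho> / 2\<close> then lie in one good set
    together.\<close>
  define U where "U = (\<Union>x\<in>closure \<Omega>. ball x (\<rho> / 4))"
  have "\<exists>w\<in>\<Omega>. dist w z < \<rho> / 2" if z: "z \<in> U" for z
  proof -
    obtain x where x: "x \<in> closure \<Omega>" "dist x z < \<rho> / 4" using z by (auto simp: U_def)
    obtain w where "w \<in> \<Omega>" "dist w x < \<rho> / 4" using x(1) \<rho>(1) closure_approachable[of x \<Omega>] by (metis zero_less_divide_iff zero_less_numeral)
    then show ?thesis using x(2) dist_triangle[of w z x] by (intro bexI[of _ w]) auto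
  qed
  then obtain w where w: "\<And>z. z \<in> U \<Longrightarrow> w z \<in> \<Omega> \<and> dist (w z) z < \<rho> / 2" by metis
  \<comment> \<open>The value at a nearby point of \<open>\<Omega>\<close> is transported to
    \<open>z\<close> by a line integral; on a good set the result is the local potential plus its
    constant, so the choice of \<open>w z\<close> has no influence.\<close>
  define \<psi> where "\<psi> z = \<psi>0 (w z) + seg B (w z) z" for z
  have "is_pot U B \<psi>" unfolding is_pot_def
  proof
    fix z assume "z \<in> U"
    then obtain x where x: "x \<in> closure \<Omega>" "z \<in> ball x (\<rho> / 4)" by (auto simp: U_def)
    obtain N \<psi>' where N: "ball x \<rho> \<subseteq> N" "good N \<psi>'" using \<rho>(2)[OF x(1)] by blast
    obtain D c where D: "convex D" "N \<subseteq> D" "is_pot D B \<psi>'" "\<And>w. w \<in> N \<inter> \<Omega> \<Longrightarrow> \<psi>0 w = \<psi>' w + c"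
      using N(2) unfolding good_def by blast
    have eq: "\<psi>' y + c = \<psi> y" if y: "y \<in> ball x (\<rho> / 4)" for y
    proof -
      have yU: "y \<in> U" using y x(1) by (auto simp: U_def)
      have "dist x (w y) < \<rho>" using w[OF yU] y dist_triangle[of x "w y" y] \<rho>(1) by (simp add: dist_commute)
      then have wN: "w y \<in> N" using N(1) by auto
      have yN: "y \<in> N" using N(1) y \<rho>(1) by auto
      have "seg B (w y) y = \<psi>' y - \<psi>' (w y)"
        by (rule seg_pot[OF D(3)]) (use closed_segment_subset[OF _ _ D(1)] wN yN D(2) in blast)
      then show ?thesis using D(4)[of "w y"] wN w[OF yU] by (simp add: \<psi>_def)
    qed
    have zD: "z \<in> D" using x(2) N(1) D(2) \<rho>(1) by (auto simp: subset_iff)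
    have "((\<lambda>y. \<psi>' y + c) has_derivative (\<lambda>h. B z \<bullet> h)) (at z)"
      using D(3) zD by (auto intro!: derivative_eq_intros simp: is_pot_def)
    then show "(\<psi> has_derivative (\<lambda>h. B z \<bullet> h)) (at z)"
      by (rule has_derivative_transform_within_open[OF _ open_ball[of x "\<rho> / 4"] x(2) eq])
  qed
  moreover have "U \<subseteq> W"
  proof
    fix z assume "z \<in> U"
    then obtain x where x: "x \<in> closure \<Omega>" "z \<in> ball x (\<rho> / 4)" by (auto simp: U_def)
    obtain N \<psi>' where N: "ball x \<rho> \<subseteq> N" "good N \<psi>'" using \<rho>(2)[OF x(1)] by blast
    have "z \<in> ball x \<rho>" using x(2) \<rho>(1) by auto
    then show "z \<in> W" using N unfolding good_def by blast
  qed
  moreover have "closure \<Omega> \<subseteq> U" using \<rho>(1) by (auto simp: U_def)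
  moreover have "open U" by (auto simp: U_def)
  ultimately show ?thesis by blast
qed


section \<open>Algebra of C^2 functions and cutoffs around compact sets\<close>

lemma C_on_2_mult:
  fixes f g :: "'a::euclidean_space \<Rightarrow> real"
  assumes f: "C_on 2 UNIV f" and g: "C_on 2 UNIV g"
  shows "C_on 2 UNIV (\<lambda>x. f x * g x)"
proof -
  have f1: "C1_on UNIV f" "\<And>b. b \<in> Basis \<Longrightarrow> C1_on UNIV (partial b f)"
    and g1: "C1_on UNIV g" "\<And>b. b \<in> Basis \<Longrightarrow> C1_on UNIV (partial b g)"
    using f g by (auto simp: C_on_2)
  have "partial b (\<lambda>x. f x * g x) = (\<lambda>x. f x * partial b g x + partial b f x * g x)" for b
    by (rule ext, rule partial_mult) (use f1 g1 in \<open>auto simp: C1_on_def\<close>)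
  then show ?thesis unfolding C_on_2
    by (auto intro!: C1_on_add C1_on_mult f1 g1)
qed

lemma C_on_2_const: "C_on 2 U (\<lambda>x. c)"
proof -
  have "partial b (\<lambda>x. c) = (\<lambda>x. 0)" for b :: 'a and c :: 'b by (rule ext) simp
  then show ?thesis by (simp add: C_on_2)
qed

lemma C_on_2_prod:
  fixes f :: "'i \<Rightarrow> 'a::euclidean_space \<Rightarrow> real"
  shows "(\<And>i. i \<in> I \<Longrightarrow> C_on 2 UNIV (f i)) \<Longrightarrow> C_on 2 UNIV (\<lambda>x. \<Prod>i\<in>I. f i x)"
  by (induction I rule: infinite_finite_induct) (auto intro: C_on_2_mult C_on_2_const)

lemma C_on_2_diff:
  fixes f g :: "'a::euclidean_space \<Rightarrow> 'b::real_normed_vector"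
  assumes U: "open U" and f: "C_on 2 U f" and g: "C_on 2 U g"
  shows "C_on 2 U (\<lambda>x. f x - g x)"
proof -
  have f1: "C1_on U f" "\<And>b. b \<in> Basis \<Longrightarrow> C1_on U (partial b f)"
    and g1: "C1_on U g" "\<And>b. b \<in> Basis \<Longrightarrow> C1_on U (partial b g)"
    using f g by (auto simp: C_on_2)
  have "C1_on U (partial b (\<lambda>x. f x - g x)) = C1_on U (\<lambda>x. partial b f x - partial b g x)" for b
    by (rule C1_on_cong[OF U], rule partial_diff) (use f1 g1 in \<open>auto simp: C1_on_def\<close>)
  then show ?thesis unfolding C_on_2
    by (auto intro!: C1_on_diff f1 g1)
qed

text \<open>Finitely many balls cover \<open>K\<close> while their doubles stay in \<open>U\<close>;
  the product of the functions \<open>1 - bump\<close> vanishes on the balls and is 1 off the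
  doubles.\<close>

lemma cutoff_exists:
  fixes K :: "'a::euclidean_space set"
  assumes K: "compact K" and U: "open U" "K \<subseteq> U"
  obtains f V K' where "C_on 2 UNIV f" "open V" "K \<subseteq> V" "\<And>x. x \<in> V \<Longrightarrow> f x = (0::real)"
    "compact K'" "K' \<subseteq> U" "\<And>x. x \<notin> K' \<Longrightarrow> f x = 1"
proof -
  have "\<forall>x\<in>K. \<exists>r>0. cball x (2 * r) \<subseteq> U"
  proof
    fix x assume "x \<in> K"
    then obtain s where "s > 0" "cball x s \<subseteq> U" using U open_contains_cball by blast
    then show "\<exists>r>0. cball x (2 * r) \<subseteq> U" by (intro exI[of _ "s / 2"]) auto
  qed
  then obtain r where r: "\<And>x. x \<in> K \<Longrightarrow> r x > 0 \<and> cball x (2 * r x) \<subseteq> U" by metis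
  obtain I where I: "I \<subseteq> K" "finite I" "K \<subseteq> (\<Union>i\<in>I. ball i (r i))"
    using compactE_image[OF K, of K "\<lambda>i. ball i (r i)"] r by (metis (no_types, lifting) UN_I centre_in_ball open_ball subsetI)
  have rI: "0 \<le> r i" "r i < 2 * r i" if "i \<in> I" for i using r[of i] that I by auto
  show ?thesis
  proof (rule that)
    show "C_on 2 UNIV (\<lambda>x. \<Prod>i\<in>I. 1 - bump i (r i) (2 * r i) x)"
      by (intro C_on_2_prod C_on_2_diff C_on_2_const C2_bump open_UNIV) (use rI in auto)
    show "(\<Prod>i\<in>I. 1 - bump i (r i) (2 * r i) x) = 0" if xU: "x \<in> (\<Union>i\<in>I. ball i (r i))" for x
    proof -
      obtain i where i: "i \<in> I" "x \<in> ball i (r i)" using xU by blast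
      then have "bump i (r i) (2 * r i) x = 1" by (intro bump_1 rI) (auto simp: dist_norm norm_minus_commute)
      then show ?thesis using i I(2) by (intro prod_zero) auto
    qed
    show "compact (\<Union>i\<in>I. cball i (2 * r i))" using I(2) by auto
    show "(\<Union>i\<in>I. cball i (2 * r i)) \<subseteq> U" using r I(1) by blast
    show "(\<Prod>i\<in>I. 1 - bump i (r i) (2 * r i) x) = 1" if "x \<notin> (\<Union>i\<in>I. cball i (2 * r i))" for x
    proof (rule prod.neutral)
      show "\<forall>i\<in>I. 1 - bump i (r i) (2 * r i) x = 1"
      proof
        fix i assume i: "i \<in> I"
        then have "x \<notin> cball i (2 * r i)" using that by blast
        then have "bump i (r i) (2 * r i) x = 0" by (intro bump_0 rI i) (auto simp: dist_norm norm_minus_commute)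
        then show "1 - bump i (r i) (2 * r i) x = 1" by simp
      qed
    qed
    show "K \<subseteq> (\<Union>i\<in>I. ball i (r i))" by (rule I(3))
  qed auto
qed

subsection \<open>The Biot--Savart field of a polygon\<close>

text \<open>Compact support turns the Lebesgue integral over the space into an integral over a fixed
  box, where continuity in parameters and interchange of integrals hold for continuous
  integrands.\<close>

lemma lborel_integral_cbox:
  fixes g :: "real^3 \<Rightarrow> 'b::euclidean_space"
  assumes "continuous_on UNIV g" "\<And>y. R \<le> norm y \<Longrightarrow> g y = 0"
  shows "(\<integral>y. g y \<partial>lborel) = integral (cbox (\<chi> i. -R) (\<chi> i. R)) g"
proof -
  let ?Q = "cbox (\<chi> i. -R) (\<chi> i. R) :: (real^3) set"
  have "g y = 0" if yQ: "y \<notin> ?Q" for y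
  proof -
    obtain i where "\<not> (- R \<le> y $ i \<and> y $ i \<le> R)" using yQ by (auto simp: mem_box_cart)
    then have "R < \<bar>y $ i\<bar>" by linarith
    then show ?thesis using component_le_norm_cart[of y i] assms(2)[of y] by linarith
  qed
  then have eq: "g = (\<lambda>y. if y \<in> ?Q then g y else 0)" by auto
  have "(\<integral>y. g y \<partial>lborel) = integral UNIV g"
    using integral_lborel[OF integrable_compact_support[OF assms]] by simp
  also have "\<dots> = integral ?Q g" by (subst eq) (rule integral_restrict_UNIV)
  finally show ?thesis .
qed

lemma segment_fubini:
  fixes f :: "real \<Rightarrow> real^3 \<Rightarrow> 'b::euclidean_space"
  assumes c: "continuous_on UNIV (\<lambda>(t,y). f t y)" and z: "\<And>t y. R \<le> norm y \<Longrightarrow> f t y = 0"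
  shows "integral {0..1} (\<lambda>t. \<integral>y. f t y \<partial>lborel) = (\<integral>y. integral {0..1} (\<lambda>t. f t y) \<partial>lborel)"
    and "continuous_on UNIV (\<lambda>y. integral {0..1} (\<lambda>t. f t y))"
proof -
  let ?c = "\<chi> i. -R :: real^3" and ?d = "\<chi> i. R :: real^3"
  have c1: "continuous_on UNIV (f t)" for t
    using continuous_on_compose2[OF c continuous_on_Pair[OF continuous_on_const[of UNIV t] continuous_on_id]] by simp
  have "continuous_on (UNIV \<times> cbox 0 1) (\<lambda>(y,t). f t y)"
    using continuous_on_compose2[OF c continuous_on_swap[of "UNIV \<times> cbox 0 1"]] by (simp add: case_prod_beta prod.swap_def)
  from integral_continuous_on_param[OF this]
  show c2: "continuous_on UNIV (\<lambda>y. integral {0..1} (\<lambda>t. f t y))" by simp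
  have "integral {0..1} (\<lambda>t. \<integral>y. f t y \<partial>lborel) = integral (cbox 0 1) (\<lambda>t. integral (cbox (\<chi> i. -R) (\<chi> i. R)) (f t))"
    by (simp add: lborel_integral_cbox[OF c1 z])
  also have "\<dots> = integral (cbox (\<chi> i. -R) (\<chi> i. R)) (\<lambda>y. integral (cbox 0 1) (\<lambda>t. f t y))"
    by (rule integral_swap_continuous) (rule continuous_on_subset[OF c], simp)
  also have "\<dots> = (\<integral>y. integral {0..1} (\<lambda>t. f t y) \<partial>lborel)"
    by (subst lborel_integral_cbox[OF c2]) (auto simp: z)
  finally show "integral {0..1} (\<lambda>t. \<integral>y. f t y \<partial>lborel) = (\<integral>y. integral {0..1} (\<lambda>t. f t y) \<partial>lborel)" .
qed

text \<open>The regularised Biot--Savart integral over the oriented segment from \<open>a\<close> to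
  \<open>b\<close>, without its normalising factor.\<close>

definition edge :: "real \<Rightarrow> real^3 \<Rightarrow> real^3 \<Rightarrow> real^3 \<Rightarrow> real^3"
  where "edge e a b y = integral {0..1} (\<lambda>t. cross3 (newt e (a + t *\<^sub>R (b - a) - y)) (b - a))"

context
  fixes e :: real
  assumes e: "0 < e"
begin

lemma newt_diff: "newt e differentiable (at z)"
  using C1_on_newt[OF e] by (simp add: C1_on_def)

lemma continuous_newt_compose: "continuous_on A f \<Longrightarrow> continuous_on A (\<lambda>x. newt e (f x))"
  by (rule continuous_on_compose2[OF C1_on_continuous[OF C1_on_newt[OF e]]]) auto

lemma continuous_partial_newt_compose: "continuous_on A f \<Longrightarrow> continuous_on A (\<lambda>x. partial h (newt e) (f x))"
  by (rule continuous_on_compose2[OF C1_on_continuous_partial[OF C1_on_newt[OF e]]]) auto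

lemma edge_has_derivative:
  "(edge e a b has_derivative (\<lambda>h. integral {0..1} (\<lambda>t. cross3 (- partial h (newt e) (a + t *\<^sub>R (b - a) - y)) (b - a)))) (at y)"
  unfolding edge_def[abs_def]
proof (rule leibniz_interval[OF open_UNIV convex_UNIV UNIV_I])
  fix x and t :: real
  have "((\<lambda>y. a + t *\<^sub>R (b - a) - y) has_derivative (\<lambda>h. - h)) (at x)" by (auto intro!: derivative_eq_intros)
  from has_derivative_compose[OF this has_derivative_partial[OF newt_diff]]
  have "((\<lambda>y. newt e (a + t *\<^sub>R (b - a) - y)) has_derivative (\<lambda>h. - partial h (newt e) (a + t *\<^sub>R (b - a) - x))) (at x)"
    by (simp add: linear_neg[OF linear_partial[OF newt_diff]])
  from bounded_bilinear.FDERIV[OF bounded_bilinear_cross3 this has_derivative_const]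
  show "((\<lambda>y. cross3 (newt e (a + t *\<^sub>R (b - a) - y)) (b - a)) has_derivative
     (\<lambda>h. cross3 (- partial h (newt e) (a + t *\<^sub>R (b - a) - x)) (b - a))) (at x)"
    by simp
next
  fix h
  have "continuous_on (UNIV \<times> {0..1}) (\<lambda>z::(real^3) \<times> real. cross3 (- partial h (newt e) (a + snd z *\<^sub>R (b - a) - fst z)) (b - a))"
    by (intro continuous_on_cross continuous_intros continuous_partial_newt_compose)
  then show "continuous_on (UNIV \<times> {0..1}) (\<lambda>(y, t). cross3 (- partial h (newt e) (a + t *\<^sub>R (b - a) - y)) (b - a))"
    by (simp add: case_prod_beta)
next
  show "continuous_on {0..1} (\<lambda>t. cross3 (newt e (a + t *\<^sub>R (b - a) - x)) (b - a))" for x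
    by (intro continuous_on_cross continuous_intros continuous_newt_compose)
qed

lemma C1_on_edge: "C1_on UNIV (edge e a b)"
proof (rule C1_onI[OF edge_has_derivative])
  fix h
  have "continuous_on (UNIV \<times> cbox 0 1) (\<lambda>z::(real^3) \<times> real. cross3 (- partial h (newt e) (a + snd z *\<^sub>R (b - a) - fst z)) (b - a))"
    by (intro continuous_on_cross continuous_intros continuous_partial_newt_compose)
  then have "continuous_on (UNIV \<times> cbox 0 1) (\<lambda>(y, t::real). cross3 (- partial h (newt e) (a + t *\<^sub>R (b - a) - y)) (b - a))"
    by (simp add: case_prod_beta)
  from integral_continuous_on_param[OF this]
  show "continuous_on UNIV (\<lambda>y. integral {0..1} (\<lambda>t. cross3 (- partial h (newt e) (a + t *\<^sub>R (b - a) - y)) (b - a)))"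
    by simp
qed

text \<open>Where the kernel is divergence-free, the curl of the integrand in \<open>y\<close> is
  minus the derivative of the kernel in the direction of the edge, and integrating it leaves the
  endpoints. These endpoint terms cancel when the edges close up to a polygon.\<close>

lemma curl_edge:
  assumes far: "\<And>x. x \<in> closed_segment a b \<Longrightarrow> e \<le> norm (x - y)"
  shows "curl (edge e a b) y = newt e (a - y) - newt e (b - y)"
proof -
  let ?p = "\<lambda>t. a + t *\<^sub>R (b - a) - y"
  let ?c = "\<lambda>j t. cross3 (- partial (axis j 1) (newt e) (?p t)) (b - a)"
  have P: "((\<lambda>t. ?c j t $ i) has_integral partial (axis j 1) (edge e a b) y $ i) {0..1}" for i j
  proof -
    have "continuous_on {0..1} (?c j)" by (intro continuous_on_cross continuous_intros continuous_partial_newt_compose)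
    then have "(?c j has_integral partial (axis j 1) (edge e a b) y) {0..1}"
      unfolding partial_eq[OF edge_has_derivative] using integrable_continuous_real by blast
    from has_integral_linear[OF this bounded_linear_vec_nth[of i]] show ?thesis by (simp add: o_def)
  qed
  have D: "((\<lambda>t. partial (b - a) (newt e) (?p t)) has_integral newt e (?p 1) - newt e (?p 0)) {0..1}"
  proof (rule fundamental_theorem_of_calculus)
    fix t :: real
    have "a - y + t *\<^sub>R (b - a) = ?p t" for t by simp
    then show "((\<lambda>t. newt e (?p t)) has_vector_derivative partial (b - a) (newt e) (?p t)) (at t within {0..1})"
      using partial_line[of "newt e" "a - y" t "b - a", OF newt_diff] by (simp add: has_vector_derivative_at_within algebra_simps)
  qed simp
  have D': "((\<lambda>t. partial (b - a) (newt e) (?p t) $ i) has_integral (newt e (b - y) - newt e (a - y)) $ i) {0..1}" for i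
    using has_integral_linear[OF D bounded_linear_vec_nth[of i]] by (simp add: o_def)
  \<comment> \<open>Distance at least \<open>e\<close> from the edge is what makes
    \<open>kap e\<close> vanish along it.\<close>
  have div0: "partial (axis 1 1) (newt e) (?p t) $ 1 + partial (axis 2 1) (newt e) (?p t) $ 2 + partial (axis 3 1) (newt e) (?p t) $ 3 = 0" 
    if "t \<in> {0..1}" for t
  proof -
    have "e \<le> norm (?p t)" using far[OF seg_point[OF that, of a b]] by simp
    from kap_outside[OF e this] show ?thesis by (simp add: kap_def divergence_3)
  qed
  have s: "partial (b - a) (newt e) z $ i = (b - a) $ 1 * partial (axis 1 1) (newt e) z $ i + (b - a) $ 2 * partial (axis 2 1) (newt e) z $ i
     + (b - a) $ 3 * partial (axis 3 1) (newt e) z $ i" for z i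
    unfolding partial_eq_sum_3[OF newt_diff, of "b - a"] by simp
  have comp: "((\<lambda>t. - (partial (b - a) (newt e) (?p t) $ i)) has_integral curl (edge e a b) y $ i) {0..1}" for i
  proof -
    have "((\<lambda>t. ?c 2 t $ 3 - ?c 3 t $ 2) has_integral curl (edge e a b) y $ 1) {0..1}"
         "((\<lambda>t. ?c 3 t $ 1 - ?c 1 t $ 3) has_integral curl (edge e a b) y $ 2) {0..1}"
         "((\<lambda>t. ?c 1 t $ 2 - ?c 2 t $ 1) has_integral curl (edge e a b) y $ 3) {0..1}"
      unfolding curl_nth by (intro has_integral_diff P)+
    moreover have "?c 2 t $ 3 - ?c 3 t $ 2 = - (partial (b - a) (newt e) (?p t) $ 1)" 
      "?c 3 t $ 1 - ?c 1 t $ 3 = - (partial (b - a) (newt e) (?p t) $ 2)" 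
      "?c 1 t $ 2 - ?c 2 t $ 1 = - (partial (b - a) (newt e) (?p t) $ 3)" if "t \<in> {0..1}" for t
      using div0[OF that] unfolding s cross3_def by (simp_all; algebra)+
    ultimately show ?thesis using exhaust_3[of i]
      by (elim disjE) (auto elim!: has_integral_eq[rotated])
  qed
  have "curl (edge e a b) y $ i = - ((newt e (b - y) - newt e (a - y)) $ i)" for i
    using has_integral_unique[OF comp[of i] has_integral_neg[OF D'[of i]]] .
  then show ?thesis by (simp add: vec_eq_iff)
qed

end


section \<open>Smoothing with the kernel and circulation along polygons\<close>

lemma kap_even: "0 < e \<Longrightarrow> kap e (- z) = kap e z"
  by (simp add: kap_eq)

lemma integral_kap_shift:
  assumes e: "0 < e"
  shows "(\<integral>y. kap e (x - y) \<partial>lborel) = (\<integral>y. kap e y \<partial>lborel)"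
proof -
  have m: "kap e \<in> borel_measurable borel" using continuous_kap[OF e] borel_measurable_continuous_onI by blast
  have "(\<integral>y. kap e y \<partial>lborel) = (\<integral>y. kap e y \<partial>distr lborel borel ((+) (- x)))" by (simp add: lborel_distr_plus)
  also have "\<dots> = (\<integral>y. kap e (- x + y) \<partial>lborel)" by (rule integral_distr) (use m in auto)
  also have "\<dots> = (\<integral>y. kap e (x - y) \<partial>lborel)" using kap_even[OF e, of "x - _"] by simp
  finally show ?thesis ..
qed

text \<open>\<open>kap e\<close> is nonnegative and supported in the ball of radius
  \<open>e\<close>, so a variation of \<open>g\<close> by \<open>\<eta>\<close> there changes the
  weighted integral by at most \<open>\<eta>\<close> times the mass. The mass stays explicit because
  it is not normalised to 1.\<close>

lemma kap_average:
  fixes g :: "real^3 \<Rightarrow> real^3"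
  assumes e: "0 < e" and g: "continuous_on UNIV g" and near: "\<And>y. norm (y - x) \<le> e \<Longrightarrow> norm (g y - v) \<le> \<eta>"
  shows "norm ((\<integral>y. kap e (x - y) *\<^sub>R g y \<partial>lborel) - (\<integral>y. kap e y \<partial>lborel) *\<^sub>R v) \<le> \<eta> * (\<integral>y. kap e y \<partial>lborel)"
proof -
  have ck: "continuous_on UNIV (\<lambda>y. kap e (x - y))"
    by (rule continuous_on_compose2[OF continuous_kap[OF e]]) (auto intro: continuous_intros)
  have z: "kap e (x - y) = 0" if "norm x + e \<le> norm y" for y
    using kap_outside[OF e, of "x - y"] norm_triangle_ineq2[of y x] that by (simp add: norm_minus_commute)
  have i1: "integrable lborel (\<lambda>y. kap e (x - y) *\<^sub>R g y)" "integrable lborel (\<lambda>y. kap e (x - y) *\<^sub>R v)" "integrable lborel (\<lambda>y. kap e (x - y))"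
    by (rule integrable_compact_support[where R="norm x + e"]; auto intro!: continuous_intros ck g simp: z)+
  have "(\<integral>y. kap e (x - y) *\<^sub>R g y \<partial>lborel) - (\<integral>y. kap e y \<partial>lborel) *\<^sub>R v
     = (\<integral>y. kap e (x - y) *\<^sub>R g y - kap e (x - y) *\<^sub>R v \<partial>lborel)"
    using i1 by (simp add: integral_kap_shift[OF e])
  also have "norm \<dots> \<le> (\<integral>y. \<eta> * kap e (x - y) \<partial>lborel)"
  proof (rule Bochner_Integration.integral_norm_bound_integral)
    show "norm (kap e (x - y) *\<^sub>R g y - kap e (x - y) *\<^sub>R v) \<le> \<eta> * kap e (x - y)" for y
    proof (cases "norm (y - x) \<le> e")
      case True
      have "norm (kap e (x - y) *\<^sub>R g y - kap e (x - y) *\<^sub>R v) = kap e (x - y) * norm (g y - v)"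
        using kap_nonneg[OF e, of "x - y"] by (simp add: scaleR_diff_right[symmetric])
      also have "\<dots> \<le> kap e (x - y) * \<eta>" using near[OF True] kap_nonneg[OF e] by (intro mult_left_mono) auto
      finally show ?thesis by (simp add: mult.commute)
    next
      case False
      then have "kap e (x - y) = 0" by (intro kap_outside[OF e]) (simp add: norm_minus_commute)
      then show ?thesis by simp
    qed
  qed (use i1 in auto)
  also have "\<dots> = \<eta> * (\<integral>y. kap e y \<partial>lborel)" by (simp add: integral_kap_shift[OF e])
  finally show ?thesis .
qed

lemma integrable_wsum:
  fixes F :: "'a \<Rightarrow> 'a \<Rightarrow> 'm \<Rightarrow> 'b::euclidean_space"
  assumes "\<And>a b. integrable M (F a b)"
  shows "integrable M (\<lambda>y. wsum (\<lambda>a b. F a b y) ps)" "(\<integral>y. wsum (\<lambda>a b. F a b y) ps \<partial>M) = wsum (\<lambda>a b. \<integral>y. F a b y \<partial>M) ps"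
proof (induction "\<lambda>a b. \<integral>y. F a b y \<partial>M" ps rule: wsum.induct)
  case (1 a b ps)
  { case 1 then show ?case using assms "1.hyps" by simp }
  { case 2 then show ?case using assms "1.hyps" by simp }
qed auto

text \<open>The Helmholtz identity is integrated along each edge. In the divergence part the kernel
  is a gradient with potential \<open>k\<close>, so each edge contributes a difference of values of
  \<open>k\<close> and the closed polygon telescopes to zero; what remains is the curl paired with
  the field of the edges.\<close>

lemma loop_average:
  fixes g :: "real^3 \<Rightarrow> real^3"
  assumes e: "0 < e" and g: "C1_on UNIV g" and lim: "(g \<longlongrightarrow> 0) at_infinity"
    and dz: "\<And>x. R0 \<le> norm x \<Longrightarrow> divergence g x = 0 \<and> curl g x = 0"
    and ps: "ps \<noteq> []" "hd ps = last ps"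
  shows "wsum (\<lambda>a b. integral {0..1} (\<lambda>t. (\<integral>y. kap e (a + t *\<^sub>R (b - a) - y) *\<^sub>R g y \<partial>lborel) \<bullet> (b - a))) ps
     = - (\<integral>y. curl g y \<bullet> wsum (\<lambda>a b. edge e a b y) ps \<partial>lborel)"
proof -
  obtain k where k: "is_pot UNIV (newt e) k"
    using pot_convex[OF open_UNIV convex_UNIV C1_on_newt[OF e]] curl_newt[OF e] by blast
  have kc: "continuous_on UNIV k" by (rule C1_on_continuous[OF is_pot_C1[OF k C1_on_continuous[OF C1_on_newt[OF e]]]])
  have cg: "continuous_on UNIV (divergence g)" "continuous_on UNIV (curl g)"
    by (auto intro!: C1_on_continuous_divergence C1_on_continuous_curl g)
  have cdg: "continuous_on UNIV (\<lambda>z::real \<times> (real^3). divergence g (snd z))" "continuous_on UNIV (\<lambda>z::real \<times> (real^3). curl g (snd z))"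
    by (rule continuous_on_compose2[OF cg(1)] continuous_on_compose2[OF cg(2)]; auto intro: continuous_intros)+
  let ?F = "\<lambda>a b y. divergence g y * (k (b - y) - k (a - y)) + curl g y \<bullet> edge e a b y"
  have Fc: "continuous_on UNIV (?F a b)" for a b
    by (intro continuous_intros cg C1_on_continuous[OF C1_on_edge[OF e]] continuous_on_compose2[OF kc]) auto
  have Fz: "?F a b y = 0" if "R0 \<le> norm y" for a b y using dz[OF that] by simp
  have Fi: "integrable lborel (?F a b)" for a b by (rule integrable_compact_support[OF Fc Fz])
  have cr: "cross3 u v \<bullet> w = u \<bullet> cross3 v w" for u v w :: "real^3"
    by (simp add: cross3_simps)
  have main: "integral {0..1} (\<lambda>t. (\<integral>y. kap e (a + t *\<^sub>R (b - a) - y) *\<^sub>R g y \<partial>lborel) \<bullet> (b - a)) = - (\<integral>y. ?F a b y \<partial>lborel)" for a b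
  proof -
    let ?p = "\<lambda>t. a + t *\<^sub>R (b - a)"
    let ?n = "\<lambda>t y. newt e (?p t - y)"
    let ?f = "\<lambda>t y. divergence g y * (?n t y \<bullet> (b - a)) + curl g y \<bullet> cross3 (?n t y) (b - a)"
    have nc: "continuous_on UNIV (\<lambda>z::real \<times> (real^3). newt e (?p (fst z) - snd z))"
      by (intro continuous_newt_compose[OF e] continuous_intros)
    have fc: "continuous_on UNIV (\<lambda>(t, y). ?f t y)"
      unfolding case_prod_beta by (intro continuous_intros continuous_on_cross cdg nc)
    have fz: "?f t y = 0" if "R0 \<le> norm y" for t y using dz[OF that] by simp
    have "(\<integral>y. kap e (?p t - y) *\<^sub>R g y \<partial>lborel) \<bullet> (b - a) = - (\<integral>y. ?f t y \<partial>lborel)" for t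
    proof -
      let ?G = "\<lambda>y. divergence g y *\<^sub>R ?n t y + cross3 (curl g y) (?n t y)"
      have "continuous_on UNIV ?G"
        by (intro continuous_intros continuous_on_cross cg continuous_newt_compose[OF e])
      then have Gi: "integrable lborel ?G" by (rule integrable_compact_support[where R=R0]) (use dz in auto)
      have "(\<integral>y. kap e (?p t - y) *\<^sub>R g y \<partial>lborel) \<bullet> (b - a) = - ((\<integral>y. ?G y \<partial>lborel) \<bullet> (b - a))"
        using helmholtz[OF e g lim dz, where x="?p t"] by simp
      also have "(\<integral>y. ?G y \<partial>lborel) \<bullet> (b - a) = (\<integral>y. ?G y \<bullet> (b - a) \<partial>lborel)"
        using integral_bounded_linear[OF bounded_linear_inner_left Gi, of "b - a"] by simp
      also have "\<dots> = (\<integral>y. ?f t y \<partial>lborel)"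
        by (rule Bochner_Integration.integral_cong) (simp_all add: inner_add_left cr)
      finally show ?thesis .
    qed
    then have "integral {0..1} (\<lambda>t. (\<integral>y. kap e (?p t - y) *\<^sub>R g y \<partial>lborel) \<bullet> (b - a)) = - integral {0..1} (\<lambda>t. \<integral>y. ?f t y \<partial>lborel)"
      by simp
    also have "integral {0..1} (\<lambda>t. \<integral>y. ?f t y \<partial>lborel) = (\<integral>y. integral {0..1} (\<lambda>t. ?f t y) \<partial>lborel)"
      by (rule segment_fubini(1)[OF fc fz])
    also have "\<dots> = (\<integral>y. ?F a b y \<partial>lborel)"
    proof (rule Bochner_Integration.integral_cong[OF refl])
      fix y
      have c1: "continuous_on {0..1} (\<lambda>t. ?n t y \<bullet> (b - a))" "continuous_on {0..1} (\<lambda>t. cross3 (?n t y) (b - a))"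
        by (intro continuous_intros continuous_on_cross continuous_newt_compose[OF e])+
      have "integral {0..1} (\<lambda>t. ?n t y \<bullet> (b - a)) = seg (newt e) (a - y) (b - y)"
        by (simp add: seg_def algebra_simps)
      also have "\<dots> = k (b - y) - k (a - y)" by (rule seg_pot[OF k]) simp
      finally have i1: "((\<lambda>t. ?n t y \<bullet> (b - a)) has_integral k (b - y) - k (a - y)) {0..1}"
        using integrable_continuous_real[OF c1(1)] by (metis integrable_integral)
      have i2: "((\<lambda>t. cross3 (?n t y) (b - a)) has_integral edge e a b y) {0..1}"
        unfolding edge_def by (rule integrable_integral[OF integrable_continuous_real[OF c1(2)]])
      have i3: "((\<lambda>t. curl g y \<bullet> cross3 (?n t y) (b - a)) has_integral curl g y \<bullet> edge e a b y) {0..1}"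
        using has_integral_linear[OF i2 bounded_linear_inner_right[of "curl g y"]] by (simp add: o_def)
      show "integral {0..1} (\<lambda>t. ?f t y) = ?F a b y"
        by (rule integral_unique[OF has_integral_add[OF has_integral_mult_right[OF i1] i3]])
    qed
    finally show ?thesis .
  qed
  have "wsum (\<lambda>a b. ?F a b y) ps = curl g y \<bullet> wsum (\<lambda>a b. edge e a b y) ps" for y
  proof -
    have lin: "linear (\<lambda>s. divergence g y * s)" "linear (\<lambda>s. curl g y \<bullet> s)"
      by (auto intro!: linearI simp: algebra_simps inner_add_right)
    have "wsum (\<lambda>a b. ?F a b y) ps = wsum (\<lambda>a b. divergence g y * (k (b - y) - k (a - y))) ps + wsum (\<lambda>a b. curl g y \<bullet> edge e a b y) ps"
      by (induction ps rule: wset.induct) auto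
    also have "\<dots> = divergence g y * (k (last ps - y) - k (hd ps - y)) + curl g y \<bullet> wsum (\<lambda>a b. edge e a b y) ps"
      unfolding wsum_linear[OF lin(1)] wsum_linear[OF lin(2)] by (simp add: wsum_telescope[OF ps(1), of "\<lambda>a. k (a - y)"])
    finally show ?thesis using ps by simp
  qed
  then have "(\<integral>y. curl g y \<bullet> wsum (\<lambda>a b. edge e a b y) ps \<partial>lborel) = wsum (\<lambda>a b. \<integral>y. ?F a b y \<partial>lborel) ps"
    using integrable_wsum(2)[of lborel ?F ps, OF Fi] by simp
  moreover have "wsum (\<lambda>a b. - (\<integral>y. ?F a b y \<partial>lborel)) ps = - wsum (\<lambda>a b. \<integral>y. ?F a b y \<partial>lborel) ps"
    by (rule wsum_linear) (auto intro!: linearI)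
  ultimately show ?thesis by (simp only: main)
qed


subsection \<open>Curl-free fields on the exterior domain\<close>

text \<open>\<open>O_lc\<close> is the form in which boundary regularity enters the construction of
  the potential: small pieces of \<open>\<Omega>\<close> at a boundary point can be chosen
  connected, as needed to extend potentials across the boundary.\<close>

locale exterior_domain =
  fixes \<Omega> :: "(real^3) set"
  assumes O_open: "open \<Omega>" and O_bounded: "bounded \<Omega>"
    and E_connected: "connected (exterior \<Omega>)"
    and O_lc: "\<And>x r. x \<in> closure \<Omega> \<Longrightarrow> 0 < r \<Longrightarrow> \<exists>N. open N \<and> x \<in> N \<and> N \<subseteq> ball x r \<and> connected (N \<inter> \<Omega>)"
begin

lemma E_open: "open (exterior \<Omega>)" by (simp add: open_Compl)

lemma compact_closure_O: "compact (closure \<Omega>)"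
  using O_bounded by (simp add: compact_closure)

text \<open>Since \<open>v\<close> is curl-free, the curl of the truncated field is the cross
  product of the cutoff gradient with \<open>v\<close>. It contains no derivative of
  \<open>v\<close>, so it is again C^1 and its divergence can be taken, although \<open>v\<close>
  itself is only C^1.\<close>

lemma cutoff_field:
  fixes v :: "real^3 \<Rightarrow> real^3"
  assumes v: "C1_on (exterior \<Omega>) v" and cv: "\<And>x. x \<in> exterior \<Omega> \<Longrightarrow> curl v x = 0" 
    and dv: "\<And>x. x \<in> exterior \<Omega> \<Longrightarrow> divergence v x = 0" and v0: "(v \<longlongrightarrow> 0) at_infinity"
    and U: "open U" "closure \<Omega> \<subseteq> U"
  obtains g K' where "C1_on UNIV g" "(g \<longlongrightarrow> 0) at_infinity" "compact K'" "closure \<Omega> \<subseteq> K'" "K' \<subseteq> U"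
    "\<And>y. y \<notin> K' \<Longrightarrow> g y = v y" "\<And>y. y \<notin> K' \<Longrightarrow> divergence g y = 0 \<and> curl g y = 0"
    "C1_on UNIV (curl g)" "\<And>y. divergence (curl g) y = 0"
proof -
  obtain c V K' where c: "C_on 2 UNIV c" "open V" "closure \<Omega> \<subseteq> V" "\<And>x. x \<in> V \<Longrightarrow> c x = (0::real)"
    "compact K'" "K' \<subseteq> U" "\<And>x. x \<notin> K' \<Longrightarrow> c x = 1"
    using cutoff_exists[OF compact_closure_O U] by metis
  let ?E = "exterior \<Omega>"
  have c1: "C1_on UNIV c" and c2: "C1_on UNIV (grad c)"
    using c(1) by (auto simp: C_on_2 intro!: C1_on_grad)
  have cd: "c differentiable (at x)" "grad c differentiable (at x)" for x using c1 c2 by (auto simp: C1_on_def)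
  have vd: "v differentiable (at x)" if "x \<in> ?E" for x using v that by (auto simp: C1_on_def)
  define g where "g y = (if y \<in> ?E then c y *\<^sub>R v y else 0)" for y
  have VK: "V \<subseteq> K'" using c(4,7) by (metis subsetI zero_neq_one)
  have mV: "closed (- V)" "- V \<subseteq> ?E" using c(2,3) by auto
  have g1: "C1_on UNIV g" unfolding g_def[abs_def]
  proof (rule C1_on_extend_zero[OF E_open _ mV])
    show "C1_on ?E (\<lambda>y. c y *\<^sub>R v y)" by (rule C1_on_scaleR[OF C1_on_subset[OF c1] v]) simp
  qed (use c(4) in auto)
  have gV: "g y = 0" if "y \<in> V" for y using c(4)[OF that] by (simp add: g_def)
  have gK: "g y = v y" if "y \<notin> K'" for y using c(7)[OF that] that VK c(3) by (auto simp: g_def)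
  have gradV: "grad c y = 0" if "y \<in> V" for y
    using grad_cong_open[OF c(2) that, of c "\<lambda>x. 0"] c(4) by (simp add: grad_def vec_eq_iff)
  have oK: "open (- K')" using c(5) compact_imp_closed by blast
  have gradK: "grad c y = 0" if "y \<notin> K'" for y
    using grad_cong_open[OF oK, of y c "\<lambda>x. 1"] that c(7) by (simp add: grad_def vec_eq_iff)
  have cgE: "curl g y = cross3 (grad c y) (v y)" if "y \<in> ?E" for y
  proof -
    have "curl g y = curl (\<lambda>y. c y *\<^sub>R v y) y"
      by (rule curl_cong_open[OF E_open that]) (simp add: g_def)
    then show ?thesis using curl_scaleR[OF cd(1) vd[OF that]] cv[OF that] by simp
  qed
  have dgE: "divergence g y = grad c y \<bullet> v y" if "y \<in> ?E" for y
  proof -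
    have "divergence g y = divergence (\<lambda>y. c y *\<^sub>R v y) y"
      by (rule divergence_cong_open[OF E_open that]) (simp add: g_def)
    then show ?thesis using divergence_scaleR[OF cd(1) vd[OF that]] dv[OF that] by simp
  qed
  have cgV: "curl g y = 0" if "y \<in> V" for y
    using curl_cong_open[OF c(2) that, of g "\<lambda>x. 0"] gV by (simp add: curl_nth vec_eq_iff forall_3)
  have J: "curl g = (\<lambda>y. if y \<in> ?E then cross3 (grad c y) (v y) else 0)"
  proof
    fix y show "curl g y = (if y \<in> ?E then cross3 (grad c y) (v y) else 0)"
      using cgE[of y] cgV[of y] c(3) by auto
  qed
  have J1: "C1_on UNIV (curl g)" unfolding J
  proof (rule C1_on_extend_zero[OF E_open _ mV])
    show "C1_on ?E (\<lambda>y. cross3 (grad c y) (v y))" by (rule C1_on_cross[OF C1_on_subset[OF c2] v]) simp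
  qed (use gradV in auto)
  have JE: "divergence (curl g) y = 0" for y
  proof (cases "y \<in> ?E")
    case True
    have "divergence (curl g) y = divergence (\<lambda>y. cross3 (grad c y) (v y)) y"
      by (rule divergence_cong_open[OF E_open True]) (simp add: J)
    also have "\<dots> = 0"
      using divergence_cross[OF cd(2) vd[OF True]] cv[OF True] curl_grad[OF open_UNIV UNIV_I c(1)] by simp
    finally show ?thesis .
  next
    case False
    then have "y \<in> V" using c(3) by auto
    then show ?thesis using divergence_cong_open[OF c(2), of y "curl g" "\<lambda>x. 0"] cgV by (simp add: divergence_def)
  qed
  have "eventually (\<lambda>y. v y = g y) at_infinity"
  proof -
    obtain B where "\<And>y. y \<in> K' \<Longrightarrow> norm y \<le> B" using compact_imp_bounded[OF c(5)] bounded_iff by blast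
    then have "v y = g y" if "B + 1 \<le> norm y" for y using that gK[of y] by force
    then show ?thesis unfolding eventually_at_infinity by blast
  qed
  then have "(g \<longlongrightarrow> 0) at_infinity" using v0 by (rule Lim_transform_eventually[rotated])
  moreover have "divergence g y = 0 \<and> curl g y = 0" if "y \<notin> K'" for y
  proof -
    have "y \<in> ?E" using that VK c(3) by auto
    then show ?thesis using dgE cgE gradK[OF that] by simp
  qed
  moreover have "closure \<Omega> \<subseteq> K'" using VK c(3) by blast
  ultimately show thesis using that g1 c(5,6) gK J1 JE by blast
qed

text \<open>\<open>J \<bullet> B\<close> is the divergence of \<open>\<psi>\<close> times
  \<open>J\<close>, a compactly supported C^1 field once it is extended by zero outside
  \<open>U\<close>.\<close>

lemma flux_potential_zero:
  fixes J :: "real^3 \<Rightarrow> real^3"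
  assumes J: "C1_on UNIV J" "\<And>y. divergence J y = 0" "\<And>y. y \<notin> K \<Longrightarrow> J y = 0"
    and K: "compact K" "K \<subseteq> U" and U: "open U" and B: "continuous_on U B" "is_pot U B \<psi>"
  shows "(\<integral>y. J y \<bullet> B y \<partial>lborel) = 0"
proof -
  let ?F = "\<lambda>y. if y \<in> U then \<psi> y *\<^sub>R J y else 0"
  have p1: "C1_on U \<psi>" by (rule is_pot_C1[OF B(2,1)])
  have F: "C1_on UNIV ?F"
    by (rule C1_on_extend_zero[OF U C1_on_scaleR[OF p1 C1_on_subset[OF J(1)]] compact_imp_closed[OF K(1)] K(2)])
      (use J(3) in auto)
  obtain R where R: "\<And>y. y \<in> K \<Longrightarrow> norm y \<le> R" using compact_imp_bounded[OF K(1)] bounded_iff by blast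
  have Fz: "?F y = 0" if "R + 1 \<le> norm y" for y using R[of y] that J(3)[of y] by force
  have "divergence ?F y = J y \<bullet> B y" for y
  proof (cases "y \<in> U")
    case True
    have d: "\<psi> differentiable (at y)" "J differentiable (at y)" using p1 J(1) True by (auto simp: C1_on_def)
    have "divergence ?F y = divergence (\<lambda>y. \<psi> y *\<^sub>R J y) y" by (rule divergence_cong_open[OF U True]) simp
    also have "\<dots> = grad \<psi> y \<bullet> J y" using divergence_scaleR[OF d] J(2) by simp
    also have "\<dots> = J y \<bullet> B y" using grad_inner[OF d(1)] is_pot_partial[OF B(2) True] by (simp add: inner_commute)
    finally show ?thesis .
  next
    case False
    then have yK: "y \<in> - K" using K(2) by auto
    have "divergence ?F y = divergence (\<lambda>y. 0) y" 
      by (rule divergence_cong_open[OF _ yK]) (use compact_imp_closed[OF K(1)] J(3) in auto)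
    then show ?thesis using J(3) yK by (simp add: divergence_def)
  qed
  then show ?thesis using integral_divergence_zero[OF F Fz] by simp
qed

lemma exterior_pot:
  fixes v :: "real^3 \<Rightarrow> real^3"
  assumes sc: "simply_connected \<Omega>"
    and v: "C1_on (exterior \<Omega>) v" and cv: "\<And>x. x \<in> exterior \<Omega> \<Longrightarrow> curl v x = 0" 
    and dv: "\<And>x. x \<in> exterior \<Omega> \<Longrightarrow> divergence v x = 0" and v0: "(v \<longlongrightarrow> 0) at_infinity"
  shows "\<exists>\<phi>. is_pot (exterior \<Omega>) v \<phi>"
proof (rule walk_pot[OF E_open E_connected locally_pot_curl_free[OF E_open v cv] C1_on_continuous[OF v]])
  let ?E = "exterior \<Omega>"
  fix ps assume ps: "ps \<noteq> []" "wset ps \<subseteq> ?E" "hd ps = last ps"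
  let ?K = "wset ps"
  let ?nb = "\<lambda>e. (\<Union>x\<in>?K. \<Union>y\<in>cball 0 e. {x + y})"
  have nbc: "compact (?nb e)" for e by (rule compact_sums'[OF compact_wset compact_cball])
  have nbI: "y \<in> ?nb e" if "x \<in> ?K" "norm (y - x) \<le> e" for x y e
    using that by (intro UN_I[of x] UN_I[of "y - x"]) auto
  obtain e0 where e0: "e0 > 0" "?nb e0 \<subseteq> ?E"
  proof -
    have "?K \<subseteq> \<Union>{?E}" "\<And>G. G \<in> {?E} \<Longrightarrow> open G" using ps(2) E_open by auto
    then obtain d where d: "d > 0" "\<And>x. x \<in> ?K \<Longrightarrow> \<exists>G\<in>{?E}. ball x d \<subseteq> G"
      using Heine_Borel_lemma[OF compact_wset, of ps "{?E}"] by metis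
    have "?nb (d / 2) \<subseteq> ?E"
    proof
      fix z assume "z \<in> ?nb (d / 2)"
      then obtain x y where "x \<in> ?K" "norm y \<le> d / 2" "z = x + y" by auto
      then have "z \<in> ball x d" using d(1) by (auto simp: dist_norm)
      then show "z \<in> ?E" using d(2) \<open>x \<in> ?K\<close> by blast
    qed
    then show thesis using that d(1) by (meson half_gt_zero)
  qed
  have avg: "\<exists>g. continuous_on UNIV g \<and> (\<forall>x\<in>?K. \<forall>y. norm (y - x) \<le> e \<longrightarrow> g y = v y) \<and>
     wsum (\<lambda>a b. integral {0..1} (\<lambda>t. (\<integral>y. kap e (a + t *\<^sub>R (b - a) - y) *\<^sub>R g y \<partial>lborel) \<bullet> (b - a))) ps = 0"
    if e: "0 < e" "e \<le> e0" for e
  proof -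
    \<comment> \<open>Off the closed \<open>e\<close>-neighbourhood of the polygon the field of the
      edges is curl-free, and \<open>e \<le> e0\<close> keeps the closure of \<open>\<Omega>\<close>
      inside this open set.\<close>
    let ?W = "- ?nb e"
    let ?B = "\<lambda>y. wsum (\<lambda>a b. edge e a b y) ps"
    have Wo: "open ?W" using nbc[of e] compact_imp_closed by blast
    have OW: "closure \<Omega> \<subseteq> ?W" 
    proof -
      have "?nb e \<subseteq> ?nb e0" using e by fastforce
      then show ?thesis using e0(2) by auto
    qed
    have B1: "C1_on UNIV ?B"
      by (induction ps rule: wset.induct) (auto intro!: C1_on_add C1_on_edge e)
    have cB: "curl ?B y = 0" if y: "y \<in> ?W" for y
    proof -
      have far: "e \<le> norm (x - y)" if "x \<in> ?K" for x
        using nbI[OF that, of y e] y by (force simp: norm_minus_commute)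
      \<comment> \<open>Generalised to all walks inside the polygon, open ones included, so that the
        induction over the vertex list goes through; closedness is used only afterwards.\<close>
      have "curl (\<lambda>y. wsum (\<lambda>a b. edge e a b y) qs) y = wsum (\<lambda>a b. newt e (a - y) - newt e (b - y)) qs" if "wset qs \<subseteq> ?K" for qs
        using that
      proof (induction qs rule: wset.induct)
        case (1 a b qs)
        have C: "C1_on UNIV (\<lambda>y. wsum (\<lambda>a b. edge e a b y) (b # qs))"
          by (induction "b # qs" arbitrary: b qs rule: wset.induct) (auto intro!: C1_on_add C1_on_edge e)
        have "curl (\<lambda>y. edge e a b y + wsum (\<lambda>a b. edge e a b y) (b # qs)) y = 
            curl (edge e a b) y + curl (\<lambda>y. wsum (\<lambda>a b. edge e a b y) (b # qs)) y"
          using C C1_on_edge[OF e(1), of a b] by (auto simp: vec_eq_iff forall_3 curl_nth partial_add C1_on_def)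
        moreover have "curl (edge e a b) y = newt e (a - y) - newt e (b - y)"
          by (rule curl_edge[OF e(1)]) (use far 1(2) in auto)
        ultimately show ?case using 1 by simp
      qed (auto simp: vec_eq_iff forall_3 curl_nth)
      then have "curl ?B y = wsum (\<lambda>a b. newt e (a - y) - newt e (b - y)) ps" by blast
      also have "\<dots> = 0" using wsum_telescope[OF ps(1), of "\<lambda>a. - newt e (a - y)"] ps(3) by simp
      finally show ?thesis .
    qed
    have lW: "locally_pot ?W ?B" by (rule locally_pot_curl_free[OF Wo C1_on_subset[OF B1] cB]) auto
    have lO: "locally_pot \<Omega> ?B"
      by (rule locally_pot_curl_free[OF O_open C1_on_subset[OF B1]]) (use cB OW closure_subset in auto)
    obtain \<psi>0 where "is_pot \<Omega> ?B \<psi>0" using simply_connected_pot[OF O_open sc lO] by blast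
    from pot_neighbourhood[OF compact_closure_O O_lc O_open OW lW this]
    obtain U \<psi> where U: "open U" "closure \<Omega> \<subseteq> U" "U \<subseteq> ?W" "is_pot U ?B \<psi>" by blast
    \<comment> \<open>The cutoff is adapted to the set \<open>U\<close> carrying the potential of
      the edge field, and \<open>U\<close> avoids the \<open>e\<close>-neighbourhood of the polygon;
      hence \<open>g\<close> and \<open>v\<close> agree wherever the averages below look at
      them.\<close>
    obtain g K' where g: "C1_on UNIV g" "(g \<longlongrightarrow> 0) at_infinity" "compact K'" "K' \<subseteq> U"
      "\<And>y. y \<notin> K' \<Longrightarrow> g y = v y" "\<And>y. y \<notin> K' \<Longrightarrow> divergence g y = 0 \<and> curl g y = 0"
      "C1_on UNIV (curl g)" "\<And>y. divergence (curl g) y = 0"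
      using cutoff_field[OF v cv dv v0 U(1,2)] by metis
    obtain R where R: "\<And>y. y \<in> K' \<Longrightarrow> norm y \<le> R" using compact_imp_bounded[OF g(3)] bounded_iff by blast
    have far: "divergence g y = 0 \<and> curl g y = 0" if "R + 1 \<le> norm y" for y
      by (rule g(6)) (use R[of y] that in force)
    have "(\<integral>y. curl g y \<bullet> ?B y \<partial>lborel) = 0"
      by (rule flux_potential_zero[OF g(7,8) _ g(3,4) U(1) C1_on_continuous[OF C1_on_subset[OF B1]] U(4)]) (use g(6) in auto)
    then have "wsum (\<lambda>a b. integral {0..1} (\<lambda>t. (\<integral>y. kap e (a + t *\<^sub>R (b - a) - y) *\<^sub>R g y \<partial>lborel) \<bullet> (b - a))) ps = 0"
      using loop_average[OF e(1) g(1,2) far ps(1,3)] by simp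
    moreover have "g y = v y" if "x \<in> ?K" "norm (y - x) \<le> e" for x y
      using nbI[OF that] g(4,5) U(3) by blast
    ultimately show ?thesis using C1_on_continuous[OF g(1)] by blast
  qed
  \<comment> \<open>The length of the polygon. The circulation is bounded by
    \<open>\<eta> * L\<close> for every \<open>\<eta>\<close>, with \<open>e\<close> and the
    truncated field chosen anew for each \<open>\<eta>\<close>.\<close>
  define L where "L = wsum (\<lambda>a b. norm (b - a)) ps"
  have bound: "\<bar>wsum (seg v) ps\<bar> \<le> \<eta> * L" if \<eta>: "\<eta> > 0" for \<eta>
  proof -
    have "uniformly_continuous_on (?nb e0) v"
      by (rule compact_uniformly_continuous[OF continuous_on_subset[OF C1_on_continuous[OF v] e0(2)] nbc])
    then obtain d where d: "d > 0" "\<And>x y. x \<in> ?nb e0 \<Longrightarrow> y \<in> ?nb e0 \<Longrightarrow> dist y x < d \<Longrightarrow> dist (v y) (v x) < \<eta>"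
      unfolding uniformly_continuous_on_def using \<eta> by metis
    define e where "e = min e0 (d / 2)"
    have e: "0 < e" "e \<le> e0" "e < d" using d(1) e0(1) by (auto simp: e_def)
    obtain g where g: "continuous_on UNIV g" "\<And>x y. x \<in> ?K \<Longrightarrow> norm (y - x) \<le> e \<Longrightarrow> g y = v y"
      "wsum (\<lambda>a b. integral {0..1} (\<lambda>t. (\<integral>y. kap e (a + t *\<^sub>R (b - a) - y) *\<^sub>R g y \<partial>lborel) \<bullet> (b - a))) ps = 0"
      using avg[OF e(1,2)] by blast
    define C where "C = (\<integral>y. kap e y \<partial>lborel)"
    have C: "C > 0" using integral_kap_lower[OF e(1)] by (simp add: C_def)
    let ?A = "\<lambda>x. \<integral>y. kap e (x - y) *\<^sub>R g y \<partial>lborel"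
    have near: "norm (?A x - C *\<^sub>R v x) \<le> \<eta> * C" if x: "x \<in> ?K" for x
      unfolding C_def
    proof (rule kap_average[OF e(1) g(1)])
      fix y assume y: "norm (y - x) \<le> e"
      have "dist (v y) (v x) < \<eta>"
        by (rule d(2)) (use nbI[OF x, of x e0] nbI[OF x, of y e0] y e e0 in \<open>auto simp: dist_norm\<close>)
      then show "norm (g y - v x) \<le> \<eta>" using g(2)[OF x y] by (simp add: dist_norm)
    qed
    have cA: "continuous_on ?K ?A"
    proof -
      obtain M where M: "\<And>x. x \<in> ?K \<Longrightarrow> norm x \<le> M" using compact_imp_bounded[OF compact_wset] bounded_iff by blast
      have kz: "kap e (x - y) *\<^sub>R g y = 0" if "x \<in> ?K" "M + e \<le> norm y" for x y
        using kap_outside[OF e(1), of "x - y"] norm_triangle_ineq2[of y x] M[OF that(1)] that(2) by (simp add: norm_minus_commute)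
      have kc: "continuous_on A (\<lambda>z. kap e (f z))" if "continuous_on A f" for f :: "(real^3) \<times> (real^3) \<Rightarrow> real^3" and A
        by (rule continuous_on_compose2[OF continuous_kap[OF e(1)] that]) simp
      let ?Q = "cbox (\<chi> i. -(M + e)) (\<chi> i. M + e) :: (real^3) set"
      have "continuous_on (?K \<times> ?Q) (\<lambda>(x, y). kap e (x - y) *\<^sub>R g y)"
        unfolding case_prod_beta
        by (intro continuous_intros kc continuous_on_compose2[OF g(1) continuous_on_snd[OF continuous_on_id]]) auto
      from integral_continuous_on_param[OF this]
      have "continuous_on ?K (\<lambda>x. integral ?Q (\<lambda>y. kap e (x - y) *\<^sub>R g y))" by simp
      moreover have "?A x = integral ?Q (\<lambda>y. kap e (x - y) *\<^sub>R g y)" if "x \<in> ?K" for x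
      proof (rule lborel_integral_cbox)
        have "continuous_on UNIV (\<lambda>y. kap e (x - y))"
          by (rule continuous_on_compose2[OF continuous_kap[OF e(1)]]) (auto intro: continuous_intros)
        then show "continuous_on UNIV (\<lambda>y. kap e (x - y) *\<^sub>R g y)" by (intro continuous_intros g(1))
      qed (use kz[OF that] in auto)
      ultimately show ?thesis by (simp cong: continuous_on_cong)
    qed
    have "norm (wsum (\<lambda>a b. integral {0..1} (\<lambda>t. ?A (a + t *\<^sub>R (b - a)) \<bullet> (b - a)) - C * seg v a b) ps) \<le> wsum (\<lambda>a b. \<eta> * C * norm (b - a)) ps"
    proof (rule wsum_norm_le[OF order.refl])
      fix a b assume ab: "closed_segment a b \<subseteq> ?K"
      let ?p = "\<lambda>t. a + t *\<^sub>R (b - a)"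
      have pK: "?p t \<in> ?K" if "t \<in> {0..1}" for t using seg_point[OF that] ab by blast
      have c1: "continuous_on {0..1} (\<lambda>t. ?A (?p t) \<bullet> (b - a))"
        by (intro continuous_intros continuous_on_compose2[OF cA]) (use pK in auto)
      have c2: "continuous_on {0..1} (\<lambda>t. v (?p t) \<bullet> (b - a))"
      proof (intro continuous_intros continuous_on_compose2[OF C1_on_continuous[OF v]])
        show "?p ` {0..1} \<subseteq> ?E" using pK ps(2) by blast
      qed
      have "integral {0..1} (\<lambda>t. ?A (?p t) \<bullet> (b - a)) - C * seg v a b = integral {0..1} (\<lambda>t. ?A (?p t) \<bullet> (b - a) - C * (v (?p t) \<bullet> (b - a)))"
        unfolding seg_def
        by (rule integral_unique[symmetric]) (intro has_integral_diff has_integral_mult_right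
            integrable_integral integrable_continuous_real c1 c2)
      also have "norm \<dots> \<le> integral {0..1::real} (\<lambda>t. \<eta> * C * norm (b - a))"
      proof (rule integral_norm_bound_integral)
        show "(\<lambda>t. ?A (?p t) \<bullet> (b - a) - C * (v (?p t) \<bullet> (b - a))) integrable_on {0..1}"
          by (intro integrable_continuous_real continuous_intros c1 c2)
        show "norm (?A (?p t) \<bullet> (b - a) - C * (v (?p t) \<bullet> (b - a))) \<le> \<eta> * C * norm (b - a)" if "t \<in> {0..1}" for t
        proof -
          have "?A (?p t) \<bullet> (b - a) - C * (v (?p t) \<bullet> (b - a)) = (?A (?p t) - C *\<^sub>R v (?p t)) \<bullet> (b - a)"
            by (simp add: inner_diff_left)
          also have "norm \<dots> \<le> norm (?A (?p t) - C *\<^sub>R v (?p t)) * norm (b - a)" by (simp add: Cauchy_Schwarz_ineq2)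
          also have "\<dots> \<le> \<eta> * C * norm (b - a)" by (intro mult_right_mono near pK that) simp
          finally show ?thesis .
        qed
      qed auto
      finally show "norm (integral {0..1} (\<lambda>t. ?A (?p t) \<bullet> (b - a)) - C * seg v a b) \<le> \<eta> * C * norm (b - a)" by simp
    qed
    moreover have "wsum (\<lambda>a b. integral {0..1} (\<lambda>t. ?A (a + t *\<^sub>R (b - a)) \<bullet> (b - a)) - C * seg v a b) ps = - (C * wsum (seg v) ps)"
      unfolding wsum_diff g(3) by (subst wsum_linear[of "\<lambda>s. C * s"]) (auto intro!: linearI simp: algebra_simps)
    moreover have "wsum (\<lambda>a b. \<eta> * C * norm (b - a)) ps = \<eta> * C * L"
      unfolding L_def by (subst wsum_linear[of "\<lambda>s. \<eta> * C * s"]) (auto intro!: linearI simp: algebra_simps)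
    ultimately have "C * \<bar>wsum (seg v) ps\<bar> \<le> C * (\<eta> * L)" using C by (simp add: abs_mult algebra_simps)
    then show ?thesis using C by simp
  qed
  show "wsum (seg v) ps = 0"
  proof (rule ccontr)
    assume s: "wsum (seg v) ps \<noteq> 0"
    have "L \<ge> 0" unfolding L_def by (induction ps rule: wset.induct) auto
    then have "\<bar>wsum (seg v) ps\<bar> / (2 * (L + 1)) * L < \<bar>wsum (seg v) ps\<bar>" using s by (simp add: field_simps add_nonneg_pos)
    moreover have "\<bar>wsum (seg v) ps\<bar> \<le> \<bar>wsum (seg v) ps\<bar> / (2 * (L + 1)) * L"
      using s \<open>L \<ge> 0\<close> by (intro bound) simp
    ultimately show False by simp
  qed
qed

end


subsection \<open>Decay at infinity\<close>

lemma pot_lipschitz: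
  assumes "is_pot U v \<phi>" "closed_segment a b \<subseteq> U" "\<And>x. x \<in> closed_segment a b \<Longrightarrow> norm (v x) \<le> M"
  shows "\<bar>\<phi> b - \<phi> a\<bar> \<le> M * norm (b - a)"
proof -
  have "norm (\<phi> b - \<phi> a) \<le> M * norm (b - a)"
  proof (rule differentiable_bound[where S="closed_segment a b" and f'="\<lambda>x h. v x \<bullet> h"])
    show "(\<phi> has_derivative (\<lambda>h. v x \<bullet> h)) (at x within closed_segment a b)" if "x \<in> closed_segment a b" for x
      using assms(1,2) that unfolding is_pot_def by (blast intro: has_derivative_at_withinI)
    show "onorm (\<lambda>h. v x \<bullet> h) \<le> M" if "x \<in> closed_segment a b" for x
    proof (rule onorm_le)
      fix h
      have "norm (v x \<bullet> h) \<le> norm (v x) * norm h" by (simp add: Cauchy_Schwarz_ineq2)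
      also have "\<dots> \<le> M * norm h" by (intro mult_right_mono assms(3) that) simp
      finally show "norm (v x \<bullet> h) \<le> M * norm h" .
    qed
  qed auto
  then show ?thesis by simp
qed

text \<open>Serves to join two points of a sphere by two chords through a third point orthogonal to
  both; chords between orthogonal points stay away from the centre.\<close>

lemma orthogonal_pair_exists:
  fixes x y :: "real^3"
  shows "\<exists>w. norm w = 1 \<and> x \<bullet> w = 0 \<and> y \<bullet> w = 0"
proof -
  obtain z where z: "z \<noteq> 0" "\<And>u. u \<in> span {x, y} \<Longrightarrow> orthogonal z u"
  proof -
    have "dim {x, y} \<le> card {x, y}" by (rule dim_le_card[OF span_superset]) simp
    also have "\<dots> \<le> 2" by (rule card_insert_le_m1) auto
    finally have "dim {x, y} < DIM(real^3)" by simp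
    then show thesis using orthogonal_to_subspace_exists[of "{x,y}"] that by blast
  qed
  show ?thesis
    by (rule exI[of _ "(1 / norm z) *\<^sub>R z"]) (use z(1) z(2)[OF span_base, of x] z(2)[OF span_base, of y] in \<open>auto simp: orthogonal_def inner_commute\<close>)
qed

text \<open>Integrating the bound \<open>C / r ^ 3\<close> along a ray costs one power and gives the
  factor \<open>1 / 2\<close>. This yields a limit along one ray; it is the same along all rays
  because the oscillation of \<open>\<phi>\<close> on the sphere of radius \<open>\<rho>\<close> is
  of order \<open>1 / \<rho> ^ 2\<close>.\<close>

lemma potential_decay:
  fixes \<phi> :: "real^3 \<Rightarrow> real"
  assumes R: "0 < R" and p: "is_pot {x. R \<le> norm x} v \<phi>" and C: "\<And>x. R \<le> norm x \<Longrightarrow> norm (v x) \<le> C / norm x ^ 3"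
  shows "\<exists>c. \<forall>x. R \<le> norm x \<longrightarrow> \<bar>\<phi> x - c\<bar> \<le> C / 2 / norm x ^ 2"
proof -
  have C0: "0 \<le> C"
  proof -
    have "norm (R *\<^sub>R axis 1 1 :: real^3) = R" using R by (simp add: norm_axis_1)
    then have "0 \<le> C / R ^ 3" using C[of "R *\<^sub>R axis 1 1"] norm_ge_zero[of "v (R *\<^sub>R axis 1 1)"] by (metis order.refl order.trans)
    then show ?thesis using R by (simp add: zero_le_divide_iff)
  qed
  have radial: "\<bar>\<phi> (s *\<^sub>R x) - \<phi> x\<bar> \<le> C / 2 / norm x ^ 2" if x: "R \<le> norm x" and s: "1 \<le> s" for x s
  proof -
    have nx: "norm x > 0" using x R by linarith
    have d: "((\<lambda>t. \<phi> (t *\<^sub>R x)) has_real_derivative v (t *\<^sub>R x) \<bullet> x) (at t)" if t: "1 \<le> t" for t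
    proof -
      have "R \<le> norm (t *\<^sub>R x)" using t x mult_right_mono[OF t, of "norm x"] by simp
      then have m: "t *\<^sub>R x \<in> {x. R \<le> norm x}" by simp
      then have "\<phi> differentiable (at (t *\<^sub>R x))" using p unfolding is_pot_def differentiable_def by blast
      then show ?thesis using partial_line[of \<phi> 0 t x] is_pot_partial[OF p m, of x]
        by (simp add: has_real_derivative_iff_has_vector_derivative)
    qed
    have b: "\<bar>v (t *\<^sub>R x) \<bullet> x\<bar> \<le> C / (t ^ 3 * norm x ^ 2)" if t: "1 \<le> t" for t
    proof -
      have "R \<le> norm (t *\<^sub>R x)" using t x mult_right_mono[OF t, of "norm x"] by simp
      then have "norm (v (t *\<^sub>R x)) \<le> C / norm (t *\<^sub>R x) ^ 3" by (rule C)
      then have "norm (v (t *\<^sub>R x)) * norm x \<le> C / norm (t *\<^sub>R x) ^ 3 * norm x" by (rule mult_right_mono) simp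
      also have "\<dots> = C / (t ^ 3 * norm x ^ 2)" using nx t by (simp add: field_simps power_numeral_reduce)
      finally show ?thesis using Cauchy_Schwarz_ineq2[of "v (t *\<^sub>R x)" x] by linarith
    qed
    have q: "((\<lambda>t. - C / 2 / (t ^ 2 * norm x ^ 2)) has_real_derivative C / (t ^ 3 * norm x ^ 2)) (at t)" if "1 \<le> t" for t
      using that nx by (auto intro!: derivative_eq_intros simp: field_simps power_numeral_reduce)
    \<comment> \<open>An antiderivative of the bound: adding \<open>\<phi>\<close> along the ray to
      it or subtracting \<open>\<phi>\<close> from it gives nondecreasing functions, which replaces
      integrating the derivative.\<close>
    let ?q = "\<lambda>t. - C / 2 / (t ^ 2 * norm x ^ 2)"
    have "\<phi> (1 *\<^sub>R x) + ?q 1 \<le> \<phi> (s *\<^sub>R x) + ?q s"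
    proof (rule DERIV_nonneg_imp_nondecreasing[OF s])
      fix t :: real assume "1 \<le> t" "t \<le> s"
      then show "\<exists>y. ((\<lambda>t. \<phi> (t *\<^sub>R x) + ?q t) has_real_derivative y) (at t) \<and> 0 \<le> y"
        using DERIV_add[OF d q, of t] b[of t] by (intro exI conjI) auto
    qed
    moreover have "?q 1 - \<phi> (1 *\<^sub>R x) \<le> ?q s - \<phi> (s *\<^sub>R x)"
    proof (rule DERIV_nonneg_imp_nondecreasing[OF s])
      fix t :: real assume "1 \<le> t" "t \<le> s"
      then show "\<exists>y. ((\<lambda>t. ?q t - \<phi> (t *\<^sub>R x)) has_real_derivative y) (at t) \<and> 0 \<le> y"
        using DERIV_diff[OF q d, of t] b[of t] by (intro exI conjI) auto
    qed
    moreover have "?q s \<le> 0" using C0 by simp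
    ultimately show ?thesis by (simp add: abs_le_iff)
  qed
  \<comment> \<open>For orthogonal \<open>x\<close> and \<open>y\<close> of norm
    \<open>\<rho>\<close> the chord stays at distance at least \<open>\<rho> / 2\<close> from the
    origin, so the gradient is at most \<open>8 * C / \<rho> ^ 3\<close> along a chord no longer
    than \<open>2 * \<rho>\<close>.\<close>
  have perp: "\<bar>\<phi> y - \<phi> x\<bar> \<le> 16 * C / \<rho> ^ 2" if \<rho>: "2 * R \<le> \<rho>" and n: "norm x = \<rho>" "norm y = \<rho>" and o: "x \<bullet> y = 0" for x y \<rho>
  proof -
    have \<rho>0: "\<rho> > 0" using \<rho> R by linarith
    have far: "\<rho> / 2 \<le> norm z" if zz: "z \<in> closed_segment x y" for z
    proof -
      obtain t where t: "0 \<le> t" "t \<le> 1" "z = (1 - t) *\<^sub>R x + t *\<^sub>R y" using zz by (auto simp: in_segment)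
      have "(norm z)\<^sup>2 = ((1 - t)\<^sup>2 + t\<^sup>2) * \<rho>\<^sup>2"
      proof -
        have xx: "x \<bullet> x = \<rho>\<^sup>2" "y \<bullet> y = \<rho>\<^sup>2" using n by (simp_all add: power2_norm_eq_inner[symmetric])
        have "z \<bullet> z = (1 - t)\<^sup>2 * (x \<bullet> x) + 2 * ((1 - t) * t) * (x \<bullet> y) + t\<^sup>2 * (y \<bullet> y)"
          unfolding t by (simp add: inner_add_left inner_add_right inner_commute[of y x] power2_eq_square) (simp add: algebra_simps)
        then show ?thesis unfolding power2_norm_eq_inner xx o by (simp add: distrib_right)
      qed
      moreover have "1 / 4 \<le> (1 - t)\<^sup>2 + t\<^sup>2"
        using zero_le_power2[of "2 * t - 1"] by (simp add: power2_eq_square algebra_simps)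
      ultimately have "(\<rho> / 2)\<^sup>2 \<le> (norm z)\<^sup>2"
        using mult_right_mono[of "1/4" "(1 - t)\<^sup>2 + t\<^sup>2" "\<rho>\<^sup>2"] by (simp add: power_divide)
      then show ?thesis by (rule power2_le_imp_le) simp
    qed
    have "\<bar>\<phi> y - \<phi> x\<bar> \<le> (8 * C / \<rho> ^ 3) * norm (y - x)"
    proof (rule pot_lipschitz[OF p])
      show "closed_segment x y \<subseteq> {x. R \<le> norm x}" using far \<rho> by force
      show "norm (v z) \<le> 8 * C / \<rho> ^ 3" if "z \<in> closed_segment x y" for z
      proof -
        have "norm (v z) \<le> C / norm z ^ 3" using far[OF that] \<rho> by (intro C) simp
        also have "\<dots> \<le> C / (\<rho> / 2) ^ 3" using far[OF that] \<rho>0 C0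
          by (intro divide_left_mono power_mono mult_pos_pos zero_less_power) auto
        finally show ?thesis by (simp add: power_divide mult.commute)
      qed
    qed
    also have "\<dots> \<le> (8 * C / \<rho> ^ 3) * (2 * \<rho>)"
      using norm_triangle_ineq4[of y x] n C0 \<rho>0 by (intro mult_left_mono) auto
    also have "\<dots> = 16 * C / \<rho> ^ 2" using \<rho>0 by (simp add: field_simps power_numeral_reduce)
    finally show ?thesis .
  qed
  have sphere: "\<bar>\<phi> y - \<phi> x\<bar> \<le> 32 * C / \<rho> ^ 2" if \<rho>: "2 * R \<le> \<rho>" and n: "norm x = \<rho>" "norm y = \<rho>" for x y \<rho>
  proof -
    obtain w where w: "norm w = 1" "x \<bullet> w = 0" "y \<bullet> w = 0" using orthogonal_pair_exists by blast
    have "\<rho> > 0" using \<rho> R by linarith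
    then have "\<bar>\<phi> (\<rho> *\<^sub>R w) - \<phi> x\<bar> \<le> 16 * C / \<rho> ^ 2" "\<bar>\<phi> (\<rho> *\<^sub>R w) - \<phi> y\<bar> \<le> 16 * C / \<rho> ^ 2"
      using perp[OF \<rho> n(1), of "\<rho> *\<^sub>R w"] perp[OF \<rho> n(2), of "\<rho> *\<^sub>R w"] w by simp_all
    then show ?thesis by (simp add: abs_le_iff)
  qed
  define a where "a n = \<phi> (real n *\<^sub>R axis 1 1)" for n :: nat
  have na: "norm (s *\<^sub>R axis 1 1 :: real^3) = s" if "0 \<le> s" for s using that by (simp add: norm_axis_1)
  have "Cauchy a"
  proof (rule metric_CauchyI)
    fix e :: real assume e: "0 < e"
    obtain N :: nat where N: "max (max R 1) (C / e) < real N" using reals_Archimedean2 by blast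
    then have N': "R \<le> real N" "1 \<le> real N" "C / e < real N" by auto
    have step: "\<bar>a m - a N\<bar> < e / 2" if "N \<le> m" for m
    proof -
      have "\<bar>\<phi> ((real m / real N) *\<^sub>R (real N *\<^sub>R axis 1 1)) - \<phi> (real N *\<^sub>R axis 1 1)\<bar> \<le> C / 2 / norm (real N *\<^sub>R axis 1 1 :: real^3) ^ 2"
        by (rule radial) (use N' that in \<open>auto simp: na\<close>)
      then have "\<bar>a m - a N\<bar> \<le> C / 2 / real N ^ 2" using N' by (simp add: a_def na)
      also have "\<dots> \<le> C / 2 / real N" using N' C0 self_le_power[of "real N" 2] 
        by (intro divide_left_mono) auto
      also have "\<dots> < e / 2" using N' e by (simp add: field_simps)
      finally show ?thesis .
    qed
    show "\<exists>M. \<forall>m\<ge>M. \<forall>n\<ge>M. dist (a m) (a n) < e"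
    proof (intro exI[of _ N] allI impI)
      fix m n assume "N \<le> m" "N \<le> n"
      then have "\<bar>a m - a N\<bar> < e / 2" "\<bar>a n - a N\<bar> < e / 2" using step by auto
      then show "dist (a m) (a n) < e" unfolding dist_real_def by linarith
    qed
  qed
  then obtain c where c: "a \<longlonglongrightarrow> c" using Cauchy_convergent_iff convergent_def by blast
  have "\<bar>\<phi> x - c\<bar> \<le> C / 2 / norm x ^ 2" if x: "R \<le> norm x" for x
  proof (rule field_le_epsilon)
    fix e :: real assume e: "0 < e"
    have nx: "norm x > 0" using x R by linarith
    obtain N1 where N1: "\<And>n. n \<ge> N1 \<Longrightarrow> \<bar>a n - c\<bar> < e / 2" using c e LIMSEQ_D[of a c "e / 2"] by auto
    obtain N2 :: nat where N2: "max (max (2 * R) 1) (max (norm x) (64 * C / e)) < real N2" using reals_Archimedean2 by blast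
    let ?n = "max N1 N2"
    have n: "2 * R \<le> real ?n" "1 \<le> real ?n" "norm x \<le> real ?n" "64 * C / e < real ?n" using N2 by auto
    have n0: "0 < real ?n" using n(2) by linarith
    let ?s = "real ?n / norm x"
    have "\<bar>\<phi> (?s *\<^sub>R x) - \<phi> x\<bar> \<le> C / 2 / norm x ^ 2" by (rule radial[OF x]) (use n nx in simp)
    moreover have "\<bar>a ?n - \<phi> (?s *\<^sub>R x)\<bar> \<le> 32 * C / real ?n ^ 2"
      unfolding a_def by (rule sphere[OF n(1)]) (use n nx in \<open>simp_all add: na del: of_nat_max\<close>)
    moreover have "32 * C / real ?n ^ 2 \<le> 32 * C / real ?n"
      by (rule divide_left_mono[OF self_le_power[OF n(2)] _ mult_pos_pos[OF zero_less_power[OF n0] n0]]) (use C0 in simp_all)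
    moreover have "32 * C / real ?n < e / 2" using n e by (simp add: field_simps del: of_nat_max)
    moreover have "\<bar>a ?n - c\<bar> < e / 2" by (rule N1) simp
    ultimately show "\<bar>\<phi> x - c\<bar> \<le> C / 2 / norm x ^ 2 + e" by linarith
  qed
  then show ?thesis by blast
qed

context exterior_domain
begin

text \<open>\<open>g\<close> is curl-free on the whole space, so its smoothed values are integrals
  of the compactly supported density \<open>f\<close> against the kernel. Mean zero of
  \<open>f\<close> allows subtracting the kernel at \<open>x\<close>, and the difference of the
  kernel at \<open>x - y\<close> and at \<open>x\<close> is one order smaller than the
  kernel.\<close>

lemma gradient_decay:
  fixes v u :: "real^3 \<Rightarrow> real^3"
  assumes v: "C1_on (exterior \<Omega>) v" and cv: "\<And>x. x \<in> exterior \<Omega> \<Longrightarrow> curl v x = 0" 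
    and dv: "\<And>x. x \<in> exterior \<Omega> \<Longrightarrow> divergence v x = 0" and v0: "(v \<longlongrightarrow> 0) at_infinity"
    and p: "is_pot (exterior \<Omega>) v \<phi>"
    and u: "C1_on (exterior \<Omega>) u" and cu: "\<And>x. x \<in> exterior \<Omega> \<Longrightarrow> curl u x = v x"
  shows "\<exists>R>0. \<exists>C. - ball 0 R \<subseteq> exterior \<Omega> \<and> (\<forall>x. R \<le> norm x \<longrightarrow> norm (v x) \<le> C / norm x ^ 3)"
proof -
  let ?E = "exterior \<Omega>"
  obtain c V K' where c: "C_on 2 UNIV c" "open V" "closure \<Omega> \<subseteq> V" "\<And>x. x \<in> V \<Longrightarrow> c x = (0::real)"
    "compact K'" "\<And>x. x \<notin> K' \<Longrightarrow> c x = 1"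
    using cutoff_exists[OF compact_closure_O open_UNIV] by (metis subset_UNIV)
  have c1: "C1_on UNIV c" and c2: "C1_on UNIV (grad c)"
    using c(1) by (auto simp: C_on_2 intro!: C1_on_grad)
  have cd: "c differentiable (at x)" "grad c differentiable (at x)" for x using c1 c2 by (auto simp: C1_on_def)
  have p1: "C1_on ?E \<phi>" by (rule is_pot_C1[OF p C1_on_continuous[OF v]])
  have vd: "v differentiable (at x)" "\<phi> differentiable (at x)" if "x \<in> ?E" for x using v p1 that by (auto simp: C1_on_def)
  have gp: "grad \<phi> x = v x" if "x \<in> ?E" for x using p that by (auto simp: is_pot_def intro: grad_eqI)
  define g where "g y = (if y \<in> ?E then c y *\<^sub>R v y + \<phi> y *\<^sub>R grad c y else 0)" for y
  have VK: "V \<subseteq> K'" using c(4,6) by (metis subsetI zero_neq_one)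
  have mV: "closed (- V)" "- V \<subseteq> ?E" using c(2,3) by auto
  have gradV: "grad c y = 0" if "y \<in> V" for y
    using grad_cong_open[OF c(2) that, of c "\<lambda>x. 0"] c(4) by (simp add: grad_def vec_eq_iff)
  have oK: "open (- K')" using c(5) compact_imp_closed by blast
  have gradK: "grad c y = 0" if "y \<notin> K'" for y
    using grad_cong_open[OF oK, of y c "\<lambda>x. 1"] that c(6) by (simp add: grad_def vec_eq_iff)
  have g1: "C1_on UNIV g" unfolding g_def[abs_def]
  proof (rule C1_on_extend_zero[OF E_open _ mV])
    show "C1_on ?E (\<lambda>y. c y *\<^sub>R v y + \<phi> y *\<^sub>R grad c y)" 
      by (rule C1_on_add[OF C1_on_scaleR[OF C1_on_subset[OF c1] v] C1_on_scaleR[OF p1 C1_on_subset[OF c2]]]) auto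
  qed (use c(4) gradV in auto)
  have gK: "g y = v y" if "y \<notin> K'" for y using c(6)[OF that] that VK c(3) gradK[OF that] by (auto simp: g_def)
  have curlg: "curl g y = 0" for y
  proof (cases "y \<in> ?E")
    case True
    have "curl g y = curl (\<lambda>y. c y *\<^sub>R v y + \<phi> y *\<^sub>R grad c y) y"
      by (rule curl_cong_open[OF E_open True]) (simp add: g_def)
    also have "\<dots> = curl (\<lambda>y. c y *\<^sub>R v y) y + curl (\<lambda>y. \<phi> y *\<^sub>R grad c y) y"
      using cd vd[OF True] by (simp add: vec_eq_iff forall_3 curl_nth partial_add differentiable_scaleR)
    also have "\<dots> = cross3 (grad c y) (v y) + cross3 (v y) (grad c y)"
      using cv[OF True] gp[OF True] curl_grad[OF open_UNIV UNIV_I c(1)] by (simp add: curl_scaleR cd vd[OF True])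
    also have "\<dots> = 0" by (simp add: cross_skew[of "v y"])
    finally show ?thesis .
  next
    case False
    then have "y \<in> V" using c(3) by auto
    moreover have "g z = 0" if "z \<in> V" for z using that c(4) gradV by (simp add: g_def)
    ultimately show ?thesis
      using curl_cong_open[OF c(2), of y g "\<lambda>x. 0"] by (simp add: curl_nth vec_eq_iff forall_3)
  qed
  define f where "f = divergence g"
  have fK: "f y = 0" if "y \<notin> K'" for y
  proof -
    have "f y = divergence v y" unfolding f_def by (rule divergence_cong_open[OF oK]) (use that gK in auto)
    then show ?thesis using dv that VK c(3) by auto
  qed
  obtain B where B: "\<And>y. y \<in> K' \<Longrightarrow> norm y \<le> B" using compact_imp_bounded[OF c(5)] bounded_iff by blast
  define R0 where "R0 = max B 0 + 1"
  have R0: "R0 \<ge> 1" "\<And>y. R0 \<le> norm y \<Longrightarrow> y \<notin> K'" using B by (force simp: R0_def)+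
  have fc: "continuous_on UNIV f" unfolding f_def by (rule C1_on_continuous_divergence[OF g1])
  have fz: "f y = 0" if "R0 \<le> norm y" for y using fK R0(2)[OF that] by blast
  have fi: "integrable lborel f" by (rule integrable_compact_support[OF fc fz])
  have EK: "y \<in> ?E" if "y \<notin> K'" for y using that VK c(3) by auto
  have g_lim: "(g \<longlongrightarrow> 0) at_infinity"
  proof -
    have "eventually (\<lambda>y. v y = g y) at_infinity"
      unfolding eventually_at_infinity using R0(2) gK by metis
    then show ?thesis using v0 by (rule Lim_transform_eventually[rotated])
  qed
  have f0: "(\<integral>y. f y \<partial>lborel) = 0"
  proof -
    let ?\<zeta> = "bump (0::real^3) R0 (2 * R0)"
    have Rp: "0 \<le> R0" "R0 < 2 * R0" using R0 by auto
    have \<zeta>2: "C_on 2 UNIV ?\<zeta>" by (rule C2_bump[OF Rp])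
    have \<zeta>: "C1_on UNIV ?\<zeta>" "C1_on UNIV (grad ?\<zeta>)" using \<zeta>2 by (auto simp: C_on_2 intro!: C1_on_grad)
    have dif: "?\<zeta> differentiable (at y)" "g differentiable (at y)" "grad ?\<zeta> differentiable (at y)" for y using \<zeta> g1 by (auto simp: C1_on_def)
    have z0: "?\<zeta> y = 0" if "2 * R0 \<le> norm y" for y using bump_0[OF Rp, of y "0::real^3"] that by simp
    have z1: "?\<zeta> y = 1" if "norm y \<le> R0" for y using bump_1[OF Rp, of y "0::real^3"] that by simp
    have gz: "grad ?\<zeta> y = 0" if "norm y \<le> R0 \<or> 2 * R0 \<le> norm y" for y
      using grad_bump_0[OF Rp, of y 0] that by simp
    \<comment> \<open>Where the cutoff gradient is nonzero, \<open>g\<close> equals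
      \<open>v = curl u\<close>, so its product with that gradient is the divergence of this
      compactly supported field. Hence the flux of \<open>g\<close> through the shell, and with it
      the mean of \<open>f\<close>, is zero.\<close>
    let ?X = "\<lambda>y. if y \<in> ?E then cross3 (u y) (grad ?\<zeta> y) else 0"
    have sub: "- ball 0 R0 \<subseteq> ?E"
    proof (rule subsetI)
      fix y :: "real^3" assume "y \<in> - ball 0 R0"
      then have "R0 \<le> norm y" by simp
      then show "y \<in> ?E" using EK R0(2) by blast
    qed
    have X1: "C1_on UNIV ?X"
      by (rule C1_on_extend_zero[OF E_open C1_on_cross[OF u C1_on_subset[OF \<zeta>(2)]] _ sub]) (auto simp: gz)
    have Xz: "?X y = 0" if "2 * R0 \<le> norm y" for y using gz that by simp
    have dX: "divergence ?X y = grad ?\<zeta> y \<bullet> g y" for y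
    proof (cases "norm y < R0")
      case True
      have "divergence ?X y = divergence (\<lambda>y. 0) y"
        by (rule divergence_cong_open[of "ball 0 R0"]) (use True gz in auto)
      then show ?thesis using True gz by (simp add: divergence_def)
    next
      case False
      then have y: "y \<in> ?E" "y \<notin> K'" using EK R0(2) by auto
      have ud: "u differentiable (at y)" using u y by (auto simp: C1_on_def)
      have "divergence ?X y = divergence (\<lambda>y. cross3 (u y) (grad ?\<zeta> y)) y"
        by (rule divergence_cong_open[OF E_open y(1)]) auto
      also have "\<dots> = v y \<bullet> grad ?\<zeta> y"
        using divergence_cross[OF ud dif(3)] cu[OF y(1)] curl_grad[OF open_UNIV UNIV_I \<zeta>2] by simp
      finally show ?thesis using gK[OF y(2)] by (simp add: inner_commute)
    qed
    have H1: "C1_on UNIV (\<lambda>y. ?\<zeta> y *\<^sub>R g y)" by (rule C1_on_scaleR[OF \<zeta>(1) g1])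
    have dh: "divergence (\<lambda>y. ?\<zeta> y *\<^sub>R g y) y = f y + divergence ?X y" for y
      using divergence_scaleR[OF dif(1,2)] fz[of y] z1[of y] dX[of y] by (cases "norm y \<le> R0") (auto simp: f_def)
    have "0 = (\<integral>y. divergence (\<lambda>y. ?\<zeta> y *\<^sub>R g y) y \<partial>lborel)"
      using integral_divergence_zero[OF H1, of "2 * R0"] z0 by simp
    also have "\<dots> = (\<integral>y. f y \<partial>lborel) + (\<integral>y. divergence ?X y \<partial>lborel)"
      unfolding dh by (rule Bochner_Integration.integral_add[OF fi integrable_divergence[OF X1 Xz]])
    finally show ?thesis using integral_divergence_zero[OF X1 Xz] by simp
  qed
  define M where "M = 32 * R0 * (\<integral>y. \<bar>f y\<bar> \<partial>lborel)"
  \<comment> \<open>The radius \<open>2 * R0 + 2\<close> keeps the segment from \<open>x\<close> to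
    \<open>x - y\<close> at distance at least \<open>norm x / 2\<close> and at least 1 from the
    origin. The factor \<open>64 / 45\<close> undoes the lower bound of the mass, and 32 in
    \<open>M\<close> is 4 from the kernel estimate times 2^3.\<close>
  have "norm (v x) \<le> 64 / 45 * M / norm x ^ 3" if x: "2 * R0 + 2 \<le> norm x" for x
  proof (rule field_le_epsilon)
    fix \<eta> :: real assume \<eta>: "0 < \<eta>"
    have xE: "x \<in> ?E" "x \<notin> K'" using EK R0 x by auto
    have "isCont g x" using C1_on_continuous[OF g1] by (simp add: continuous_on_eq_continuous_at)
    then obtain d where d: "d > 0" "\<And>y. norm (y - x) < d \<Longrightarrow> norm (g y - g x) < \<eta>"
      unfolding continuous_at_eps_delta dist_norm using \<eta> by metis
    define e where "e = min 1 (d / 2)"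
    have e: "0 < e" "e \<le> 1" "e < d" using d(1) by (auto simp: e_def)
    define C where "C = (\<integral>y. kap e y \<partial>lborel)"
    have C: "45 / 64 \<le> C" using integral_kap_lower[OF e(1)] by (simp add: C_def)
    let ?A = "\<integral>y. kap e (x - y) *\<^sub>R g y \<partial>lborel"
    have near: "norm (?A - C *\<^sub>R v x) \<le> \<eta> * C"
      unfolding C_def using kap_average[OF e(1) C1_on_continuous[OF g1], of x "v x" \<eta>] gK[OF xE(2)] d(2) e(3)
      by (simp add: less_imp_le)
    have nb: "norm (newt e (x - y) - newt e x) \<le> 32 * R0 / norm x ^ 3" if y: "norm y \<le> R0" for y
    proof -
      have far: "norm x / 2 \<le> norm z" if zz: "z \<in> closed_segment x (x - y)" for z
      proof -
        obtain t where t: "0 \<le> t" "t \<le> 1" "z = (1 - t) *\<^sub>R x + t *\<^sub>R (x - y)" using zz by (auto simp: in_segment)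
        then have "z = x - t *\<^sub>R y" by (simp add: algebra_simps)
        moreover have "norm (t *\<^sub>R y) \<le> R0" using t y mult_left_le_one_le[of "norm y" t] by simp
        ultimately show ?thesis using norm_triangle_ineq2[of x "t *\<^sub>R y"] x by simp
      qed
      have "norm (newt e (x - y) - newt e x) \<le> 32 / norm x ^ 3 * norm ((x - y) - x)"
      proof (rule differentiable_bound[where S="closed_segment x (x - y)" and f'="\<lambda>z h. partial h (newt e) z"])
        show "(newt e has_derivative (\<lambda>h. partial h (newt e) z)) (at z within closed_segment x (x - y))" for z
          by (rule has_derivative_at_withinI[OF has_derivative_partial[OF newt_diff[OF e(1)]]])
        show "onorm (\<lambda>h. partial h (newt e) z) \<le> 32 / norm x ^ 3" if z: "z \<in> closed_segment x (x - y)" for z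
        proof (rule onorm_le)
          fix h
          have "e \<le> norm z" using far[OF z] x e R0 by linarith
          from norm_partial_newt[OF e(1) this, of h]
          have "norm (partial h (newt e) z) \<le> 4 * norm h / norm z ^ 3" .
          also have "\<dots> \<le> 4 * norm h / (norm x / 2) ^ 3"
            using far[OF z] x R0 by (intro divide_left_mono power_mono mult_pos_pos zero_less_power) auto
          finally show "norm (partial h (newt e) z) \<le> 32 / norm x ^ 3 * norm h" by (simp add: power_divide field_simps)
        qed
      qed auto
      also have "\<dots> \<le> 32 / norm x ^ 3 * R0" using y by (intro mult_left_mono) auto
      finally show ?thesis by simp
    qed
    have nc: "continuous_on UNIV (\<lambda>y. newt e (x - y))" by (intro continuous_newt_compose[OF e(1)] continuous_intros)
    have i1: "integrable lborel (\<lambda>y. f y *\<^sub>R newt e (x - y))" 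
      by (rule integrable_compact_support[where R=R0]) (auto intro!: continuous_intros fc nc simp: fz)
    have i2: "integrable lborel (\<lambda>y. f y *\<^sub>R newt e x)" using fi by simp
    have "?A = - (\<integral>y. f y *\<^sub>R newt e (x - y) \<partial>lborel)"
    proof -
      have "divergence g y = 0 \<and> curl g y = 0" if "R0 \<le> norm y" for y using fz[OF that] curlg by (simp add: f_def)
      from helmholtz[OF e(1) g1 g_lim this] show ?thesis by (simp add: f_def curlg)
    qed
    also have "\<dots> = - (\<integral>y. f y *\<^sub>R newt e (x - y) - f y *\<^sub>R newt e x \<partial>lborel)"
    proof -
      have "(\<integral>y. f y *\<^sub>R newt e x \<partial>lborel) = 0" using integral_scaleR_left[of "newt e x" lborel f] fi f0 by simp
      then show ?thesis by (simp add: Bochner_Integration.integral_diff[OF i1 i2])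
    qed
    finally have "norm ?A = norm (\<integral>y. f y *\<^sub>R newt e (x - y) - f y *\<^sub>R newt e x \<partial>lborel)" by simp
    also have "\<dots> \<le> (\<integral>y. 32 * R0 / norm x ^ 3 * \<bar>f y\<bar> \<partial>lborel)"
    proof (rule Bochner_Integration.integral_norm_bound_integral)
      show "norm (f y *\<^sub>R newt e (x - y) - f y *\<^sub>R newt e x) \<le> 32 * R0 / norm x ^ 3 * \<bar>f y\<bar>" for y
      proof (cases "norm y \<le> R0")
        case True
        have "norm (f y *\<^sub>R newt e (x - y) - f y *\<^sub>R newt e x) = norm (newt e (x - y) - newt e x) * \<bar>f y\<bar>"
          by (simp flip: scaleR_diff_right)
        also have "\<dots> \<le> 32 * R0 / norm x ^ 3 * \<bar>f y\<bar>" by (intro mult_right_mono nb True) simp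
        finally show ?thesis .
      qed (simp add: fz)
    qed (use i1 i2 fi in auto)
    also have "\<dots> = M / norm x ^ 3" by (simp add: M_def)
    finally have "norm ?A \<le> M / norm x ^ 3" .
    moreover have "C * norm (v x) \<le> norm ?A + \<eta> * C"
      using near norm_triangle_ineq4[of ?A "?A - C *\<^sub>R v x"] C by simp
    ultimately have "C * (norm (v x) - \<eta>) \<le> M / norm x ^ 3" by (simp add: algebra_simps)
    moreover have "45 / 64 * (norm (v x) - \<eta>) \<le> C * (norm (v x) - \<eta>) \<or> norm (v x) \<le> \<eta>"
      using mult_right_mono[OF C, of "norm (v x) - \<eta>"] by (cases "\<eta> \<le> norm (v x)") auto
    moreover have "0 \<le> M / norm x ^ 3" using R0 by (simp add: M_def)
    ultimately show "norm (v x) \<le> 64 / 45 * M / norm x ^ 3 + \<eta>" by auto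
  qed
  moreover have "- ball 0 (2 * R0 + 2) \<subseteq> ?E"
  proof (rule subsetI)
    fix y :: "real^3" assume "y \<in> - ball 0 (2 * R0 + 2)"
    then have "R0 \<le> norm y" using R0 by simp
    then show "y \<in> ?E" using EK R0(2) by blast
  qed
  ultimately show ?thesis using R0 by (intro exI[of _ "2 * R0 + 2"] conjI exI[of _ "64 / 45 * M"]) auto
qed

end


subsection \<open>Graph patches\<close>

text \<open>A tangent half-space with outer normal \<open>v\<close>, described without reference to
  a chart; directions orthogonal to \<open>v\<close> are left undecided. Normals computed in
  different patches can be identified through it.\<close>

definition half_space_at :: "(real^3) set \<Rightarrow> real^3 \<Rightarrow> real^3 \<Rightarrow> bool"
  where "half_space_at \<Omega> x v \<longleftrightarrow> norm v = 1 \<and>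
    (\<forall>d. d \<bullet> v < 0 \<longrightarrow> (\<forall>\<^sub>F t in at_right 0. x + t *\<^sub>R d \<in> \<Omega>)) \<and>
    (\<forall>d. 0 < d \<bullet> v \<longrightarrow> (\<forall>\<^sub>F t in at_right 0. x + t *\<^sub>R d \<in> exterior \<Omega>))"

text \<open>For two different unit vectors the direction \<open>w - v\<close> points inwards with
  respect to \<open>v\<close> and outwards with respect to \<open>w\<close>.\<close>

lemma half_space_at_unique:
  assumes "half_space_at \<Omega> x v" "half_space_at \<Omega> x w"
  shows "v = w"
proof (rule ccontr)
  assume ne: "v \<noteq> w"
  have vv: "v \<bullet> v = 1" "w \<bullet> w = 1" using assms by (auto simp: half_space_at_def norm_eq_1)
  have "0 < (w - v) \<bullet> (w - v)" using ne by simp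
  then have "v \<bullet> w < 1" using vv by (simp add: inner_diff_left inner_diff_right inner_commute)
  moreover have "w \<bullet> v = v \<bullet> w" by (rule inner_commute)
  ultimately have "(w - v) \<bullet> v < 0" "0 < (w - v) \<bullet> w" using vv by (simp_all add: inner_diff_left)
  then have "\<forall>\<^sub>F t in at_right 0. x + t *\<^sub>R (w - v) \<in> \<Omega>" "\<forall>\<^sub>F t in at_right 0. x + t *\<^sub>R (w - v) \<in> exterior \<Omega>"
    using assms unfolding half_space_at_def by blast+
  then have "\<forall>\<^sub>F t in at_right (0::real). False"
    by eventually_elim (use closure_subset in auto)
  then show False by simp
qed

text \<open>The witnesses behind the existential quantifiers of \<open>graph_patch\<close>, given
  names; \<open>x\<close> is the value of the chart at 0.\<close>

locale patch =
  fixes \<Omega> :: "(real^3) set" and x n :: "real^3" and p :: "real^2 \<Rightarrow> real^3" and h \<delta> :: real and g :: "real^2 \<Rightarrow> real"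
  assumes O_open: "open \<Omega>" and delta: "0 < \<delta>" and lin: "linear p" and iso: "\<And>y. norm (p y) = norm y" and n1: "norm n = 1"
    and orth: "\<And>y. p y \<bullet> n = 0" and h: "0 < h" and g1: "C1_on (ball 0 \<delta>) g" and g0: "g 0 = 0"
    and gh: "\<And>y. y \<in> ball 0 \<delta> \<Longrightarrow> \<bar>g y\<bar> < h"
    and graph: "\<And>y t. y \<in> ball 0 \<delta> \<Longrightarrow> \<bar>t\<bar> < h \<Longrightarrow> x + p y + t *\<^sub>R n \<in> \<Omega> \<longleftrightarrow> t < g y"
begin

definition sig :: "real^2 \<Rightarrow> real^3" where "sig y = x + p y + g y *\<^sub>R n"

text \<open>Inner products with the images of the axes form the adjoint of the isometry
  \<open>p\<close>, so together with \<open>hgt\<close> these are orthonormal coordinates centred at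
  \<open>x\<close>.\<close>

definition prj :: "real^3 \<Rightarrow> real^2" where "prj z = (\<chi> i. (z - x) \<bullet> p (axis i 1))"

definition hgt :: "real^3 \<Rightarrow> real" where "hgt z = (z - x) \<bullet> n"

definition cyl :: "(real^3) set" where "cyl = {z. norm (prj z) < \<delta> \<and> \<bar>hgt z\<bar> < h}"

definition dg :: "real^2 \<Rightarrow> real^2" where "dg y = (\<chi> i. partial (axis i 1) g y)"

text \<open>The gradient of the height above the graph: the outer normal scaled so that its
  component along \<open>n\<close> is 1.\<close>

definition nml :: "real^2 \<Rightarrow> real^3" where "nml y = n - p (dg y)"

lemma inner_p: "p y \<bullet> p z = y \<bullet> z"
proof -
  have "(norm (p (y + z)))\<^sup>2 = (norm (y + z))\<^sup>2" by (simp add: iso)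
  then show ?thesis using iso[of y] iso[of z]
    unfolding linear_add[OF lin] by (simp add: power2_norm_eq_inner[symmetric] dot_norm iso) 
qed

lemma nn: "n \<bullet> n = 1" using n1 by (simp add: norm_eq_1)

lemma orth': "n \<bullet> p y = 0" using orth by (simp add: inner_commute)

lemma sum_axis_2: "y = y $ 1 *\<^sub>R axis 1 1 + y $ 2 *\<^sub>R axis 2 1" for y :: "real^2"
  by (simp add: vec_eq_iff forall_2 axis_def)

lemma prj_Z: "prj (x + p y + t *\<^sub>R n) = y"
proof -
  have "prj (x + p y + t *\<^sub>R n) = (\<chi> i. y \<bullet> axis i 1)"
    by (simp add: prj_def inner_add_left inner_p orth' algebra_simps)
  then show ?thesis by (simp add: inner_axis vec_eq_iff)
qed

lemma hgt_Z: "hgt (x + p y + t *\<^sub>R n) = t"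
  by (simp add: hgt_def inner_add_left orth nn algebra_simps)

text \<open>The images of the two axes and \<open>n\<close> are three orthonormal vectors, hence
  span the space, and the difference of both sides is orthogonal to each of them.\<close>

lemma Z_coords: "x + p (prj z) + hgt z *\<^sub>R n = z"
proof -
  let ?B = "{p (axis 1 1), p (axis 2 1), n}"
  have o12: "p (axis 1 1) \<bullet> p (axis 2 1) = 0" by (simp add: inner_p inner_axis_axis)
  have nz: "p (axis i 1) \<bullet> p (axis i 1) = 1" for i by (simp add: inner_p inner_axis_axis)
  have card: "card ?B = 3"
  proof -
    have "p (axis 1 1) \<noteq> p (axis 2 1)" using o12 nz[of 1] by auto
    moreover have "p (axis i 1) \<noteq> n" for i using orth[of "axis i 1"] nn by auto
    ultimately show ?thesis by simp
  qed
  have "pairwise orthogonal ?B"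
    using o12 orth orth' by (auto simp: pairwise_def orthogonal_def inner_commute)
  moreover have "0 \<notin> ?B" using nz nn by (metis inner_zero_left insert_iff empty_iff zero_neq_one)
  ultimately have ind: "independent ?B" by (rule pairwise_orthogonal_independent)
  have "UNIV \<subseteq> span ?B"
    by (rule card_ge_dim_independent) (use ind card in auto)
  then have sp: "span ?B = UNIV" by auto
  let ?r = "z - (x + p (prj z) + hgt z *\<^sub>R n)"
  have pp: "p (prj z) \<bullet> p (axis i 1) = (z - x) \<bullet> p (axis i 1)" for i
    unfolding inner_p by (simp add: inner_axis prj_def)
  have "?r \<bullet> b = 0" if "b \<in> ?B" for b
    using that pp[of 1] pp[of 2] orth orth' nn
    by (auto simp: inner_diff_left inner_add_left hgt_def)
  then have "orthogonal ?r b" if "b \<in> ?B" for b using that by (simp add: orthogonal_def)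
  then have "orthogonal ?r ?r" using orthogonal_to_span[of ?r ?B ?r] sp by blast
  then show ?thesis by (simp add: orthogonal_self)
qed

lemma norm_Z: "norm (p y + t *\<^sub>R n) \<le> norm y + \<bar>t\<bar>"
  using norm_triangle_ineq[of "p y" "t *\<^sub>R n"] by (simp add: iso n1)

lemma continuous_on_p: "continuous_on A p"
  using lin linear_continuous_on linear_conv_bounded_linear by blast

lemma continuous_on_prj: "continuous_on A prj"
  unfolding prj_def[abs_def] by (intro continuous_intros)

lemma continuous_on_hgt: "continuous_on A hgt"
  unfolding hgt_def[abs_def] by (intro continuous_intros)

lemma open_cyl: "open cyl"
  unfolding cyl_def by (intro open_Collect_conj open_Collect_less continuous_intros continuous_on_prj continuous_on_hgt)

lemma cyl_iff: "x + p y + t *\<^sub>R n \<in> cyl \<longleftrightarrow> y \<in> ball 0 \<delta> \<and> \<bar>t\<bar> < h"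
  by (simp add: cyl_def prj_Z hgt_Z)

lemma in_O_iff: "z \<in> cyl \<Longrightarrow> z \<in> \<Omega> \<longleftrightarrow> hgt z < g (prj z)"
  using graph[of "prj z" "hgt z"] by (simp add: cyl_def Z_coords)

lemma continuous_on_g: "continuous_on (ball 0 \<delta>) g"
  by (rule C1_on_continuous[OF g1])

lemma continuous_on_g_prj: "continuous_on cyl (\<lambda>z. g (prj z))"
  by (rule continuous_on_compose2[OF continuous_on_g continuous_on_prj]) (auto simp: cyl_def)

text \<open>The patch condition only says that points on or above the graph are not in
  \<open>\<Omega>\<close>; the strictly higher points form an open set, which therefore misses the
  closure too.\<close>

lemma above_exterior: 
  assumes "z \<in> cyl" "g (prj z) < hgt z" shows "z \<in> exterior \<Omega>"
proof -
  let ?S = "cyl \<inter> (\<lambda>z. hgt z - g (prj z)) -` {0<..}"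
  have "open ?S"
    by (rule continuous_open_preimage[OF continuous_on_diff[OF continuous_on_hgt continuous_on_g_prj] open_cyl open_greaterThan])
  moreover have "?S \<inter> \<Omega> = {}" using in_O_iff by auto
  ultimately have "?S \<inter> closure \<Omega> = {}" using open_Int_closure_eq_empty by blast
  then show ?thesis using assms by auto
qed

lemma sig_cyl: "y \<in> ball 0 \<delta> \<Longrightarrow> sig y \<in> cyl"
  unfolding sig_def cyl_iff using gh by simp

lemma prj_sig: "prj (sig y) = y" by (simp add: sig_def prj_Z)

lemma hgt_sig: "hgt (sig y) = g y" by (simp add: sig_def hgt_Z)

lemma sig_shift: "sig y + t *\<^sub>R n = x + p y + (g y + t) *\<^sub>R n"
  by (simp add: sig_def algebra_simps)

lemma sig_shift_cyl: "y \<in> ball 0 \<delta> \<Longrightarrow> \<bar>g y\<bar> + \<bar>t\<bar> < h \<Longrightarrow> sig y + t *\<^sub>R n \<in> cyl"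
  unfolding sig_shift cyl_iff by auto

lemma sig_shift_exterior: "y \<in> ball 0 \<delta> \<Longrightarrow> \<bar>g y\<bar> + \<bar>t\<bar> < h \<Longrightarrow> 0 < t \<Longrightarrow> sig y + t *\<^sub>R n \<in> exterior \<Omega>"
  by (rule above_exterior[OF sig_shift_cyl]) (auto simp: sig_shift prj_Z hgt_Z)

lemma sig_shift_O: "y \<in> ball 0 \<delta> \<Longrightarrow> \<bar>g y\<bar> + \<bar>t\<bar> < h \<Longrightarrow> t < 0 \<Longrightarrow> sig y + t *\<^sub>R n \<in> \<Omega>"
  unfolding sig_shift by (subst graph) auto

lemma shift_tendsto: "((\<lambda>t. a + t *\<^sub>R d) \<longlongrightarrow> a) (at (0::real) within T)" for a d :: "real^3"
  by (rule tendsto_eq_intros | simp)+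

lemma small_h: 
  assumes "y \<in> ball 0 \<delta>" 
  shows "\<forall>\<^sub>F t in at_right 0. \<bar>g y\<bar> + \<bar>t\<bar> < h \<and> 0 < t" "\<forall>\<^sub>F t in at_left 0. \<bar>g y\<bar> + \<bar>t\<bar> < h \<and> t < 0"
proof -
  have "h - \<bar>g y\<bar> > 0" using gh[OF assms] by simp
  then show "\<forall>\<^sub>F t in at_right 0. \<bar>g y\<bar> + \<bar>t\<bar> < h \<and> 0 < t" "\<forall>\<^sub>F t in at_left 0. \<bar>g y\<bar> + \<bar>t\<bar> < h \<and> t < 0"
    unfolding eventually_at by (auto simp: dist_real_def intro!: exI[of _ "h - \<bar>g y\<bar>"])
qed

text \<open>A point of the graph is approached along \<open>n\<close> from below through
  \<open>\<Omega>\<close> and from above through the exterior. The second conclusion later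
  identifies the closure of the exterior with the complement of \<open>\<Omega>\<close>.\<close>

lemma sig_frontier:
  assumes y: "y \<in> ball 0 \<delta>" shows "sig y \<in> frontier \<Omega>" "sig y \<in> closure (exterior \<Omega>)"
proof -
  have ev: "\<forall>\<^sub>F t in at_left 0. sig y + t *\<^sub>R n \<in> \<Omega>"
    using small_h(2)[OF y] by eventually_elim (use sig_shift_O[OF y] in auto)
  have "sig y \<in> closure \<Omega>"
    by (rule Lim_in_closed_set[OF closed_closure eventually_mono[OF ev] _ shift_tendsto[of _ n]]) (use closure_subset in auto)
  moreover have "sig y \<notin> \<Omega>" using in_O_iff[OF sig_cyl[OF y]] by (simp add: prj_sig hgt_sig)
  ultimately show "sig y \<in> frontier \<Omega>" using O_open by (simp add: frontier_def interior_open)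
  have ev: "\<forall>\<^sub>F t in at_right 0. sig y + t *\<^sub>R n \<in> exterior \<Omega>"
    using small_h(1)[OF y] by eventually_elim (use sig_shift_exterior[OF y] in auto)
  have "\<forall>\<^sub>F t in at_right 0. sig y + t *\<^sub>R n \<in> closure (exterior \<Omega>)"
    by (rule eventually_mono[OF ev]) (rule subsetD[OF closure_subset])
  from Lim_in_closed_set[OF closed_closure this _ shift_tendsto]
  show "sig y \<in> closure (exterior \<Omega>)" by simp
qed

lemma frontier_cyl: "z \<in> cyl \<Longrightarrow> z \<in> frontier \<Omega> \<Longrightarrow> z = sig (prj z) \<and> prj z \<in> ball 0 \<delta>"
proof -
  assume z: "z \<in> cyl" "z \<in> frontier \<Omega>"
  then have "z \<notin> \<Omega>" "z \<in> closure \<Omega>" using O_open by (auto simp: frontier_def interior_open)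
  then have "hgt z = g (prj z)" using in_O_iff[OF z(1)] above_exterior[OF z(1)] by force
  then show ?thesis using Z_coords[of z] z(1) by (simp add: sig_def cyl_def)
qed

lemma partial_g: "y \<in> ball 0 \<delta> \<Longrightarrow> partial k g y = dg y \<bullet> k"
proof -
  assume "y \<in> ball 0 \<delta>"
  then have d: "g differentiable (at y)" using g1 by (simp add: C1_on_def)
  have "partial k g y = partial (k $ 1 *\<^sub>R axis 1 1 + k $ 2 *\<^sub>R axis 2 1) g y" using sum_axis_2[of k] by simp
  also have "\<dots> = k $ 1 * dg y $ 1 + k $ 2 * dg y $ 2"
    by (simp add: linear_add[OF linear_partial[OF d]] linear_cmul[OF linear_partial[OF d]] dg_def)
  finally show ?thesis by (simp add: inner_vec_def sum_2 mult.commute)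
qed

lemma g_has_derivative: "y \<in> ball 0 \<delta> \<Longrightarrow> (g has_derivative (\<lambda>k. dg y \<bullet> k)) (at y)"
  using C1_on_has_derivative[OF g1, of y] partial_g by simp

lemma continuous_on_dg: "continuous_on (ball 0 \<delta>) dg"
  unfolding dg_def[abs_def] by (intro continuous_intros C1_on_continuous_partial g1)

lemma nml_inner: "nml y \<bullet> (p k + s *\<^sub>R n) = s - dg y \<bullet> k"
  by (simp add: nml_def inner_diff_left inner_add_right inner_p orth orth' nn)

lemma nml_nz: "nml y \<noteq> 0" "0 < norm (nml y)"
proof -
  have "nml y \<bullet> n = 1" using nml_inner[of y 0 1] by (simp add: linear_0[OF lin])
  then show "nml y \<noteq> 0" by auto
  then show "0 < norm (nml y)" by simp
qed

lemma sig_has_derivative: "y \<in> ball 0 \<delta> \<Longrightarrow> (sig has_derivative (\<lambda>k. p k + (dg y \<bullet> k) *\<^sub>R n)) (at y)"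
  unfolding sig_def[abs_def]
  by (auto intro!: derivative_eq_intros g_has_derivative bounded_linear_imp_has_derivative simp: linear_conv_bounded_linear[THEN iffD1, OF lin])

lemma partial_sig: "y \<in> ball 0 \<delta> \<Longrightarrow> partial k sig y = p k + (dg y \<bullet> k) *\<^sub>R n"
  by (rule partial_eq[OF sig_has_derivative])

lemma C1_on_sig: "C1_on (ball 0 \<delta>) sig"
  by (rule C1_onI[OF sig_has_derivative]) (auto intro!: continuous_intros continuous_on_dg)

text \<open>Along the ray in direction \<open>d\<close> the height above the graph has derivative
  \<open>nml y \<bullet> d\<close> at 0, and its sign decides on which side of the graph the ray
  starts.\<close>

lemma half_space_sig:
  assumes y: "y \<in> ball 0 \<delta>"
  shows "half_space_at \<Omega> (sig y) ((1 / norm (nml y)) *\<^sub>R nml y)"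
proof -
  have key: "(\<forall>\<^sub>F t in at_right 0. sig y + t *\<^sub>R d \<in> cyl) \<and>
     (\<lambda>t. (hgt (sig y + t *\<^sub>R d) - g (prj (sig y + t *\<^sub>R d))) / t) \<midarrow>0\<rightarrow> nml y \<bullet> d" for d
  proof
    have "((\<lambda>t. sig y + t *\<^sub>R d) \<longlongrightarrow> sig y) (at_right 0)" by (rule shift_tendsto)
    then show "\<forall>\<^sub>F t in at_right 0. sig y + t *\<^sub>R d \<in> cyl"
      by (rule topological_tendstoD[OF _ open_cyl sig_cyl[OF y]])
    define k s where "k = prj (x + d)" and "s = hgt (x + d)"
    have d: "d = p k + s *\<^sub>R n" using Z_coords[of "x + d"] by (simp add: k_def s_def add.assoc)
    have Z: "sig y + t *\<^sub>R d = x + p (y + t *\<^sub>R k) + (g y + t * s) *\<^sub>R n" for t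
      by (simp add: d sig_def linear_add[OF lin] linear_cmul[OF lin] algebra_simps)
    have gd: "g differentiable (at (y + 0 *\<^sub>R k))" using g1 y by (simp add: C1_on_def)
    have "((\<lambda>t. g (y + t *\<^sub>R k)) has_real_derivative dg y \<bullet> k) (at 0)"
      using partial_line[OF gd] partial_g[OF y] by (simp add: has_real_derivative_iff_has_vector_derivative)
    then have "((\<lambda>t. (g (y + t *\<^sub>R k) - g y) / t) \<longlongrightarrow> dg y \<bullet> k) (at 0)" by (simp add: has_field_derivative_iff)
    then have L: "((\<lambda>t. s - (g (y + t *\<^sub>R k) - g y) / t) \<longlongrightarrow> s - dg y \<bullet> k) (at 0)" by (intro tendsto_intros)
    have "((\<lambda>t. (hgt (sig y + t *\<^sub>R d) - g (prj (sig y + t *\<^sub>R d))) / t) \<longlongrightarrow> s - dg y \<bullet> k) (at 0)"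
    proof (rule Lim_transform_eventually[OF L])
      have "s - (g (y + t *\<^sub>R k) - g y) / t = (hgt (sig y + t *\<^sub>R d) - g (prj (sig y + t *\<^sub>R d))) / t" if "t \<noteq> 0" for t
        unfolding Z prj_Z hgt_Z using that by (simp add: field_simps)
      then show "\<forall>\<^sub>F t in at 0. s - (g (y + t *\<^sub>R k) - g y) / t = (hgt (sig y + t *\<^sub>R d) - g (prj (sig y + t *\<^sub>R d))) / t"
        by (simp add: eventually_at_filter)
    qed
    then show "(\<lambda>t. (hgt (sig y + t *\<^sub>R d) - g (prj (sig y + t *\<^sub>R d))) / t) \<midarrow>0\<rightarrow> nml y \<bullet> d"
      unfolding d nml_inner .
  qed
  have lim: "((\<lambda>t. (hgt (sig y + t *\<^sub>R d) - g (prj (sig y + t *\<^sub>R d))) / t) \<longlongrightarrow> nml y \<bullet> d) (at_right 0)" for d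
    using conjunct2[OF key[of d]] by (simp add: filterlim_at_split)
  have pos: "\<forall>\<^sub>F t in at_right (0::real). 0 < t" by (auto simp: eventually_at_filter)
  show ?thesis unfolding half_space_at_def
  proof (intro conjI allI impI)
    show "norm ((1 / norm (nml y)) *\<^sub>R nml y) = 1" using nml_nz by simp
    fix d
    { assume "d \<bullet> ((1 / norm (nml y)) *\<^sub>R nml y) < 0"
      then have "nml y \<bullet> d < 0" using nml_nz(2)[of y] by (simp add: inner_commute field_simps)
      from order_tendstoD(2)[OF lim this] conjunct1[OF key[of d]] pos
      show "\<forall>\<^sub>F t in at_right 0. sig y + t *\<^sub>R d \<in> \<Omega>"
      proof eventually_elim
        case (elim t)
        then have "hgt (sig y + t *\<^sub>R d) < g (prj (sig y + t *\<^sub>R d))" by (simp add: divide_less_0_iff)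
        then show ?case using in_O_iff[OF elim(2)] by simp
      qed }
    { assume "0 < d \<bullet> ((1 / norm (nml y)) *\<^sub>R nml y)"
      then have "0 < nml y \<bullet> d" using nml_nz(2)[of y] by (simp add: inner_commute field_simps)
      from order_tendstoD(1)[OF lim this] conjunct1[OF key[of d]] pos
      show "\<forall>\<^sub>F t in at_right 0. sig y + t *\<^sub>R d \<in> exterior \<Omega>"
      proof eventually_elim
        case (elim t)
        then have "g (prj (sig y + t *\<^sub>R d)) < hgt (sig y + t *\<^sub>R d)" by (simp add: zero_less_divide_iff)
        then show ?case by (rule above_exterior[OF elim(2)])
      qed }
  qed
qed

lemma nml_orth: "y \<in> ball 0 \<delta> \<Longrightarrow> nml y \<bullet> partial k sig y = 0"
  unfolding partial_sig nml_inner by simp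

lemma orth_nml:
  assumes y: "y \<in> ball 0 \<delta>" and w: "\<And>b. b \<in> Basis \<Longrightarrow> w \<bullet> partial b sig y = 0"
  shows "w = (w \<bullet> n) *\<^sub>R nml y"
proof -
  define k s where "k = prj (x + w)" and "s = hgt (x + w)"
  have d: "w = p k + s *\<^sub>R n" using Z_coords[of "x + w"] by (simp add: k_def s_def add.assoc)
  have "k = - s *\<^sub>R dg y"
  proof (rule euclidean_eqI)
    fix b :: "real^2" assume "b \<in> Basis"
    from w[OF this] show "k \<bullet> b = (- s *\<^sub>R dg y) \<bullet> b"
      unfolding partial_sig[OF y] d by (simp add: inner_add_left inner_add_right inner_p orth orth' nn eq_neg_iff_add_eq_0 mult.commute)
  qed
  then have "w = s *\<^sub>R nml y" unfolding d nml_def by (simp add: linear_neg[OF lin] linear_cmul[OF lin] algebra_simps)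
  moreover have "w \<bullet> n = s" unfolding d by (simp add: inner_add_left orth nn)
  ultimately show ?thesis by simp
qed

lemma sig_0: "sig 0 = x" by (simp add: sig_def g0 linear_0[OF lin])

lemma graph_patch_sig: "graph_patch \<Omega> sig \<delta>"
  unfolding graph_patch_def C_on_1[unfolded One_nat_def] One_nat_def
  using delta lin iso n1 orth h g1 g0 gh graph
  by (intro conjI exI[of _ x] exI[of _ p] exI[of _ n] exI[of _ h] exI[of _ g]) (auto simp: sig_def fun_eq_iff)

end

lemma graph_patchE:
  assumes "open \<Omega>" "graph_patch \<Omega> \<sigma> \<delta>"
  obtains x n p h g where "patch \<Omega> x n p h \<delta> g" "\<sigma> = patch.sig x n p g"
proof -
  obtain x p n h g where *: "0 < \<delta>" "linear p" "\<forall>y. norm (p y) = norm y" "norm n = 1" "\<forall>y. p y \<bullet> n = 0"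
      "0 < h" "C_on 1 (ball 0 \<delta>) g" "g 0 = 0" "\<forall>y\<in>ball 0 \<delta>. \<bar>g y\<bar> < h"
      "\<sigma> = (\<lambda>y. x + p y + g y *\<^sub>R n)"
      "\<forall>y\<in>ball 0 \<delta>. \<forall>t. \<bar>t\<bar> < h \<longrightarrow> (x + p y + t *\<^sub>R n \<in> \<Omega> \<longleftrightarrow> t < g y)"
    using assms(2) unfolding graph_patch_def by blast
  have P: "patch \<Omega> x n p h \<delta> g"
    by (rule patch.intro[OF assms(1) *(1,2) _ *(4) _ *(6) C_on_1[THEN iffD1, OF *(7)] *(8)]) (use * in auto)
  show thesis by (rule that[OF P]) (simp add: fun_eq_iff patch.sig_def[OF P] *(10))
qed

text \<open>A candidate in the description of \<open>nu\<close> is orthogonal to the tangent plane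
  of some patch, hence a multiple of its \<open>nml\<close>; the condition on the exterior excludes
  the inward sign. Candidates from different patches coincide because the half-space determines its
  normal.\<close>

lemma nu_half_space:
  assumes "open \<Omega>" "graph_patch \<Omega> \<sigma> \<delta>" "\<sigma> 0 = z"
  shows "half_space_at \<Omega> z (nu \<Omega> z)"
proof -
  have pos: "half_space_at \<Omega> z v" if v: "norm v = 1" and s: "graph_patch \<Omega> \<sigma> \<delta>" "\<sigma> 0 = z" "\<forall>b\<in>Basis. v \<bullet> partial b \<sigma> 0 = 0"
    and ev: "\<forall>\<^sub>F t in at_right 0. z + t *\<^sub>R v \<in> exterior \<Omega>" for v \<sigma> \<delta>
  proof -
    obtain x n p h g where P: "patch \<Omega> x n p h \<delta> g" "\<sigma> = patch.sig x n p g"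
      using graph_patchE[OF assms(1) s(1)] by blast
    interpret P: patch \<Omega> x n p h \<delta> g by fact
    have 0: "0 \<in> ball 0 \<delta>" using P.delta by simp
    have H: "half_space_at \<Omega> z ((1 / norm (P.nml 0)) *\<^sub>R P.nml 0)" using P.half_space_sig[OF 0] s(2) P(2) by simp
    have w: "v = (v \<bullet> n) *\<^sub>R P.nml 0" by (rule P.orth_nml[OF 0]) (use s(3) P(2) in auto)
    have nz: "v \<bullet> n \<noteq> 0" using w v by (metis norm_zero scale_zero_left zero_neq_one)
    have c: "\<bar>v \<bullet> n\<bar> = 1 / norm (P.nml 0)"
      using v w P.nml_nz(2)[of 0] by (metis abs_of_nonneg norm_ge_zero norm_scaleR nonzero_eq_divide_eq norm_eq_zero P.nml_nz(1))
    show ?thesis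
    proof (cases "v \<bullet> n > 0")
      case True
      then have "v \<bullet> n = 1 / norm (P.nml 0)" using c by simp
      then have "v = (1 / norm (P.nml 0)) *\<^sub>R P.nml 0" using w by simp
      then show ?thesis using H by simp
    next
      case False
      then have s: "v \<bullet> n < 0" using nz by simp
      have "v \<bullet> ((1 / norm (P.nml 0)) *\<^sub>R P.nml 0) = (v \<bullet> n) * norm (P.nml 0)"
        using P.nml_nz(2)[of 0] by (subst w) (simp add: power2_norm_eq_inner[symmetric] power2_eq_square)
      then have "v \<bullet> ((1 / norm (P.nml 0)) *\<^sub>R P.nml 0) < 0" using s P.nml_nz(2)[of 0] by (simp add: mult_neg_pos)
      then have "\<forall>\<^sub>F t in at_right 0. z + t *\<^sub>R v \<in> \<Omega>" using H unfolding half_space_at_def by blast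
      then have "\<forall>\<^sub>F t in at_right (0::real). False" using ev
        by eventually_elim (use closure_subset in auto)
      then show ?thesis by simp
    qed
  qed
  obtain x n p h g where P: "patch \<Omega> x n p h \<delta> g" "\<sigma> = patch.sig x n p g"
    using graph_patchE[OF assms(1,2)] by blast
  interpret P: patch \<Omega> x n p h \<delta> g by fact
  have 0: "0 \<in> ball 0 \<delta>" using P.delta by simp
  let ?v = "(1 / norm (P.nml 0)) *\<^sub>R P.nml 0"
  have H: "half_space_at \<Omega> z ?v" using P.half_space_sig[OF 0] assms(3) P(2) by simp
  have n1: "norm ?v = 1" using P.nml_nz(2)[of 0] by simp
  have ex: "norm ?v = 1 \<and> (\<exists>\<sigma> \<delta>. graph_patch \<Omega> \<sigma> \<delta> \<and> \<sigma> 0 = z \<and> (\<forall>b\<in>Basis. ?v \<bullet> partial b \<sigma> 0 = 0)) \<and>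
      (\<forall>\<^sub>F t in at_right 0. z + t *\<^sub>R ?v \<in> exterior \<Omega>)"
  proof (intro conjI exI[of _ \<sigma>] exI[of _ \<delta>] n1 assms(2,3) ballI)
    show "?v \<bullet> partial b \<sigma> 0 = 0" for b using P.nml_orth[OF 0, of b] P(2) by simp
    have "0 < ?v \<bullet> ?v" using n1 by (metis inner_gt_zero_iff norm_zero zero_neq_one)
    then show "\<forall>\<^sub>F t in at_right 0. z + t *\<^sub>R ?v \<in> exterior \<Omega>" using H unfolding half_space_at_def by blast
  qed
  have "nu \<Omega> z = ?v" unfolding nu_def
  proof (rule the_equality)
    show "norm ?v = 1 \<and> (\<exists>\<sigma> \<delta>. graph_patch \<Omega> \<sigma> \<delta> \<and> \<sigma> 0 = z \<and> (\<forall>b\<in>Basis. ?v \<bullet> partial b \<sigma> 0 = 0)) \<and>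
      (\<forall>\<^sub>F t in at_right 0. z + t *\<^sub>R ?v \<in> exterior \<Omega>)" by (rule ex)
    fix v assume "norm v = 1 \<and> (\<exists>\<sigma> \<delta>. graph_patch \<Omega> \<sigma> \<delta> \<and> \<sigma> 0 = z \<and> (\<forall>b\<in>Basis. v \<bullet> partial b \<sigma> 0 = 0)) \<and>
      (\<forall>\<^sub>F t in at_right 0. z + t *\<^sub>R v \<in> exterior \<Omega>)"
    then have "half_space_at \<Omega> z v" using pos by blast
    then show "v = ?v" using half_space_at_unique[OF _ H] by blast
  qed
  then show ?thesis using H by simp
qed


section \<open>Local shape of the domain and of its exterior at a patch\<close>

context patch
begin

lemma norm_pn: "(norm (p k + s *\<^sub>R n))\<^sup>2 = (norm k)\<^sup>2 + s\<^sup>2"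
  unfolding power2_norm_eq_inner
  by (simp add: inner_add_left inner_add_right inner_p orth orth' nn power2_eq_square)

lemma prj_hgt_le: "norm (prj z - prj z') \<le> norm (z - z')" "\<bar>hgt z - hgt z'\<bar> \<le> norm (z - z')"
proof -
  have "z - z' = p (prj z - prj z') + (hgt z - hgt z') *\<^sub>R n"
  proof -
    have "z - z' = (x + p (prj z) + hgt z *\<^sub>R n) - (x + p (prj z') + hgt z' *\<^sub>R n)" by (simp only: Z_coords)
    then show ?thesis by (simp add: linear_diff[OF lin] scaleR_diff_left)
  qed
  then have *: "(norm (z - z'))\<^sup>2 = (norm (prj z - prj z'))\<^sup>2 + (hgt z - hgt z')\<^sup>2"
    using norm_pn by metis
  show "norm (prj z - prj z') \<le> norm (z - z')" by (rule power2_le_imp_le) (use * in auto)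
  have "\<bar>hgt z - hgt z'\<bar>\<^sup>2 \<le> (norm (z - z'))\<^sup>2" using * by simp
  then show "\<bar>hgt z - hgt z'\<bar> \<le> norm (z - z')" by (rule power2_le_imp_le) simp
qed

lemma prj_x: "prj x = 0" "hgt x = 0"
  by (simp_all add: prj_def hgt_def vec_eq_iff)

text \<open>The disc is shrunk until the graph stays within the height \<open>h'\<close>. Each
  vertical fibre of the part in \<open>\<Omega>\<close> is then a nonempty interval under the graph,
  and the whole is a continuous image of a disc times an interval.\<close>

lemma locally_connected_x:
  assumes r: "0 < r"
  shows "\<exists>N. open N \<and> x \<in> N \<and> N \<subseteq> ball x r \<and> connected (N \<inter> \<Omega>)"
proof -
  define h' where "h' = min (h / 2) (r / 3)"
  have h': "0 < h'" "h' < h" "h' \<le> r / 3" using h r by (auto simp: h'_def)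
  have "isCont g 0" using continuous_on_g delta by (simp add: continuous_on_eq_continuous_at)
  then obtain d where d: "d > 0" "\<And>y. norm y < d \<Longrightarrow> \<bar>g y\<bar> < h'"
    unfolding continuous_at_eps_delta dist_norm using h'(1) g0 by (metis diff_zero real_norm_def)
  define \<delta>' where "\<delta>' = min (min d \<delta>) (r / 3)"
  have \<delta>': "0 < \<delta>'" "\<delta>' \<le> d" "\<delta>' \<le> \<delta>" "\<delta>' \<le> r / 3" using d(1) delta r by (auto simp: \<delta>'_def)
  define N where "N = {z. norm (prj z) < \<delta>' \<and> \<bar>hgt z\<bar> < h'}"
  have oN: "open N"
    unfolding N_def by (intro open_Collect_conj open_Collect_less continuous_intros continuous_on_prj continuous_on_hgt)
  have Ncyl: "z \<in> cyl" if "z \<in> N" for z using that \<delta>' h' by (auto simp: N_def cyl_def)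
  have xN: "x \<in> N" using \<delta>' h' by (simp add: N_def prj_x)
  have Nr: "N \<subseteq> ball x r"
  proof
    fix z assume "z \<in> N"
    then have "norm (p (prj z) + hgt z *\<^sub>R n) < \<delta>' + h'" using norm_Z[of "prj z" "hgt z"] by (simp add: N_def)
    moreover have "z - x = p (prj z) + hgt z *\<^sub>R n" using Z_coords[of z] by (simp add: algebra_simps)
    ultimately have "norm (z - x) < r" using \<delta>' h' r by simp
    then show "z \<in> ball x r" by (simp add: dist_norm norm_minus_commute)
  qed
  \<comment> \<open>The parameter in the unit interval moves from the bottom \<open>- h'\<close> up
    to the graph.\<close>
  let ?F = "\<lambda>w. x + p (fst w) + (- h' + snd w * (g (fst w) + h')) *\<^sub>R n"
  have "N \<inter> \<Omega> = ?F ` (ball 0 \<delta>' \<times> {0<..<1})"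
  proof (intro set_eqI iffI)
    fix z assume z: "z \<in> N \<inter> \<Omega>"
    then have lt: "hgt z < g (prj z)" using in_O_iff Ncyl by auto
    have b: "norm (prj z) < \<delta>'" "- h' < hgt z" using z by (auto simp: N_def)
    let ?s = "(hgt z + h') / (g (prj z) + h')"
    have "?F (prj z, ?s) = z" using lt b Z_coords[of z] by simp
    moreover have "(prj z, ?s) \<in> ball 0 \<delta>' \<times> {0<..<1}" using lt b by simp
    ultimately show "z \<in> ?F ` (ball 0 \<delta>' \<times> {0<..<1})" by (metis (no_types, lifting) image_eqI)
  next
    fix z assume "z \<in> ?F ` (ball 0 \<delta>' \<times> {0<..<1})"
    then obtain y s where y: "norm y < \<delta>'" and s: "0 < s" "s < 1" and z: "z = x + p y + (- h' + s * (g y + h')) *\<^sub>R n" by auto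
    have gy: "\<bar>g y\<bar> < h'" using d(2)[of y] y \<delta>' by simp
    then have pos: "0 < g y + h'" by linarith
    have "s * (g y + h') < 1 * (g y + h')" "0 < s * (g y + h')" 
      using mult_strict_right_mono[OF s(2) pos] mult_pos_pos[OF s(1) pos] by auto
    then have t: "- h' + s * (g y + h') < g y" "\<bar>- h' + s * (g y + h')\<bar> < h'" using gy by auto
    have "z \<in> N" unfolding N_def z using t y by (simp add: prj_Z hgt_Z)
    moreover have "z \<in> \<Omega>" using in_O_iff[OF Ncyl[OF \<open>z \<in> N\<close>]] t(1) unfolding z by (simp add: prj_Z hgt_Z)
    ultimately show "z \<in> N \<inter> \<Omega>" by simp
  qed
  moreover have "connected (?F ` (ball 0 \<delta>' \<times> {0<..<1}))"
  proof (rule connected_continuous_image)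
    have cg: "continuous_on (ball 0 \<delta>' \<times> {0<..<1}) (\<lambda>w. g (fst w))" 
      by (rule continuous_on_compose2[OF continuous_on_g continuous_on_fst[OF continuous_on_id]]) (use \<delta>' in auto)
    have cp: "continuous_on (ball 0 \<delta>' \<times> {0<..<1}) (\<lambda>w. p (fst w))" 
      by (rule continuous_on_compose2[OF continuous_on_p continuous_on_fst[OF continuous_on_id]]) auto
    show "continuous_on (ball 0 \<delta>' \<times> {0<..<1}) ?F" by (intro continuous_intros cg cp)
    show "connected (ball (0::real^2) \<delta>' \<times> {0<..<1::real})" by (intro connected_Times connected_ball) auto
  qed
  ultimately show ?thesis using oN xN Nr by auto
qed

lemma g_lipschitz:
  assumes d: "0 < d" "d < \<delta>"
  obtains L where "0 \<le> L" "\<And>y y'. norm y < d \<Longrightarrow> norm y' < d \<Longrightarrow> \<bar>g y - g y'\<bar> \<le> L * norm (y - y')"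
proof -
  have "compact (dg ` cball 0 d)"
    by (intro compact_continuous_image continuous_on_subset[OF continuous_on_dg]) (use d in auto)
  then obtain L where L: "\<And>y. y \<in> cball 0 d \<Longrightarrow> norm (dg y) \<le> L" using compact_imp_bounded bounded_iff by (metis image_eqI)
  have L0: "0 \<le> L" using L[of 0] d norm_ge_zero[of "dg 0"] by (metis centre_in_cball less_imp_le order.trans)
  have "\<bar>g y - g y'\<bar> \<le> L * norm (y - y')" if "norm y < d" "norm y' < d" for y y'
  proof -
    have "norm (g y - g y') \<le> L * norm (y - y')"
    proof (rule differentiable_bound[where S="ball 0 d" and f'="\<lambda>y k. dg y \<bullet> k"])
      show "(g has_derivative (\<lambda>k. dg y \<bullet> k)) (at y within ball 0 d)" if "y \<in> ball 0 d" for y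
        by (rule has_derivative_at_withinI[OF g_has_derivative]) (use that d in auto)
      show "onorm (\<lambda>k. dg y \<bullet> k) \<le> L" if "y \<in> ball 0 d" for y
      proof (rule onorm_le)
        fix k
        have "norm (dg y \<bullet> k) \<le> norm (dg y) * norm k" by (simp add: Cauchy_Schwarz_ineq2)
        also have "\<dots> \<le> L * norm k" using L[of y] that by (intro mult_right_mono) auto
        finally show "norm (dg y \<bullet> k) \<le> L * norm k" .
      qed
    qed (use that in auto)
    then show ?thesis by simp
  qed
  then show thesis using that L0 by blast
qed

text \<open>The connecting path rises parallel to \<open>n\<close>, crosses over and descends. With
  Lipschitz constant \<open>L\<close> and horizontal distance \<open>l\<close>, the graph rises by
  at most \<open>L * l\<close> on the way, so a lift by \<open>m = 2 * L * l\<close> clears it; the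
  two vertical parts add \<open>4 * L * l\<close> to the length.\<close>

lemma exterior_quasiconvex_x:
  assumes r: "0 < r"
  shows "\<exists>\<rho>>0. \<exists>K. \<forall>z1\<in>exterior \<Omega> \<inter> ball x \<rho>. \<forall>z2\<in>exterior \<Omega> \<inter> ball x \<rho>. \<exists>w1 w2.
    closed_segment z1 w1 \<union> closed_segment w1 w2 \<union> closed_segment w2 z2 \<subseteq> exterior \<Omega> \<inter> ball x r \<and>
    norm (w1 - z1) + norm (w2 - w1) + norm (z2 - w2) \<le> K * norm (z2 - z1)"
proof -
  have d: "0 < \<delta> / 2" "\<delta> / 2 < \<delta>" using delta by auto
  obtain L where L: "0 \<le> L" "\<And>y y'. norm y < \<delta> / 2 \<Longrightarrow> norm y' < \<delta> / 2 \<Longrightarrow> \<bar>g y - g y'\<bar> \<le> L * norm (y - y')"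
    using g_lipschitz[OF d] by metis
  \<comment> \<open>The lift is at most \<open>4 * L * \<rho>\<close>, so every point of the path is
    within \<open>(2 + 4 * L) * \<rho>\<close> of \<open>x\<close>, which is below both
    \<open>h\<close> and \<open>r\<close>.\<close>
  define \<rho> where "\<rho> = min (\<delta> / 2) (min h r / (3 + 4 * L))"
  have \<rho>: "0 < \<rho>" using delta h r L(1) by (auto simp: \<rho>_def intro!: divide_pos_pos)
  have \<rho>': "\<rho> \<le> \<delta> / 2" "\<rho> \<le> min h r / (3 + 4 * L)" unfolding \<rho>_def by (rule min.cobounded1, rule min.cobounded2)
  note \<rho> = \<rho> \<rho>'(1)
  have "\<rho> * (3 + 4 * L) \<le> min h r" using \<rho>'(2) L(1) by (subst (asm) pos_le_divide_eq) auto
  then have \<rho>2: "(2 + 4 * L) * \<rho> < h" "(2 + 4 * L) * \<rho> < r" using \<rho>(1) by (auto simp: algebra_simps)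
  have \<rho>3: "\<rho> < h" 
  proof -
    have "0 \<le> 4 * L * \<rho>" using \<rho>(1) L(1) by simp
    then show ?thesis using \<rho>2(1) \<rho>(1) unfolding distrib_right by linarith
  qed
  have "\<exists>w1 w2. closed_segment z1 w1 \<union> closed_segment w1 w2 \<union> closed_segment w2 z2 \<subseteq> exterior \<Omega> \<inter> ball x r \<and>
    norm (w1 - z1) + norm (w2 - w1) + norm (z2 - w2) \<le> (1 + 4 * L) * norm (z2 - z1)"
    if z: "z1 \<in> exterior \<Omega> \<inter> ball x \<rho>" "z2 \<in> exterior \<Omega> \<inter> ball x \<rho>" for z1 z2
  proof -
    define y1 y2 t1 t2 where "y1 = prj z1" and "y2 = prj z2" and "t1 = hgt z1" and "t2 = hgt z2"
    note defs = y1_def y2_def t1_def t2_def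
    define l where "l = norm (y1 - y2)"
    define m where "m = 2 * L * l"
    have b: "norm y1 < \<rho>" "norm y2 < \<rho>" "\<bar>t1\<bar> < \<rho>" "\<bar>t2\<bar> < \<rho>"
      using prj_hgt_le[of z1 x] prj_hgt_le[of z2 x] z by (auto simp: defs prj_x dist_norm norm_minus_commute)
    have l: "0 \<le> l" "l < 2 * \<rho>" "l \<le> norm (z2 - z1)"
      using norm_triangle_ineq4[of y1 y2] b prj_hgt_le(1)[of z1 z2] by (auto simp: l_def defs norm_minus_commute)
    have m: "0 \<le> m" "m \<le> 4 * L * \<rho>" using l L(1) mult_left_mono[of l "2 * \<rho>" "2 * L"] by (auto simp: m_def)
    have good: "x + p y + t *\<^sub>R n \<in> exterior \<Omega> \<inter> ball x r" if "norm y < \<rho>" "\<bar>t\<bar> < \<rho> + m" "g y < t" for y t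
    proof
      have c: "x + p y + t *\<^sub>R n \<in> cyl" unfolding cyl_iff using that \<rho> \<rho>2 m L by (auto simp: algebra_simps)
      show "x + p y + t *\<^sub>R n \<in> exterior \<Omega>" by (rule above_exterior[OF c]) (simp add: prj_Z hgt_Z that)
      have "norm (p y + t *\<^sub>R n) < (2 + 4 * L) * \<rho>" using norm_Z[of y t] that m by (simp add: algebra_simps)
      then have "norm (p y + t *\<^sub>R n) < r" using \<rho>2 by linarith
      moreover have "x - (x + p y + t *\<^sub>R n) = - (p y + t *\<^sub>R n)" by simp
      ultimately show "x + p y + t *\<^sub>R n \<in> ball x r"
        unfolding mem_ball dist_norm by (simp only: norm_minus_cancel)
    qed
    have lt: "g y1 < t1" "g y2 < t2"
    proof -
      have c: "z1 \<in> cyl" "z2 \<in> cyl" using b \<rho> \<rho>3 unfolding cyl_def defs by auto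
      have n: "z1 \<notin> \<Omega>" "z2 \<notin> \<Omega>" using z closure_subset by auto
      have "z \<in> frontier \<Omega>" if "z \<in> cyl" "hgt z = g (prj z)" for z
        using sig_frontier(1)[of "prj z"] Z_coords[of z] that by (simp add: sig_def cyl_def)
      then have "t1 \<noteq> g y1" "t2 \<noteq> g y2" using c z by (auto simp: defs frontier_def)
      then show "g y1 < t1" "g y2 < t2" using in_O_iff[OF c(1)] in_O_iff[OF c(2)] n by (auto simp: defs)
    qed
    have zc: "z1 = x + p y1 + t1 *\<^sub>R n" "z2 = x + p y2 + t2 *\<^sub>R n" using Z_coords[of z1] Z_coords[of z2] by (simp_all add: defs)
    let ?w1 = "x + p y1 + (t1 + m) *\<^sub>R n" and ?w2 = "x + p y2 + (t2 + m) *\<^sub>R n"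
    have vert: "closed_segment (x + p y + t *\<^sub>R n) (x + p y + (t + m) *\<^sub>R n) \<subseteq> exterior \<Omega> \<inter> ball x r"
      if "norm y < \<rho>" "\<bar>t\<bar> < \<rho>" "g y < t" for y t
    proof
      fix z assume "z \<in> closed_segment (x + p y + t *\<^sub>R n) (x + p y + (t + m) *\<^sub>R n)"
      then obtain s where s: "0 \<le> s" "s \<le> 1" "z = (1 - s) *\<^sub>R (x + p y + t *\<^sub>R n) + s *\<^sub>R (x + p y + (t + m) *\<^sub>R n)"
        by (auto simp: in_segment)
      have "z = x + p y + (t + s * m) *\<^sub>R n" unfolding s(3) by (simp add: algebra_simps)
      moreover have "0 \<le> s * m" "s * m \<le> m" using s m by (auto simp: mult_left_le_one_le)
      ultimately show "z \<in> exterior \<Omega> \<inter> ball x r" using good[of y "t + s * m"] that by auto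
    qed
    have horiz: "closed_segment ?w1 ?w2 \<subseteq> exterior \<Omega> \<inter> ball x r"
    proof
      fix z assume "z \<in> closed_segment ?w1 ?w2"
      then obtain s where s: "0 \<le> s" "s \<le> 1" "z = (1 - s) *\<^sub>R ?w1 + s *\<^sub>R ?w2" by (auto simp: in_segment)
      let ?y = "(1 - s) *\<^sub>R y1 + s *\<^sub>R y2" and ?t = "(1 - s) * t1 + s * t2 + m"
      have py: "p ?y = (1 - s) *\<^sub>R p y1 + s *\<^sub>R p y2" by (simp only: linear_add[OF lin] linear_cmul[OF lin])
      have z: "z = x + p ?y + ?t *\<^sub>R n" unfolding s(3) py by (simp add: algebra_simps)
      have ny: "norm ?y < \<rho>"
      proof -
        have "norm ?y \<le> (1 - s) * norm y1 + s * norm y2" using norm_triangle_ineq[of "(1 - s) *\<^sub>R y1" "s *\<^sub>R y2"] s by simp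
        also have "\<dots> < \<rho>" using convex_bound_lt[of "norm y1" \<rho> "norm y2" "1 - s" s] b s by simp
        finally show ?thesis .
      qed
      have nt: "\<bar>?t\<bar> < \<rho> + m"
      proof -
        have "(1 - s) * t1 + s * t2 < \<rho>" using convex_bound_lt[of t1 \<rho> t2 "1 - s" s] b s by simp
        moreover have "(1 - s) * (- t1) + s * (- t2) < \<rho>" using convex_bound_lt[of "- t1" \<rho> "- t2" "1 - s" s] b s by simp
        ultimately show ?thesis using m by (auto simp: abs_less_iff)
      qed
      have "g ?y < ?t"
      proof -
        have "?y - y1 = s *\<^sub>R (y2 - y1)" "?y - y2 = (1 - s) *\<^sub>R (y1 - y2)" by (simp_all add: algebra_simps)
        then have e: "norm (?y - y1) = s * l" "norm (?y - y2) = (1 - s) * l" using s by (simp_all add: l_def norm_minus_commute)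
        have "norm y < \<delta> / 2" if "norm y < \<rho>" for y :: "real^2" using that \<rho>(2) by simp
        then have "\<bar>g ?y - g y1\<bar> \<le> L * (s * l)" "\<bar>g ?y - g y2\<bar> \<le> L * ((1 - s) * l)"
          using L(2)[of ?y y1] L(2)[of ?y y2] ny b e by auto
        moreover have "L * (s * l) \<le> L * l" "L * ((1 - s) * l) \<le> L * l"
          using s l L(1) by (intro mult_left_mono mult_left_le_one_le; simp)+
        moreover have "L * l \<le> m" using L l by (simp add: m_def)
        ultimately have "g ?y - m < t1" "g ?y - m < t2" using lt by auto
        then have "(1 - s) * (- t1) + s * (- t2) < - (g ?y - m)" 
          using convex_bound_lt[of "- t1" "- (g ?y - m)" "- t2" "1 - s" s] s by simp
        then show ?thesis by simp
      qed
      then show "z \<in> exterior \<Omega> \<inter> ball x r" unfolding z by (rule good[OF ny nt])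
    qed
    have "?w1 - z1 = m *\<^sub>R n" "z2 - ?w2 = - (m *\<^sub>R n)" and w: "?w2 - ?w1 = z2 - z1" unfolding zc by (simp_all add: algebra_simps)
    then have nm: "norm (?w1 - z1) = m" "norm (z2 - ?w2) = m" using m n1 by simp_all
    have "2 * m \<le> 4 * L * norm (z2 - z1)" using l L(1) unfolding m_def by (simp add: mult_left_mono)
    then have len: "norm (?w1 - z1) + norm (?w2 - ?w1) + norm (z2 - ?w2) \<le> (1 + 4 * L) * norm (z2 - z1)"
      unfolding nm w distrib_right by linarith
    have "closed_segment z1 ?w1 \<subseteq> exterior \<Omega> \<inter> ball x r" using vert[OF b(1,3) lt(1)] unfolding zc(1)[symmetric] .
    moreover have "closed_segment ?w2 z2 \<subseteq> exterior \<Omega> \<inter> ball x r" 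
      using vert[OF b(2,4) lt(2)] unfolding zc(2)[symmetric] closed_segment_commute[of z2] .
    ultimately have "closed_segment z1 ?w1 \<union> closed_segment ?w1 ?w2 \<union> closed_segment ?w2 z2 \<subseteq> exterior \<Omega> \<inter> ball x r"
      using horiz by blast
    then show ?thesis using len by blast
  qed
  then show ?thesis using \<rho>(1) by blast
qed

end


subsection \<open>Domains with smooth boundary\<close>

lemma C_closure_mono: "C_closure k U f \<Longrightarrow> j \<le> k \<Longrightarrow> C_closure j U f"
  unfolding C_closure_def using C_on_mono[of k U f j] by auto

lemma C_closure_C_on: "C_closure k U f \<Longrightarrow> C_on k U f"
  by (simp add: C_closure_def)

lemma C_closure_loc_C_on:
  fixes f :: "'a::euclidean_space \<Rightarrow> 'b::real_normed_vector"
  assumes U: "open U" and f: "C_closure_loc k U f" shows "C_on k U f"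
proof -
  have *: "C_on k (ball c R \<inter> U) f" for c R using f by (simp add: C_closure_loc_def C_closure_def)
  show ?thesis unfolding C_on_def
  proof (intro conjI allI impI ballI)
    fix bs :: "'a list" and x assume "set bs \<subseteq> Basis \<and> length bs < k" "x \<in> U"
    then show "iter_partial bs f differentiable (at x)" using *[of x 1] unfolding C_on_def by auto
  next
    fix bs :: "'a list" assume bs: "set bs \<subseteq> Basis \<and> length bs \<le> k"
    have "continuous_on (\<Union>x\<in>U. ball x 1 \<inter> U) (iter_partial bs f)"
      by (rule continuous_on_open_UN) (use * bs U in \<open>auto simp: C_on_def\<close>)
    moreover have "(\<Union>x\<in>U. ball x 1 \<inter> U) = U" by auto
    ultimately show "continuous_on U (iter_partial bs f)" by simp
  qed
qed

lemma C_closure_bounded: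
  assumes "C_closure k U f" "bounded U" "set bs \<subseteq> Basis" "length bs \<le> k"
  shows "\<exists>M. \<forall>x\<in>U. norm (iter_partial bs f x) \<le> M"
proof -
  obtain g where g: "continuous_on (closure U) g" "\<forall>x\<in>U. g x = iter_partial bs f x"
    using assms unfolding C_closure_def by blast
  have "compact (g ` closure U)" using assms(2) by (intro compact_continuous_image g) (simp add: compact_closure)
  then obtain M where "\<And>x. x \<in> closure U \<Longrightarrow> norm (g x) \<le> M" using compact_imp_bounded bounded_iff by (metis image_eqI)
  then show ?thesis using g(2) closure_subset by (metis subsetD)
qed

text \<open>\<open>bdry_trace\<close> is a \<open>Lim\<close>, informative only when the limit
  exists and the filter is nontrivial. A continuous extension near \<open>x\<close> provides the
  first; the second holds because \<open>x\<close> is in the closure but not in the set.\<close>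

lemma trace_of_extension:
  fixes f :: "real^3 \<Rightarrow> 'b::real_normed_vector"
  assumes g: "continuous_on (closure (ball x R \<inter> U)) g" "\<And>y. y \<in> ball x R \<inter> U \<Longrightarrow> g y = f y" and R: "0 < R"
    and x: "x \<in> closure U" "x \<notin> U"
  shows "(f \<longlongrightarrow> g x) (at x within U)" "bdry_trace U f x = g x" "x \<in> closure (ball x R \<inter> U)" "at x within U \<noteq> bot"
proof -
  have xi: "x islimpt U" using x by (simp add: closure_def)
  show nb: "at x within U \<noteq> bot" using xi trivial_limit_within by blast
  show xc: "x \<in> closure (ball x R \<inter> U)"
    using open_Int_closure_subset[OF open_ball, of x R U] x R by auto
  have "(g \<longlongrightarrow> g x) (at x within closure (ball x R \<inter> U))"
    using g(1) xc by (simp add: continuous_on_def)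
  then have "(g \<longlongrightarrow> g x) (at x within (ball x R \<inter> U))" by (rule tendsto_within_subset) (rule closure_subset)
  moreover have "eventually (\<lambda>y. g y = f y) (at x within (ball x R \<inter> U))"
    unfolding eventually_at_topological using g(2) by blast
  ultimately have "(f \<longlongrightarrow> g x) (at x within (ball x R \<inter> U))" by (rule Lim_transform_eventually)
  then show l: "(f \<longlongrightarrow> g x) (at x within U)"
  proof -
    have "at x within (ball x R \<inter> U) = at x within U"
      by (rule at_within_nhd[of x "ball x R"]) (use R in auto)
    then show "(f \<longlongrightarrow> g x) (at x within (ball x R \<inter> U)) \<Longrightarrow> ?thesis" by simp
  qed
  show "bdry_trace U f x = g x" unfolding bdry_trace_def by (rule tendsto_Lim[OF nb l])
qed

text \<open>Two derivatives of the charts are requested because Stokes' theorem on a patch exchanges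
  the mixed second derivatives of the parametrisation.\<close>

locale smooth_domain =
  fixes \<Omega> :: "(real^3) set"
  assumes O_open: "open \<Omega>" and O_bounded: "bounded \<Omega>"
    and E_connected: "connected (exterior \<Omega>)"
    and smooth: "\<And>z. z \<in> frontier \<Omega> \<Longrightarrow> \<exists>\<sigma> \<delta>. graph_patch \<Omega> \<sigma> \<delta> \<and> \<sigma> 0 = z \<and> C_closure 2 (ball 0 \<delta>) \<sigma>"
begin

abbreviation "E \<equiv> exterior \<Omega>"

lemma frontier_O: "frontier \<Omega> = closure \<Omega> - \<Omega>"
  using O_open by (simp add: frontier_def interior_open)

lemma patch_at:
  assumes "z \<in> frontier \<Omega>"
  obtains n p h \<delta> g where "patch \<Omega> z n p h \<delta> g" "C_closure 2 (ball 0 \<delta>) (patch.sig z n p g)"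
proof -
  obtain \<sigma> \<delta> where s: "graph_patch \<Omega> \<sigma> \<delta>" "\<sigma> 0 = z" "C_closure 2 (ball 0 \<delta>) \<sigma>" using smooth[OF assms] by blast
  obtain x n p h g where P: "patch \<Omega> x n p h \<delta> g" "\<sigma> = patch.sig x n p g" using graph_patchE[OF O_open s(1)] by blast
  then have "x = z" using patch.sig_0[OF P(1)] s(2) by simp
  then show thesis using P s(3) that by blast
qed

sublocale exterior_domain \<Omega>
proof
  fix x r assume x: "x \<in> closure \<Omega>" and r: "(0::real) < r"
  show "\<exists>N. open N \<and> x \<in> N \<and> N \<subseteq> ball x r \<and> connected (N \<inter> \<Omega>)"
  proof (cases "x \<in> \<Omega>")
    case True
    then obtain s where s: "s > 0" "ball x s \<subseteq> \<Omega>" using O_open open_contains_ball by blast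
    have "ball x (min r s) \<inter> \<Omega> = ball x (min r s)" using s by auto
    then show ?thesis using r s by (intro exI[of _ "ball x (min r s)"]) auto
  next
    case False
    then have "x \<in> frontier \<Omega>" using x by (simp add: frontier_O)
    then obtain n p h \<delta> g where P: "patch \<Omega> x n p h \<delta> g" using patch_at by metis
    show ?thesis by (rule patch.locally_connected_x[OF P r])
  qed
qed (use O_open O_bounded E_connected in auto)

lemma nu_half_space_at: "z \<in> frontier \<Omega> \<Longrightarrow> half_space_at \<Omega> z (nu \<Omega> z)"
  using smooth nu_half_space[OF O_open] by metis

lemma frontier_closures: "z \<in> frontier \<Omega> \<Longrightarrow> z \<in> closure E" "z \<in> frontier \<Omega> \<Longrightarrow> z \<notin> E" 
  "z \<in> frontier \<Omega> \<Longrightarrow> z \<in> closure \<Omega>" "z \<in> frontier \<Omega> \<Longrightarrow> z \<notin> \<Omega>"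
proof -
  assume z: "z \<in> frontier \<Omega>"
  then obtain n p h \<delta> g where P: "patch \<Omega> z n p h \<delta> g" using patch_at by metis
  show "z \<in> closure E" using patch.sig_frontier(2)[OF P, of 0] patch.sig_0[OF P] patch.delta[OF P] by simp
qed (auto simp: frontier_O)

lemma closure_E: "closure E = - \<Omega>"
proof
  show "closure E \<subseteq> - \<Omega>" using O_open closure_subset by (intro closure_minimal) auto
  show "- \<Omega> \<subseteq> closure E"
  proof
    fix z assume "z \<in> - \<Omega>"
    then show "z \<in> closure E" using frontier_closures(1)[of z] closure_subset[of E] by (auto simp: frontier_O)
  qed
qed

text \<open>In Euclidean space a connected set with connected complement has a connected frontier;
  here the complement is the closure of the connected exterior.\<close>

lemma frontier_connected:
  assumes "connected \<Omega>" shows "connected (frontier \<Omega>)"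
  using connected_frontier_simple[OF assms] E_connected closure_E connected_imp_connected_closure by metis

lemma quasiconvex_at:
  assumes z: "z \<in> closure E" and r: "0 < r"
  shows "\<exists>\<rho>>0. \<exists>K. \<forall>z1\<in>E \<inter> ball z \<rho>. \<forall>z2\<in>E \<inter> ball z \<rho>. \<exists>w1 w2.
    closed_segment z1 w1 \<union> closed_segment w1 w2 \<union> closed_segment w2 z2 \<subseteq> E \<inter> ball z r \<and>
    norm (w1 - z1) + norm (w2 - w1) + norm (z2 - w2) \<le> K * norm (z2 - z1)"
proof (cases "z \<in> frontier \<Omega>")
  case True
  then obtain n p h \<delta> g where P: "patch \<Omega> z n p h \<delta> g" using patch_at by metis
  show ?thesis by (rule patch.exterior_quasiconvex_x[OF P r])
next
  case False
  then have "z \<in> E" using z by (auto simp: closure_E frontier_O)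
  then obtain s where s: "s > 0" "ball z s \<subseteq> E" using E_open open_contains_ball by blast
  have "\<exists>w1 w2. closed_segment z1 w1 \<union> closed_segment w1 w2 \<union> closed_segment w2 z2 \<subseteq> E \<inter> ball z r \<and>
      norm (w1 - z1) + norm (w2 - w1) + norm (z2 - w2) \<le> 1 * norm (z2 - z1)"
    if "z1 \<in> E \<inter> ball z (min r s)" "z2 \<in> E \<inter> ball z (min r s)" for z1 z2
  proof -
    have "closed_segment z1 z2 \<subseteq> ball z (min r s)" using that by (intro closed_segment_subset) auto
    moreover have "ball z (min r s) \<subseteq> ball z s \<inter> ball z r" by auto
    ultimately have sub: "closed_segment z1 z2 \<subseteq> E \<inter> ball z r" using s(2) by blast
    show ?thesis by (rule exI[of _ z1], rule exI[of _ z2]) (use sub that s r in auto)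
  qed
  moreover have "min r s > 0" using r s by simp
  ultimately show ?thesis by blast
qed

lemma segment_bound:
  fixes F :: "real^3 \<Rightarrow> 'b::real_normed_vector"
  assumes "closed_segment a b \<subseteq> S" "\<And>y. y \<in> S \<Longrightarrow> F differentiable (at y)"
    and "\<And>y h. y \<in> S \<Longrightarrow> norm (partial h F y) \<le> M * norm h"
  shows "norm (F b - F a) \<le> M * norm (b - a)"
proof (rule differentiable_bound[where S="closed_segment a b" and f'="\<lambda>y h. partial h F y"])
  show "(F has_derivative (\<lambda>h. partial h F y)) (at y within closed_segment a b)" if "y \<in> closed_segment a b" for y
    by (rule has_derivative_at_withinI[OF has_derivative_partial]) (use assms that in auto)
  show "onorm (\<lambda>h. partial h F y) \<le> M" if "y \<in> closed_segment a b" for y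
    by (rule onorm_le) (use assms that in auto)
qed auto

lemma lipschitz_at:
  fixes F :: "real^3 \<Rightarrow> 'b::real_normed_vector"
  assumes z: "z \<in> closure E" and d: "\<And>y. y \<in> E \<Longrightarrow> F differentiable (at y)"
    and b: "\<And>y h. y \<in> E \<inter> ball z 1 \<Longrightarrow> norm (partial h F y) \<le> M * norm h"
  shows "\<exists>\<rho>>0. \<exists>K. \<forall>z1\<in>E \<inter> ball z \<rho>. \<forall>z2\<in>E \<inter> ball z \<rho>. norm (F z2 - F z1) \<le> K * norm (z2 - z1)"
proof -
  obtain \<rho> K where K: "\<rho> > 0" "\<And>z1 z2. z1 \<in> E \<inter> ball z \<rho> \<Longrightarrow> z2 \<in> E \<inter> ball z \<rho> \<Longrightarrow> \<exists>w1 w2.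
    closed_segment z1 w1 \<union> closed_segment w1 w2 \<union> closed_segment w2 z2 \<subseteq> E \<inter> ball z 1 \<and>
    norm (w1 - z1) + norm (w2 - w1) + norm (z2 - w2) \<le> K * norm (z2 - z1)"
    using quasiconvex_at[OF z zero_less_one] by (elim exE conjE) blast
  have "norm (F z2 - F z1) \<le> (\<bar>M\<bar> * K) * norm (z2 - z1)" if zz: "z1 \<in> E \<inter> ball z \<rho>" "z2 \<in> E \<inter> ball z \<rho>" for z1 z2
  proof -
    obtain w1 w2 where w: "closed_segment z1 w1 \<union> closed_segment w1 w2 \<union> closed_segment w2 z2 \<subseteq> E \<inter> ball z 1"
      "norm (w1 - z1) + norm (w2 - w1) + norm (z2 - w2) \<le> K * norm (z2 - z1)" using K(2)[OF zz] by blast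
    have b': "norm (partial h F y) \<le> \<bar>M\<bar> * norm h" if "y \<in> E \<inter> ball z 1" for y h
      using b[OF that, of h] mult_right_mono[OF abs_ge_self, of "norm h" M] by simp
    have d': "F differentiable (at y)" if "y \<in> E \<inter> ball z 1" for y using d that by blast
    have "norm (F w1 - F z1) \<le> \<bar>M\<bar> * norm (w1 - z1)" "norm (F w2 - F w1) \<le> \<bar>M\<bar> * norm (w2 - w1)"
      "norm (F z2 - F w2) \<le> \<bar>M\<bar> * norm (z2 - w2)"
      using w(1) by (auto intro!: segment_bound[OF _ d' b'])
    moreover have "norm (F z2 - F z1) \<le> norm (F w1 - F z1) + norm (F w2 - F w1) + norm (F z2 - F w2)"
    proof -
      have "F z2 - F z1 = (F w1 - F z1) + (F w2 - F w1) + (F z2 - F w2)" by simp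
      then show ?thesis using norm_triangle_ineq[of "F w1 - F z1" "F w2 - F w1"] norm_triangle_ineq[of "(F w1 - F z1) + (F w2 - F w1)" "F z2 - F w2"] by simp
    qed
    ultimately have "norm (F z2 - F z1) \<le> \<bar>M\<bar> * (norm (w1 - z1) + norm (w2 - w1) + norm (z2 - w2))"
      by (simp add: distrib_left)
    also have "\<dots> \<le> \<bar>M\<bar> * (K * norm (z2 - z1))" by (rule mult_left_mono[OF w(2)]) simp
    finally show ?thesis by (simp add: mult.assoc)
  qed
  then show ?thesis using K(1) by blast
qed

text \<open>Local Lipschitz constants on a finite cover are combined with a Lebesgue number
  \<open>e\<close>: pairs closer than \<open>e\<close> lie in one member, and for all other pairs a
  bound of \<open>F\<close> divided by \<open>e\<close> serves as Lipschitz constant.\<close>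

lemma lipschitz_ball:
  fixes F :: "real^3 \<Rightarrow> 'b::real_normed_vector"
  assumes d: "\<And>y. y \<in> E \<Longrightarrow> F differentiable (at y)"
    and b: "\<And>R. \<exists>M. \<forall>y\<in>E \<inter> ball 0 R. \<forall>h. norm (partial h F y) \<le> M * norm h"
  shows "\<exists>K\<ge>0. \<forall>x\<in>E \<inter> ball 0 R. \<forall>y\<in>E \<inter> ball 0 R. norm (F y - F x) \<le> K * norm (y - x)"
proof -
  let ?S = "E \<inter> ball 0 R"
  have "\<forall>z\<in>closure ?S. \<exists>\<rho> K. \<rho> > 0 \<and> (\<forall>z1\<in>E \<inter> ball z \<rho>. \<forall>z2\<in>E \<inter> ball z \<rho>. norm (F z2 - F z1) \<le> K * norm (z2 - z1))"
  proof
    fix z assume "z \<in> closure ?S"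
    then have zE: "z \<in> closure E" using closure_mono[of ?S E] by auto
    \<comment> \<open>The connecting paths around \<open>z\<close> may leave the ball of radius
      \<open>R\<close>, so the derivative bound is taken on a ball that contains the unit ball at
      \<open>z\<close>.\<close>
    obtain M where M: "\<And>y h. y \<in> E \<inter> ball 0 (norm z + 1) \<Longrightarrow> norm (partial h F y) \<le> M * norm h" using b by blast
    have "ball z 1 \<subseteq> ball 0 (norm z + 1)"
    proof
      fix y assume "y \<in> ball z 1"
      then show "y \<in> ball 0 (norm z + 1)" using norm_triangle_sub[of y z] by (simp add: dist_norm norm_minus_commute)
    qed
    then have "\<And>y h. y \<in> E \<inter> ball z 1 \<Longrightarrow> norm (partial h F y) \<le> M * norm h" using M by blast
    from lipschitz_at[OF zE d this] 
    show "\<exists>\<rho> K. \<rho> > 0 \<and> (\<forall>z1\<in>E \<inter> ball z \<rho>. \<forall>z2\<in>E \<inter> ball z \<rho>. norm (F z2 - F z1) \<le> K * norm (z2 - z1))" by blast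
  qed
  then obtain \<rho> K where \<rho>: "\<And>z. z \<in> closure ?S \<Longrightarrow> \<rho> z > 0"
    and K: "\<And>z z1 z2. z \<in> closure ?S \<Longrightarrow> z1 \<in> E \<inter> ball z (\<rho> z) \<Longrightarrow> z2 \<in> E \<inter> ball z (\<rho> z) \<Longrightarrow> norm (F z2 - F z1) \<le> K z * norm (z2 - z1)"
    by metis
  have cS: "compact (closure ?S)" by (simp add: compact_closure bounded_Int)
  obtain I where I: "I \<subseteq> closure ?S" "finite I" "closure ?S \<subseteq> (\<Union>z\<in>I. ball z (\<rho> z))"
  proof (rule compactE_image[OF cS, of "closure ?S" "\<lambda>z. ball z (\<rho> z)"])
    show "closure ?S \<subseteq> (\<Union>z\<in>closure ?S. ball z (\<rho> z))" using \<rho> by force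
  qed auto
  obtain e where e: "e > 0" "\<And>z. z \<in> closure ?S \<Longrightarrow> \<exists>B\<in>(\<lambda>z. ball z (\<rho> z)) ` I. ball z e \<subseteq> B"
    using Heine_Borel_lemma[OF cS, of "(\<lambda>z. ball z (\<rho> z)) ` I"] I(3) by (metis (no_types, lifting) image_iff open_ball)
  define Km where "Km = (\<Sum>z\<in>I. \<bar>K z\<bar>)"
  have Km: "\<bar>K z\<bar> \<le> Km" if "z \<in> I" for z unfolding Km_def by (rule member_le_sum[OF that]) (use I in auto)
  have Km0: "0 \<le> Km" unfolding Km_def by (rule sum_nonneg) simp
  have near: "norm (F y - F x) \<le> Km * norm (y - x)" if "z \<in> I" "x \<in> E \<inter> ball z (\<rho> z)" "y \<in> E \<inter> ball z (\<rho> z)" for x y z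
  proof -
    have "norm (F y - F x) \<le> K z * norm (y - x)" using K that I(1) by blast
    also have "\<dots> \<le> Km * norm (y - x)" using Km[OF that(1)] by (intro mult_right_mono) auto
    finally show ?thesis .
  qed
  have "\<exists>B. \<forall>x\<in>E \<inter> ball z (\<rho> z). norm (F x) \<le> B" if zI: "z \<in> I" for z
  proof (cases "E \<inter> ball z (\<rho> z) = {}")
    case False
    then obtain x0 where x0: "x0 \<in> E \<inter> ball z (\<rho> z)" by blast
    have "norm (F x) \<le> norm (F x0) + Km * (2 * \<rho> z)" if x: "x \<in> E \<inter> ball z (\<rho> z)" for x
    proof -
      have "norm (x - x0) \<le> 2 * \<rho> z" using x x0 dist_triangle[of x x0 z] by (simp add: dist_norm[symmetric] dist_commute)
      then have "Km * norm (x - x0) \<le> Km * (2 * \<rho> z)" using Km0 by (rule mult_left_mono)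
      then show ?thesis using near[OF zI x0 x] norm_triangle_sub[of "F x" "F x0"] by linarith
    qed
    then show ?thesis by blast
  qed auto
  then obtain B where B: "\<And>z x. z \<in> I \<Longrightarrow> x \<in> E \<inter> ball z (\<rho> z) \<Longrightarrow> norm (F x) \<le> B z" by metis
  define Bm where "Bm = (\<Sum>z\<in>I. \<bar>B z\<bar>)"
  have Bm0: "0 \<le> Bm" unfolding Bm_def by (rule sum_nonneg) simp
  have Bm: "norm (F x) \<le> Bm" if "x \<in> ?S" for x
  proof -
    have "x \<in> closure ?S" by (rule subsetD[OF closure_subset that])
    then obtain z where z: "z \<in> I" "x \<in> ball z (\<rho> z)" using I(3) by blast
    have "norm (F x) \<le> B z" using B[OF z(1)] z(2) that by blast
    also have "\<dots> \<le> \<bar>B z\<bar>" by simp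
    also have "\<dots> \<le> Bm" unfolding Bm_def by (rule member_le_sum[OF z(1)]) (use I in auto)
    finally show ?thesis .
  qed
  have "norm (F y - F x) \<le> (Km + 2 * Bm / e) * norm (y - x)" if x: "x \<in> ?S" and y: "y \<in> ?S" for x y
  proof (cases "dist x y < e")
    case True
    have "x \<in> closure ?S" by (rule subsetD[OF closure_subset x])
    then obtain z where z: "z \<in> I" "ball x e \<subseteq> ball z (\<rho> z)" using e(2) by blast
    have "x \<in> ball z (\<rho> z)" "y \<in> ball z (\<rho> z)" by (rule subsetD[OF z(2)]; use e(1) True in simp)+
    then have "norm (F y - F x) \<le> Km * norm (y - x)" using near[OF z(1)] x y by blast
    also have "\<dots> \<le> (Km + 2 * Bm / e) * norm (y - x)" using Bm0 e by (intro mult_right_mono) auto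
    finally show ?thesis .
  next
    case False
    have "norm (F y - F x) \<le> 2 * Bm" using norm_triangle_ineq4[of "F y" "F x"] Bm[OF x] Bm[OF y] by linarith
    also have "\<dots> = (2 * Bm / e) * e" using e by simp
    also have "\<dots> \<le> (2 * Bm / e) * norm (y - x)"
      using False Bm0 e by (intro mult_left_mono) (auto simp: dist_norm norm_minus_commute)
    also have "\<dots> \<le> (Km + 2 * Bm / e) * norm (y - x)" using Km0 by (intro mult_right_mono) auto
    finally show ?thesis .
  qed
  moreover have "0 \<le> Km + 2 * Bm / e" using Km0 Bm0 e by simp
  ultimately show ?thesis by blast
qed

end


subsection \<open>Stokes' theorem on a patch\<close>

lemma UNIV_2_axis: "(Basis :: (real^2) set) = {axis 1 1, axis 2 1}"
  by (auto simp: Basis_vec_def UNIV_2)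

context patch
begin

definition d1 :: "real^2 \<Rightarrow> real^3" where "d1 y = partial (axis 1 1) sig y"
definition d2 :: "real^2 \<Rightarrow> real^3" where "d2 y = partial (axis 2 1) sig y"
definition N :: "real^2 \<Rightarrow> real^3" where "N y = cross3 (d1 y) (d2 y)"
text \<open>The isometry \<open>p\<close> is not tied to an orientation, so the cross product of the
  chart derivatives points along \<open>nml\<close> or against it; this sign records which.\<close>

definition om :: real where "om = cross3 (p (axis 1 1)) (p (axis 2 1)) \<bullet> n"

lemma om: "\<bar>om\<bar> = 1"
proof -
  let ?w = "cross3 (p (axis 1 1)) (p (axis 2 1))"
  have o: "?w \<bullet> p (axis 1 1) = 0" "?w \<bullet> p (axis 2 1) = 0" by (simp_all add: dot_cross_self inner_commute[of "cross3 _ _"])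
  have "prj (x + ?w) = 0" using o by (simp add: prj_def vec_eq_iff forall_2)
  then have "?w = om *\<^sub>R n" using Z_coords[of "x + ?w"] by (simp add: linear_0[OF lin] hgt_def om_def)
  then have "norm ?w = \<bar>om\<bar>" using n1 by simp
  moreover have "(norm ?w)\<^sup>2 = 1"
    using norm_cross_dot[of "p (axis 1 1)" "p (axis 2 1)"] by (simp add: inner_p inner_axis_axis iso)
  ultimately show ?thesis by (auto simp: power2_eq_1_iff)
qed

lemma N_eq: assumes y: "y \<in> ball 0 \<delta>" shows "N y = om *\<^sub>R nml y"
proof -
  have "N y \<bullet> partial b sig y = 0" if "b \<in> Basis" for b
    using that unfolding N_def d1_def d2_def UNIV_2_axis by (auto simp: dot_cross_self)
  then have "N y = (N y \<bullet> n) *\<^sub>R nml y" by (rule orth_nml[OF y])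
  moreover have "N y \<bullet> n = om"
    unfolding N_def d1_def d2_def partial_sig[OF y] om_def
    by (simp add: cross_add_left cross_add_right cross_mult_left cross_mult_right inner_add_left dot_cross_self)
  ultimately show ?thesis by simp
qed

lemma norm_N: "y \<in> ball 0 \<delta> \<Longrightarrow> norm (N y) = norm (nml y)"
  using om by (simp add: N_eq)

lemma continuous_on_d: "continuous_on (ball 0 \<delta>) d1" "continuous_on (ball 0 \<delta>) d2"
  unfolding d1_def[abs_def] d2_def[abs_def] by (intro C1_on_continuous_partial[OF C1_on_sig])+

lemma continuous_on_N: "continuous_on (ball 0 \<delta>) N"
  unfolding N_def[abs_def] by (intro continuous_on_cross continuous_on_d)

lemma C1_on_d:
  assumes "C_on 2 (ball 0 \<delta>) sig"
  shows "C1_on (ball 0 \<delta>) d1" "C1_on (ball 0 \<delta>) d2"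
    "y \<in> ball 0 \<delta> \<Longrightarrow> partial (axis 1 1) d2 y = partial (axis 2 1) d1 y"
proof -
  have b: "axis 1 1 \<in> (Basis :: (real^2) set)" "axis 2 1 \<in> (Basis :: (real^2) set)" by (auto simp: UNIV_2_axis)
  show 1: "C1_on (ball 0 \<delta>) d1" "C1_on (ball 0 \<delta>) d2"
    using assms b by (auto simp: C_on_2 d1_def[abs_def] d2_def[abs_def])
  show "y \<in> ball 0 \<delta> \<Longrightarrow> partial (axis 1 1) d2 y = partial (axis 2 1) d1 y"
    using partial_commute[OF open_ball _ C1_on_sig 1[unfolded d1_def[abs_def] d2_def[abs_def]]]
    by (simp add: d1_def[abs_def] d2_def[abs_def])
qed

lemma sig_bounded: "y \<in> ball 0 \<delta> \<Longrightarrow> \<bar>t\<bar> < h \<Longrightarrow> dist x (sig y + t *\<^sub>R n) < \<delta> + 2 * h"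
proof -
  assume y: "y \<in> ball 0 \<delta>" and t: "\<bar>t\<bar> < h"
  have "x - (sig y + t *\<^sub>R n) = - (p y + (g y + t) *\<^sub>R n)" by (simp add: sig_def algebra_simps)
  then have "dist x (sig y + t *\<^sub>R n) = norm (p y + (g y + t) *\<^sub>R n)" unfolding dist_norm by (simp only: norm_minus_cancel)
  then show ?thesis using norm_Z[of y "g y + t"] gh[OF y] y t by simp
qed

text \<open>Pulled back to the disc, the integrand is the first partial derivative of
  \<open>f\<close> times \<open>W \<bullet> d2\<close> minus the second one of \<open>f\<close>
  times \<open>W \<bullet> d1\<close>, so it integrates to zero. Since \<open>W\<close> is
  differentiable only inside \<open>U\<close>, this is done on copies of the surface shifted by
  \<open>\<tau> k\<close> along \<open>n\<close>, and the limit is taken with the extensions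
  \<open>W1\<close> and \<open>C1\<close>. The sign of \<open>s\<close> selects the side.\<close>

lemma patch_stokes:
  assumes s2: "C_on 2 (ball 0 \<delta>) sig"
    and U: "open U" "s \<noteq> 0" "\<And>y t. y \<in> ball 0 \<delta> \<Longrightarrow> \<bar>g y\<bar> + \<bar>t\<bar> < h \<Longrightarrow> 0 < s * t \<Longrightarrow> sig y + t *\<^sub>R n \<in> U"
    and W: "C1_on U W" "bounded V" "\<And>y t. y \<in> ball 0 \<delta> \<Longrightarrow> \<bar>t\<bar> < h \<Longrightarrow> sig y + t *\<^sub>R n \<in> V"
    and ext: "continuous_on (closure (V \<inter> U)) W1" "\<And>z. z \<in> V \<inter> U \<Longrightarrow> W1 z = W z"
      "continuous_on (closure (V \<inter> U)) C1" "\<And>z. z \<in> V \<inter> U \<Longrightarrow> C1 z = curl W z"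
    and f: "C1_on (ball 0 \<delta>) f" "0 < d" "d < \<delta>" "\<And>y. y \<in> ball 0 \<delta> \<Longrightarrow> d \<le> norm y \<Longrightarrow> f y = (0::real)"
  shows "(\<integral>y. indicator (ball 0 \<delta>) y * (f y * (C1 (sig y) \<bullet> N y)
      + (partial (axis 1 1) f y * (W1 (sig y) \<bullet> d2 y) - partial (axis 2 1) f y * (W1 (sig y) \<bullet> d1 y))) \<partial>lborel) = 0"
    "integrable lborel (\<lambda>y. indicator (ball 0 \<delta>) y * (f y * (C1 (sig y) \<bullet> N y)
      + (partial (axis 1 1) f y * (W1 (sig y) \<bullet> d2 y) - partial (axis 2 1) f y * (W1 (sig y) \<bullet> d1 y))))"
proof -
  \<comment> \<open>A radius strictly between \<open>d\<close> and \<open>\<delta>\<close>: on its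
    closed disc everything continuous is bounded, and the shifted surfaces keep a uniform distance
    from the ends of the cylinder.\<close>
  define d' where "d' = (d + \<delta>) / 2"
  have d': "0 < d'" "d < d'" "d' < \<delta>" using f(2,3) by (auto simp: d'_def)
  have sub: "cball 0 d' \<subseteq> ball 0 \<delta>" "ball 0 d' \<subseteq> ball 0 \<delta>" using d' by auto
  have inB: "y \<in> ball 0 \<delta>" if "norm y \<le> d'" for y :: "real^2" using that d' by simp
  let ?K = "cball (0::real^2) d'"
  have bnd: "\<exists>M. \<forall>y\<in>?K. norm (k y) \<le> M" if "continuous_on (ball 0 \<delta>) k" for k :: "real^2 \<Rightarrow> 'b::real_normed_vector"
  proof -
    have "compact (k ` ?K)" by (intro compact_continuous_image continuous_on_subset[OF that sub(1)]) simp
    then show ?thesis using compact_imp_bounded bounded_iff by (metis image_eqI)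
  qed
  obtain \<tau>0 where \<tau>0: "0 < \<tau>0" "\<And>y. y \<in> ?K \<Longrightarrow> \<bar>g y\<bar> + \<tau>0 < h"
  proof -
    have "compact ((\<lambda>y. \<bar>g y\<bar>) ` ?K)" by (intro compact_continuous_image continuous_intros continuous_on_subset[OF continuous_on_g sub(1)]) simp
    moreover have "(\<lambda>y. \<bar>g y\<bar>) ` ?K \<noteq> {}" using d' by auto
    ultimately obtain y0 where y0: "y0 \<in> ?K" "\<And>y. y \<in> ?K \<Longrightarrow> \<bar>g y\<bar> \<le> \<bar>g y0\<bar>"
      using compact_attains_sup[of "(\<lambda>y. \<bar>g y\<bar>) ` ?K"] by auto
    have "\<bar>g y0\<bar> < h" using gh sub(1) y0(1) by blast
    then have "0 < (h - \<bar>g y0\<bar>) / 2" "\<bar>g y0\<bar> + (h - \<bar>g y0\<bar>) / 2 < h" by (simp_all add: field_simps)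
    then show thesis using y0(2) by (intro that[of "(h - \<bar>g y0\<bar>) / 2"]) force+
  qed
  define \<tau> where "\<tau> k = sgn s * \<tau>0 / real (Suc (Suc k))" for k
  have \<tau>: "0 < s * \<tau> k" "\<bar>\<tau> k\<bar> \<le> \<tau>0" for k
    using U(2) \<tau>0(1) by (auto simp: \<tau>_def abs_mult abs_sgn_eq sgn_if field_simps)
  have \<tau>lim: "\<tau> \<longlonglongrightarrow> 0"
  proof -
    have "(\<lambda>k. (sgn s * \<tau>0) * (1 / real (Suc (Suc k)))) \<longlonglongrightarrow> (sgn s * \<tau>0) * 0"
      by (intro tendsto_intros LIMSEQ_Suc[OF LIMSEQ_Suc[OF lim_1_over_n]])
    then show ?thesis by (simp add: \<tau>_def[abs_def])
  qed
  have inVU: "sig y + \<tau> k *\<^sub>R n \<in> V \<inter> U" if "y \<in> ?K" for y k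
  proof -
    have "\<bar>g y\<bar> + \<bar>\<tau> k\<bar> < h" using \<tau>0(2)[OF that] \<tau>(2)[of k] by linarith
    moreover have "\<bar>\<tau> k\<bar> < h" using calculation abs_ge_zero[of "g y"] by linarith
    moreover have "y \<in> ball 0 \<delta>" using that by (intro inB) simp
    ultimately show ?thesis using U(3) W(3) \<tau>(1)[of k] by blast
  qed
  have cl: "sig y \<in> closure (V \<inter> U)" if "y \<in> ?K" for y
  proof (rule Lim_in_closed_set[OF closed_closure])
    show "\<forall>\<^sub>F k in sequentially. sig y + \<tau> k *\<^sub>R n \<in> closure (V \<inter> U)"
      using subsetD[OF closure_subset inVU[OF that]] by (intro always_eventually allI)
    have "(\<lambda>k. sig y + \<tau> k *\<^sub>R n) \<longlonglongrightarrow> sig y + 0 *\<^sub>R n" by (intro tendsto_intros \<tau>lim)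
    then show "(\<lambda>k. sig y + \<tau> k *\<^sub>R n) \<longlonglongrightarrow> sig y" by simp
  qed simp
  have lim: "(\<lambda>k. k1 (sig y + \<tau> k *\<^sub>R n)) \<longlonglongrightarrow> k1 (sig y)" if k1: "continuous_on (closure (V \<inter> U)) k1" and y: "y \<in> ?K" for k1 :: "real^3 \<Rightarrow> real^3" and y
  proof -
    have "(\<lambda>k. sig y + \<tau> k *\<^sub>R n) \<longlonglongrightarrow> sig y + 0 *\<^sub>R n" by (intro tendsto_intros \<tau>lim)
    then have "(\<lambda>k. sig y + \<tau> k *\<^sub>R n) \<longlonglongrightarrow> sig y" by simp
    then show ?thesis
      by (rule continuous_on_tendsto_compose[OF k1 _ cl[OF y] always_eventually]) (intro allI, rule subsetD[OF closure_subset inVU[OF y]])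
  qed
  define \<Phi> where "\<Phi> A B y = indicator (ball 0 d') y * (f y * (A y \<bullet> N y)
      + (partial (axis 1 1) f y * (B y \<bullet> d2 y) - partial (axis 2 1) f y * (B y \<bullet> d1 y)))" for A B :: "real^2 \<Rightarrow> real^3" and y
  let ?\<Phi>k = "\<lambda>k. \<Phi> (\<lambda>y. curl W (sig y + \<tau> k *\<^sub>R n)) (\<lambda>y. W (sig y + \<tau> k *\<^sub>R n))"
  let ?\<Phi>0 = "\<Phi> (\<lambda>y. C1 (sig y)) (\<lambda>y. W1 (sig y))"
  have zero: "integrable lborel (?\<Phi>k k) \<and> (\<integral>y. ?\<Phi>k k y \<partial>lborel) = 0" for k
  proof -
    let ?B = "ball (0::real^2) d'"
    let ?w = "\<lambda>y. W (sig y + \<tau> k *\<^sub>R n)"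
    have sk: "C1_on ?B (\<lambda>y. sig y + \<tau> k *\<^sub>R n)" by (intro C1_on_add C1_on_const C1_on_subset[OF C1_on_sig sub(2)])
    have w1: "C1_on ?B ?w" by (rule C1_on_compose[OF sk W(1)]) (use inVU in auto)
    have fB: "C1_on ?B f" "C1_on ?B d1" "C1_on ?B d2" using C1_on_subset[OF _ sub(2)] f(1) C1_on_d(1,2)[OF s2] by auto
    let ?F1 = "\<lambda>y. f y * (?w y \<bullet> d2 y)" and ?F2 = "\<lambda>y. f y * (?w y \<bullet> d1 y)"
    let ?G1 = "\<lambda>y. if y \<in> ?B then ?F1 y else 0" and ?G2 = "\<lambda>y. if y \<in> ?B then ?F2 y else 0"
    have F: "C1_on ?B ?F1" "C1_on ?B ?F2" by (intro C1_on_mult C1_on_inner fB w1)+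
    have z: "f y = 0" if "y \<in> ?B" "d \<le> norm y" for y using f(4)[OF inB] that by auto
    have Kd: "cball 0 d \<subseteq> ?B" using d' by auto
    have G: "C1_on UNIV ?G1" "C1_on UNIV ?G2"
      by (rule C1_on_extend_zero[OF open_ball _ closed_cball Kd]; use F z in auto)+
    have Gz: "?G1 y = 0" "?G2 y = 0" if "d \<le> norm y" for y using z[of y] that by auto
    have pw: "partial (axis i 1) ?w y = partial (partial (axis i 1) sig y) W (sig y + \<tau> k *\<^sub>R n)" if y: "y \<in> ?B" for y i
    proof -
      have "sig differentiable (at y)" using C1_on_sig inB[of y] y by (auto simp: C1_on_def)
      moreover have "partial h (\<lambda>y. sig y + \<tau> k *\<^sub>R n) y = partial h sig y" for h
        using partial_add[OF \<open>sig differentiable (at y)\<close>, of "\<lambda>y. \<tau> k *\<^sub>R n"] by simp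
      moreover have "W differentiable (at (sig y + \<tau> k *\<^sub>R n))" using W(1) inVU[of y k] y by (auto simp: C1_on_def)
      ultimately show ?thesis using partial_compose[of "\<lambda>y. sig y + \<tau> k *\<^sub>R n" y W "axis i 1"]
          C1_on_differentiable[OF sk y] by simp
    qed
    have key: "?\<Phi>k k y = partial (axis 1 1) ?G1 y - partial (axis 2 1) ?G2 y" for y
    proof (cases "y \<in> ?B")
      case True
      have dd: "f differentiable (at y)" "?w differentiable (at y)" "d1 differentiable (at y)" "d2 differentiable (at y)"
        "(\<lambda>y. ?w y \<bullet> d1 y) differentiable (at y)" "(\<lambda>y. ?w y \<bullet> d2 y) differentiable (at y)"
        using fB w1 C1_on_inner[OF w1 fB(2)] C1_on_inner[OF w1 fB(3)] True by (auto simp: C1_on_def)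
      have "partial (axis 1 1) ?G1 y = partial (axis 1 1) ?F1 y" "partial (axis 2 1) ?G2 y = partial (axis 2 1) ?F2 y"
        by (rule partial_cong_open[OF open_ball True]; simp)+
      moreover have "partial (axis 1 1) ?F1 y = f y * (?w y \<bullet> partial (axis 1 1) d2 y + partial (axis 1 1) ?w y \<bullet> d2 y)
          + partial (axis 1 1) f y * (?w y \<bullet> d2 y)"
        using dd by (simp add: partial_mult partial_inner)
      moreover have "partial (axis 2 1) ?F2 y = f y * (?w y \<bullet> partial (axis 2 1) d1 y + partial (axis 2 1) ?w y \<bullet> d1 y)
          + partial (axis 2 1) f y * (?w y \<bullet> d1 y)"
        using dd by (simp add: partial_mult partial_inner)
      \<comment> \<open>Symmetry of the second derivatives of the chart removes the terms that are
        not expressible through \<open>curl W\<close>.\<close>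
      moreover have "partial (axis 1 1) d2 y = partial (axis 2 1) d1 y" by (rule C1_on_d(3)[OF s2 inB]) (use True in auto)
      moreover have "partial (axis 1 1) ?w y \<bullet> d2 y - partial (axis 2 1) ?w y \<bullet> d1 y = curl W (sig y + \<tau> k *\<^sub>R n) \<bullet> N y"
        unfolding pw[OF True] N_def d1_def d2_def
        by (rule partial_curl_cross) (use W(1) inVU[of y k] True in \<open>auto simp: C1_on_def\<close>)
      ultimately show ?thesis using True unfolding \<Phi>_def by (simp add: algebra_simps)
    next
      case False
      then have "d < norm y" using d' by simp
      then have "partial h ?G1 y = 0" "partial h ?G2 y = 0" for h
        using partial_zero_outside[of d ?G1 y] partial_zero_outside[of d ?G2 y] Gz by auto
      then show ?thesis using False by (simp add: \<Phi>_def)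
    qed
    have i: "integrable lborel (partial (axis 1 1) ?G1)" "integrable lborel (partial (axis 2 1) ?G2)"
      "(\<integral>y. partial (axis 1 1) ?G1 y \<partial>lborel) = 0" "(\<integral>y. partial (axis 2 1) ?G2 y \<partial>lborel) = 0"
      using integrable_partial[OF G(1), of d] integrable_partial[OF G(2), of d] integral_partial_zero[OF G(1), of d] integral_partial_zero[OF G(2), of d] Gz
      by auto
    have "?\<Phi>k k = (\<lambda>y. partial (axis 1 1) ?G1 y - partial (axis 2 1) ?G2 y)" using key by blast
    then show ?thesis using i by simp
  qed
  have plim: "(\<lambda>k. ?\<Phi>k k y) \<longlonglongrightarrow> ?\<Phi>0 y" for y
  proof (cases "y \<in> ball 0 d'")
    case True
    then have y: "y \<in> ?K" by simp
    have "(\<lambda>k. C1 (sig y + \<tau> k *\<^sub>R n)) \<longlonglongrightarrow> C1 (sig y)" "(\<lambda>k. W1 (sig y + \<tau> k *\<^sub>R n)) \<longlonglongrightarrow> W1 (sig y)"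
      by (rule lim[OF ext(3) y], rule lim[OF ext(1) y])
    then have "(\<lambda>k. curl W (sig y + \<tau> k *\<^sub>R n)) \<longlonglongrightarrow> C1 (sig y)" "(\<lambda>k. W (sig y + \<tau> k *\<^sub>R n)) \<longlonglongrightarrow> W1 (sig y)"
      using ext(2,4) inVU[OF y] by simp_all
    then show ?thesis unfolding \<Phi>_def by (intro tendsto_intros)
  qed (simp add: \<Phi>_def)
  have cb: "\<exists>M. \<forall>z\<in>V \<inter> U. norm (k1 z) \<le> M" if k1: "continuous_on (closure (V \<inter> U)) k1" for k1 :: "real^3 \<Rightarrow> real^3"
  proof -
    have "compact (k1 ` closure (V \<inter> U))" using W(2) by (intro compact_continuous_image k1) (simp add: compact_closure bounded_Int)
    then show ?thesis using compact_imp_bounded bounded_iff closure_subset by (metis image_eqI subsetD)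
  qed
  obtain MC where MC: "\<And>z. z \<in> V \<inter> U \<Longrightarrow> norm (curl W z) \<le> MC" using cb[OF ext(3)] ext(4) by metis
  obtain MW where MW: "\<And>z. z \<in> V \<inter> U \<Longrightarrow> norm (W z) \<le> MW" using cb[OF ext(1)] ext(2) by metis
  obtain Mf where Mf: "\<And>y. y \<in> ?K \<Longrightarrow> norm (f y) \<le> Mf" using bnd[OF C1_on_continuous[OF f(1)]] by blast
  obtain Mf1 where Mf1: "\<And>y. y \<in> ?K \<Longrightarrow> norm (partial (axis 1 1) f y) \<le> Mf1" using bnd[OF C1_on_continuous_partial[OF f(1)]] by blast
  obtain Mf2 where Mf2: "\<And>y. y \<in> ?K \<Longrightarrow> norm (partial (axis 2 1) f y) \<le> Mf2" using bnd[OF C1_on_continuous_partial[OF f(1)]] by blast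
  obtain M1 where M1: "\<And>y. y \<in> ?K \<Longrightarrow> norm (d1 y) \<le> M1" using bnd[OF continuous_on_d(1)] by blast
  obtain M2 where M2: "\<And>y. y \<in> ?K \<Longrightarrow> norm (d2 y) \<le> M2" using bnd[OF continuous_on_d(2)] by blast
  obtain MN where MN: "\<And>y. y \<in> ?K \<Longrightarrow> norm (N y) \<le> MN" using bnd[OF continuous_on_N] by blast
  define M where "M = Mf * (MC * MN) + (Mf1 * (MW * M2) + Mf2 * (MW * M1))"
  have bound: "norm (?\<Phi>k k y) \<le> M * indicator (ball 0 d') y" for k y
  proof (cases "y \<in> ball 0 d'")
    case True
    then have y: "y \<in> ?K" by simp
    have ip: "\<bar>a * (b \<bullet> c)\<bar> \<le> A * (B * C)" if "norm a \<le> A" "norm b \<le> B" "norm c \<le> C" for a A B C :: real and b c :: "real^3"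
    proof -
      have "\<bar>b \<bullet> c\<bar> \<le> norm b * norm c" by (rule Cauchy_Schwarz_ineq2)
      also have "\<dots> \<le> B * C" using that order.trans[OF norm_ge_zero that(2)] by (intro mult_mono) auto
      finally show ?thesis unfolding abs_mult using that(1) order.trans[OF norm_ge_zero that(1)] by (intro mult_mono) auto
    qed
    have "norm (?\<Phi>k k y) \<le> \<bar>f y * (curl W (sig y + \<tau> k *\<^sub>R n) \<bullet> N y)\<bar>
      + (\<bar>partial (axis 1 1) f y * (W (sig y + \<tau> k *\<^sub>R n) \<bullet> d2 y)\<bar> + \<bar>partial (axis 2 1) f y * (W (sig y + \<tau> k *\<^sub>R n) \<bullet> d1 y)\<bar>)"
      using True unfolding \<Phi>_def by simp
    also have "\<dots> \<le> M" unfolding M_def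
      by (intro add_mono ip Mf[OF y] Mf1[OF y] Mf2[OF y] M1[OF y] M2[OF y] MN[OF y] MC[OF inVU[OF y]] MW[OF inVU[OF y]])
    finally show ?thesis using True by simp
  qed (simp add: \<Phi>_def)
  have Mint: "integrable lborel (\<lambda>y. M * indicator (ball (0::real^2) d') y)"
    by (rule integrable_mult_right[OF integrable_real_indicator[OF _ emeasure_bounded_finite[OF bounded_ball]]]) simp
  have mk: "?\<Phi>k k \<in> borel_measurable lborel" for k by (rule borel_measurable_integrable[OF conjunct1[OF zero]])
  have meas: "?\<Phi>0 \<in> borel_measurable lborel"
    by (rule borel_measurable_LIMSEQ_real[OF plim mk])
  have AE: "AE y in lborel. (\<lambda>k. ?\<Phi>k k y) \<longlonglongrightarrow> ?\<Phi>0 y" "\<And>k. AE y in lborel. norm (?\<Phi>k k y) \<le> M * indicator (ball 0 d') y"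
    using plim bound by auto
  have "(\<lambda>k. \<integral>y. ?\<Phi>k k y \<partial>lborel) \<longlonglongrightarrow> (\<integral>y. ?\<Phi>0 y \<partial>lborel)"
    by (rule integral_dominated_convergence[where s="?\<Phi>k", OF meas mk Mint AE])
  then have I0: "(\<integral>y. ?\<Phi>0 y \<partial>lborel) = 0" using zero LIMSEQ_unique[OF _ tendsto_const] by simp
  have i0: "integrable lborel ?\<Phi>0"
    by (rule integrable_dominated_convergence[where s="?\<Phi>k", OF meas mk Mint AE])
  have eq: "?\<Phi>0 = (\<lambda>y. indicator (ball 0 \<delta>) y * (f y * (C1 (sig y) \<bullet> N y)
      + (partial (axis 1 1) f y * (W1 (sig y) \<bullet> d2 y) - partial (axis 2 1) f y * (W1 (sig y) \<bullet> d1 y))))"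
  proof
    fix y
    show "?\<Phi>0 y = indicator (ball 0 \<delta>) y * (f y * (C1 (sig y) \<bullet> N y)
      + (partial (axis 1 1) f y * (W1 (sig y) \<bullet> d2 y) - partial (axis 2 1) f y * (W1 (sig y) \<bullet> d1 y)))"
    proof (cases "y \<in> ball 0 \<delta> \<and> y \<notin> ball 0 d'")
      case True
      have y: "y \<in> ball 0 \<delta> - cball 0 d" using True d' by auto
      have "open (ball 0 \<delta> - cball (0::real^2) d)" by (intro open_Diff) auto
      from partial_cong_open[OF this y, of f "\<lambda>y. 0"] f(4) have "partial h f y = 0" for h by auto
      moreover have "f y = 0" using f(4) y by auto
      ultimately show ?thesis using True by (simp add: \<Phi>_def)
    next
      case False
      then show ?thesis using inB[of y] by (cases "y \<in> ball 0 d'") (auto simp: \<Phi>_def indicator_def)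
    qed
  qed
  show "(\<integral>y. indicator (ball 0 \<delta>) y * (f y * (C1 (sig y) \<bullet> N y)
      + (partial (axis 1 1) f y * (W1 (sig y) \<bullet> d2 y) - partial (axis 2 1) f y * (W1 (sig y) \<bullet> d1 y))) \<partial>lborel) = 0"
    "integrable lborel (\<lambda>y. indicator (ball 0 \<delta>) y * (f y * (C1 (sig y) \<bullet> N y)
      + (partial (axis 1 1) f y * (W1 (sig y) \<bullet> d2 y) - partial (axis 2 1) f y * (W1 (sig y) \<bullet> d1 y))))"
    using I0 i0 unfolding eq by auto
qed

end


lemma C_closure_ext:
  assumes "C_closure k U f"
  shows "\<exists>g. continuous_on (closure U) g \<and> (\<forall>x\<in>U. g x = f x)"
  using assms unfolding C_closure_def by (auto dest!: spec[of _ "[]"] simp: iter_partial_def)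

lemma C_closure_partial_ext:
  assumes "C_closure k U f" "1 \<le> k" "b \<in> Basis"
  shows "\<exists>g. continuous_on (closure U) g \<and> (\<forall>x\<in>U. g x = partial b f x)"
  using assms unfolding C_closure_def by (auto dest!: spec[of _ "[b]"] simp: iter_partial_def)

lemma C_closure_curl_ext:
  assumes "C_closure 1 U F"
  shows "\<exists>g. continuous_on (closure U) g \<and> (\<forall>x\<in>U. g x = curl F x)"
proof -
  obtain G where G: "\<And>b. b \<in> Basis \<Longrightarrow> continuous_on (closure U) (G b) \<and> (\<forall>x\<in>U. G b x = partial b F x)"
    using C_closure_partial_ext[OF assms] by (metis order.refl)
  have b: "axis i 1 \<in> (Basis :: (real^3) set)" for i by (auto simp: Basis_vec_def)
  let ?C = "\<lambda>x. (G (axis 2 1) x $ 3 - G (axis 3 1) x $ 2) *\<^sub>R axis 1 1 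
    + (G (axis 3 1) x $ 1 - G (axis 1 1) x $ 3) *\<^sub>R axis 2 1
    + (G (axis 1 1) x $ 2 - G (axis 2 1) x $ 1) *\<^sub>R axis 3 (1::real) :: real^3"
  have "continuous_on (closure U) ?C" using G[OF b] by (intro continuous_intros) auto
  moreover have "?C x = curl F x" if "x \<in> U" for x using G[OF b] that by (simp add: curl_sum_axis)
  ultimately show ?thesis by blast
qed

lemma trace_eq:
  fixes f :: "real^3 \<Rightarrow> 'b::real_normed_vector"
  assumes g: "continuous_on (closure (V \<inter> U)) g" "\<And>y. y \<in> V \<inter> U \<Longrightarrow> g y = f y" and V: "open V" "x \<in> V"
    and x: "x \<in> closure U" "x \<notin> U"
  shows "(f \<longlongrightarrow> g x) (at x within U)" "bdry_trace U f x = g x" "x \<in> closure (V \<inter> U)"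
proof -
  obtain r where r: "r > 0" "ball x r \<subseteq> V" using V open_contains_ball by blast
  have sub: "closure (ball x r \<inter> U) \<subseteq> closure (V \<inter> U)" using r by (intro closure_mono) auto
  note * = trace_of_extension[OF continuous_on_subset[OF g(1) sub] _ r(1) x]
  show "(f \<longlongrightarrow> g x) (at x within U)" "bdry_trace U f x = g x" by (rule *; use g(2) r in auto)+
  show "x \<in> closure (V \<inter> U)" using *(3)[of f] g(2) r sub by blast
qed

context smooth_domain
begin

lemma nu_sig:
  assumes P: "patch \<Omega> z n p h \<delta> g" and y: "y \<in> ball 0 \<delta>"
  shows "nu \<Omega> (patch.sig z n p g y) = (1 / norm (patch.nml n p g y)) *\<^sub>R patch.nml n p g y"
  using half_space_at_unique[OF nu_half_space_at[OF patch.sig_frontier(1)[OF P y]] patch.half_space_sig[OF P y]] .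

lemma nu_tangent:
  assumes P: "patch \<Omega> z n p h \<delta> g" and y: "y \<in> ball 0 \<delta>"
  shows "nu \<Omega> (patch.sig z n p g y) \<bullet> patch.d1 z n p g y = 0" "nu \<Omega> (patch.sig z n p g y) \<bullet> patch.d2 z n p g y = 0"
  unfolding nu_sig[OF assms] patch.d1_def[OF P] patch.d2_def[OF P] using patch.nml_orth[OF P y] by simp_all

lemma tangential_inner:
  assumes "nu \<Omega> y \<bullet> d = 0"
  shows "tangential \<Omega> w y \<bullet> d = w y \<bullet> d"
  using assms by (simp add: tangential_def inner_diff_left)

text \<open>The identity on the patch is used from both sides with the same test function. The terms
  with derivatives of \<open>f\<close> see only tangential components, which agree, so the
  difference \<open>q\<close> of the normal components is orthogonal to all test functions; being
  continuous, it vanishes at the centre of the patch.\<close>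

lemma normal_curl_trace:
  assumes W: "C_closure 1 \<Omega> W" and W': "C_closure_loc 1 E W'"
    and t: "\<And>y. y \<in> frontier \<Omega> \<Longrightarrow> tan_minus \<Omega> W y = tan_plus \<Omega> W' y" and z: "z \<in> frontier \<Omega>"
  shows "nu \<Omega> z \<bullet> trace_minus \<Omega> (curl W) z = nu \<Omega> z \<bullet> trace_plus \<Omega> (curl W') z"
proof -
  obtain n p h \<delta> g where P: "patch \<Omega> z n p h \<delta> g" and s2': "C_closure 2 (ball 0 \<delta>) (patch.sig z n p g)"
    using patch_at[OF z] by metis
  interpret P: patch \<Omega> z n p h \<delta> g by fact
  have s2: "C_on 2 (ball 0 \<delta>) P.sig" by (rule C_closure_C_on[OF s2'])
  let ?V = "ball z (\<delta> + 2 * h)"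
  have VO: "closure (?V \<inter> \<Omega>) \<subseteq> closure \<Omega>" by (intro closure_mono) auto
  obtain A1 where A1': "continuous_on (closure \<Omega>) A1" "\<And>x. x \<in> \<Omega> \<Longrightarrow> A1 x = W x" using C_closure_ext[OF W] by blast
  obtain C1 where C1': "continuous_on (closure \<Omega>) C1" "\<And>x. x \<in> \<Omega> \<Longrightarrow> C1 x = curl W x" using C_closure_curl_ext[OF W] by blast
  have A1: "continuous_on (closure (?V \<inter> \<Omega>)) A1" "\<And>x. x \<in> ?V \<inter> \<Omega> \<Longrightarrow> A1 x = W x"
    and C1: "continuous_on (closure (?V \<inter> \<Omega>)) C1" "\<And>x. x \<in> ?V \<inter> \<Omega> \<Longrightarrow> C1 x = curl W x"
    using continuous_on_subset[OF _ VO] A1' C1' by auto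
  have W'V: "C_closure 1 (?V \<inter> E) W'" using W' by (simp add: C_closure_loc_def)
  obtain A2 where A2: "continuous_on (closure (?V \<inter> E)) A2" "\<And>x. x \<in> ?V \<inter> E \<Longrightarrow> A2 x = W' x" using C_closure_ext[OF W'V] by blast
  obtain C2 where C2: "continuous_on (closure (?V \<inter> E)) C2" "\<And>x. x \<in> ?V \<inter> E \<Longrightarrow> C2 x = curl W' x" using C_closure_curl_ext[OF W'V] by blast
  have inV: "P.sig y + t *\<^sub>R n \<in> ?V" if "y \<in> ball 0 \<delta>" "\<bar>t\<bar> < h" for y t using P.sig_bounded[OF that] by simp
  have inV0: "P.sig y \<in> ?V" if "y \<in> ball 0 \<delta>" for y using inV[OF that, of 0] P.h by simp
  have tr1: "trace_minus \<Omega> W (P.sig y) = A1 (P.sig y)" "trace_minus \<Omega> (curl W) (P.sig y) = C1 (P.sig y)"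
    and tr2: "trace_plus \<Omega> W' (P.sig y) = A2 (P.sig y)" "trace_plus \<Omega> (curl W') (P.sig y) = C2 (P.sig y)" 
    and cl: "P.sig y \<in> closure (?V \<inter> \<Omega>)" "P.sig y \<in> closure (?V \<inter> E)" if y: "y \<in> ball 0 \<delta>" for y
    using trace_eq[OF A1 open_ball inV0[OF y] frontier_closures(3,4)[OF P.sig_frontier(1)[OF y]]]
      trace_eq[OF C1 open_ball inV0[OF y] frontier_closures(3,4)[OF P.sig_frontier(1)[OF y]]]
      trace_eq[OF A2 open_ball inV0[OF y] frontier_closures(1,2)[OF P.sig_frontier(1)[OF y]]]
      trace_eq[OF C2 open_ball inV0[OF y] frontier_closures(1,2)[OF P.sig_frontier(1)[OF y]]] by auto
  have tan_eq: "A1 (P.sig y) \<bullet> d = A2 (P.sig y) \<bullet> d" if "y \<in> ball 0 \<delta>" "nu \<Omega> (P.sig y) \<bullet> d = 0" for y d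
    using t[OF P.sig_frontier(1)[OF that(1)]] tangential_inner[OF that(2)] tr1(1)[OF that(1)] tr2(1)[OF that(1)] by metis
  define q where "q y = (C1 (P.sig y) - C2 (P.sig y)) \<bullet> P.N y" for y
  have cq: "continuous_on (ball 0 \<delta>) q"
    unfolding q_def[abs_def]
    by (intro continuous_intros P.continuous_on_N continuous_on_compose2[OF C1(1) C1_on_continuous[OF P.C1_on_sig]]
        continuous_on_compose2[OF C2(1) C1_on_continuous[OF P.C1_on_sig]]) (use cl in auto)
  have test: "(\<integral>y. indicator (ball 0 \<delta>) y * (f y * q y) \<partial>lborel) = 0 \<and> integrable lborel (\<lambda>y. indicator (ball 0 \<delta>) y * (f y * q y))"
    if f: "C1_on (ball 0 \<delta>) f" "0 < d" "d < \<delta>" "\<And>y. y \<in> ball 0 \<delta> \<Longrightarrow> d \<le> norm y \<Longrightarrow> f y = (0::real)" for f d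
  proof -
    let ?I = "\<lambda>A C y. indicator (ball 0 \<delta>) y * (f y * (C (P.sig y) \<bullet> P.N y)
      + (partial (axis 1 1) f y * (A (P.sig y) \<bullet> P.d2 y) - partial (axis 2 1) f y * (A (P.sig y) \<bullet> P.d1 y)))"
    have S1: "(\<integral>y. ?I A1 C1 y \<partial>lborel) = 0" "integrable lborel (?I A1 C1)"
      by (rule P.patch_stokes[OF s2 O_open _ _ C1_on_subset[OF C_on_1[THEN iffD1, OF C_closure_C_on[OF W]]] bounded_ball inV A1 C1 f, of "-1"];
          use P.sig_shift_O in auto)+
    have S2: "(\<integral>y. ?I A2 C2 y \<partial>lborel) = 0" "integrable lborel (?I A2 C2)"
      by (rule P.patch_stokes[OF s2 E_open _ _ C_on_1[THEN iffD1, OF C_closure_loc_C_on[OF E_open W']] bounded_ball inV A2 C2 f, of "1"];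
          use P.sig_shift_exterior in auto)+
    have eq: "indicator (ball 0 \<delta>) y * (f y * q y) = ?I A1 C1 y - ?I A2 C2 y" for y
    proof (cases "y \<in> ball 0 \<delta>")
      case True
      show ?thesis using tan_eq[OF True nu_tangent(1)[OF P True]] tan_eq[OF True nu_tangent(2)[OF P True]]
        by (simp add: q_def inner_diff_left algebra_simps)
    qed simp
    show ?thesis unfolding eq using S1 S2 by simp
  qed
  have q0: "q 0 = 0"
  proof (rule ccontr)
    assume ne: "q 0 \<noteq> 0"
    have 0: "0 \<in> ball 0 \<delta>" using P.delta by simp
    have "isCont q 0" using cq 0 by (simp add: continuous_on_eq_continuous_at)
    then obtain r0 where r0: "r0 > 0" "\<And>y. norm y < r0 \<Longrightarrow> \<bar>q y - q 0\<bar> < \<bar>q 0\<bar> / 2"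
    proof -
      have "0 < \<bar>q 0\<bar> / 2" using ne by simp
      then obtain r0 where "r0 > 0" "\<forall>y. norm (y - 0) < r0 \<longrightarrow> norm (q y - q 0) < \<bar>q 0\<bar> / 2"
        using \<open>isCont q 0\<close> unfolding continuous_at_eps_delta dist_norm by blast
      then show thesis by (intro that[of r0]) auto
    qed
    define r where "r = min r0 (\<delta> / 2)"
    have r: "0 < r" "r \<le> r0" "r < \<delta>" using r0(1) P.delta by (auto simp: r_def)
    \<comment> \<open>On the ball of radius \<open>r\<close> the function \<open>q\<close> keeps the
      sign of \<open>q 0\<close> and at least half its size, so testing with a bump supported there
      cannot give zero.\<close>
    let ?f = "bump (0::real^2) (r / 2) r"
    have rr: "0 \<le> r / 2" "r / 2 < r" using r by auto
    have f1: "C1_on (ball 0 \<delta>) ?f" by (rule conjunct1[OF C_on_2[THEN iffD1, OF C2_bump[OF rr]]])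
    have fz: "?f y = 0" if "r \<le> norm y" for y using bump_0[OF rr, of y 0] that by simp
    have T: "(\<integral>y. indicator (ball 0 \<delta>) y * (?f y * q y) \<partial>lborel) = 0" "integrable lborel (\<lambda>y. indicator (ball 0 \<delta>) y * (?f y * q y))"
      using test[OF f1 r(1,3)] fz by auto
    have lower: "\<bar>q 0\<bar> / 2 * indicator (ball 0 (r / 2)) y \<le> sgn (q 0) * (indicator (ball 0 \<delta>) y * (?f y * q y))" for y
    proof (cases "norm y < r")
      case True
      have "\<bar>q y - q 0\<bar> < \<bar>q 0\<bar> / 2" using r0(2)[of y] True r by simp
      then have sq: "\<bar>q 0\<bar> / 2 \<le> sgn (q 0) * q y" using ne by (auto simp: sgn_if abs_if split: if_splits)
      have b: "0 \<le> ?f y" by (rule bump_range[OF rr])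
      have b1: "?f y = 1" if "norm y < r / 2" using bump_1[OF rr, of y 0] that by simp
      have e1: "sgn (q 0) * (indicator (ball 0 \<delta>) y * (?f y * q y)) = ?f y * (sgn (q 0) * q y)"
        using True r by (simp add: mult_ac)
      have "\<bar>q 0\<bar> / 2 * indicator (ball 0 (r / 2)) y \<le> ?f y * (\<bar>q 0\<bar> / 2)"
        using b b1 by (cases "norm y < r / 2") auto
      moreover have "?f y * (\<bar>q 0\<bar> / 2) \<le> ?f y * (sgn (q 0) * q y)" by (rule mult_left_mono[OF sq b])
      ultimately show ?thesis unfolding e1 by linarith
    next
      case False
      then show ?thesis using fz[of y] r by (simp add: indicator_def)
    qed
    have "(\<integral>y. \<bar>q 0\<bar> / 2 * indicator (ball (0::real^2) (r / 2)) y \<partial>lborel) \<le> (\<integral>y. sgn (q 0) * (indicator (ball 0 \<delta>) y * (?f y * q y)) \<partial>lborel)"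
      by (rule Bochner_Integration.integral_mono[OF integrable_mult_right[OF integrable_real_indicator[OF _ emeasure_bounded_finite[OF bounded_ball]]] integrable_mult_right[OF T(2)] lower]) simp
    also have "\<dots> = 0" using T by simp
    finally have "\<bar>q 0\<bar> / 2 * measure lborel (ball (0::real^2) (r / 2)) \<le> 0" by simp
    moreover have "0 < measure lborel (ball (0::real^2) (r / 2))" using r content_ball_pos[of "r / 2" "0::real^2"] by simp
    ultimately show False using ne by (simp add: mult_le_0_iff)
  qed
  have 0: "0 \<in> ball 0 \<delta>" using P.delta by simp
  have s0: "P.sig 0 = z" by (rule P.sig_0)
  have "(C1 z - C2 z) \<bullet> P.nml 0 = 0" using q0 P.N_eq[OF 0] P.om by (auto simp: q_def s0)
  then have "(C1 z - C2 z) \<bullet> nu \<Omega> z = 0" using nu_sig[OF P 0] by (simp add: s0)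
  then have "nu \<Omega> z \<bullet> C1 z = nu \<Omega> z \<bullet> C2 z" by (simp add: inner_diff_left inner_commute[of "nu \<Omega> z"])
  then show ?thesis using tr1(2)[OF 0] tr2(2)[OF 0] by (simp add: s0)
qed

end


subsection \<open>Independence of the surface integral from the patch\<close>

lemma borel_preimage_open:
  fixes f :: "'a::euclidean_space \<Rightarrow> 'b::euclidean_space"
  assumes "continuous_on A f" "open A" "P \<in> sets borel"
  shows "{y \<in> A. f y \<in> P} \<in> sets borel"
proof -
  have "f \<in> borel_measurable (restrict_space borel A)" by (rule borel_measurable_continuous_on_restrict[OF assms(1)])
  from measurable_sets[OF this assms(3)] have "f -` P \<inter> A \<in> sets (restrict_space borel A)"
    by (simp add: space_restrict_space)
  then have "f -` P \<inter> A \<in> sets borel" using assms(2) by (subst (asm) sets_restrict_space_iff) auto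
  moreover have "f -` P \<inter> A = {y \<in> A. f y \<in> P}" by auto
  ultimately show ?thesis by simp
qed

lemma lborel_integrable_absolutely:
  fixes F :: "'a::euclidean_space \<Rightarrow> 'b::euclidean_space"
  assumes "set_integrable lborel S F"
  shows "F absolutely_integrable_on S" "integral S F = set_lebesgue_integral lborel S F"
proof -
  have b: "(\<lambda>y. indicator S y *\<^sub>R F y) \<in> borel_measurable lborel" using assms unfolding set_integrable_def by auto
  show 1: "F absolutely_integrable_on S"
    using assms integrable_completion[OF b] unfolding set_integrable_def by simp
  show "integral S F = set_lebesgue_integral lborel S F"
    using set_lebesgue_integral_eq_integral(2)[OF 1] integral_completion[OF b] unfolding set_lebesgue_integral_def by simp
qed

text \<open>The charts are related by \<open>T\<close>, the projection of the second patch applied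
  to the first chart. Their derivatives differ by the matrix of \<open>T'\<close>, so their cross
  products differ by its determinant, which is the factor of the change of variables
  formula.\<close>

lemma patch_transition:
  fixes G :: "real^3 \<Rightarrow> real"
  assumes P1: "patch \<Omega> x1 n1 p1 h1 \<delta>1 g1" and P2: "patch \<Omega> x2 n2 p2 h2 \<delta>2 g2"
    and S: "S \<in> sets borel" "S \<subseteq> frontier \<Omega>" "S \<subseteq> patch.cyl x1 n1 p1 h1 \<delta>1" "S \<subseteq> patch.cyl x2 n2 p2 h2 \<delta>2"
  defines "F1 \<equiv> \<lambda>y. G (patch.sig x1 n1 p1 g1 y) * norm (patch.N x1 n1 p1 g1 y)"
    and "F2 \<equiv> \<lambda>y. G (patch.sig x2 n2 p2 g2 y) * norm (patch.N x2 n2 p2 g2 y)"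
    and "S1 \<equiv> {y \<in> ball 0 \<delta>1. patch.sig x1 n1 p1 g1 y \<in> S}" and "S2 \<equiv> {y \<in> ball 0 \<delta>2. patch.sig x2 n2 p2 g2 y \<in> S}"
  assumes i1: "set_integrable lborel S1 F1" and i2: "set_integrable lborel S2 F2"
  shows "set_lebesgue_integral lborel S1 F1 = set_lebesgue_integral lborel S2 F2"
proof -
  interpret A: patch \<Omega> x1 n1 p1 h1 \<delta>1 g1 by fact
  interpret B: patch \<Omega> x2 n2 p2 h2 \<delta>2 g2 by fact
  define T where "T y = B.prj (A.sig y)" for y
  define L where "L w = (\<chi> i. w \<bullet> p2 (axis i 1))" for w :: "real^3"
  have L: "linear L" unfolding L_def by (auto intro!: linearI simp: vec_eq_iff inner_add_left)
  define T' where "T' y k = L (partial k A.sig y)" for y and k :: "real^2"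
  have dT: "(T has_derivative T' y) (at y)" if "y \<in> ball 0 \<delta>1" for y
  proof -
    have "(A.sig has_derivative (\<lambda>k. partial k A.sig y)) (at y)"
      by (rule C1_on_has_derivative[OF A.C1_on_sig that])
    then have "((\<lambda>y. A.sig y - x2) has_derivative (\<lambda>k. partial k A.sig y)) (at y)" by (auto intro!: derivative_eq_intros)
    from bounded_linear.has_derivative[OF L[unfolded linear_conv_bounded_linear] this]
    show ?thesis by (simp add: T_def[abs_def] T'_def[abs_def] B.prj_def L_def)
  qed
  have sT: "A.sig y = B.sig (T y) \<and> T y \<in> ball 0 \<delta>2" if "y \<in> ball 0 \<delta>1" "A.sig y \<in> B.cyl" for y
    using B.frontier_cyl[OF that(2) A.sig_frontier(1)[OF that(1)]] by (simp add: T_def)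
  have S1b: "y \<in> ball 0 \<delta>1" "A.sig y \<in> B.cyl" "A.sig y \<in> S" if "y \<in> S1" for y using that S(4) by (auto simp: S1_def)
  have img: "T ` S1 = S2"
  proof (intro set_eqI iffI)
    fix w assume "w \<in> T ` S1"
    then obtain y where "y \<in> S1" "w = T y" by blast
    then show "w \<in> S2" using sT[OF S1b(1,2)] S1b(3) unfolding S2_def by auto
  next
    fix w assume "w \<in> S2"
    then have w: "w \<in> ball 0 \<delta>2" "B.sig w \<in> S" by (auto simp: S2_def)
    let ?y = "A.prj (B.sig w)"
    have "B.sig w = A.sig ?y" "?y \<in> ball 0 \<delta>1" using A.frontier_cyl[of "B.sig w"] w S by auto
    then have y: "?y \<in> S1" "w = T ?y" using w B.prj_sig by (auto simp: S1_def T_def)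
    show "w \<in> T ` S1" using imageI[OF y(1), of T] y(2) by simp
  qed
  have inj: "inj_on T S1"
  proof (rule inj_onI)
    fix a b assume ab: "a \<in> S1" "b \<in> S1" "T a = T b"
    have "A.sig a = A.sig b" using sT[OF S1b(1,2)[OF ab(1)]] sT[OF S1b(1,2)[OF ab(2)]] ab(3) by simp
    then show "a = b" using A.prj_sig by metis
  qed
  have jac: "\<bar>det (matrix (T' y))\<bar> * F2 (T y) = F1 y" if y: "y \<in> S1" for y
  proof -
    note y' = S1b[OF y] and Ty = sT[OF S1b(1,2)[OF y]]
    let ?O = "{y \<in> ball 0 \<delta>1. A.sig y \<in> B.cyl}"
    have oO: "open ?O"
    proof -
      have "open (ball 0 \<delta>1 \<inter> A.sig -` B.cyl)"
        by (rule continuous_open_preimage[OF C1_on_continuous[OF A.C1_on_sig] open_ball B.open_cyl])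
      moreover have "ball 0 \<delta>1 \<inter> A.sig -` B.cyl = ?O" by auto
      ultimately show ?thesis by simp
    qed
    have dB: "B.sig differentiable (at (T y))" using B.C1_on_sig Ty by (auto simp: C1_on_def)
    have ch: "partial k A.sig y = T' y k $ 1 *\<^sub>R B.d1 (T y) + T' y k $ 2 *\<^sub>R B.d2 (T y)" for k
    proof -
      have "partial k A.sig y = partial k (\<lambda>y. B.sig (T y)) y"
        by (rule partial_cong_open[OF oO]) (use y' sT in auto)
      also have "\<dots> = partial (T' y k) B.sig (T y)"
        by (rule partial_eq[OF has_derivative_compose[OF dT[OF y'(1)] has_derivative_partial[OF dB]]])
      also have "\<dots> = partial (T' y k $ 1 *\<^sub>R axis 1 1 + T' y k $ 2 *\<^sub>R axis 2 1) B.sig (T y)"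
        by (metis B.sum_axis_2)
      also have "\<dots> = T' y k $ 1 *\<^sub>R B.d1 (T y) + T' y k $ 2 *\<^sub>R B.d2 (T y)"
        unfolding B.d1_def B.d2_def by (simp only: linear_add[OF linear_partial[OF dB]] linear_cmul[OF linear_partial[OF dB]])
      finally show ?thesis .
    qed
    have "A.N y = det (matrix (T' y)) *\<^sub>R B.N (T y)"
      unfolding A.N_def A.d1_def A.d2_def ch B.N_def det_2 matrix_def
      by (simp add: cross_add_left cross_add_right cross_mult_left cross_mult_right cross_skew[of "B.d2 (T y)" "B.d1 (T y)"] algebra_simps)
    then have "norm (A.N y) = \<bar>det (matrix (T' y))\<bar> * norm (B.N (T y))" by simp
    then show ?thesis unfolding F1_def F2_def using Ty by (simp add: mult_ac)
  qed
  have S1m: "S1 \<in> sets borel" unfolding S1_def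
    by (rule borel_preimage_open[OF C1_on_continuous[OF A.C1_on_sig] open_ball S(1)])
  \<comment> \<open>The change of variables theorem speaks of vector-valued integrands, so the real
    ones are multiplied by the unit vector of \<open>real^1\<close>.\<close>
  let ?c = "axis 1 1 :: real^1"
  have j2: "set_integrable lborel S2 (\<lambda>y. F2 y *\<^sub>R ?c)" "set_integrable lborel S1 (\<lambda>y. F1 y *\<^sub>R ?c)"
    using integrable_scaleR_left[of ?c lborel "\<lambda>y. indicator S2 y *\<^sub>R F2 y"] i2
      integrable_scaleR_left[of ?c lborel "\<lambda>y. indicator S1 y *\<^sub>R F1 y"] i1
    unfolding set_integrable_def by simp_all
  have lin: "set_lebesgue_integral lborel S (\<lambda>y. F y *\<^sub>R ?c) = set_lebesgue_integral lborel S F *\<^sub>R ?c" 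
    if "set_integrable lborel S F" for S and F :: "real^2 \<Rightarrow> real"
    using integral_scaleR_left[of ?c lborel "\<lambda>y. indicator S y *\<^sub>R F y"] that
    unfolding set_lebesgue_integral_def set_integrable_def by simp
  have S1l: "S1 \<in> sets lebesgue" using S1m by simp
  have "(\<lambda>y. \<bar>det (matrix (T' y))\<bar> *\<^sub>R (F2 (T y) *\<^sub>R ?c)) absolutely_integrable_on S1 \<and>
    integral S1 (\<lambda>y. \<bar>det (matrix (T' y))\<bar> *\<^sub>R (F2 (T y) *\<^sub>R ?c)) = integral S2 (\<lambda>y. F2 y *\<^sub>R ?c)"
    using has_absolute_integral_change_of_variables[where f="\<lambda>y. F2 y *\<^sub>R ?c" and g=T and g'=T' and S=S1 and b="integral S2 (\<lambda>y. F2 y *\<^sub>R ?c)",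
        OF S1l has_derivative_at_withinI[OF dT[OF S1b(1)]] inj] img
    using lborel_integrable_absolutely(1)[OF j2(1)] by blast
  then have "integral S1 (\<lambda>y. \<bar>det (matrix (T' y))\<bar> *\<^sub>R (F2 (T y) *\<^sub>R ?c)) = integral S2 (\<lambda>y. F2 y *\<^sub>R ?c)" by blast
  also have "integral S1 (\<lambda>y. \<bar>det (matrix (T' y))\<bar> *\<^sub>R (F2 (T y) *\<^sub>R ?c)) = integral S1 (\<lambda>y. F1 y *\<^sub>R ?c)"
    by (rule Henstock_Kurzweil_Integration.integral_cong) (simp add: jac)
  finally show ?thesis
    unfolding lborel_integrable_absolutely(2)[OF j2(1)] lborel_integrable_absolutely(2)[OF j2(2)] lin[OF i1] lin[OF i2]
    by (simp add: axis_eq_0_iff)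
qed


subsection \<open>The flux of a curl through the boundary\<close>

text \<open>The weights \<open>b j\<close> times the product of the earlier \<open>1 - b i\<close>
  sum to 1 wherever one of the \<open>b i\<close> is 1. No division is involved, so they inherit the
  smoothness of the \<open>b i\<close>.\<close>

lemma telescope_partition:
  fixes b :: "nat \<Rightarrow> real"
  shows "(\<Sum>j<m. b j * (\<Prod>i<j. 1 - b i)) = 1 - (\<Prod>i<m. 1 - b i)"
  by (induction m) (auto simp: algebra_simps)

lemma grad_sum:
  fixes f :: "nat \<Rightarrow> real^3 \<Rightarrow> real"
  assumes "\<And>j. f j differentiable (at z)"
  shows "grad (\<lambda>z. \<Sum>j<m. f j z) z = (\<Sum>j<m. grad (f j) z)" "(\<lambda>z. \<Sum>j<m. f j z) differentiable (at z)"
proof (induction m)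
  case 0
  { case 1 show ?case by (simp add: grad_def vec_eq_iff) }
  { case 2 show ?case by simp }
next
  case (Suc m)
  { case 1 show ?case using Suc assms[of m] by (simp add: grad_def vec_eq_iff partial_add) }
  { case 2 show ?case using Suc assms[of m] by simp }
qed

context smooth_domain
begin

text \<open>\<open>W\<close> is split into the fields \<open>\<beta> j\<close> times
  \<open>W\<close>; the boundary value of the curl of each is \<open>F j\<close>, supported in one
  patch, with zero flux by Stokes' theorem there. The surface integral is defined by pieces with
  their own charts, so the parts of \<open>F j\<close> lying in other pieces have to be carried into
  chart \<open>j\<close>.\<close>

theorem flux_curl_zero:
  assumes W: "C_closure_loc 1 E W"
  shows "has_surface_integral \<Omega> (\<lambda>z. nu \<Omega> z \<bullet> trace_plus \<Omega> (curl W) z) 0"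
proof -
  obtain R0 where R0: "\<And>z. z \<in> closure \<Omega> \<Longrightarrow> norm z \<le> R0" using compact_imp_bounded[OF compact_closure_O] bounded_iff by blast
  define R where "R = R0 + 1"
  let ?V = "ball (0::real^3) R"
  have OV: "z \<in> ?V" if "z \<in> frontier \<Omega>" for z using R0[of z] frontier_closures(3)[OF that] by (simp add: R_def)
  have WV: "C_closure 1 (?V \<inter> E) W" using W by (simp add: C_closure_loc_def)
  obtain Wb where Wb: "continuous_on (closure (?V \<inter> E)) Wb" "\<And>z. z \<in> ?V \<inter> E \<Longrightarrow> Wb z = W z" using C_closure_ext[OF WV] by blast
  obtain Cb where Cb: "continuous_on (closure (?V \<inter> E)) Cb" "\<And>z. z \<in> ?V \<inter> E \<Longrightarrow> Cb z = curl W z" using C_closure_curl_ext[OF WV] by blast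
  have trC: "trace_plus \<Omega> (curl W) z = Cb z" and fcl: "z \<in> closure (?V \<inter> E)" if "z \<in> frontier \<Omega>" for z
    using trace_eq[OF Cb open_ball OV[OF that] frontier_closures(1,2)[OF that]] by auto
  have "\<exists>n p h \<delta> g r. patch \<Omega> z n p h \<delta> g \<and> C_on 2 (ball 0 \<delta>) (patch.sig z n p g) \<and> 0 < r \<and> 2 * r < \<delta> \<and>
     cball z (2 * r) \<subseteq> patch.cyl z n p h \<delta>" if z: "z \<in> frontier \<Omega>" for z
  proof -
    obtain n p h \<delta> g where P: "patch \<Omega> z n p h \<delta> g" and s2: "C_closure 2 (ball 0 \<delta>) (patch.sig z n p g)"
      using patch_at[OF z] by metis
    interpret P: patch \<Omega> z n p h \<delta> g by fact
    have "z \<in> P.cyl" using P.sig_cyl[of 0] P.sig_0 P.delta by simp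
    then obtain s where s: "s > 0" "cball z s \<subseteq> P.cyl" using P.open_cyl open_contains_cball by blast
    \<comment> \<open>The ball of twice this radius lies in the cylinder of the patch, and its part
      of the surface corresponds to a compact part of the disc since
      \<open>2 * r < \<delta>\<close>.\<close>
    define r where "r = min (s / 2) (\<delta> / 3)"
    have "0 < r" "2 * r \<le> s" "2 * r < \<delta>" using s(1) P.delta by (auto simp: r_def)
    moreover from this have "cball z (2 * r) \<subseteq> P.cyl" using s(2) by auto
    ultimately show ?thesis using P C_closure_C_on[OF s2] by blast
  qed
  then obtain nn pp hh dd gg rr where good: "\<And>z. z \<in> frontier \<Omega> \<Longrightarrow> patch \<Omega> z (nn z) (pp z) (hh z) (dd z) (gg z) \<and> 
      C_on 2 (ball 0 (dd z)) (patch.sig z (nn z) (pp z) (gg z)) \<and> 0 < rr z \<and> 2 * rr z < dd z \<and>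
      cball z (2 * rr z) \<subseteq> patch.cyl z (nn z) (pp z) (hh z) (dd z)"
    by metis
  have cF: "compact (frontier \<Omega>)" using O_bounded by (rule compact_frontier_bounded)
  obtain I where I: "I \<subseteq> frontier \<Omega>" "finite I" "frontier \<Omega> \<subseteq> (\<Union>z\<in>I. ball z (rr z))"
  proof (rule compactE_image[OF cF, of "frontier \<Omega>" "\<lambda>z. ball z (rr z)"])
    show "frontier \<Omega> \<subseteq> (\<Union>z\<in>frontier \<Omega>. ball z (rr z))" using good by force
  qed auto
  obtain m and zz :: "nat \<Rightarrow> real^3" where zz: "I = zz ` {..<m}"
    using finite_imp_nat_seg_image_inj_on[OF I(2)] by (metis lessThan_def)
  define sg where "sg i = patch.sig (zz i) (nn (zz i)) (pp (zz i)) (gg (zz i))" for i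
  define NN where "NN i = patch.N (zz i) (nn (zz i)) (pp (zz i)) (gg (zz i))" for i
  define D where "D i = dd (zz i)" for i
  define \<rho> where "\<rho> i = rr (zz i)" for i
  have zzF: "zz i \<in> frontier \<Omega>" if "i < m" for i using I(1) zz that by auto
  have pat: "patch \<Omega> (zz i) (nn (zz i)) (pp (zz i)) (hh (zz i)) (D i) (gg (zz i))"
    and s2: "C_on 2 (ball 0 (D i)) (sg i)" and \<rho>: "0 < \<rho> i" "2 * \<rho> i < D i" 
    and cyl: "cball (zz i) (2 * \<rho> i) \<subseteq> patch.cyl (zz i) (nn (zz i)) (pp (zz i)) (hh (zz i)) (D i)" if "i < m" for i
    using good[OF zzF[OF that]] by (auto simp: sg_def D_def \<rho>_def)
  have sgc: "continuous_on (ball 0 (D i)) (sg i)" and NNc: "continuous_on (ball 0 (D i)) (NN i)" 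
    and sgF: "y \<in> ball 0 (D i) \<Longrightarrow> sg i y \<in> frontier \<Omega>"
    and sgd: "y \<in> ball 0 (D i) \<Longrightarrow> norm y \<le> norm (sg i y - zz i)" if "i < m" for i y
  proof -
    interpret P: patch \<Omega> "zz i" "nn (zz i)" "pp (zz i)" "hh (zz i)" "D i" "gg (zz i)" by (rule pat[OF that])
    show "continuous_on (ball 0 (D i)) (sg i)" unfolding sg_def by (rule C1_on_continuous[OF P.C1_on_sig])
    show "continuous_on (ball 0 (D i)) (NN i)" unfolding NN_def by (rule P.continuous_on_N)
    show "y \<in> ball 0 (D i) \<Longrightarrow> sg i y \<in> frontier \<Omega>" unfolding sg_def by (rule P.sig_frontier(1))
    show "norm y \<le> norm (sg i y - zz i)" using P.prj_hgt_le(1)[of "sg i y" "zz i"] by (simp add: sg_def P.prj_sig P.prj_x)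
  qed
  define b where "b i = bump (zz i) (\<rho> i) (2 * \<rho> i)" for i
  define \<beta> where "\<beta> j = (\<lambda>z. b j z * (\<Prod>i<j. 1 - b i z))" for j
  have \<rho>0: "0 \<le> \<rho> i" "\<rho> i < 2 * \<rho> i" if "i < m" for i using \<rho>(1)[OF that] by auto
  have b2: "C_on 2 UNIV (b i)" if "i < m" for i unfolding b_def by (rule C2_bump[OF \<rho>0[OF that]])
  have \<beta>2: "C_on 2 UNIV (\<beta> j)" if "j < m" for j unfolding \<beta>_def
    by (intro C_on_2_mult C_on_2_prod C_on_2_diff C_on_2_const b2 open_UNIV) (use that in auto)
  have \<beta>1: "C1_on UNIV (\<beta> j)" "C1_on UNIV (grad (\<beta> j))" if "j < m" for j
    using \<beta>2[OF that] by (auto simp: C_on_2 intro!: C1_on_grad)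
  have \<beta>z: "\<beta> j z = 0" "grad (\<beta> j) z = 0" if j: "j < m" and far: "2 * \<rho> j \<le> norm (z - zz j)" for j z
  proof -
    have 0: "b j z = 0" unfolding b_def by (rule bump_0[OF \<rho>0[OF j] far])
    then show "\<beta> j z = 0" by (simp add: \<beta>_def)
    have g0: "grad (b j) z = 0" unfolding b_def by (rule grad_bump_0[OF \<rho>0[OF j]]) (use far in simp)
    have dd: "b j differentiable (at z)" using b2[OF j] by (auto simp: C_on_2 C1_on_def)
    have "C_on 2 UNIV (\<lambda>z. \<Prod>i<j. 1 - b i z)" by (intro C_on_2_prod C_on_2_diff C_on_2_const b2 open_UNIV) (use j in auto)
    then have dp: "(\<lambda>z. \<Prod>i<j. 1 - b i z) differentiable (at z)" by (auto simp: C_on_2 C1_on_def)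
    have "partial h (b j) z = 0" for h using grad_inner[OF dd, of h] g0 by simp
    then have "partial h (\<beta> j) z = 0" for h unfolding \<beta>_def using partial_mult[OF dd dp] 0 by simp
    then show "grad (\<beta> j) z = 0" by (simp add: grad_def vec_eq_iff)
  qed
  define U where "U = (\<Union>i<m. ball (zz i) (\<rho> i))"
  have FU: "frontier \<Omega> \<subseteq> U" using I(3) zz by (auto simp: U_def \<rho>_def)
  have sum1: "(\<Sum>j<m. \<beta> j z) = 1" if zU: "z \<in> U" for z
  proof -
    obtain i where i: "i < m" "z \<in> ball (zz i) (\<rho> i)" using zU by (auto simp: U_def)
    then have "b i z = 1" unfolding b_def by (intro bump_1[OF \<rho>0]) (auto simp: dist_norm norm_minus_commute)
    then have "(\<Prod>i<m. 1 - b i z) = 0" using i by (intro prod_zero) auto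
    then show ?thesis unfolding \<beta>_def telescope_partition by simp
  qed
  have sum0: "(\<Sum>j<m. grad (\<beta> j) z) = 0" if zU: "z \<in> U" for z
  proof -
    define \<beta>' where "\<beta>' j = (if j < m then \<beta> j else (\<lambda>z. 0))" for j
    have d: "\<beta>' j differentiable (at z)" for j using \<beta>1(1)[of j] by (auto simp: \<beta>'_def C1_on_def)
    have "grad (\<lambda>z. \<Sum>j<m. \<beta>' j z) z = grad (\<lambda>z. 1) z"
      by (rule grad_cong_open[of U]) (use zU sum1 in \<open>auto simp: U_def \<beta>'_def\<close>)
    then have "(\<Sum>j<m. grad (\<beta>' j) z) = 0" unfolding grad_sum(1)[of \<beta>', OF d] by (simp add: grad_def vec_eq_iff)
    then show ?thesis by (simp add: \<beta>'_def)
  qed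
  \<comment> \<open>The product rule for the curl of \<open>\<beta> j\<close> times
    \<open>W\<close>, written with the continuous extensions. Near the boundary the gradients of the
    weights sum to zero, so the \<open>F j\<close> sum to the boundary value of
    \<open>curl W\<close>.\<close>
  define F where "F j z = \<beta> j z *\<^sub>R Cb z + cross3 (grad (\<beta> j) z) (Wb z)" for j z
  define G where "G j z = nu \<Omega> z \<bullet> F j z" for j z
  have Fsum: "(\<Sum>j<m. F j z) = Cb z" if "z \<in> frontier \<Omega>" for z
  proof -
    have zU: "z \<in> U" using FU that by blast
    have "(\<Sum>j<m. F j z) = (\<Sum>j<m. \<beta> j z) *\<^sub>R Cb z + cross3 (\<Sum>j<m. grad (\<beta> j) z) (Wb z)"
      unfolding F_def by (induction m) (auto simp: scaleR_add_left cross_add_left)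
    then show ?thesis using sum1[OF zU] sum0[OF zU] by simp
  qed
  have Gz: "G j z = 0" if "j < m" "2 * \<rho> j \<le> norm (z - zz j)" for j z using \<beta>z[OF that] by (simp add: G_def F_def)
  define om where "om i = patch.om (nn (zz i)) (pp (zz i))" for i
  have om: "\<bar>om i\<bar> = 1" if "i < m" for i unfolding om_def by (rule patch.om[OF pat[OF that]])
  \<comment> \<open>\<open>nu\<close> is the normalised \<open>nml\<close> while \<open>NN i\<close>
    is \<open>om i\<close> times \<open>nml\<close>, so the surface element absorbs the norm and
    leaves the orientation sign.\<close>
  have GN: "G j (sg i y) * norm (NN i y) = om i * (F j (sg i y) \<bullet> NN i y)" if i: "i < m" and y: "y \<in> ball 0 (D i)" for i j y
  proof -
    interpret P: patch \<Omega> "zz i" "nn (zz i)" "pp (zz i)" "hh (zz i)" "D i" "gg (zz i)" by (rule pat[OF i])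
    have oo: "om i * om i = 1" using om[OF i] by (metis abs_mult_self_eq mult_1)
    have "G j (sg i y) * norm (NN i y) = F j (sg i y) \<bullet> P.nml y"
      unfolding G_def sg_def nu_sig[OF pat[OF i] y] NN_def P.norm_N[OF y] using P.nml_nz(2)[of y] by (simp add: inner_commute)
    also have "\<dots> = om i * (F j (sg i y) \<bullet> NN i y)"
      unfolding NN_def P.N_eq[OF y] om_def[symmetric] using oo by (simp add: mult.assoc[symmetric])
    finally show ?thesis .
  qed
  have Fc: "continuous_on (ball 0 (D i)) (\<lambda>y. F j (sg i y))" if i: "i < m" and j: "j < m" for i j
  proof -
    have c: "continuous_on (ball 0 (D i)) (\<lambda>y. k (sg i y))" if "continuous_on (closure (?V \<inter> E)) k" for k :: "real^3 \<Rightarrow> real^3"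
      by (rule continuous_on_compose2[OF that sgc[OF i]]) (use fcl sgF[OF i] in auto)
    have c': "continuous_on (ball 0 (D i)) (\<lambda>y. \<beta> j (sg i y))" "continuous_on (ball 0 (D i)) (\<lambda>y. grad (\<beta> j) (sg i y))"
      by (rule continuous_on_compose2[OF C1_on_continuous[OF \<beta>1(1)[OF j]] sgc[OF i]]; simp)
         (rule continuous_on_compose2[OF C1_on_continuous[OF \<beta>1(2)[OF j]] sgc[OF i]]; simp)
    show ?thesis unfolding F_def by (intro continuous_intros continuous_on_cross c c' Wb(1) Cb(1))
  qed
  let ?H = "\<lambda>j i y. G j (sg i y) * norm (NN i y)"
  have Hc: "continuous_on (ball 0 (D i)) (?H j i)" if "i < m" "j < m" for i j
  proof (rule continuous_on_cong[THEN iffD1, OF refl])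
    show "continuous_on (ball 0 (D i)) (\<lambda>y. om i * (F j (sg i y) \<bullet> NN i y))"
      by (intro continuous_intros Fc NNc that)
  qed (use GN[OF that(1)] in simp)
  have Hint: "set_integrable lborel {y \<in> ball 0 (D i). sg i y \<in> S} (?H j i)" 
    if i: "i < m" and j: "j < m" and S: "S \<in> sets borel" "S \<subseteq> ball (zz i) (2 * \<rho> i)" for i j S
  proof -
    have K: "cball 0 (2 * \<rho> i) \<subseteq> ball (0::real^2) (D i)" using \<rho>(2)[OF i] by auto
    have "set_integrable lborel (cball 0 (2 * \<rho> i)) (?H j i)"
      unfolding set_integrable_def by (intro borel_integrable_compact continuous_on_subset[OF Hc[OF i j] K]) auto
    moreover have "{y \<in> ball 0 (D i). sg i y \<in> S} \<subseteq> cball 0 (2 * \<rho> i)"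
    proof
      fix y assume y: "y \<in> {y \<in> ball 0 (D i). sg i y \<in> S}"
      then have "norm y \<le> norm (sg i y - zz i)" using sgd[OF i] by blast
      moreover have "sg i y \<in> ball (zz i) (2 * \<rho> i)" using y S(2) by blast
      ultimately show "y \<in> cball 0 (2 * \<rho> i)" by (simp add: dist_norm norm_minus_commute)
    qed
    moreover have "{y \<in> ball 0 (D i). sg i y \<in> S} \<in> sets lborel"
      using borel_preimage_open[OF sgc[OF i] open_ball S(1)] by simp
    ultimately show ?thesis using set_integrable_subset by blast
  qed
  \<comment> \<open>Each boundary point is assigned to the first ball that contains it.\<close>
  define P where "P k = frontier \<Omega> \<inter> ball (zz k) (\<rho> k) - (\<Union>i<k. ball (zz i) (\<rho> i))" for k
  have Pb: "P k \<in> sets borel" for k unfolding P_def by (intro sets.Diff sets.Int sets.countable_UN' borel_closed borel_open) auto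
  have Pdisj: "disjoint_family_on P {..<m}"
  proof -
    have "P i \<inter> P j = {}" if "i < j" for i j using that by (auto simp: P_def)
    then show ?thesis unfolding disjoint_family_on_def by (metis Int_commute linorder_neqE_nat)
  qed
  have PU: "(\<Union>k<m. P k) = frontier \<Omega>"
  proof
    show "frontier \<Omega> \<subseteq> (\<Union>k<m. P k)"
    proof
      fix z assume z: "z \<in> frontier \<Omega>"
      have ex: "\<exists>i. i < m \<and> z \<in> ball (zz i) (\<rho> i)" using subsetD[OF FU z] unfolding U_def by blast
      define k where "k = (LEAST i. i < m \<and> z \<in> ball (zz i) (\<rho> i))"
      have k: "k < m" "z \<in> ball (zz k) (\<rho> k)" using LeastI_ex[OF ex] by (auto simp: k_def)
      have "z \<notin> ball (zz i) (\<rho> i)" if "i < k" for i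
        using not_less_Least[of i "\<lambda>i. i < m \<and> z \<in> ball (zz i) (\<rho> i)"] that k(1) unfolding k_def[symmetric] by auto
      then show "z \<in> (\<Union>k<m. P k)" using k z unfolding P_def by auto
    qed
  qed (auto simp: P_def)
  have Psub: "P k \<subseteq> ball (zz k) (2 * \<rho> k)" if "k < m" for k using \<rho>(1)[OF that] by (auto simp: P_def)
  let ?Q = "\<lambda>k. {y \<in> ball 0 (D k). sg k y \<in> P k}"
  have patch_zero: "(\<integral>y. indicator (ball 0 (D j)) y * ?H j j y \<partial>lborel) = 0" 
     if j: "j < m" for j
  proof -
    interpret P: patch \<Omega> "zz j" "nn (zz j)" "pp (zz j)" "hh (zz j)" "D j" "gg (zz j)" by (rule pat[OF j])
    have sgP: "sg j = P.sig" "NN j = P.N" by (simp_all add: sg_def NN_def)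
    let ?f = "\<lambda>y. \<beta> j (P.sig y)"
    have f1: "C1_on (ball 0 (D j)) ?f" by (rule C1_on_compose[OF P.C1_on_sig \<beta>1(1)[OF j]]) simp
    have fz: "?f y = 0" if "y \<in> ball 0 (D j)" "2 * \<rho> j \<le> norm y" for y
      using \<beta>z(1)[OF j, of "P.sig y"] sgd[OF j that(1)] that(2) by (simp add: sgP)
    have pf: "partial k ?f y = grad (\<beta> j) (P.sig y) \<bullet> partial k P.sig y" if "y \<in> ball 0 (D j)" for y k
    proof -
      have db: "\<beta> j differentiable (at (P.sig y))" using \<beta>1(1)[OF j] by (simp add: C1_on_def)
      have ds: "P.sig differentiable (at y)" using P.C1_on_sig that by (simp add: C1_on_def)
      show ?thesis using partial_compose[OF ds db] grad_inner[OF db] by simp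
    qed
    let ?V' = "ball (zz j) (D j + 2 * hh (zz j))"
    have WV': "C_closure 1 (?V' \<inter> E) W" using W by (simp add: C_closure_loc_def)
    obtain W1 where W1: "continuous_on (closure (?V' \<inter> E)) W1" "\<And>z. z \<in> ?V' \<inter> E \<Longrightarrow> W1 z = W z" using C_closure_ext[OF WV'] by blast
    obtain C1 where C1: "continuous_on (closure (?V' \<inter> E)) C1" "\<And>z. z \<in> ?V' \<inter> E \<Longrightarrow> C1 z = curl W z" using C_closure_curl_ext[OF WV'] by blast
    have inV: "P.sig y + t *\<^sub>R nn (zz j) \<in> ?V'" if "y \<in> ball 0 (D j)" "\<bar>t\<bar> < hh (zz j)" for y t using P.sig_bounded[OF that] by simp
    have inV0: "P.sig y \<in> ?V'" if "y \<in> ball 0 (D j)" for y using inV[OF that, of 0] P.h by simp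
    have same: "W1 (P.sig y) = Wb (P.sig y)" "C1 (P.sig y) = Cb (P.sig y)" if y: "y \<in> ball 0 (D j)" for y
    proof -
      note fr = P.sig_frontier(1)[OF y]
      show "W1 (P.sig y) = Wb (P.sig y)"
        using trace_eq(2)[OF W1 open_ball inV0[OF y] frontier_closures(1,2)[OF fr]] trace_eq(2)[OF Wb open_ball OV[OF fr] frontier_closures(1,2)[OF fr]] by simp
      show "C1 (P.sig y) = Cb (P.sig y)"
        using trace_eq(2)[OF C1 open_ball inV0[OF y] frontier_closures(1,2)[OF fr]] trC[OF fr] by simp
    qed
    have "(\<integral>y. indicator (ball 0 (D j)) y * (?f y * (C1 (P.sig y) \<bullet> P.N y)
      + (partial (axis 1 1) ?f y * (W1 (P.sig y) \<bullet> P.d2 y) - partial (axis 2 1) ?f y * (W1 (P.sig y) \<bullet> P.d1 y))) \<partial>lborel) = 0"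
      by (rule P.patch_stokes(1)[OF s2[OF j, unfolded sgP] E_open _ _ C_on_1[THEN iffD1, OF C_closure_loc_C_on[OF E_open W]] bounded_ball inV W1 C1 f1 _ \<rho>(2)[OF j] fz, of 1])
        (use P.sig_shift_exterior \<rho>(1)[OF j] in auto)
    moreover have "indicator (ball 0 (D j)) y * (?f y * (C1 (P.sig y) \<bullet> P.N y)
      + (partial (axis 1 1) ?f y * (W1 (P.sig y) \<bullet> P.d2 y) - partial (axis 2 1) ?f y * (W1 (P.sig y) \<bullet> P.d1 y)))
      = om j * (indicator (ball 0 (D j)) y * ?H j j y)" for y
    proof (cases "y \<in> ball 0 (D j)")
      case True
      have oo: "om j * om j = 1" using om[OF j] by (metis abs_mult_self_eq mult_1)
      \<comment> \<open>The Binet--Cauchy identity for the inner product of two cross products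
        matches the gradient term of \<open>F j\<close> with the test function terms of Stokes'
        theorem.\<close>
      have "F j (P.sig y) \<bullet> P.N y = \<beta> j (P.sig y) * (Cb (P.sig y) \<bullet> P.N y)
         + ((grad (\<beta> j) (P.sig y) \<bullet> P.d1 y) * (Wb (P.sig y) \<bullet> P.d2 y) - (grad (\<beta> j) (P.sig y) \<bullet> P.d2 y) * (Wb (P.sig y) \<bullet> P.d1 y))"
        unfolding F_def P.N_def inner_add_left by (simp add: cross3_simps)
      then show ?thesis using True GN[OF j True, of j] oo same[OF True] pf[OF True, of "axis 1 1"] pf[OF True, of "axis 2 1"]
        by (simp add: sgP P.d1_def P.d2_def mult.assoc[symmetric])
    qed simp
    ultimately have "om j * (\<integral>y. indicator (ball 0 (D j)) y * ?H j j y \<partial>lborel) = 0" by simp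
    then show ?thesis using om[OF j] by auto
  qed
  \<comment> \<open>The part of each piece within the support ball of \<open>\<beta> j\<close> is
    moved to chart \<open>j\<close>; there the parts add up to the whole support, where
    \<open>patch_zero\<close> applies.\<close>
  have jzero: "(\<Sum>k<m. set_lebesgue_integral lborel (?Q k) (?H j k)) = 0" if j: "j < m" for j
  proof -
    let ?S = "\<lambda>k. P k \<inter> ball (zz j) (2 * \<rho> j)"
    have Sb: "?S k \<in> sets borel" for k using Pb by auto
    let ?T = "\<lambda>k. {y \<in> ball 0 (D j). sg j y \<in> ?S k}"
    have Ti: "set_integrable lborel (?T k) (?H j j)" if "k < m" for k by (rule Hint[OF j j Sb]) auto
    have "set_lebesgue_integral lborel (?Q k) (?H j k) = set_lebesgue_integral lborel (?T k) (?H j j)" if k: "k < m" for k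
    proof -
      let ?Q' = "{y \<in> ball 0 (D k). sg k y \<in> ?S k}"
      have eq: "indicator (?Q k) y *\<^sub>R ?H j k y = indicator ?Q' y *\<^sub>R ?H j k y" for y
        using Gz[OF j, of "sg k y"] by (auto simp: indicator_def dist_norm norm_minus_commute)
      then have "set_lebesgue_integral lborel (?Q k) (?H j k) = set_lebesgue_integral lborel ?Q' (?H j k)"
        unfolding set_lebesgue_integral_def by (intro Bochner_Integration.integral_cong[OF refl] eq)
      also have "\<dots> = set_lebesgue_integral lborel (?T k) (?H j j)"
      proof (rule patch_transition[OF pat[OF k] pat[OF j] Sb, where G="G j", folded sg_def NN_def])
        show "?S k \<subseteq> frontier \<Omega>" by (auto simp: P_def)
        have "ball (zz k) (2 * \<rho> k) \<subseteq> cball (zz k) (2 * \<rho> k)" by (rule ball_subset_cball)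
        then show "?S k \<subseteq> patch.cyl (zz k) (nn (zz k)) (pp (zz k)) (hh (zz k)) (D k)" using Psub[OF k] cyl[OF k] by blast
        have "ball (zz j) (2 * \<rho> j) \<subseteq> cball (zz j) (2 * \<rho> j)" by (rule ball_subset_cball)
        then show "?S k \<subseteq> patch.cyl (zz j) (nn (zz j)) (pp (zz j)) (hh (zz j)) (D j)" using cyl[OF j] by blast
        show "set_integrable lborel ?Q' (?H j k)" by (rule Hint[OF k j Sb]) (use Psub[OF k] in blast)
        show "set_integrable lborel (?T k) (?H j j)" by (rule Ti[OF k])
      qed
      finally show ?thesis .
    qed
    then have "(\<Sum>k<m. set_lebesgue_integral lborel (?Q k) (?H j k)) = (\<Sum>k<m. set_lebesgue_integral lborel (?T k) (?H j j))" by simp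
    also have "\<dots> = (\<integral>y. (\<Sum>k<m. indicator (?T k) y *\<^sub>R ?H j j y) \<partial>lborel)"
      unfolding set_lebesgue_integral_def using Ti unfolding set_integrable_def
      by (subst Bochner_Integration.integral_sum) auto
    also have "\<dots> = (\<integral>y. indicator (ball 0 (D j)) y * ?H j j y \<partial>lborel)"
    proof (rule Bochner_Integration.integral_cong[OF refl])
      fix y
      show "(\<Sum>k<m. indicator (?T k) y *\<^sub>R ?H j j y) = indicator (ball 0 (D j)) y * ?H j j y"
      proof (cases "y \<in> ball 0 (D j) \<and> sg j y \<in> ball (zz j) (2 * \<rho> j)")
        case True
        have "(\<Sum>k<m. indicator (?T k) y) = (\<Sum>k<m. indicator (P k) (sg j y) :: real)" using True by (auto simp: indicator_def intro!: sum.cong)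
        also have "\<dots> = indicator (\<Union>k<m. P k) (sg j y)"
          by (rule indicator_UN_disjoint[symmetric]) (use Pdisj in auto)
        also have "\<dots> = 1" using PU sgF[OF j] True by simp
        finally have "(\<Sum>k<m. indicator (?T k) y) = (1::real)" .
        then show ?thesis using True by (simp flip: sum_distrib_right)
      next
        case False
        then have "y \<notin> ball 0 (D j) \<or> ?H j j y = 0" using Gz[OF j, of "sg j y"] by (auto simp: dist_norm norm_minus_commute)
        then show ?thesis by auto
      qed
    qed
    also have "\<dots> = 0" by (rule patch_zero[OF j])
    finally show ?thesis .
  qed
  let ?f = "\<lambda>z. nu \<Omega> z \<bullet> trace_plus \<Omega> (curl W) z"
  let ?Ff = "\<lambda>i y. ?f (sg i y) * norm (cross3 (partial (axis 1 1) (sg i) y) (partial (axis 2 1) (sg i) y))"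
  have NNeq: "cross3 (partial (axis 1 1) (sg i) y) (partial (axis 2 1) (sg i) y) = NN i y" if "i < m" for i y
    using patch.N_def[OF pat[OF that]] patch.d1_def[OF pat[OF that]] patch.d2_def[OF pat[OF that]] by (simp add: NN_def sg_def)
  have Feq: "?Ff i y = (\<Sum>j<m. ?H j i y)" if i: "i < m" and y: "y \<in> ball 0 (D i)" for i y
  proof -
    have "?f (sg i y) = nu \<Omega> (sg i y) \<bullet> (\<Sum>j<m. F j (sg i y))" using trC Fsum sgF[OF i y] by simp
    also have "\<dots> = (\<Sum>j<m. G j (sg i y))" by (simp add: G_def inner_sum_right)
    finally show ?thesis using NNeq[OF i] by (simp add: sum_distrib_right)
  qed
  have Fi: "indicator (?Q i) y *\<^sub>R ?Ff i y = (\<Sum>j<m. indicator (?Q i) y *\<^sub>R ?H j i y)" if "i < m" for i y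
    using Feq[OF that, of y] by (cases "y \<in> ?Q i") auto
  have Qi: "set_integrable lborel (?Q i) (?H j i)" if "i < m" "j < m" for i j by (rule Hint[OF that Pb Psub[OF that(1)]])
  have int: "set_integrable lborel (?Q i) (?Ff i)" if "i < m" for i
    unfolding set_integrable_def Fi[OF that] by (rule Bochner_Integration.integrable_sum) (use Qi[OF that] in \<open>auto simp: set_integrable_def\<close>)
  have val: "set_lebesgue_integral lborel (?Q i) (?Ff i) = (\<Sum>j<m. set_lebesgue_integral lborel (?Q i) (?H j i))" if "i < m" for i
    unfolding set_lebesgue_integral_def Fi[OF that]
    by (rule Bochner_Integration.integral_sum) (use Qi[OF that] in \<open>auto simp: set_integrable_def\<close>)
  have "(\<Sum>i<m. set_lebesgue_integral lborel (?Q i) (?Ff i)) = (\<Sum>i<m. \<Sum>j<m. set_lebesgue_integral lborel (?Q i) (?H j i))"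
    by (rule sum.cong[OF refl], rule val) simp
  also have "\<dots> = (\<Sum>j<m. \<Sum>i<m. set_lebesgue_integral lborel (?Q i) (?H j i))" by (rule sum.swap)
  also have "\<dots> = 0" using jzero by simp
  finally have total: "0 = (\<Sum>i<m. set_lebesgue_integral lborel (?Q i) (?Ff i))" by simp
  have gp: "graph_patch \<Omega> (sg i) (D i)" if "i < m" for i
    unfolding sg_def by (rule patch.graph_patch_sig[OF pat[OF that]])
  have Pim: "P i \<subseteq> sg i ` ball 0 (D i)" if i: "i < m" for i
  proof
    fix z assume z: "z \<in> P i"
    have "z \<in> patch.cyl (zz i) (nn (zz i)) (pp (zz i)) (hh (zz i)) (D i)"
      using z Psub[OF i] cyl[OF i] ball_subset_cball by blast
    from patch.frontier_cyl[OF pat[OF i] this] z show "z \<in> sg i ` ball 0 (D i)" by (auto simp: P_def sg_def)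
  qed
  show ?thesis unfolding has_surface_integral_def Let_def
    by (rule exI[of _ m], rule exI[of _ sg], rule exI[of _ D], rule exI[of _ P])
      (use gp Pb Pim Pdisj PU int total in auto)
qed

end


subsection \<open>The maximum principle and uniqueness\<close>

lemma second_derivative_min:
  fixes \<phi> \<phi>' :: "real \<Rightarrow> real"
  assumes e: "0 < e" and d: "\<And>t. \<bar>t\<bar> < e \<Longrightarrow> (\<phi> has_real_derivative \<phi>' t) (at t)"
    and d2: "(\<phi>' has_real_derivative c) (at 0)" and min: "\<And>t. \<bar>t\<bar> < e \<Longrightarrow> \<phi> 0 \<le> \<phi> t"
  shows "0 \<le> c"
proof (rule ccontr)
  assume "\<not> 0 \<le> c"
  then have c: "c < 0" by simp
  have "\<phi>' 0 = 0" by (rule DERIV_local_min[OF d[of 0] e]) (use e min in auto)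
  then obtain s where s: "s > 0" "\<And>h. 0 < h \<Longrightarrow> h < s \<Longrightarrow> \<phi>' h < 0"
    using DERIV_neg_dec_right[OF d2 c] by auto
  define t where "t = min e s / 2"
  have t: "0 < t" "t < e" "t < s" using e s(1) by (auto simp: t_def)
  obtain z where z: "0 < z" "z < t" "\<phi> t - \<phi> 0 = (t - 0) * \<phi>' z"
    using MVT2[OF t(1), of \<phi> \<phi>'] d t by auto
  have "\<phi>' z < 0" using s(2) z t by simp
  then have "\<phi> t - \<phi> 0 < 0" using z(3) t(1) by (simp add: mult_pos_neg)
  then show False using min[of t] t by simp
qed

lemma has_real_derivative_line:
  fixes f :: "'a::euclidean_space \<Rightarrow> real"
  assumes "f differentiable (at (x + t *\<^sub>R b))"
  shows "((\<lambda>t. f (x + t *\<^sub>R b)) has_real_derivative partial b f (x + t *\<^sub>R b)) (at t)"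
  using partial_line[OF assms] by (simp add: has_real_derivative_iff_has_vector_derivative)

lemma pot_C2:
  fixes f :: "real^3 \<Rightarrow> real"
  assumes U: "open U" and p: "is_pot U V f" and V: "C1_on U V"
  shows "C_on 2 U f" "x \<in> U \<Longrightarrow> grad f x = V x" "x \<in> U \<Longrightarrow> laplacian f x = divergence V x"
proof -
  have eq: "partial h f y = V y \<bullet> h" if "y \<in> U" for y h by (rule is_pot_partial[OF p that])
  show "C_on 2 U f" unfolding C_on_2
  proof (intro conjI ballI)
    show "C1_on U f" by (rule is_pot_C1[OF p C1_on_continuous[OF V]])
    fix b :: "real^3"
    have "C1_on U (\<lambda>y. V y \<bullet> b)" by (rule C1_on_inner[OF V C1_on_const])
    then show "C1_on U (partial b f)" using C1_on_cong[OF U, of "partial b f" "\<lambda>y. V y \<bullet> b"] eq by simp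
  qed
  assume x: "x \<in> U"
  show "grad f x = V x" using p x unfolding is_pot_def by (intro grad_eqI) auto
  have "partial (axis i 1) (partial (axis i 1) f) x = partial (axis i 1) V x $ i" for i
  proof -
    have "partial (axis i 1) (partial (axis i 1) f) x = partial (axis i 1) (\<lambda>y. V y $ i) x"
      by (rule partial_cong_open[OF U x]) (simp add: eq inner_axis)
    then show ?thesis using partial_nth[OF C1_on_differentiable[OF V x]] by simp
  qed
  then show "laplacian f x = divergence V x" by (simp add: laplacian_def divergence_def)
qed

text \<open>At a minimum of the perturbed function its second derivative along each axis is
  nonnegative, so that of \<open>f\<close> is at least \<open>2 * d\<close>; three axes give 6. For
  harmonic \<open>f\<close> and positive \<open>d\<close> an interior minimum is thus
  impossible.\<close>

lemma pot_perturbed_min: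
  fixes f :: "real^3 \<Rightarrow> real"
  assumes U: "open U" "x \<in> U" and p: "is_pot U V f" and V: "C1_on U V"
    and min: "\<And>y. y \<in> U \<Longrightarrow> f x - d * (norm (x - z))\<^sup>2 \<le> f y - d * (norm (y - z))\<^sup>2"
  shows "6 * d \<le> divergence V x"
proof -
  have ax: "2 * d \<le> partial (axis i 1) V x $ i" for i
  proof -
    define b where "b = (axis i 1 :: real^3)"
    have bb: "b \<bullet> b = 1" by (simp add: b_def inner_axis_axis)
    obtain e where e: "e > 0" "ball x e \<subseteq> U" using U open_contains_ball by blast
    have inU: "x + t *\<^sub>R b \<in> U" if "\<bar>t\<bar> < e" for t
    proof -
      have "dist x (x + t *\<^sub>R b) < e" using that by (simp add: dist_norm b_def)
      then show ?thesis using e(2) by auto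
    qed
    have sq: "((\<lambda>t. (norm (x + t *\<^sub>R b - z))\<^sup>2) has_real_derivative 2 * ((x + t *\<^sub>R b - z) \<bullet> b)) (at t)" for t
    proof -
      have "(norm (x + t *\<^sub>R b - z))\<^sup>2 = (x - z) \<bullet> (x - z) + 2 * t * ((x - z) \<bullet> b) + t^2" for t
        unfolding power2_norm_eq_inner using bb by (simp add: inner_simps inner_commute power2_eq_square algebra_simps)
      moreover have "((\<lambda>t. (x - z) \<bullet> (x - z) + 2 * t * ((x - z) \<bullet> b) + t^2) has_real_derivative 2 * ((x - z) \<bullet> b) + 2 * t) (at t)"
        by (auto intro!: derivative_eq_intros)
      moreover have "(x + t *\<^sub>R b - z) \<bullet> b = (x - z) \<bullet> b + t" using bb by (simp add: inner_simps)
      ultimately show ?thesis by simp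
    qed
    let ?\<phi> = "\<lambda>t. f (x + t *\<^sub>R b) - d * (norm (x + t *\<^sub>R b - z))\<^sup>2"
    let ?\<phi>' = "\<lambda>t. V (x + t *\<^sub>R b) \<bullet> b - d * (2 * ((x + t *\<^sub>R b - z) \<bullet> b))"
    have "0 \<le> partial b (\<lambda>y. V y \<bullet> b) x - d * 2"
    proof (rule second_derivative_min[OF e(1), of ?\<phi> ?\<phi>'])
      fix t :: real assume t: "\<bar>t\<bar> < e"
      have "f differentiable (at (x + t *\<^sub>R b))" using p inU[OF t] by (auto simp: is_pot_def differentiable_def)
      from has_real_derivative_line[OF this] show "(?\<phi> has_real_derivative ?\<phi>' t) (at t)"
        unfolding is_pot_partial[OF p inU[OF t]] by (intro DERIV_diff DERIV_cmult sq)
      show "?\<phi> 0 \<le> ?\<phi> t" using min[OF inU[OF t]] by simp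
    next
      have "(\<lambda>y. V y \<bullet> b) differentiable (at x)" by (rule C1_on_differentiable[OF C1_on_inner[OF V C1_on_const] U(2)])
      then have "((\<lambda>t. V (x + t *\<^sub>R b) \<bullet> b) has_real_derivative partial b (\<lambda>y. V y \<bullet> b) x) (at 0)"
        using has_real_derivative_line[of "\<lambda>y. V y \<bullet> b" x 0 b] by simp
      moreover have "((\<lambda>t. 2 * ((x + t *\<^sub>R b - z) \<bullet> b)) has_real_derivative 2) (at 0)"
        by (auto intro!: derivative_eq_intros simp: inner_simps bb)
      ultimately show "(?\<phi>' has_real_derivative partial b (\<lambda>y. V y \<bullet> b) x - d * 2) (at 0)"
        by (intro DERIV_diff DERIV_cmult)
    qed
    moreover have "partial b (\<lambda>y. V y \<bullet> b) x = partial b V x $ i"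
      using partial_inner[OF C1_on_differentiable[OF V U(2)], of "\<lambda>y. b" b] by (simp add: b_def inner_axis)
    ultimately show ?thesis by (simp add: b_def)
  qed
  show ?thesis using ax[of 1] ax[of 2] ax[of 3] by (simp add: divergence_3)
qed

context smooth_domain
begin

text \<open>If \<open>f z = - m\<close> with \<open>m > 0\<close>, the function minus a small
  quadratic is minimised over the part of the closed exterior within radius \<open>R\<close>. Since
  \<open>f\<close> is nonnegative on the boundary of \<open>\<Omega>\<close> and above
  \<open>- m / 4\<close> on the outer sphere, the minimiser is an interior point, which the
  perturbation excludes.\<close>

lemma exterior_min_principle:
  fixes f :: "real^3 \<Rightarrow> real"
  assumes p: "is_pot E V f" and V: "C1_on E V" and dv: "\<And>x. x \<in> E \<Longrightarrow> divergence V x = 0"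
    and lim: "(f \<longlongrightarrow> 0) at_infinity"
    and ext: "\<And>R. \<exists>G. continuous_on (closure (ball 0 R \<inter> E)) G \<and> (\<forall>y\<in>ball 0 R \<inter> E. G y = f y) \<and> (\<forall>y\<in>ball 0 R \<inter> frontier \<Omega>. 0 \<le> G y)"
    and z: "z \<in> E"
  shows "0 \<le> f z"
proof (rule ccontr)
  assume neg: "\<not> 0 \<le> f z"
  define m where "m = - f z"
  have m: "0 < m" using neg by (simp add: m_def)
  obtain R1 where R1: "\<And>y. R1 \<le> norm y \<Longrightarrow> \<bar>f y\<bar> < m / 4"
    using tendstoD[OF lim, of "m / 4"] m by (auto simp: eventually_at_infinity dist_norm)
  define R where "R = \<bar>R1\<bar> + norm z + 1"
  have R: "R1 \<le> R" "norm z < R" "0 < R" unfolding R_def using norm_ge_zero[of z] abs_ge_self[of R1] abs_ge_zero[of R1] by linarith+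
  obtain G where G: "continuous_on (closure (ball 0 (R + 1) \<inter> E)) G" "\<And>y. y \<in> ball 0 (R + 1) \<inter> E \<Longrightarrow> G y = f y"
    "\<And>y. y \<in> ball 0 (R + 1) \<inter> frontier \<Omega> \<Longrightarrow> 0 \<le> G y" using ext by metis
  define K where "K = cball 0 R \<inter> closure E"
  have "K \<subseteq> ball 0 (R + 1) \<inter> closure E" by (auto simp: K_def)
  then have sub: "K \<subseteq> closure (ball 0 (R + 1) \<inter> E)" using open_Int_closure_subset[OF open_ball] by blast
  have K: "compact K" unfolding K_def by (intro compact_Int_closed) auto
  have zK: "z \<in> K" using subsetD[OF closure_subset z] R by (simp add: K_def)
  \<comment> \<open>The perturbation is at most \<open>d * (2 * R)\<^sup>2 = m / 4\<close>, so the
    minimiser still has a value of at most \<open>- (3 / 4) * m\<close>.\<close>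
  define d where "d = m / (16 * R^2)"
  have d: "0 < d" using m R by (simp add: d_def)
  have "continuous_on K (\<lambda>y. G y - d * (norm (y - z))\<^sup>2)"
    by (intro continuous_intros continuous_on_subset[OF G(1) sub])
  then obtain x where x: "x \<in> K" "\<And>y. y \<in> K \<Longrightarrow> G x - d * (norm (x - z))\<^sup>2 \<le> G y - d * (norm (y - z))\<^sup>2"
    using continuous_attains_inf[OF K, of "\<lambda>y. G y - d * (norm (y - z))\<^sup>2"] zK by blast
  have "norm (x - z) \<le> 2 * R" using x(1) R norm_triangle_ineq4[of x z] by (simp add: K_def)
  then have "(norm (x - z))\<^sup>2 \<le> (2 * R)\<^sup>2" by (intro power_mono) auto
  then have "d * (norm (x - z))\<^sup>2 \<le> d * (2 * R)\<^sup>2" using d by (intro mult_left_mono) auto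
  also have "\<dots> = m / 4" using R by (simp add: d_def power_mult_distrib)
  finally have "d * (norm (x - z))\<^sup>2 \<le> m / 4" .
  moreover have "G z = - m" using G(2)[of z] z R by (simp add: m_def)
  ultimately have Gx: "G x \<le> - (3 / 4) * m" using x(2)[OF zK] by simp
  have x1: "x \<in> ball 0 (R + 1)" "x \<in> closure E" using x(1) by (auto simp: K_def)
  have "x \<notin> frontier \<Omega>" using G(3)[of x] x1 Gx m by auto
  then have xE: "x \<in> E" using x1(2) by (auto simp: closure_E frontier_O)
  then have fx: "f x \<le> - (3 / 4) * m" using G(2)[of x] x1 Gx by simp
  have "norm x < R"
  proof (rule ccontr)
    assume "\<not> norm x < R"
    then show False using R1[of x] R(1) fx m by simp
  qed
  then have xU: "x \<in> ball 0 R \<inter> E" using xE by simp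
  have "6 * d \<le> divergence V x"
  proof (rule pot_perturbed_min[OF _ xU, of V f d z])
    show "f x - d * (norm (x - z))\<^sup>2 \<le> f y - d * (norm (y - z))\<^sup>2" if y: "y \<in> ball 0 R \<inter> E" for y
    proof -
      have "y \<in> K" using y closure_subset[of E] by (auto simp: K_def)
      moreover have "G y = f y" "G x = f x" using G(2) y xU by auto
      ultimately show ?thesis using x(2) by metis
    qed
  qed (use p V E_open in \<open>auto intro: is_pot_subset C1_on_subset\<close>)
  then show False using dv[OF xE] d by simp
qed

text \<open>Outside the ball of radius \<open>d\<close> the regularised kernel is the exact
  gradient, so the comparison function inherits its regularity and vanishing divergence without new
  computation.\<close>

lemma inverse_norm_pot:
  fixes x0 :: "real^3"
  assumes d: "0 < d"
  shows "is_pot {y. d < norm (y - x0)} (\<lambda>y. newt d (y - x0)) (\<lambda>y. 1 / norm (y - x0))"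
  unfolding is_pot_def
proof
  fix y assume "y \<in> {y. d < norm (y - x0)}"
  then have y: "d < norm (y - x0)" by simp
  then have nz: "y - x0 \<noteq> 0" using d by auto
  have "((\<lambda>y. 1 / norm (y - x0)) has_derivative (\<lambda>h. - (sgn (y - x0) \<bullet> h) / (norm (y - x0))\<^sup>2)) (at y)"
  proof -
    have 1: "((\<lambda>y. norm (y - x0)) has_derivative (\<lambda>h. sgn (y - x0) \<bullet> h)) (at y)"
    proof -
      have "((\<lambda>y. y - x0) has_derivative (\<lambda>h. h)) (at y)" by (auto intro!: derivative_eq_intros)
      from has_derivative_compose[OF this has_derivative_norm[OF nz]] show ?thesis by (simp add: inner_commute)
    qed
    from Deriv.has_derivative_inverse[OF _ 1] nz show ?thesis 
      by (simp add: inverse_eq_divide power2_eq_square divide_simps)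
  qed
  moreover have "(\<bullet>) (newt d (y - x0)) = (\<lambda>h. - (sgn (y - x0) \<bullet> h) / (norm (y - x0))\<^sup>2)"
    using y nz by (simp add: fun_eq_iff newt_outside[OF d] sgn_div_norm power2_eq_square power3_eq_cube divide_simps)
  ultimately show "((\<lambda>y. 1 / norm (y - x0)) has_derivative (\<bullet>) (newt d (y - x0))) (at y)" by (simp only:)
qed

lemma boundary_const_nonpos:
  fixes w :: "real^3 \<Rightarrow> real"
  assumes p: "is_pot E V w" and V: "C1_on E V" and dv: "\<And>x. x \<in> E \<Longrightarrow> divergence V x = 0"
    and dec: "\<And>x. R0 \<le> norm x \<Longrightarrow> \<bar>w x\<bar> \<le> C / (norm x)\<^sup>2"
    and ext: "\<And>R. \<exists>G. continuous_on (closure (ball 0 R \<inter> E)) G \<and> (\<forall>y\<in>ball 0 R \<inter> E. G y = w y) \<and> (\<forall>y\<in>ball 0 R \<inter> frontier \<Omega>. G y = c)"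
    and ne: "\<Omega> \<noteq> {}"
  shows "c \<le> 0"
proof (rule ccontr)
  assume "\<not> c \<le> 0"
  then have c: "0 < c" by simp
  obtain x0 d0 where x0: "x0 \<in> \<Omega>" "0 < d0" "ball x0 d0 \<subseteq> \<Omega>" using ne O_open open_contains_ball by blast
  define d where "d = d0 / 2"
  have d: "0 < d" "d < d0" using x0 by (auto simp: d_def)
  have far: "d < norm (y - x0)" if "y \<in> closure E" for y
  proof -
    have "y \<notin> ball x0 d0" using that x0(3) closure_E by auto
    then show ?thesis using d by (simp add: dist_norm norm_minus_commute)
  qed
  have sub: "E \<subseteq> {y. d < norm (y - x0)}" using far closure_subset[of E] by auto
  let ?s = "\<lambda>y. 1 / norm (y - x0)" and ?S = "\<lambda>y. newt d (y - x0)"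
  \<comment> \<open>The coefficient \<open>c * d\<close> makes the comparison function at most
    \<open>c\<close> on the boundary, where the distance to \<open>x0\<close> exceeds
    \<open>d\<close>.\<close>
  let ?f = "\<lambda>y. w y - (c * d) * ?s y" and ?V = "\<lambda>y. V y - (c * d) *\<^sub>R ?S y"
  have s: "is_pot E ?S ?s" by (rule is_pot_subset[OF inverse_norm_pot[OF d(1)] sub])
  have sd: "((?S) has_derivative (\<lambda>h. partial h (newt d) (y - x0))) (at y)" for y
  proof -
    have 1: "((\<lambda>y. y - x0) has_derivative (\<lambda>h. h)) (at y)" by (auto intro!: derivative_eq_intros)
    have 2: "(newt d has_derivative (\<lambda>h. partial h (newt d) (y - x0))) (at (y - x0))"
      by (rule C1_on_has_derivative[OF C1_on_newt[OF d(1)]]) simp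
    show ?thesis by (rule has_derivative_compose[OF 1 2])
  qed
  have S1: "C1_on E ?S"
  proof (rule C1_onI[OF sd])
    show "continuous_on E (\<lambda>y. partial h (newt d) (y - x0))" for h
      by (rule continuous_on_compose2[OF C1_on_continuous_partial[OF C1_on_newt[OF d(1)]]]) (auto intro!: continuous_intros)
  qed
  have Sdiv: "divergence ?S y = 0" if "y \<in> E" for y
  proof -
    have "partial h ?S y = partial h (newt d) (y - x0)" for h by (rule partial_eq[OF sd])
    then have "divergence ?S y = divergence (newt d) (y - x0)" by (simp add: divergence_def)
    also have "\<dots> = 0" using kap_outside[OF d(1), of "y - x0"] sub that by (auto simp: kap_def)
    finally show ?thesis .
  qed
  have S1': "C1_on E (\<lambda>y. (c * d) *\<^sub>R ?S y)" by (rule C1_on_scaleR[OF C1_on_const S1])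
  have s_lim: "(?s \<longlongrightarrow> 0) at_infinity"
  proof -
    have "filterlim (\<lambda>y. norm (y - x0)) at_top at_infinity"
    proof (rule filterlim_at_top_mono)
      show "filterlim (\<lambda>y::real^3. - norm x0 + norm y) at_top at_infinity"
        by (rule filterlim_tendsto_add_at_top[OF tendsto_const filterlim_norm_at_top])
      show "\<forall>\<^sub>F y in at_infinity. - norm x0 + norm y \<le> norm (y - x0)"
        by (intro always_eventually allI) (use norm_triangle_ineq2 in \<open>simp add: add.commute\<close>)
    qed
    then show ?thesis by (intro tendsto_divide_0[OF tendsto_const] filterlim_at_top_imp_at_infinity)
  qed
  have w_lim: "(w \<longlongrightarrow> 0) at_infinity"
  proof (rule Lim_null_comparison)
    show "\<forall>\<^sub>F x in at_infinity. norm (w x) \<le> C / (norm x)\<^sup>2" using dec by (auto simp: eventually_at_infinity)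
    show "((\<lambda>x::real^3. C / (norm x)\<^sup>2) \<longlongrightarrow> 0) at_infinity"
      by (intro tendsto_divide_0[OF tendsto_const] filterlim_at_top_imp_at_infinity filterlim_pow_at_top filterlim_norm_at_top) simp
  qed
  have pos: "0 \<le> ?f y" if y: "y \<in> E" for y
  proof (rule exterior_min_principle[of ?V ?f, OF _ _ _ _ _ y])
    show "is_pot E ?V ?f" unfolding is_pot_def
    proof
      fix y assume y: "y \<in> E"
      have 1: "(w has_derivative (\<lambda>h. V y \<bullet> h)) (at y)" "(?s has_derivative (\<lambda>h. ?S y \<bullet> h)) (at y)"
        using p s y by (auto simp: is_pot_def)
      have "(?f has_derivative (\<lambda>h. V y \<bullet> h - (c * d) * (?S y \<bullet> h))) (at y)"
        by (intro has_derivative_diff has_derivative_mult_right 1)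
      then show "(?f has_derivative (\<lambda>h. ?V y \<bullet> h)) (at y)" by (simp add: inner_diff_left)
    qed
    show "C1_on E ?V" by (rule C1_on_diff[OF V S1'])
    show "divergence ?V y = 0" if "y \<in> E" for y
      using divergence_diff[OF C1_on_differentiable[OF V that] C1_on_differentiable[OF S1' that]] dv[OF that] Sdiv[OF that]
        divergence_scaleR[of "\<lambda>y. c * d" y ?S] C1_on_differentiable[OF S1 that]
      by (simp add: grad_def zero_vec_def[symmetric])
    show "(?f \<longlongrightarrow> 0) at_infinity" using tendsto_diff[OF w_lim tendsto_mult[OF tendsto_const s_lim, of "c * d"]] by simp
    fix R
    obtain G where G: "continuous_on (closure (ball 0 R \<inter> E)) G" "\<And>y. y \<in> ball 0 R \<inter> E \<Longrightarrow> G y = w y" "\<And>y. y \<in> ball 0 R \<inter> frontier \<Omega> \<Longrightarrow> G y = c"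
      using ext by metis
    have nz: "norm (y - x0) \<noteq> 0" if "y \<in> closure (ball 0 R \<inter> E)" for y
      using far[of y] that closure_mono[of "ball 0 R \<inter> E" E] d by force
    have "continuous_on (closure (ball 0 R \<inter> E)) (\<lambda>y. G y - (c * d) * ?s y)"
      by (intro continuous_intros G(1)) (use nz in auto)
    moreover have "0 \<le> G y - (c * d) * ?s y" if y: "y \<in> ball 0 R \<inter> frontier \<Omega>" for y
    proof -
      have "d < norm (y - x0)" using far frontier_closures(1) y by blast
      then have "d * ?s y \<le> 1" using d by (simp add: divide_simps)
      then have "c * (d * ?s y) \<le> c * 1" using c by (intro mult_left_mono) auto
      then show ?thesis using G(3)[OF y] by (simp add: mult.assoc)
    qed
    ultimately show "\<exists>G. continuous_on (closure (ball 0 R \<inter> E)) G \<and> (\<forall>y\<in>ball 0 R \<inter> E. G y = ?f y) \<and> (\<forall>y\<in>ball 0 R \<inter> frontier \<Omega>. 0 \<le> G y)"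
      using G(2) by (intro exI[of _ "\<lambda>y. G y - (c * d) * ?s y"]) auto
  qed
  obtain B where B: "closure \<Omega> \<subseteq> ball 0 B" using compact_closure_O compact_imp_bounded bounded_subset_ballD by blast
  \<comment> \<open>A radius beyond all earlier ones and so large that
    \<open>c * d * r > 2 * \<bar>C\<bar>\<close>: at distance \<open>r\<close> the lower bound
    \<open>c * d / (2 * r)\<close> then exceeds \<open>C / r\<^sup>2\<close>.\<close>
  define r where "r = \<bar>R0\<bar> + \<bar>B\<bar> + norm x0 + 1 + 2 * \<bar>C\<bar> / (c * d)"
  have cd: "0 < c * d" using c d by simp
  have r: "\<bar>R0\<bar> \<le> r" "\<bar>B\<bar> \<le> r" "norm x0 \<le> r" "0 < r" "2 * \<bar>C\<bar> / (c * d) < r" using cd by (simp_all add: r_def add_pos_nonneg add_nonneg_pos)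
  define y where "y = r *\<^sub>R (axis 1 1 :: real^3)"
  have ny: "norm y = r" using r by (simp add: y_def)
  have "y \<notin> ball 0 B" using ny r by simp
  then have yE: "y \<in> E" using B by blast
  have yx: "norm (y - x0) \<le> 2 * r" using norm_triangle_ineq4[of y x0] ny r by simp
  have yx0: "0 < norm (y - x0)" using sub yE d by force
  have "(c * d) / (2 * r) \<le> (c * d) / norm (y - x0)" using yx yx0 cd r by (intro divide_left_mono) auto
  also have "\<dots> \<le> w y" using pos[OF yE] by simp
  also have "\<dots> \<le> C / r\<^sup>2" using dec[of y] ny r(1) abs_le_iff[of "w y"] by simp
  also have "\<dots> \<le> \<bar>C\<bar> / r\<^sup>2" by (intro divide_right_mono) auto
  finally have "(c * d) / (2 * r) \<le> \<bar>C\<bar> / r\<^sup>2" .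
  then have "c * d * r \<le> 2 * \<bar>C\<bar>" using r by (simp add: divide_simps power2_eq_square)
  moreover have "2 * \<bar>C\<bar> < c * d * r" using r(5) cd by (simp add: divide_simps mult.commute)
  ultimately show False by simp
qed

text \<open>\<open>w\<close> is differentiable off the boundary, so it is followed along curves on
  the surface shifted by \<open>t\<close> along \<open>n\<close>. By the mean value theorem its
  change is a value of the derivative along the shifted curve, which tends to zero uniformly with
  \<open>t\<close>. So the trace is constant on each patch, and the frontier is connected.\<close>

lemma tangential_gradient_zero_const:
  fixes w :: "real^3 \<Rightarrow> real"
  assumes w: "C_closure_loc 1 E w" and t: "\<And>z. z \<in> frontier \<Omega> \<Longrightarrow> tan_plus \<Omega> (grad w) z = 0"
    and con: "connected \<Omega>" and z: "z \<in> frontier \<Omega>" "z' \<in> frontier \<Omega>"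
  shows "trace_plus \<Omega> w z = trace_plus \<Omega> w z'"
proof (rule connected_local_const[OF frontier_connected[OF con] z])
  show "\<forall>a\<in>frontier \<Omega>. \<forall>\<^sub>F b in at a within frontier \<Omega>. trace_plus \<Omega> w a = trace_plus \<Omega> w b"
  proof
    fix a assume a: "a \<in> frontier \<Omega>"
    obtain n p h \<delta> g where pat: "patch \<Omega> a n p h \<delta> g" using patch_at[OF a] by metis
    interpret P: patch \<Omega> a n p h \<delta> g by (rule pat)
    let ?V = "ball a (\<delta> + 2 * h)"
    have wV: "C_closure 1 (?V \<inter> E) w" using w by (simp add: C_closure_loc_def)
    have wd: "w differentiable (at y)" if "y \<in> E" for y
      using C_closure_loc_C_on[OF E_open w] that unfolding C_on_1 by (rule C1_on_differentiable)
    obtain W where W: "continuous_on (closure (?V \<inter> E)) W" "\<And>y. y \<in> ?V \<inter> E \<Longrightarrow> W y = w y" using C_closure_ext[OF wV] by blast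
    have "\<exists>G. continuous_on (closure (?V \<inter> E)) G \<and> (\<forall>y\<in>?V \<inter> E. G y = partial (axis i 1) w y)" for i
      by (rule C_closure_partial_ext[OF wV]) auto
    then obtain Gi where Gi: "\<And>i. continuous_on (closure (?V \<inter> E)) (Gi i)" "\<And>i y. y \<in> ?V \<inter> E \<Longrightarrow> Gi i y = partial (axis i 1) w y" by metis
    define G where "G y = (\<chi> i. Gi i y)" for y
    have G: "continuous_on (closure (?V \<inter> E)) G" "\<And>y. y \<in> ?V \<inter> E \<Longrightarrow> G y = grad w y"
      unfolding G_def grad_def by (auto intro!: continuous_on_vec_lambda Gi(1) simp: Gi(2))
    have inV: "P.sig y + t *\<^sub>R n \<in> ?V" if "y \<in> ball 0 \<delta>" "\<bar>t\<bar> < h" for y t using P.sig_bounded[OF that] by simp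
    have inV0: "P.sig y \<in> ?V" if "y \<in> ball 0 \<delta>" for y using inV[OF that, of 0] P.h by simp
    have fcl: "P.sig y \<in> closure (?V \<inter> E)" if "y \<in> ball 0 \<delta>" for y
      by (rule trace_eq(3)[OF W open_ball inV0[OF that] frontier_closures(1,2)[OF P.sig_frontier(1)[OF that]]])
    have trW: "trace_plus \<Omega> w (P.sig y) = W (P.sig y)" if "y \<in> ball 0 \<delta>" for y
      by (rule trace_eq(2)[OF W open_ball inV0[OF that] frontier_closures(1,2)[OF P.sig_frontier(1)[OF that]]])
    have trG: "trace_plus \<Omega> (grad w) (P.sig y) = G (P.sig y)" if "y \<in> ball 0 \<delta>" for y
      by (rule trace_eq(2)[OF G open_ball inV0[OF that] frontier_closures(1,2)[OF P.sig_frontier(1)[OF that]]])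
    have G0: "G (P.sig y) \<bullet> partial k P.sig y = 0" if y: "y \<in> ball 0 \<delta>" for y k
    proof -
      have "G (P.sig y) \<bullet> d = 0" if "nu \<Omega> (P.sig y) \<bullet> d = 0" for d
        using tangential_inner[OF that, of "trace_plus \<Omega> (grad w)"] trG[OF y] t[OF P.sig_frontier(1)[OF y]] by simp
      from this[OF nu_tangent(1)[OF pat y]] this[OF nu_tangent(2)[OF pat y]]
      have "G (P.sig y) \<bullet> partial b P.sig y = 0" if "b \<in> Basis" for b
        using that unfolding UNIV_2_axis P.d1_def P.d2_def by auto
      then have "(\<Sum>b\<in>Basis. (k \<bullet> b) * (G (P.sig y) \<bullet> partial b P.sig y)) = 0" by (intro sum.neutral) simp
      then show ?thesis
        by (subst partial_sum_Basis[OF C1_on_differentiable[OF P.C1_on_sig y]]) (simp only: inner_sum_right inner_scaleR_right)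
    qed
    have const: "W (P.sig y) = W (P.sig 0)" if y: "y \<in> ball 0 \<delta>" for y
    proof -
      have sy: "s *\<^sub>R y \<in> ball 0 \<delta>" if "s \<in> {0..1}" for s :: real
      proof -
        have "\<bar>s\<bar> * norm y \<le> 1 * norm y" using that by (intro mult_right_mono) auto
        then show ?thesis using y by simp
      qed
      have gc: "continuous_on {0..1} (\<lambda>s. \<bar>g (s *\<^sub>R y)\<bar>)"
        by (intro continuous_intros continuous_on_compose2[OF P.continuous_on_g]) (use sy in auto)
      obtain s0 where s0: "s0 \<in> {0..1}" "\<And>s. s \<in> {0..1} \<Longrightarrow> \<bar>g (s *\<^sub>R y)\<bar> \<le> \<bar>g (s0 *\<^sub>R y)\<bar>"
        using continuous_attains_sup[OF _ _ gc] by auto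
      \<comment> \<open>Half the smallest gap between the graph over the segment from 0 to
        \<open>y\<close> and the ends of the cylinder, so that all shifts up to \<open>t0\<close>
        stay inside.\<close>
      define t0 where "t0 = (h - \<bar>g (s0 *\<^sub>R y)\<bar>) / 2"
      have t0: "0 < t0" using P.gh[OF sy[OF s0(1)]] by (simp add: t0_def)
      have th: "\<bar>g (s *\<^sub>R y)\<bar> + \<bar>t\<bar> < h" if "s \<in> {0..1}" "t \<in> {0..t0}" for s t
        using s0(2)[OF that(1)] that(2) t0 unfolding t0_def by auto
      let ?z = "\<lambda>s t. P.sig (s *\<^sub>R y) + t *\<^sub>R n"
      have zE: "?z s t \<in> ?V \<inter> E" if "s \<in> {0..1}" "t \<in> {0<..t0}" for s t
        using inV[OF sy[OF that(1)], of t] P.sig_shift_exterior[OF sy[OF that(1)], of t] th[OF that(1), of t] that(2) by auto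
      have zcl: "?z s t \<in> closure (?V \<inter> E)" if st: "s \<in> {0..1}" "t \<in> {0..t0}" for s t
      proof (cases "t = 0")
        case True then show ?thesis using fcl[OF sy[OF st(1)]] by simp
      next
        case False then show ?thesis using subsetD[OF closure_subset zE[OF st(1), of t]] st(2) by auto
      qed
      \<comment> \<open>The derivative of \<open>w\<close> along the shifted curve, continuous down
        to \<open>t = 0\<close>, where it vanishes because the gradient has no tangential
        part.\<close>
      define Q where "Q = (\<lambda>q :: real \<times> real. G (?z (fst q) (snd q)) \<bullet> partial y P.sig (fst q *\<^sub>R y))"
      have Qc: "continuous_on ({0..1} \<times> {0..t0}) Q"
      proof -
        have sc: "continuous_on ({0..1} \<times> {0..t0}) (\<lambda>q. P.sig (fst q *\<^sub>R y))"
          by (rule continuous_on_compose2[OF C1_on_continuous[OF P.C1_on_sig]]) (use sy in \<open>auto intro!: continuous_intros\<close>)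
        have pc: "continuous_on ({0..1} \<times> {0..t0}) (\<lambda>q. partial y P.sig (fst q *\<^sub>R y))"
          by (rule continuous_on_compose2[OF C1_on_continuous_partial[OF P.C1_on_sig]]) (use sy in \<open>auto intro!: continuous_intros\<close>)
        have "continuous_on ({0..1} \<times> {0..t0}) (\<lambda>q. G (?z (fst q) (snd q)))"
          by (rule continuous_on_compose2[OF G(1)]) (use zcl in \<open>auto intro!: continuous_intros sc\<close>)
        then show ?thesis unfolding Q_def by (intro continuous_on_inner pc)
      qed
      have Q0: "Q (s, 0) = 0" if "s \<in> {0..1}" for s using G0[OF sy[OF that]] by (simp add: Q_def)
      have uc: "uniformly_continuous_on ({0..1} \<times> {0..t0}) Q"
        by (rule compact_uniformly_continuous[OF Qc]) (intro compact_Times compact_Icc)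
      have mvt: "\<exists>s\<in>{0..1}. w (?z 1 t) - w (?z 0 t) = Q (s, t)" if t: "t \<in> {0<..t0}" for t
      proof -
        have "((\<lambda>s. w (?z s t)) has_real_derivative Q (s, t)) (at s)" if s: "s \<in> {0..1}" for s
        proof -
          have 1: "((\<lambda>s. s *\<^sub>R y) has_derivative (\<lambda>r. r *\<^sub>R y)) (at s)" by (auto intro!: derivative_eq_intros)
          have 2: "((\<lambda>s. P.sig (s *\<^sub>R y)) has_derivative (\<lambda>r. partial (r *\<^sub>R y) P.sig (s *\<^sub>R y))) (at s)"
            by (rule has_derivative_compose[OF 1 C1_on_has_derivative[OF P.C1_on_sig sy[OF s]]])
          have 3: "((\<lambda>s. ?z s t) has_derivative (\<lambda>r. partial (r *\<^sub>R y) P.sig (s *\<^sub>R y))) (at s)"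
            using has_derivative_add[OF 2 has_derivative_const[of "t *\<^sub>R n"]] by simp
          have 4: "((\<lambda>s. w (?z s t)) has_derivative (\<lambda>r. grad w (?z s t) \<bullet> partial (r *\<^sub>R y) P.sig (s *\<^sub>R y))) (at s)"
            by (rule has_derivative_compose[OF 3 grad_has_derivative[OF wd]]) (use zE[OF s t] in blast)
          have "partial (r *\<^sub>R y) P.sig (s *\<^sub>R y) = r *\<^sub>R partial y P.sig (s *\<^sub>R y)" for r
            by (rule linear_scale[OF linear_partial[OF C1_on_differentiable[OF P.C1_on_sig sy[OF s]]]])
          then have "(\<lambda>r. grad w (?z s t) \<bullet> partial (r *\<^sub>R y) P.sig (s *\<^sub>R y)) = (\<lambda>r. Q (s, t) * r)"
            using G(2)[OF zE[OF s t]] by (simp add: Q_def fun_eq_iff)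
          then show ?thesis using 4 by (simp add: has_field_derivative_def)
        qed
        then obtain s where "0 < s" "s < 1" "w (?z 1 t) - w (?z 0 t) = (1 - 0) * Q (s, t)"
          using MVT2[of 0 1 "\<lambda>s. w (?z s t)" "\<lambda>s. Q (s, t)"] by auto
        then show ?thesis by (intro bexI[of _ s]) auto
      qed
      have lim: "((\<lambda>t. W (?z s t)) \<longlongrightarrow> W (P.sig (s *\<^sub>R y))) (at 0 within {0<..t0})" if s: "s \<in> {0..1}" for s
      proof -
        have "continuous_on {0..t0} (\<lambda>t. W (?z s t))"
          by (rule continuous_on_compose2[OF W(1)]) (use zcl[OF s] in \<open>auto intro!: continuous_intros\<close>)
        then have "((\<lambda>t. W (?z s t)) \<longlongrightarrow> W (?z s 0)) (at 0 within {0..t0})" using t0 unfolding continuous_on_def by (elim ballE[of _ _ 0]) auto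
        then have "((\<lambda>t. W (?z s t)) \<longlongrightarrow> W (?z s 0)) (at 0 within {0<..t0})" by (rule tendsto_within_subset) auto
        then show ?thesis by simp
      qed
      have nb: "at 0 within {0<..t0} \<noteq> bot" unfolding trivial_limit_within not_not
        by (rule islimpt_subset[OF islimpt_greaterThanLessThan1[OF t0]]) auto
      have l1: "((\<lambda>t. W (?z 1 t) - W (?z 0 t)) \<longlongrightarrow> W (P.sig y) - W (P.sig 0)) (at 0 within {0<..t0})"
        using tendsto_diff[OF lim[of 1] lim[of 0]] by simp
      have "((\<lambda>t. W (?z 1 t) - W (?z 0 t)) \<longlongrightarrow> 0) (at 0 within {0<..t0})"
      proof (rule tendstoI)
        fix e :: real assume "0 < e"
        then obtain d where d: "d > 0" "\<And>q q'. q \<in> {0..1} \<times> {0..t0} \<Longrightarrow> q' \<in> {0..1} \<times> {0..t0} \<Longrightarrow> dist q' q < d \<Longrightarrow> dist (Q q') (Q q) < e"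
          using uc unfolding uniformly_continuous_on_def by metis
        have "dist (W (?z 1 t) - W (?z 0 t)) 0 < e" if t: "t \<in> {0<..t0}" "dist t 0 < d" for t
        proof -
          obtain s where s: "s \<in> {0..1}" "w (?z 1 t) - w (?z 0 t) = Q (s, t)" using mvt[OF t(1)] by blast
          have "dist (Q (s, t)) (Q (s, 0)) < e"
            by (rule d(2)) (use s(1) t t0 in \<open>auto simp: dist_Pair_Pair\<close>)
          moreover have "W (?z 1 t) = w (?z 1 t)" "W (?z 0 t) = w (?z 0 t)" by (rule W(2)[OF zE[OF _ t(1)]]; simp)+
          ultimately show ?thesis using s Q0[OF s(1)] by simp
        qed
        then show "\<forall>\<^sub>F t in at 0 within {0<..t0}. dist (W (?z 1 t) - W (?z 0 t)) 0 < e"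
          unfolding eventually_at using d(1) by blast
      qed
      from tendsto_unique[OF nb l1 this] show ?thesis by simp
    qed
    have "trace_plus \<Omega> w a = trace_plus \<Omega> w b" if b: "b \<in> P.cyl" "b \<in> frontier \<Omega>" for b
    proof -
      have b': "b = P.sig (P.prj b)" "P.prj b \<in> ball 0 \<delta>" using P.frontier_cyl[OF b] by auto
      have 0: "(0::real^2) \<in> ball 0 \<delta>" using P.delta by simp
      show ?thesis using trW[OF b'(2)] trW[OF 0] const[OF b'(2)] b'(1) P.sig_0 by simp
    qed
    moreover have "a \<in> P.cyl" using P.sig_cyl[of 0] P.sig_0 P.delta by simp
    ultimately show "\<forall>\<^sub>F b in at a within frontier \<Omega>. trace_plus \<Omega> w a = trace_plus \<Omega> w b"
      unfolding eventually_at_topological using P.open_cyl by blast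
  qed
qed

end


subsection \<open>Linearity of traces\<close>

text \<open>Linear combinations cover sums, differences and multiples at once; this is why later
  fields carry explicit coefficients such as 1 and -1.\<close>

lemma iter_partial_lincomb:
  fixes f g :: "'a::euclidean_space \<Rightarrow> 'b::real_normed_vector"
  assumes U: "open U" and f: "C_on k U f" and g: "C_on k U g"
    and bs: "set bs \<subseteq> Basis" "length bs \<le> k" and x: "x \<in> U"
  shows "iter_partial bs (\<lambda>x. a *\<^sub>R f x + b *\<^sub>R g x) x = a *\<^sub>R iter_partial bs f x + b *\<^sub>R iter_partial bs g x"
  using bs x
proof (induction bs arbitrary: x)
  case Nil
  then show ?case by (simp add: iter_partial_def)
next
  case (Cons c cs)
  have d: "iter_partial cs f differentiable (at x)" "iter_partial cs g differentiable (at x)"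
    using f g Cons.prems unfolding C_on_def by auto
  have "iter_partial (c # cs) (\<lambda>x. a *\<^sub>R f x + b *\<^sub>R g x) x = partial c (iter_partial cs (\<lambda>x. a *\<^sub>R f x + b *\<^sub>R g x)) x"
    by (simp add: iter_partial_def)
  also have "\<dots> = partial c (\<lambda>x. a *\<^sub>R iter_partial cs f x + b *\<^sub>R iter_partial cs g x) x"
    by (rule partial_cong_open[OF U Cons.prems(3)]) (use Cons in auto)
  also have "\<dots> = a *\<^sub>R partial c (iter_partial cs f) x + b *\<^sub>R partial c (iter_partial cs g) x"
    using d by (subst partial_add) (auto simp: partial_cmul)
  finally show ?case by (simp add: iter_partial_def)
qed

lemma C_closure_lincomb:
  fixes f g :: "'a::euclidean_space \<Rightarrow> 'b::real_normed_vector"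
  assumes U: "open U" and f: "C_closure k U f" and g: "C_closure k U g"
  shows "C_closure k U (\<lambda>x. a *\<^sub>R f x + b *\<^sub>R g x)"
proof -
  note eq = iter_partial_lincomb[OF U C_closure_C_on[OF f] C_closure_C_on[OF g]]
  show ?thesis unfolding C_closure_def C_on_def
  proof (intro conjI allI impI ballI)
    fix bs :: "'a list" and x assume bs: "set bs \<subseteq> Basis \<and> length bs < k" and x: "x \<in> U"
    have "(\<lambda>x. a *\<^sub>R iter_partial bs f x + b *\<^sub>R iter_partial bs g x) differentiable (at x)"
      using f g bs x by (intro differentiable_add differentiable_scaleR differentiable_const) (auto simp: C_closure_def C_on_def)
    then show "iter_partial bs (\<lambda>x. a *\<^sub>R f x + b *\<^sub>R g x) differentiable (at x)"
      by (rule differentiable_cong_open[OF U x, THEN iffD1, rotated]) (use eq bs in auto)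
  next
    fix bs :: "'a list" assume bs: "set bs \<subseteq> Basis \<and> length bs \<le> k"
    have "continuous_on U (\<lambda>x. a *\<^sub>R iter_partial bs f x + b *\<^sub>R iter_partial bs g x)"
      using f g bs by (intro continuous_intros) (auto simp: C_closure_def C_on_def)
    then show "continuous_on U (iter_partial bs (\<lambda>x. a *\<^sub>R f x + b *\<^sub>R g x))"
      by (rule continuous_on_cong[THEN iffD1, OF refl, rotated]) (use eq bs in auto)
    obtain F where F: "continuous_on (closure U) F" "\<forall>x\<in>U. F x = iter_partial bs f x" using f bs unfolding C_closure_def by blast
    obtain G where G: "continuous_on (closure U) G" "\<forall>x\<in>U. G x = iter_partial bs g x" using g bs unfolding C_closure_def by blast
    show "\<exists>h. continuous_on (closure U) h \<and> (\<forall>x\<in>U. h x = iter_partial bs (\<lambda>x. a *\<^sub>R f x + b *\<^sub>R g x) x)"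
      by (rule exI[of _ "\<lambda>x. a *\<^sub>R F x + b *\<^sub>R G x"]) (use F G eq bs in \<open>auto intro!: continuous_intros\<close>)
  qed
qed

lemma C_closure_loc_lincomb:
  fixes f g :: "'a::euclidean_space \<Rightarrow> 'b::real_normed_vector"
  assumes "open U" "C_closure_loc k U f" "C_closure_loc k U g"
  shows "C_closure_loc k U (\<lambda>x. a *\<^sub>R f x + b *\<^sub>R g x)"
  using assms unfolding C_closure_loc_def by (auto intro!: C_closure_lincomb)

lemma C_closure_loc_mono: "C_closure_loc k U f \<Longrightarrow> j \<le> k \<Longrightarrow> C_closure_loc j U f"
  unfolding C_closure_loc_def using C_closure_mono by blast

lemma C_holder_loc_closure: "C_holder_loc k \<alpha> U f \<Longrightarrow> C_closure_loc k U f"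
  by (simp add: C_holder_loc_def C_closure_loc_def C_holder_def)

lemma bdry_trace_cong:
  assumes "\<And>x. x \<in> U \<Longrightarrow> F x = G x"
  shows "bdry_trace U F z = bdry_trace U G z"
proof -
  have "(F \<longlongrightarrow> l) (at z within U) \<longleftrightarrow> (G \<longlongrightarrow> l) (at z within U)" for l
    by (rule tendsto_cong) (use assms in \<open>auto simp: eventually_at_filter\<close>)
  then show ?thesis by (simp add: bdry_trace_def Topological_Spaces.Lim_def)
qed

lemma bdry_trace_lincomb:
  fixes F G :: "real^3 \<Rightarrow> 'b::real_normed_vector"
  assumes "at z within U \<noteq> bot" "(F \<longlongrightarrow> bdry_trace U F z) (at z within U)" "(G \<longlongrightarrow> bdry_trace U G z) (at z within U)"
  shows "bdry_trace U (\<lambda>x. a *\<^sub>R F x + b *\<^sub>R G x) z = a *\<^sub>R bdry_trace U F z + b *\<^sub>R bdry_trace U G z"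
  unfolding bdry_trace_def[of U "\<lambda>x. a *\<^sub>R F x + b *\<^sub>R G x"]
  by (rule tendsto_Lim[OF assms(1)]) (intro tendsto_intros assms)

lemma tangential_lincomb:
  assumes "w z = a *\<^sub>R w1 z + b *\<^sub>R w2 z"
  shows "tangential \<Omega> w z = a *\<^sub>R tangential \<Omega> w1 z + b *\<^sub>R tangential \<Omega> w2 z"
  by (simp add: tangential_def assms algebra_simps)

lemma C_closure_grad_ext:
  assumes "C_closure 1 U f"
  shows "\<exists>g. continuous_on (closure U) g \<and> (\<forall>x\<in>U. g x = grad f x)"
proof -
  have "\<exists>G. continuous_on (closure U) G \<and> (\<forall>y\<in>U. G y = partial (axis i 1) f y)" for i
    by (rule C_closure_partial_ext[OF assms]) auto
  then obtain G where "\<And>i. continuous_on (closure U) (G i)" "\<And>i y. y \<in> U \<Longrightarrow> G i y = partial (axis i 1) f y" by metis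
  then show ?thesis unfolding grad_def by (intro exI[of _ "\<lambda>y. \<chi> i. G i y"]) (auto intro!: continuous_on_vec_lambda)
qed

context smooth_domain
begin

lemma frontier_limits: 
  assumes "z \<in> frontier \<Omega>"
  shows "at z within E \<noteq> bot" "at z within \<Omega> \<noteq> bot"
  using frontier_closures[OF assms] by (auto simp: trivial_limit_within closure_def)

lemma bdry_trace_tendsto:
  fixes f :: "real^3 \<Rightarrow> 'b::real_normed_vector"
  assumes "\<exists>g. continuous_on (closure (ball z 1 \<inter> U)) g \<and> (\<forall>x\<in>ball z 1 \<inter> U. g x = f x)" "z \<in> closure U" "z \<notin> U"
  shows "(f \<longlongrightarrow> bdry_trace U f z) (at z within U)"
proof -
  obtain g where g: "continuous_on (closure (ball z 1 \<inter> U)) g" "\<And>x. x \<in> ball z 1 \<inter> U \<Longrightarrow> g x = f x" using assms(1) by blast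
  have "z \<in> ball z 1" by simp
  from trace_eq(1,2)[OF g open_ball this assms(2,3)] show ?thesis by simp
qed

lemma trace_plus_tendsto:
  assumes z: "z \<in> frontier \<Omega>"
  shows "C_closure_loc k E F \<Longrightarrow> (F \<longlongrightarrow> trace_plus \<Omega> F z) (at z within E)"
    and "C_closure_loc 1 E G \<Longrightarrow> (curl G \<longlongrightarrow> trace_plus \<Omega> (curl G) z) (at z within E)"
    and "C_closure_loc 1 E \<psi> \<Longrightarrow> (grad \<psi> \<longlongrightarrow> trace_plus \<Omega> (grad \<psi>) z) (at z within E)"
  unfolding C_closure_loc_def
  by (rule bdry_trace_tendsto[OF _ frontier_closures(1,2)[OF z]],
      blast intro: C_closure_ext C_closure_curl_ext C_closure_grad_ext)+

lemma lipschitz_of_partials: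
  fixes F :: "real^3 \<Rightarrow> 'b::real_normed_vector"
  assumes d: "\<And>y. y \<in> E \<Longrightarrow> F differentiable (at y)"
    and b: "\<And>R b. b \<in> Basis \<Longrightarrow> \<exists>M. \<forall>y\<in>ball 0 R \<inter> E. norm (partial b F y) \<le> M"
  shows "\<exists>K\<ge>0. \<forall>x\<in>E \<inter> ball 0 R. \<forall>y\<in>E \<inter> ball 0 R. norm (F y - F x) \<le> K * norm (y - x)"
proof (rule lipschitz_ball[OF d])
  fix R :: real
  obtain M where M: "\<And>b y. b \<in> Basis \<Longrightarrow> y \<in> ball 0 R \<inter> E \<Longrightarrow> norm (partial b F y) \<le> M b" using b[of _ R] by metis
  have "norm (partial h F y) \<le> (\<Sum>b\<in>Basis. M b) * norm h" if y: "y \<in> E \<inter> ball 0 R" for y h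
  proof -
    have dy: "F differentiable (at y)" using d y by blast
    have "norm (\<Sum>b\<in>Basis. (h \<bullet> b) *\<^sub>R partial b F y) \<le> (\<Sum>b\<in>Basis. norm h * M b)"
    proof (rule sum_norm_le)
      fix b :: "real^3" assume b: "b \<in> Basis"
      have "\<bar>h \<bullet> b\<bar> \<le> norm h" using Cauchy_Schwarz_ineq2[of h b] b by simp
      then show "norm ((h \<bullet> b) *\<^sub>R partial b F y) \<le> norm h * M b"
        using M[OF b, of y] y by (simp add: mult_mono)
    qed
    then show ?thesis by (subst partial_sum_Basis[OF dy]) (simp only: sum_distrib_right[symmetric] mult.commute[of "norm h"])
  qed
  then show "\<exists>M. \<forall>y\<in>E \<inter> ball 0 R. \<forall>h. norm (partial h F y) \<le> M * norm h" by blast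
qed auto

text \<open>Bounded second derivatives make the first derivatives Lipschitz on bounded parts of the
  exterior. Points of a ball of radius \<open>R\<close> are at most \<open>2 * R\<close> apart, so
  their distance is at most \<open>(2 * R) powr (1 - \<alpha>)\<close> times its own power
  \<open>\<alpha>\<close>.\<close>

lemma C_holder_loc_1:
  fixes u :: "real^3 \<Rightarrow> 'b::real_normed_vector"
  assumes u: "C_closure_loc 2 E u" and \<alpha>: "\<alpha> \<le> 1"
  shows "C_holder_loc 1 \<alpha> E u"
  unfolding C_holder_loc_def C_holder_def
proof (intro allI conjI impI)
  fix c :: "real^3" and R :: real
  show "C_closure 1 (ball c R \<inter> E) u" using C_closure_loc_mono[OF u, of 1] by (simp add: C_closure_loc_def)
  fix bs :: "(real^3) list" assume "set bs \<subseteq> Basis \<and> length bs = 1"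
  then obtain b where bs: "bs = [b]" and b: "b \<in> Basis" by (auto simp: length_Suc_conv)
  let ?F = "partial b u"
  have u2: "C_on 2 E u" by (rule C_closure_loc_C_on[OF E_open u])
  have "\<exists>K\<ge>0. \<forall>x\<in>E \<inter> ball 0 (norm c + R). \<forall>y\<in>E \<inter> ball 0 (norm c + R). norm (?F y - ?F x) \<le> K * norm (y - x)"
  proof (rule lipschitz_of_partials)
    show "?F differentiable (at y)" if "y \<in> E" for y using u2 that b unfolding C_on_2 C1_on_def by blast
    show "\<exists>M. \<forall>y\<in>ball 0 R \<inter> E. norm (partial b' ?F y) \<le> M" if b': "b' \<in> Basis" for R b'
    proof -
      have "C_closure 2 (ball 0 R \<inter> E) u" using u by (simp add: C_closure_loc_def)
      from C_closure_bounded[OF this, of "[b', b]"] b b' show ?thesis by (simp add: iter_partial_def bounded_Int)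
    qed
  qed
  then obtain K where K: "0 \<le> K" "\<And>x y. x \<in> E \<inter> ball 0 (norm c + R) \<Longrightarrow> y \<in> E \<inter> ball 0 (norm c + R) \<Longrightarrow> norm (?F y - ?F x) \<le> K * norm (y - x)"
    by blast
  have "norm (?F x - ?F y) \<le> K * (2 * R) powr (1 - \<alpha>) * dist x y powr \<alpha>" if x: "x \<in> ball c R \<inter> E" and y: "y \<in> ball c R \<inter> E" for x y
  proof (cases "x = y")
    case False
    have sub: "w \<in> E \<inter> ball 0 (norm c + R)" if "w \<in> ball c R \<inter> E" for w
      using that norm_triangle_sub[of w c] by (auto simp: dist_norm norm_minus_commute)
    have d: "0 < dist x y" "dist x y \<le> 2 * R" using False x y dist_triangle3[of x y c] by auto
    have "norm (?F x - ?F y) \<le> K * dist x y" using K(2)[OF sub[OF y] sub[OF x]] by (simp add: dist_norm)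
    also have "dist x y = dist x y powr (1 - \<alpha>) * dist x y powr \<alpha>" using d by (simp add: powr_add[symmetric])
    also have "\<dots> \<le> (2 * R) powr (1 - \<alpha>) * dist x y powr \<alpha>" using d \<alpha> by (intro mult_right_mono powr_mono2) auto
    finally show ?thesis using K(1) by (simp add: mult_left_mono mult.assoc)
  qed simp
  then show "\<exists>K. \<forall>x\<in>ball c R \<inter> E. \<forall>y\<in>ball c R \<inter> E. norm (iter_partial bs u x - iter_partial bs u y) \<le> K * dist x y powr \<alpha>"
    by (intro exI[of _ "K * (2 * R) powr (1 - \<alpha>)"] ballI) (simp add: bs iter_partial_def)
qed

lemma harmonic_pot:
  assumes "solves_exterior_harmonic \<Omega> q \<phi>"
  shows "is_pot E (grad \<phi>) \<phi>" "C1_on E (grad \<phi>)" "\<And>x. x \<in> E \<Longrightarrow> divergence (grad \<phi>) x = 0"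
proof -
  have f: "C_on 2 E \<phi>" "\<And>x. x \<in> E \<Longrightarrow> laplacian \<phi> x = 0" using assms by (auto simp: solves_exterior_harmonic_def)
  have f1: "C1_on E \<phi>" and f2: "\<And>b. b \<in> Basis \<Longrightarrow> C1_on E (partial b \<phi>)" using f(1) by (auto simp: C_on_2)
  show p: "is_pot E (grad \<phi>) \<phi>" unfolding is_pot_def using grad_has_derivative C1_on_differentiable[OF f1] by blast
  show g: "C1_on E (grad \<phi>)" by (rule C1_on_grad[OF f2])
  show "divergence (grad \<phi>) x = 0" if "x \<in> E" for x using pot_C2(3)[OF E_open p g that] f(2)[OF that] by simp
qed

text \<open>One inequality suffices, as the roles of the two solutions are symmetric. The difference
  has a constant boundary value, the decay shows that it is not positive, and the minimum principle
  applies to the negative of the difference.\<close>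

lemma exterior_harmonic_le:
  assumes con: "connected \<Omega>" and ne: "\<Omega> \<noteq> {}"
    and s: "solves_exterior_harmonic \<Omega> q \<phi>" "solves_exterior_harmonic \<Omega> q \<psi>" and x: "x \<in> E"
  shows "\<phi> x \<le> \<psi> x"
proof -
  let ?w = "\<lambda>x. 1 *\<^sub>R \<phi> x + (-1) *\<^sub>R \<psi> x" and ?V = "\<lambda>x. 1 *\<^sub>R grad \<phi> x + (-1) *\<^sub>R grad \<psi> x"
  note p = harmonic_pot[OF s(1)] harmonic_pot[OF s(2)]
  have cl: "C_closure_loc 1 E \<phi>" "C_closure_loc 1 E \<psi>" using s by (auto simp: solves_exterior_harmonic_def)
  have w: "C_closure_loc 1 E ?w" by (rule C_closure_loc_lincomb[OF E_open cl])
  have pw: "is_pot E ?V ?w" unfolding is_pot_def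
  proof
    fix x assume "x \<in> E"
    then have "(\<phi> has_derivative (\<lambda>h. grad \<phi> x \<bullet> h)) (at x)" "(\<psi> has_derivative (\<lambda>h. grad \<psi> x \<bullet> h)) (at x)"
      using p(1,4) by (auto simp: is_pot_def)
    from has_derivative_diff[OF this] show "(?w has_derivative (\<lambda>h. ?V x \<bullet> h)) (at x)" by (simp add: inner_diff_left)
  qed
  have V: "C1_on E ?V" using C1_on_diff[OF p(2,5)] by simp
  have dv: "divergence ?V x = 0" if "x \<in> E" for x
    using divergence_diff[OF C1_on_differentiable[OF p(2) that] C1_on_differentiable[OF p(5) that]] p(3,6) that by simp
  have tan: "tan_plus \<Omega> (grad ?w) z = 0" if z: "z \<in> frontier \<Omega>" for z
  proof -
    have "trace_plus \<Omega> (grad ?w) z = trace_plus \<Omega> ?V z" by (rule bdry_trace_cong[OF pot_C2(2)[OF E_open pw V]])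
    also have "\<dots> = 1 *\<^sub>R trace_plus \<Omega> (grad \<phi>) z + (-1) *\<^sub>R trace_plus \<Omega> (grad \<psi>) z"
      by (intro bdry_trace_lincomb frontier_limits(1)[OF z] trace_plus_tendsto(3)[OF z] cl)
    finally have "tan_plus \<Omega> (grad ?w) z = 1 *\<^sub>R tan_plus \<Omega> (grad \<phi>) z + (-1) *\<^sub>R tan_plus \<Omega> (grad \<psi>) z"
      by (rule tangential_lincomb)
    then show ?thesis using s z by (simp add: solves_exterior_harmonic_def)
  qed
  define c where "c = trace_plus \<Omega> ?w (SOME z. z \<in> frontier \<Omega>)"
  have c: "trace_plus \<Omega> ?w z = c" if z: "z \<in> frontier \<Omega>" for z
    unfolding c_def by (rule tangential_gradient_zero_const[OF w tan con z]) (auto intro: someI[of "\<lambda>z. z \<in> frontier \<Omega>", OF z])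
  have ext: "\<exists>G. continuous_on (closure (ball 0 R \<inter> E)) G \<and> (\<forall>y\<in>ball 0 R \<inter> E. G y = ?w y) \<and> (\<forall>y\<in>ball 0 R \<inter> frontier \<Omega>. G y = c)" for R
  proof -
    have "C_closure 1 (ball 0 R \<inter> E) ?w" using w by (simp only: C_closure_loc_def)
    from C_closure_ext[OF this] obtain G where G: "continuous_on (closure (ball 0 R \<inter> E)) G" "\<And>y. y \<in> ball 0 R \<inter> E \<Longrightarrow> G y = ?w y" by blast
    have "G y = c" if y: "y \<in> ball 0 R" "y \<in> frontier \<Omega>" for y
      using trace_eq(2)[OF G open_ball y(1) frontier_closures(1,2)[OF y(2)]] c[OF y(2)] by simp
    then show ?thesis using G by blast
  qed
  have bo: "\<phi> \<in> O[at_infinity](\<lambda>x. 1 / norm x ^ 2)" "\<psi> \<in> O[at_infinity](\<lambda>x. 1 / norm x ^ 2)"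
    using s by (auto simp: solves_exterior_harmonic_def)
  have "?w \<in> O[at_infinity](\<lambda>x. 1 / norm x ^ 2)" using sum_in_bigo(2)[OF bo] by simp
  then obtain C where "\<forall>\<^sub>F x in at_infinity. norm (?w x) \<le> C * norm (1 / norm x ^ 2)" by (elim landau_o.bigE)
  then obtain R0 where dec: "\<And>x. R0 \<le> norm x \<Longrightarrow> \<bar>?w x\<bar> \<le> C / (norm x)\<^sup>2" by (auto simp: eventually_at_infinity)
  have c0: "c \<le> 0" by (rule boundary_const_nonpos[OF pw V dv dec ext ne])
  have "0 \<le> - ?w x"
  proof (rule exterior_min_principle[of "\<lambda>x. - ?V x" "\<lambda>x. - ?w x", OF _ _ _ _ _ x])
    show "is_pot E (\<lambda>x. - ?V x) (\<lambda>x. - ?w x)" unfolding is_pot_def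
    proof
      fix x assume "x \<in> E"
      then have "(?w has_derivative (\<lambda>h. ?V x \<bullet> h)) (at x)" using pw by (simp only: is_pot_def)
      from has_derivative_minus[OF this] show "((\<lambda>x. - ?w x) has_derivative (\<lambda>h. - ?V x \<bullet> h)) (at x)" by (simp add: inner_diff_left)
    qed
    show V': "C1_on E (\<lambda>x. - ?V x)" using C1_on_diff[OF p(5,2)] by simp
    show "divergence (\<lambda>x. - ?V x) x = 0" if "x \<in> E" for x
      using divergence_diff[OF C1_on_differentiable[OF p(5) that] C1_on_differentiable[OF p(2) that]] p(3,6) that by simp
    have "(?w \<longlongrightarrow> 0) at_infinity"
    proof (rule Lim_null_comparison)
      show "\<forall>\<^sub>F x in at_infinity. norm (?w x) \<le> C / (norm x)\<^sup>2" using dec unfolding eventually_at_infinity real_norm_def by blast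
      show "((\<lambda>x::real^3. C / (norm x)\<^sup>2) \<longlongrightarrow> 0) at_infinity"
        by (intro tendsto_divide_0[OF tendsto_const] filterlim_at_top_imp_at_infinity filterlim_pow_at_top filterlim_norm_at_top) simp
    qed
    from tendsto_minus[OF this] show "((\<lambda>x. - ?w x) \<longlongrightarrow> 0) at_infinity" by simp
    fix R
    obtain G where G: "continuous_on (closure (ball 0 R \<inter> E)) G" "\<And>y. y \<in> ball 0 R \<inter> E \<Longrightarrow> G y = ?w y" "\<And>y. y \<in> ball 0 R \<inter> frontier \<Omega> \<Longrightarrow> G y = c"
      using ext[of R] by blast
    show "\<exists>G. continuous_on (closure (ball 0 R \<inter> E)) G \<and> (\<forall>y\<in>ball 0 R \<inter> E. G y = - ?w y) \<and> (\<forall>y\<in>ball 0 R \<inter> frontier \<Omega>. 0 \<le> G y)"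
      by (rule exI[of _ "\<lambda>y. - G y"]) (use G c0 in \<open>auto intro!: continuous_intros\<close>)
  qed
  then show ?thesis by simp
qed

lemma exterior_harmonic_unique:
  assumes "connected \<Omega>" "\<Omega> \<noteq> {}" "solves_exterior_harmonic \<Omega> q \<phi>" "solves_exterior_harmonic \<Omega> q \<psi>" "x \<in> E"
  shows "\<psi> x = \<phi> x"
  using exterior_harmonic_le[OF assms(1,2,3,4,5)] exterior_harmonic_le[OF assms(1,2,4,3,5)] by simp

end


section \<open>Regularity of the potential up to the boundary and conclusion\<close>

context smooth_domain
begin

text \<open>Both the value and the gradient of \<open>\<phi>\<close> extend to the boundary: the gradient because it is
  \<open>v\<close>, the value because \<open>\<phi>\<close> is Lipschitz on bounded parts of the quasi-convex exterior.\<close>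

lemma pot_C_closure_loc:
  assumes p: "is_pot E v \<phi>" and v: "C_closure_loc 1 E v"
  shows "C_closure_loc 1 E \<phi>"
  unfolding C_closure_loc_def C_closure_def
proof (intro allI conjI impI)
  fix c :: "real^3" and R :: real
  have v1: "C1_on E v" using C_closure_loc_C_on[OF E_open v] unfolding C_on_1 .
  have \<phi>1: "C1_on E \<phi>" by (rule is_pot_C1[OF p C1_on_continuous[OF v1]])
  show "C_on 1 (ball c R \<inter> E) \<phi>" unfolding C_on_1 by (rule C1_on_subset[OF \<phi>1]) simp
  fix bs :: "(real^3) list" assume bs: "set bs \<subseteq> Basis \<and> length bs \<le> 1"
  have vb: "C_closure 1 (ball a r \<inter> E) v" for a r using v by (simp add: C_closure_loc_def)
  show "\<exists>g. continuous_on (closure (ball c R \<inter> E)) g \<and> (\<forall>x\<in>ball c R \<inter> E. g x = iter_partial bs \<phi> x)"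
  proof (cases bs)
    case Nil
    have "\<exists>K\<ge>0. \<forall>x\<in>E \<inter> ball 0 (norm c + R). \<forall>y\<in>E \<inter> ball 0 (norm c + R). norm (\<phi> y - \<phi> x) \<le> K * norm (y - x)"
    proof (rule lipschitz_of_partials)
      show "\<phi> differentiable (at y)" if "y \<in> E" for y by (rule C1_on_differentiable[OF \<phi>1 that])
      show "\<exists>M. \<forall>y\<in>ball 0 R \<inter> E. norm (partial b \<phi> y) \<le> M" if b: "b \<in> Basis" for R b
      proof -
        have "\<exists>M. \<forall>y\<in>ball 0 R \<inter> E. norm (v y) \<le> M"
          using C_closure_bounded[OF vb[of 0 R], of "[]"] by (simp add: iter_partial_def bounded_Int)
        then obtain M where M: "\<And>y. y \<in> ball 0 R \<inter> E \<Longrightarrow> norm (v y) \<le> M" by blast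
        have "norm (partial b \<phi> y) \<le> M" if y: "y \<in> ball 0 R \<inter> E" for y
          using is_pot_partial[OF p, of y b] Cauchy_Schwarz_ineq2[of "v y" b] M[OF y] y b by simp
        then show ?thesis by blast
      qed
    qed
    then obtain K where K: "0 \<le> K" "\<And>x y. x \<in> E \<inter> ball 0 (norm c + R) \<Longrightarrow> y \<in> E \<inter> ball 0 (norm c + R) \<Longrightarrow> norm (\<phi> y - \<phi> x) \<le> K * norm (y - x)"
      by blast
    have sub: "w \<in> E \<inter> ball 0 (norm c + R)" if "w \<in> ball c R \<inter> E" for w
      using that norm_triangle_sub[of w c] by (auto simp: dist_norm norm_minus_commute)
    have "K-lipschitz_on (ball c R \<inter> E) \<phi>"
      by (rule lipschitz_onI) (use K(1) K(2)[OF sub sub] in \<open>auto simp: dist_norm\<close>)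
    then have "uniformly_continuous_on (ball c R \<inter> E) \<phi>" by (rule lipschitz_on_uniformly_continuous)
    from uniformly_continuous_on_extension_on_closure[OF this] obtain g where
      "uniformly_continuous_on (closure (ball c R \<inter> E)) g" "\<And>x. x \<in> ball c R \<inter> E \<Longrightarrow> \<phi> x = g x" by metis
    then show ?thesis using uniformly_continuous_imp_continuous by (intro exI[of _ g]) (auto simp: Nil iter_partial_def)
  next
    case (Cons b cs)
    then have b: "bs = [b]" using bs by simp
    obtain g where g: "continuous_on (closure (ball c R \<inter> E)) g" "\<And>x. x \<in> ball c R \<inter> E \<Longrightarrow> g x = v x"
      using C_closure_ext[OF vb] by blast
    show ?thesis
      by (rule exI[of _ "\<lambda>x. g x \<bullet> b"])
        (use g is_pot_partial[OF p] in \<open>auto simp: b iter_partial_def intro!: continuous_intros\<close>)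
  qed
qed

end

lemma holder_boundary_smooth_domain:
  assumes "open \<Omega>" "bounded \<Omega>" "connected (exterior \<Omega>)" "2 \<le> r" "holder_boundary r \<alpha> \<Omega>"
  shows "smooth_domain \<Omega>"
proof
  fix z assume "z \<in> frontier \<Omega>"
  then obtain \<sigma> \<delta> where "graph_patch \<Omega> \<sigma> \<delta>" "\<sigma> 0 = z" "C_closure r (ball 0 \<delta>) \<sigma>"
    using assms(5) by (auto simp: holder_boundary_def C_holder_def)
  then show "\<exists>\<sigma> \<delta>. graph_patch \<Omega> \<sigma> \<delta> \<and> \<sigma> 0 = z \<and> C_closure 2 (ball 0 \<delta>) \<sigma>"
    using C_closure_mono[OF _ assms(4)] by blast
qed (use assms in auto)

theorem lemma6p3:
  fixes \<alpha> lam :: real and r :: nat and \<Omega> :: "(real^3) set"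
    and He Fe A H :: "real^3 \<Rightarrow> real^3"
  assumes alpha: "0 < \<alpha>" "\<alpha> < 1"
    and lam: "0 < lam"
    and domain: "open \<Omega>" "connected \<Omega>" "\<Omega> \<noteq> {}" "bounded \<Omega>" "simply_connected \<Omega>"
    and no_holes: "connected (exterior \<Omega>)"
    and boundary: "3 \<le> r" "holder_boundary r \<alpha> \<Omega>"
    and He_reg: "C_holder_interior 2 \<alpha> (exterior \<Omega>) He" "C_holder_loc 1 \<alpha> (exterior \<Omega>) He"
    and He_eq: "\<forall>x\<in>exterior \<Omega>. curl He x = 0" "\<forall>x\<in>exterior \<Omega>. divergence He x = 0"
    and He_tan: "C_holder_on_boundary 2 \<alpha> \<Omega> (tan_plus \<Omega> He)"
    and Fe_reg: "C_holder_loc 2 \<alpha> (exterior \<Omega>) Fe"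
    and Fe_eq: "\<forall>x\<in>exterior \<Omega>. divergence Fe x = 0" "\<forall>x\<in>exterior \<Omega>. curl Fe x = He x"
    and A_reg: "Ct_holder 2 \<alpha> \<Omega> A"
    and A_sol: "solves_L \<Omega> lam He A"
    and H_def: "H = (\<lambda>x. lam *\<^sub>R curl A x)"
    and H_reg: "Ct_holder 1 \<alpha> \<Omega> H"
  shows
    "(C_holder 2 \<alpha> \<Omega> A \<and>
      (\<forall>x\<in>\<Omega>. - (lam\<^sup>2 *\<^sub>R curl (curl A) x) = (1 - (norm (A x))\<^sup>2) *\<^sub>R A x)) \<and>
     (\<exists>\<phi>.
       solves_exterior_harmonic \<Omega> (\<lambda>x. tan_minus \<Omega> H x - tan_plus \<Omega> He x) \<phi> \<and>
       (\<forall>\<psi>. solves_exterior_harmonic \<Omega> (\<lambda>x. tan_minus \<Omega> H x - tan_plus \<Omega> He x) \<psi> \<longrightarrow>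
          (\<forall>x\<in>exterior \<Omega>. \<psi> x = \<phi> x)) \<and>
       C_holder_loc 2 \<alpha> (exterior \<Omega>) A \<and>
       (\<exists>u. C_holder_loc 1 \<alpha> (exterior \<Omega>) u \<and>
          (\<forall>x\<in>exterior \<Omega>. A x = inverse lam *\<^sub>R (Fe x + u x)) \<and>
          (\<forall>x\<in>exterior \<Omega>. curl u x = grad \<phi> x) \<and>
          (\<forall>x\<in>frontier \<Omega>. tan_plus \<Omega> u x = lam *\<^sub>R tan_minus \<Omega> A x - tan_plus \<Omega> Fe x)) \<and>
       (\<forall>x\<in>frontier \<Omega>. nu_curl_tangential \<Omega> (tan_minus \<Omega> H) x = 0) \<and>
       (\<forall>x\<in>frontier \<Omega>. lam * (nu \<Omega> x \<bullet> trace_minus \<Omega> (curl A) x) =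
          nu \<Omega> x \<bullet> trace_plus \<Omega> He x + normal_deriv_plus \<Omega> \<phi> x))"
proof -
  have "smooth_domain \<Omega>"
    by (rule holder_boundary_smooth_domain[OF domain(1,4) no_holes _ boundary(2)]) (use boundary(1) in simp)
  then interpret smooth_domain \<Omega> .
  let ?q = "\<lambda>x. tan_minus \<Omega> H x - tan_plus \<Omega> He x"
  have A: "C_closure 2 \<Omega> A" "C_closure_loc 2 E A" "\<And>z. z \<in> frontier \<Omega> \<Longrightarrow> tan_minus \<Omega> A z = tan_plus \<Omega> A z"
    using A_reg C_holder_loc_closure by (auto simp: Ct_holder_def C_holder_def)
  have H: "C_closure 1 \<Omega> H" "C_closure_loc 1 E H" "\<And>z. z \<in> frontier \<Omega> \<Longrightarrow> tan_minus \<Omega> H z = tan_plus \<Omega> H z"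
    using H_reg C_holder_loc_closure by (auto simp: Ct_holder_def C_holder_def)
  note Fe = C_holder_loc_closure[OF Fe_reg]
  note He = C_holder_loc_closure[OF He_reg(2)]
  have Ad: "A differentiable (at x)" if "x \<in> E" for x
    by (rule C1_on_differentiable[OF C_on_1[THEN iffD1] that], rule C_closure_loc_C_on[OF E_open C_closure_loc_mono[OF A(2)]]) simp
  have Fd: "Fe differentiable (at x)" if "x \<in> E" for x
    by (rule C1_on_differentiable[OF C_on_1[THEN iffD1] that], rule C_closure_loc_C_on[OF E_open C_closure_loc_mono[OF Fe]]) simp
  have Hd: "H differentiable (at x)" if "x \<in> E" for x
    by (rule C1_on_differentiable[OF C_on_1[THEN iffD1] that], rule C_closure_loc_C_on[OF E_open H(2)])
  have Hed: "He differentiable (at x)" if "x \<in> E" for x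
    by (rule C1_on_differentiable[OF C_on_1[THEN iffD1] that], rule C_closure_loc_C_on[OF E_open He])
  \<comment> \<open>Both fields are written as linear combinations so that regularity and traces
    follow by linearity; \<open>curl u = v\<close> in the exterior links them.\<close>
  define u where "u = (\<lambda>x. lam *\<^sub>R A x + (-1) *\<^sub>R Fe x)"
  define v where "v = (\<lambda>x. 1 *\<^sub>R H x + (-1) *\<^sub>R He x)"
  have u: "C_closure_loc 2 E u" unfolding u_def by (rule C_closure_loc_lincomb[OF E_open A(2) Fe])
  have v: "C_closure_loc 1 E v" unfolding v_def by (rule C_closure_loc_lincomb[OF E_open H(2) He])
  have u2: "C_on 2 E u" by (rule C_closure_loc_C_on[OF E_open u])
  have u1: "C1_on E u" using u2 by (simp add: C_on_2)
  have v1: "C1_on E v" using C_closure_loc_C_on[OF E_open v] unfolding C_on_1 .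
  have cu: "curl u x = v x" if x: "x \<in> E" for x
  proof -
    have "(\<lambda>x. lam *\<^sub>R A x) differentiable (at x)" using Ad[OF x] by simp
    then show ?thesis using curl_diff[OF _ Fd[OF x]] curl_cmul[OF Ad[OF x]] Fe_eq(2) x
      by (simp add: u_def v_def H_def)
  qed
  \<comment> \<open>\<open>curl A\<close> is a multiple of the C^1 field \<open>H\<close>, so its
    differentiability is read off from \<open>H\<close>; \<open>curl H\<close> then vanishes by the
    exterior equation.\<close>
  have cA: "curl A differentiable (at x)" if x: "x \<in> E" for x
  proof -
    have "(\<lambda>x. inverse lam *\<^sub>R H x) differentiable (at x)" using Hd[OF x] by simp
    moreover have "(\<lambda>x. inverse lam *\<^sub>R H x) = curl A" using lam by (simp add: H_def fun_eq_iff)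
    ultimately show ?thesis by simp
  qed
  have cH: "curl H x = 0" if x: "x \<in> E" for x
    using curl_cmul[OF cA[OF x], of lam] A_sol x by (simp add: H_def solves_L_def)
  have cv: "curl v x = 0" if x: "x \<in> E" for x
    using curl_diff[OF Hd[OF x] Hed[OF x]] cH[OF x] He_eq(1) x by (simp add: v_def)
  have dv: "divergence v x = 0" if x: "x \<in> E" for x
    using divergence_curl[OF E_open x u2] divergence_cong_open[OF E_open x cu] by simp
  have v0: "(v \<longlongrightarrow> 0) at_infinity" using A_sol by (simp add: v_def H_def solves_L_def)
  obtain \<phi>0 where p0: "is_pot E v \<phi>0" using exterior_pot[OF domain(5) v1 cv dv v0] by blast
  obtain R C where R: "0 < R" "- ball 0 R \<subseteq> E" and vd: "\<And>x. R \<le> norm x \<Longrightarrow> norm (v x) \<le> C / norm x ^ 3"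
    using gradient_decay[OF v1 cv dv v0 p0 u1 cu] by blast
  have "{x. R \<le> norm x} \<subseteq> E" using R(2) by auto
  then obtain c where c: "\<And>x. R \<le> norm x \<Longrightarrow> \<bar>\<phi>0 x - c\<bar> \<le> C / 2 / norm x ^ 2"
    using potential_decay[OF R(1) is_pot_subset[OF p0] vd] by blast
  \<comment> \<open>Subtracting the limit at infinity normalises the potential, which turns the
    estimate for \<open>\<phi>0\<close> into decay.\<close>
  define \<phi> where "\<phi> = (\<lambda>x. \<phi>0 x - c)"
  have p: "is_pot E v \<phi>" using p0 unfolding is_pot_def \<phi>_def
    by (auto intro!: has_derivative_eq_rhs[OF has_derivative_diff[OF _ has_derivative_const]])
  note P = pot_C2[OF E_open p v1]
  have \<phi>c: "C_closure_loc 1 E \<phi>" by (rule pot_C_closure_loc[OF p v])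
  have tr_grad: "trace_plus \<Omega> (grad \<phi>) z = 1 *\<^sub>R trace_plus \<Omega> H z + (-1) *\<^sub>R trace_plus \<Omega> He z" if z: "z \<in> frontier \<Omega>" for z
  proof -
    have "trace_plus \<Omega> (grad \<phi>) z = trace_plus \<Omega> v z" by (rule bdry_trace_cong[OF P(2)])
    also have "\<dots> = 1 *\<^sub>R trace_plus \<Omega> H z + (-1) *\<^sub>R trace_plus \<Omega> He z" unfolding v_def
      by (rule bdry_trace_lincomb[OF frontier_limits(1)[OF z] trace_plus_tendsto(1)[OF z H(2)] trace_plus_tendsto(1)[OF z He]])
    finally show ?thesis .
  qed
  have sol: "solves_exterior_harmonic \<Omega> ?q \<phi>" unfolding solves_exterior_harmonic_def
  proof (intro conjI ballI)
    show "C_on 2 E \<phi>" by (rule P(1))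
    show "C_closure_loc 1 E \<phi>" by (rule \<phi>c)
    show "laplacian \<phi> x = 0" if "x \<in> E" for x using P(3)[OF that] dv[OF that] by simp
    show "tan_plus \<Omega> (grad \<phi>) z = ?q z" if z: "z \<in> frontier \<Omega>" for z
    proof -
      have "tan_plus \<Omega> (grad \<phi>) z = 1 *\<^sub>R tan_plus \<Omega> H z + (-1) *\<^sub>R tan_plus \<Omega> He z"
        by (rule tangential_lincomb) (rule tr_grad[OF z])
      then show ?thesis using H(3)[OF z] by simp
    qed
    \<comment> \<open>The gradient of \<open>\<phi>\<close> is \<open>v = curl u\<close> in the
      exterior, so the integral of the normal derivative is the flux of a curl.\<close>
    have "normal_deriv_plus \<Omega> \<phi> z = nu \<Omega> z \<bullet> trace_plus \<Omega> (curl u) z" for z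
      using bdry_trace_cong[of E "grad \<phi>" "curl u" z] P(2) cu by (simp add: normal_deriv_plus_def)
    then have "normal_deriv_plus \<Omega> \<phi> = (\<lambda>z. nu \<Omega> z \<bullet> trace_plus \<Omega> (curl u) z)" by (rule ext)
    then show "has_surface_integral \<Omega> (normal_deriv_plus \<Omega> \<phi>) 0"
      using flux_curl_zero[OF C_closure_loc_mono[OF u]] by simp
    have "\<forall>\<^sub>F x in at_infinity. norm (\<phi> x) \<le> (C / 2) * norm (1 / norm x ^ 2)"
      unfolding eventually_at_infinity by (intro exI[of _ R]) (use c in \<open>auto simp: \<phi>_def\<close>)
    then show "\<phi> \<in> O[at_infinity](\<lambda>x. 1 / norm x ^ 2)" by (rule bigoI)
    have "norm (norm (grad \<phi> x)) \<le> C * norm (1 / norm x ^ 3)" if "R \<le> norm x" for x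
    proof -
      have "x \<in> E" using R(2) that by auto
      then show ?thesis using vd[OF that] P(2) by simp
    qed
    then have "\<forall>\<^sub>F x in at_infinity. norm (norm (grad \<phi> x)) \<le> C * norm (1 / norm x ^ 3)"
      unfolding eventually_at_infinity by blast
    then show "(\<lambda>x. norm (grad \<phi> x)) \<in> O[at_infinity](\<lambda>x. 1 / norm x ^ 3)" by (rule bigoI)
  qed
  have uniq: "\<psi> x = \<phi> x" if "solves_exterior_harmonic \<Omega> ?q \<psi>" "x \<in> E" for \<psi> x
    by (rule exterior_harmonic_unique[OF domain(2,3) sol that])
  have rep: "A x = inverse lam *\<^sub>R (Fe x + u x)" for x using lam by (simp add: u_def)
  have cug: "curl u x = grad \<phi> x" if "x \<in> E" for x using cu[OF that] P(2)[OF that] by simp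
  have ut: "tan_plus \<Omega> u z = lam *\<^sub>R tan_minus \<Omega> A z - tan_plus \<Omega> Fe z" if z: "z \<in> frontier \<Omega>" for z
  proof -
    have "trace_plus \<Omega> u z = lam *\<^sub>R trace_plus \<Omega> A z + (-1) *\<^sub>R trace_plus \<Omega> Fe z" unfolding u_def
      by (rule bdry_trace_lincomb[OF frontier_limits(1)[OF z] trace_plus_tendsto(1)[OF z A(2)] trace_plus_tendsto(1)[OF z Fe]])
    then have "tan_plus \<Omega> u z = lam *\<^sub>R tan_plus \<Omega> A z + (-1) *\<^sub>R tan_plus \<Omega> Fe z" by (rule tangential_lincomb)
    then show ?thesis using A(3)[OF z] by simp
  qed
  have curlH: "trace_plus \<Omega> (curl H) z = 0" if z: "z \<in> frontier \<Omega>" for z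
  proof -
    have "trace_plus \<Omega> (curl H) z = trace_plus \<Omega> (\<lambda>x. 0 :: real^3) z" by (rule bdry_trace_cong) (rule cH)
    also have "\<dots> = 0" unfolding bdry_trace_def by (rule tendsto_Lim[OF frontier_limits(1)[OF z] tendsto_const])
    finally show ?thesis .
  qed
  have nct: "nu_curl_tangential \<Omega> (tan_minus \<Omega> H) z = 0" if z: "z \<in> frontier \<Omega>" for z
    unfolding nu_curl_tangential_def
  proof (rule the_equality)
    \<comment> \<open>Any admissible extension \<open>W\<close> shares its tangential trace with the
      exterior field \<open>H\<close>, whose curl vanishes there; hence every candidate value is 0,
      and \<open>H\<close> itself shows that one exists.\<close>
    have *: "nu \<Omega> z \<bullet> trace_minus \<Omega> (curl W) z = 0" if "C_closure 1 \<Omega> W" "\<forall>y\<in>frontier \<Omega>. tan_minus \<Omega> W y = tan_minus \<Omega> H y" for W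
      using normal_curl_trace[OF that(1) H(2) _ z] that(2) H(3) curlH[OF z] by simp
    show "\<exists>W. C_closure 1 \<Omega> W \<and> (\<forall>y\<in>frontier \<Omega>. tan_minus \<Omega> W y = tan_minus \<Omega> H y) \<and> 0 = nu \<Omega> z \<bullet> trace_minus \<Omega> (curl W) z"
      by (rule exI[of _ H]) (use H(1) *[OF H(1)] in simp)
    show "d = 0" if "\<exists>W. C_closure 1 \<Omega> W \<and> (\<forall>y\<in>frontier \<Omega>. tan_minus \<Omega> W y = tan_minus \<Omega> H y) \<and> d = nu \<Omega> z \<bullet> trace_minus \<Omega> (curl W) z" for d
      using that * by blast
  qed
  have nc: "lam * (nu \<Omega> z \<bullet> trace_minus \<Omega> (curl A) z) = nu \<Omega> z \<bullet> trace_plus \<Omega> He z + normal_deriv_plus \<Omega> \<phi> z"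
    if z: "z \<in> frontier \<Omega>" for z
  proof -
    have A1: "C_closure 1 \<Omega> A" "C_closure_loc 1 E A" using C_closure_mono[OF A(1)] C_closure_loc_mono[OF A(2)] by simp_all
    \<comment> \<open>The coefficient 0 specialises the rule for linear combinations to a scalar
      multiple.\<close>
    have "trace_plus \<Omega> H z = lam *\<^sub>R trace_plus \<Omega> (curl A) z + 0 *\<^sub>R trace_plus \<Omega> (curl A) z"
      using bdry_trace_lincomb[OF frontier_limits(1)[OF z] trace_plus_tendsto(2)[OF z A1(2)] trace_plus_tendsto(2)[OF z A1(2)], of lam 0]
      by (simp add: H_def)
    then have "lam * (nu \<Omega> z \<bullet> trace_plus \<Omega> (curl A) z) = nu \<Omega> z \<bullet> trace_plus \<Omega> H z" by simp
    \<comment> \<open>The normal component of \<open>curl A\<close> is the same from both sides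
      because the tangential traces of \<open>A\<close> agree, so the interior value can be replaced
      by the exterior one.\<close>
    then show ?thesis using normal_curl_trace[OF A1 A(3) z] tr_grad[OF z]
      by (simp add: normal_deriv_plus_def inner_diff_right)
  qed
  have "C_holder_loc 1 \<alpha> E u" by (rule C_holder_loc_1[OF u]) (use alpha in simp)
  then have "\<exists>u. C_holder_loc 1 \<alpha> E u \<and> (\<forall>x\<in>E. A x = inverse lam *\<^sub>R (Fe x + u x)) \<and> (\<forall>x\<in>E. curl u x = grad \<phi> x) \<and>
      (\<forall>x\<in>frontier \<Omega>. tan_plus \<Omega> u x = lam *\<^sub>R tan_minus \<Omega> A x - tan_plus \<Omega> Fe x)"
    using rep cug ut by blast
  moreover have "C_holder 2 \<alpha> \<Omega> A" "C_holder_loc 2 \<alpha> E A" using A_reg by (auto simp: Ct_holder_def)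
  moreover have "\<forall>x\<in>\<Omega>. - (lam\<^sup>2 *\<^sub>R curl (curl A) x) = (1 - (norm (A x))\<^sup>2) *\<^sub>R A x" using A_sol by (simp add: solves_L_def)
  ultimately show ?thesis using sol uniq nct nc by blast
qed

end
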